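(* For any category $\mathcal{A}$, we have an equivalence $(\mathcal{Q}(\mathcal{A}^{op}))^{op}\simeq\mathcal{Q}(\mathcal{A})$.
   Context: Throughout, $\mathcal{V}$ is a symmetric monoidal closed category whose underlying ordinary category is locally small, complete and cocomplete. "Category", "functor", "natural transformation" mean $\mathcal{V}$-category, $\mathcal{V}$-functor, $\mathcal{V}$-natural transformation. A category (not necessarily small) is called small if its set of isomorphism classes of objects is small. A weight is a functor $\phi:\mathcal{K}^{op}\to\mathcal{V}$ with $\mathcal{K}$ small; the $\phi$-weighted colimit $\phi*S$ of $S:\mathcal{K}\to\mathcal{A}$ is defined by $\mathcal{A}(\phi*S,a)\cong[\mathcal{K}^{op},\mathcal{V}](\phi,\mathcal{A}(S-,a))$. For a category $\mathcal{A}$, a functor $F:\mathcal{A}^{op}\to\mathcal{V}$ is accessible if it is the left Kan extension of some $\phi:\mathcal{K}^{op}\to\mathcal{V}$ with $\mathcal{K}$ small along some $H^{op}:\mathcal{K}^{op}\to\mathcal{A}^{op}$, i.e. $Fa\cong\phi*\mathcal{A}(a,H-)$. $\mathcal{P}\mathcal{A}$ is the $\mathcal{V}$-category of accessible functors $\mathcal{A}^{op}\to\mathcal{V}$, with hom $\int_a[Fa,Ga]$; it contains the representables, admits all small colimits (formed pointwise), and equals $[\mathcal{A}^{op},\mathcal{V}]$ when $\mathcal{A}$ is small. For a class $\Phi$ of weights, $\Phi(\mathcal{A})$ is the closure of the representables under $\Phi$-colimits in $\mathcal{P}\mathcal{A}$: the smallest full replete subcategory of $\mathcal{P}\mathcal{A}$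 containing the representables $\mathcal{A}(-,a)$ and closed under $\phi$-weighted colimits for all $\phi\in\Phi$. $\mathcal{Q}$ is the class of small projective weights: those $\phi:\mathcal{K}^{op}\to\mathcal{V}$ ($\mathcal{K}$ small) for which $[\mathcal{K}^{op},\mathcal{V}](\phi,-):[\mathcal{K}^{op},\mathcal{V}]\to\mathcal{V}$ preserves all small weighted colimits. $\mathcal{Q}(\mathcal{A})$ is $\Phi(\mathcal{A})$ for $\Phi=\mathcal{Q}$ (the Cauchy-completion of $\mathcal{A}$). *)

theory Defs
  imports Main
begin

unbundle cardinal_syntax

section \<open>Smallness\<close>

text \<open>
  Smallness is relative to a universe, given by a cardinal \<open>\<kappa>\<close> that is closed under the usual
  set-theoretic operations: a set is small if it has fewer than \<open>\<kappa>\<close> elements.  Uncountability of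
  \<open>\<kappa>\<close> is not demanded: every strongly inaccessible cardinal is an instance, and so is \<open>natLeq\<close>,
  so that the notion is not void in HOL.  As small sets embed into \<open>'u\<close>, it loses nothing (up to
  equivalence) to take the objects of small categories from \<open>'u\<close>.
\<close>

definition universe :: "'u rel \<Rightarrow> bool" where
  "universe \<kappa> \<longleftrightarrow>
     Cinfinite \<kappa> \<and> regularCard \<kappa> \<and> (\<forall>X :: 'u set. |X| <o \<kappa> \<longrightarrow> |Pow X| <o \<kappa>)"

definition small_set :: "'u rel \<Rightarrow> 'a set \<Rightarrow> bool" where
  "small_set \<kappa> X \<longleftrightarrow> |X| <o \<kappa>"


section \<open>Ordinary categories, limits and colimits\<close>

record ('o, 'm) cat =
  obj :: "'o set"
  arr :: "'m set"
  src :: "'m \<Rightarrow> 'o"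
  tgt :: "'m \<Rightarrow> 'o"
  idt :: "'o \<Rightarrow> 'm"
  cmp :: "'m \<Rightarrow> 'm \<Rightarrow> 'm" (infixr "\<cdot>\<index>" 70)

definition homs :: "('o, 'm, 'x) cat_scheme \<Rightarrow> 'o \<Rightarrow> 'o \<Rightarrow> 'm set" where
  "homs C X Y = {f \<in> arr C. src C f = X \<and> tgt C f = Y}"

locale category =
  fixes C :: "('o, 'm, 'x) cat_scheme" (structure)
  assumes src_obj: "f \<in> arr C \<Longrightarrow> src C f \<in> obj C"
    and tgt_obj: "f \<in> arr C \<Longrightarrow> tgt C f \<in> obj C"
    and idt_homs: "X \<in> obj C \<Longrightarrow> idt C X \<in> homs C X X"
    and cmp_homs: "f \<in> homs C X Y \<Longrightarrow> g \<in> homs C Y Z \<Longrightarrow> g \<cdot> f \<in> homs C X Z"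
    and cmp_idt_left: "f \<in> homs C X Y \<Longrightarrow> idt C Y \<cdot> f = f"
    and cmp_idt_right: "f \<in> homs C X Y \<Longrightarrow> f \<cdot> idt C X = f"
    and cmp_assoc: "f \<in> homs C W X \<Longrightarrow> g \<in> homs C X Y \<Longrightarrow> h \<in> homs C Y Z \<Longrightarrow>
                    (h \<cdot> g) \<cdot> f = h \<cdot> (g \<cdot> f)"

definition inverse_arrows :: "('o, 'm, 'x) cat_scheme \<Rightarrow> 'm \<Rightarrow> 'm \<Rightarrow> bool" where
  "inverse_arrows C f g \<longleftrightarrow>
     f \<in> arr C \<and> g \<in> homs C (tgt C f) (src C f) \<and>
     g \<cdot>\<^bsub>C\<^esub> f = idt C (src C f) \<and> f \<cdot>\<^bsub>C\<^esub> g = idt C (tgt C f)"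

definition iso_arr :: "('o, 'm, 'x) cat_scheme \<Rightarrow> 'm \<Rightarrow> bool" where
  "iso_arr C f \<longleftrightarrow> (\<exists>g. inverse_arrows C f g)"

definition inv_arr :: "('o, 'm, 'x) cat_scheme \<Rightarrow> 'm \<Rightarrow> 'm" where
  "inv_arr C f = (THE g. inverse_arrows C f g)"

definition op_cat :: "('o, 'm, 'x) cat_scheme \<Rightarrow> ('o, 'm) cat" where
  "op_cat C = \<lparr>obj = obj C, arr = arr C, src = tgt C, tgt = src C,
               idt = idt C, cmp = (\<lambda>g f. f \<cdot>\<^bsub>C\<^esub> g)\<rparr>"

definition diagram ::
  "('i, 'j, 'x) cat_scheme \<Rightarrow> ('o, 'm, 'y) cat_scheme \<Rightarrow> ('i \<Rightarrow> 'o) \<Rightarrow> ('j \<Rightarrow> 'm) \<Rightarrow> bool" where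
  "diagram J C D d \<longleftrightarrow>
     (\<forall>i \<in> obj J. D i \<in> obj C) \<and>
     (\<forall>f \<in> arr J. d f \<in> homs C (D (src J f)) (D (tgt J f))) \<and>
     (\<forall>i \<in> obj J. d (idt J i) = idt C (D i)) \<and>
     (\<forall>f \<in> arr J. \<forall>g \<in> arr J. src J g = tgt J f \<longrightarrow> d (g \<cdot>\<^bsub>J\<^esub> f) = d g \<cdot>\<^bsub>C\<^esub> d f)"

definition cone ::
  "('i, 'j, 'x) cat_scheme \<Rightarrow> ('o, 'm, 'y) cat_scheme \<Rightarrow> ('i \<Rightarrow> 'o) \<Rightarrow> ('j \<Rightarrow> 'm) \<Rightarrow>
   'o \<Rightarrow> ('i \<Rightarrow> 'm) \<Rightarrow> bool" where
  "cone J C D d L p \<longleftrightarrow>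
     L \<in> obj C \<and> (\<forall>i \<in> obj J. p i \<in> homs C L (D i)) \<and>
     (\<forall>f \<in> arr J. d f \<cdot>\<^bsub>C\<^esub> p (src J f) = p (tgt J f))"

definition limit_cone ::
  "('i, 'j, 'x) cat_scheme \<Rightarrow> ('o, 'm, 'y) cat_scheme \<Rightarrow> ('i \<Rightarrow> 'o) \<Rightarrow> ('j \<Rightarrow> 'm) \<Rightarrow>
   'o \<Rightarrow> ('i \<Rightarrow> 'm) \<Rightarrow> bool" where
  "limit_cone J C D d L p \<longleftrightarrow>
     cone J C D d L p \<and>
     (\<forall>M q. cone J C D d M q \<longrightarrow> (\<exists>!u. u \<in> homs C M L \<and> (\<forall>i \<in> obj J. p i \<cdot>\<^bsub>C\<^esub> u = q i)))"

definition complete_cat :: "'u rel \<Rightarrow> ('o, 'm, 'x) cat_scheme \<Rightarrow> bool" where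
  "complete_cat \<kappa> C \<longleftrightarrow>
     (\<forall>(J :: ('u, 'u) cat) D d.
        category J \<and> small_set \<kappa> (obj J) \<and> small_set \<kappa> (arr J) \<and> diagram J C D d \<longrightarrow>
        (\<exists>L p. limit_cone J C D d L p))"

definition cocomplete_cat :: "'u rel \<Rightarrow> ('o, 'm, 'x) cat_scheme \<Rightarrow> bool" where
  "cocomplete_cat \<kappa> C \<longleftrightarrow> complete_cat \<kappa> (op_cat C)"

definition locally_small_cat :: "'u rel \<Rightarrow> ('o, 'm, 'x) cat_scheme \<Rightarrow> bool" where
  "locally_small_cat \<kappa> C \<longleftrightarrow> (\<forall>X \<in> obj C. \<forall>Y \<in> obj C. small_set \<kappa> (homs C X Y))"


section \<open>Symmetric monoidal closed categories\<close>

text \<open>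
  The structure maps are \<open>asc X Y Z : (X \<otimes> Y) \<otimes> Z \<rightarrow> X \<otimes> (Y \<otimes> Z)\<close>, \<open>lun X : I \<otimes> X \<rightarrow> X\<close>,
  \<open>run X : X \<otimes> I \<rightarrow> X\<close>, \<open>swp X Y : X \<otimes> Y \<rightarrow> Y \<otimes> X\<close> and \<open>ev Y Z : [Y, Z] \<otimes> Y \<rightarrow> Z\<close>, where
  \<open>I = unt V\<close> and \<open>[Y, Z] = ihom V Y Z\<close>; \<open>f \<odot> g\<close> is the tensor product of arrows.
\<close>

record ('o, 'm) smcat = "('o, 'm) cat" +
  ten :: "'o \<Rightarrow> 'o \<Rightarrow> 'o" (infixr "\<otimes>\<index>" 75)
  tena :: "'m \<Rightarrow> 'm \<Rightarrow> 'm" (infixr "\<odot>\<index>" 75)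
  unt :: 'o
  asc :: "'o \<Rightarrow> 'o \<Rightarrow> 'o \<Rightarrow> 'm"
  lun :: "'o \<Rightarrow> 'm"
  run :: "'o \<Rightarrow> 'm"
  swp :: "'o \<Rightarrow> 'o \<Rightarrow> 'm"
  ihom :: "'o \<Rightarrow> 'o \<Rightarrow> 'o"
  ev :: "'o \<Rightarrow> 'o \<Rightarrow> 'm"

locale symmetric_monoidal_closed = category V
  for V :: "('o, 'm) smcat" (structure) +
  assumes ten_obj: "X \<in> obj V \<Longrightarrow> Y \<in> obj V \<Longrightarrow> X \<otimes> Y \<in> obj V"
    and tena_homs: "f \<in> homs V X X' \<Longrightarrow> g \<in> homs V Y Y' \<Longrightarrow> f \<odot> g \<in> homs V (X \<otimes> Y) (X' \<otimes> Y')"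
    and tena_idt: "X \<in> obj V \<Longrightarrow> Y \<in> obj V \<Longrightarrow> idt V X \<odot> idt V Y = idt V (X \<otimes> Y)"
    and tena_cmp: "f \<in> homs V X X' \<Longrightarrow> f' \<in> homs V X' X'' \<Longrightarrow>
                   g \<in> homs V Y Y' \<Longrightarrow> g' \<in> homs V Y' Y'' \<Longrightarrow>
                   (f' \<cdot> f) \<odot> (g' \<cdot> g) = (f' \<odot> g') \<cdot> (f \<odot> g)"
    and unt_obj: "unt V \<in> obj V"
    and asc_homs: "X \<in> obj V \<Longrightarrow> Y \<in> obj V \<Longrightarrow> Z \<in> obj V \<Longrightarrow>
                   asc V X Y Z \<in> homs V ((X \<otimes> Y) \<otimes> Z) (X \<otimes> (Y \<otimes> Z))"
    and asc_iso: "X \<in> obj V \<Longrightarrow> Y \<in> obj V \<Longrightarrow> Z \<in> obj V \<Longrightarrow> iso_arr V (asc V X Y Z)"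
    and asc_nat: "f \<in> homs V X X' \<Longrightarrow> g \<in> homs V Y Y' \<Longrightarrow> h \<in> homs V Z Z' \<Longrightarrow>
                  asc V X' Y' Z' \<cdot> ((f \<odot> g) \<odot> h) = (f \<odot> (g \<odot> h)) \<cdot> asc V X Y Z"
    and lun_homs: "X \<in> obj V \<Longrightarrow> lun V X \<in> homs V (unt V \<otimes> X) X"
    and lun_iso: "X \<in> obj V \<Longrightarrow> iso_arr V (lun V X)"
    and lun_nat: "f \<in> homs V X Y \<Longrightarrow> lun V Y \<cdot> (idt V (unt V) \<odot> f) = f \<cdot> lun V X"
    and run_homs: "X \<in> obj V \<Longrightarrow> run V X \<in> homs V (X \<otimes> unt V) X"
    and run_iso: "X \<in> obj V \<Longrightarrow> iso_arr V (run V X)"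
    and run_nat: "f \<in> homs V X Y \<Longrightarrow> run V Y \<cdot> (f \<odot> idt V (unt V)) = f \<cdot> run V X"
    and pentagon: "W \<in> obj V \<Longrightarrow> X \<in> obj V \<Longrightarrow> Y \<in> obj V \<Longrightarrow> Z \<in> obj V \<Longrightarrow>
                   asc V W X (Y \<otimes> Z) \<cdot> asc V (W \<otimes> X) Y Z =
                   (idt V W \<odot> asc V X Y Z) \<cdot> asc V W (X \<otimes> Y) Z \<cdot> (asc V W X Y \<odot> idt V Z)"
    and triangle: "X \<in> obj V \<Longrightarrow> Y \<in> obj V \<Longrightarrow>
                   (idt V X \<odot> lun V Y) \<cdot> asc V X (unt V) Y = run V X \<odot> idt V Y"
    and swp_homs: "X \<in> obj V \<Longrightarrow> Y \<in> obj V \<Longrightarrow> swp V X Y \<in> homs V (X \<otimes> Y) (Y \<otimes> X)"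
    and swp_nat: "f \<in> homs V X X' \<Longrightarrow> g \<in> homs V Y Y' \<Longrightarrow>
                  swp V X' Y' \<cdot> (f \<odot> g) = (g \<odot> f) \<cdot> swp V X Y"
    and swp_swp: "X \<in> obj V \<Longrightarrow> Y \<in> obj V \<Longrightarrow> swp V Y X \<cdot> swp V X Y = idt V (X \<otimes> Y)"
    and hexagon: "X \<in> obj V \<Longrightarrow> Y \<in> obj V \<Longrightarrow> Z \<in> obj V \<Longrightarrow>
                  asc V Y Z X \<cdot> swp V X (Y \<otimes> Z) \<cdot> asc V X Y Z =
                  (idt V Y \<odot> swp V X Z) \<cdot> asc V Y X Z \<cdot> (swp V X Y \<odot> idt V Z)"
    and ihom_obj: "Y \<in> obj V \<Longrightarrow> Z \<in> obj V \<Longrightarrow> ihom V Y Z \<in> obj V"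
    and ev_homs: "Y \<in> obj V \<Longrightarrow> Z \<in> obj V \<Longrightarrow> ev V Y Z \<in> homs V (ihom V Y Z \<otimes> Y) Z"
    and ev_universal: "X \<in> obj V \<Longrightarrow> Y \<in> obj V \<Longrightarrow> Z \<in> obj V \<Longrightarrow> f \<in> homs V (X \<otimes> Y) Z \<Longrightarrow>
                       \<exists>!g. g \<in> homs V X (ihom V Y Z) \<and> ev V Y Z \<cdot> (g \<odot> idt V Y) = f"

text \<open>The standing assumptions on the base of enrichment.\<close>

definition cosmos :: "'u rel \<Rightarrow> ('o, 'm) smcat \<Rightarrow> bool" where
  "cosmos \<kappa> V \<longleftrightarrow>
     symmetric_monoidal_closed V \<and> locally_small_cat \<kappa> V \<and> complete_cat \<kappa> V \<and> cocomplete_cat \<kappa> V"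

text \<open>The transpose \<open>X \<rightarrow> [Y, Z]\<close> of \<open>f : X \<otimes> Y \<rightarrow> Z\<close>.\<close>

definition cur :: "('o, 'm) smcat \<Rightarrow> 'o \<Rightarrow> 'o \<Rightarrow> 'o \<Rightarrow> 'm \<Rightarrow> 'm" where
  "cur V X Y Z f = (THE g. g \<in> homs V X (ihom V Y Z) \<and> ev V Y Z \<cdot>\<^bsub>V\<^esub> (g \<odot>\<^bsub>V\<^esub> idt V Y) = f)"

text \<open>The name \<open>I \<rightarrow> [X, Y]\<close> of \<open>f : X \<rightarrow> Y\<close>, and \<open>[X, f] : [X, Y] \<rightarrow> [X, Z]\<close> for \<open>f : Y \<rightarrow> Z\<close>.\<close>

definition name_of :: "('o, 'm) smcat \<Rightarrow> 'o \<Rightarrow> 'o \<Rightarrow> 'm \<Rightarrow> 'm" where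
  "name_of V X Y f = cur V (unt V) X Y (f \<cdot>\<^bsub>V\<^esub> lun V X)"

definition ihom_post :: "('o, 'm) smcat \<Rightarrow> 'o \<Rightarrow> 'o \<Rightarrow> 'o \<Rightarrow> 'm \<Rightarrow> 'm" where
  "ihom_post V X Y Z f = cur V (ihom V X Y) X Z (f \<cdot>\<^bsub>V\<^esub> ev V X Y)"


section \<open>V-categories, V-functors, V-natural transformations\<close>

text \<open>
  \<open>vcmp A a b c\<close> is the composition \<open>A(b, c) \<otimes> A(a, b) \<rightarrow> A(a, c)\<close>.  The fields are only
  meaningful at objects, so V-functors that differ outside the objects of their domain are not
  identified; they are isomorphic in any functor category that contains them.
\<close>

record ('a, 'o, 'm) vcat =
  vob :: "'a set"
  vhom :: "'a \<Rightarrow> 'a \<Rightarrow> 'o"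
  vid :: "'a \<Rightarrow> 'm"
  vcmp :: "'a \<Rightarrow> 'a \<Rightarrow> 'a \<Rightarrow> 'm"

definition vcategory :: "('o, 'm) smcat \<Rightarrow> ('a, 'o, 'm) vcat \<Rightarrow> bool" where
  "vcategory V A \<longleftrightarrow>
     (\<forall>a \<in> vob A. \<forall>b \<in> vob A. vhom A a b \<in> obj V) \<and>
     (\<forall>a \<in> vob A. vid A a \<in> homs V (unt V) (vhom A a a)) \<and>
     (\<forall>a \<in> vob A. \<forall>b \<in> vob A. \<forall>c \<in> vob A.
        vcmp A a b c \<in> homs V (vhom A b c \<otimes>\<^bsub>V\<^esub> vhom A a b) (vhom A a c)) \<and>
     (\<forall>a \<in> vob A. \<forall>b \<in> vob A. \<forall>c \<in> vob A. \<forall>d \<in> vob A.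
        vcmp A a b d \<cdot>\<^bsub>V\<^esub> (vcmp A b c d \<odot>\<^bsub>V\<^esub> idt V (vhom A a b)) =
        vcmp A a c d \<cdot>\<^bsub>V\<^esub> (idt V (vhom A c d) \<odot>\<^bsub>V\<^esub> vcmp A a b c) \<cdot>\<^bsub>V\<^esub>
          asc V (vhom A c d) (vhom A b c) (vhom A a b)) \<and>
     (\<forall>a \<in> vob A. \<forall>b \<in> vob A.
        vcmp A a b b \<cdot>\<^bsub>V\<^esub> (vid A b \<odot>\<^bsub>V\<^esub> idt V (vhom A a b)) = lun V (vhom A a b) \<and>
        vcmp A a a b \<cdot>\<^bsub>V\<^esub> (idt V (vhom A a b) \<odot>\<^bsub>V\<^esub> vid A a) = run V (vhom A a b))"

record ('a, 'b, 'm) vfun =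
  fob :: "'a \<Rightarrow> 'b"
  fmap :: "'a \<Rightarrow> 'a \<Rightarrow> 'm"

definition vfunctor ::
  "('o, 'm) smcat \<Rightarrow> ('a, 'o, 'm) vcat \<Rightarrow> ('b, 'o, 'm) vcat \<Rightarrow> ('a, 'b, 'm) vfun \<Rightarrow> bool" where
  "vfunctor V A B F \<longleftrightarrow>
     (\<forall>a \<in> vob A. fob F a \<in> vob B) \<and>
     (\<forall>a \<in> vob A. \<forall>b \<in> vob A. fmap F a b \<in> homs V (vhom A a b) (vhom B (fob F a) (fob F b))) \<and>
     (\<forall>a \<in> vob A. fmap F a a \<cdot>\<^bsub>V\<^esub> vid A a = vid B (fob F a)) \<and>
     (\<forall>a \<in> vob A. \<forall>b \<in> vob A. \<forall>c \<in> vob A.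
        fmap F a c \<cdot>\<^bsub>V\<^esub> vcmp A a b c =
        vcmp B (fob F a) (fob F b) (fob F c) \<cdot>\<^bsub>V\<^esub> (fmap F b c \<odot>\<^bsub>V\<^esub> fmap F a b))"

definition vfid :: "('o, 'm) smcat \<Rightarrow> ('a, 'o, 'm) vcat \<Rightarrow> ('a, 'a, 'm) vfun" where
  "vfid V A = \<lparr>fob = (\<lambda>a. a), fmap = (\<lambda>a b. idt V (vhom A a b))\<rparr>"

definition vfcomp ::
  "('o, 'm) smcat \<Rightarrow> ('b, 'c, 'm) vfun \<Rightarrow> ('a, 'b, 'm) vfun \<Rightarrow> ('a, 'c, 'm) vfun" where
  "vfcomp V G F = \<lparr>fob = (\<lambda>a. fob G (fob F a)),
                   fmap = (\<lambda>a b. fmap G (fob F a) (fob F b) \<cdot>\<^bsub>V\<^esub> fmap F a b)\<rparr>"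

definition vop :: "('o, 'm) smcat \<Rightarrow> ('a, 'o, 'm) vcat \<Rightarrow> ('a, 'o, 'm) vcat" where
  "vop V A = \<lparr>vob = vob A, vhom = (\<lambda>a b. vhom A b a), vid = vid A,
              vcmp = (\<lambda>a b c. vcmp A c b a \<cdot>\<^bsub>V\<^esub> swp V (vhom A c b) (vhom A b a))\<rparr>"

text \<open>\<open>F\<^sup>o\<^sup>p : A\<^sup>o\<^sup>p \<rightarrow> B\<^sup>o\<^sup>p\<close> for \<open>F : A \<rightarrow> B\<close>.\<close>

definition vfop :: "('a, 'b, 'm) vfun \<Rightarrow> ('a, 'b, 'm) vfun" where
  "vfop F = \<lparr>fob = fob F, fmap = (\<lambda>a b. fmap F b a)\<rparr>"

text \<open>A component \<open>\<alpha> a : I \<rightarrow> B(F a, G a)\<close> is an arrow out of the unit, also when \<open>B\<close> is \<open>V\<close> itself.\<close>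

definition vnat ::
  "('o, 'm) smcat \<Rightarrow> ('a, 'o, 'm) vcat \<Rightarrow> ('b, 'o, 'm) vcat \<Rightarrow>
   ('a, 'b, 'm) vfun \<Rightarrow> ('a, 'b, 'm) vfun \<Rightarrow> ('a \<Rightarrow> 'm) \<Rightarrow> bool" where
  "vnat V A B F G \<alpha> \<longleftrightarrow>
     (\<forall>a \<in> vob A. \<alpha> a \<in> homs V (unt V) (vhom B (fob F a) (fob G a))) \<and>
     (\<forall>a \<in> vob A. \<forall>b \<in> vob A.
        vcmp B (fob F a) (fob F b) (fob G b) \<cdot>\<^bsub>V\<^esub> (\<alpha> b \<odot>\<^bsub>V\<^esub> fmap F a b) \<cdot>\<^bsub>V\<^esub>
          inv_arr V (lun V (vhom A a b)) =
        vcmp B (fob F a) (fob G a) (fob G b) \<cdot>\<^bsub>V\<^esub> (fmap G a b \<odot>\<^bsub>V\<^esub> \<alpha> a) \<cdot>\<^bsub>V\<^esub>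
          inv_arr V (run V (vhom A a b)))"

text \<open>Isomorphisms in the underlying ordinary category, whose arrows \<open>a \<rightarrow> b\<close> are arrows \<open>I \<rightarrow> A(a, b)\<close>.\<close>

definition ucomp ::
  "('o, 'm) smcat \<Rightarrow> ('a, 'o, 'm) vcat \<Rightarrow> 'a \<Rightarrow> 'a \<Rightarrow> 'a \<Rightarrow> 'm \<Rightarrow> 'm \<Rightarrow> 'm" where
  "ucomp V A a b c g f = vcmp A a b c \<cdot>\<^bsub>V\<^esub> (g \<odot>\<^bsub>V\<^esub> f) \<cdot>\<^bsub>V\<^esub> inv_arr V (lun V (unt V))"

definition viso_arr :: "('o, 'm) smcat \<Rightarrow> ('a, 'o, 'm) vcat \<Rightarrow> 'a \<Rightarrow> 'a \<Rightarrow> 'm \<Rightarrow> bool" where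
  "viso_arr V A a b f \<longleftrightarrow>
     f \<in> homs V (unt V) (vhom A a b) \<and>
     (\<exists>g \<in> homs V (unt V) (vhom A b a).
        ucomp V A a b a g f = vid A a \<and> ucomp V A b a b f g = vid A b)"

definition viso :: "('o, 'm) smcat \<Rightarrow> ('a, 'o, 'm) vcat \<Rightarrow> 'a \<Rightarrow> 'a \<Rightarrow> bool" where
  "viso V A a b \<longleftrightarrow> (\<exists>f. viso_arr V A a b f)"

definition vnat_iso ::
  "('o, 'm) smcat \<Rightarrow> ('a, 'o, 'm) vcat \<Rightarrow> ('b, 'o, 'm) vcat \<Rightarrow>
   ('a, 'b, 'm) vfun \<Rightarrow> ('a, 'b, 'm) vfun \<Rightarrow> bool" where
  "vnat_iso V A B F G \<longleftrightarrow>
     (\<exists>\<alpha>. vnat V A B F G \<alpha> \<and> (\<forall>a \<in> vob A. viso_arr V B (fob F a) (fob G a) (\<alpha> a)))"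

definition vequivalent ::
  "('o, 'm) smcat \<Rightarrow> ('a, 'o, 'm) vcat \<Rightarrow> ('b, 'o, 'm) vcat \<Rightarrow> bool" where
  "vequivalent V A B \<longleftrightarrow>
     (\<exists>F G. vfunctor V A B F \<and> vfunctor V B A G \<and>
            vnat_iso V A A (vfcomp V G F) (vfid V A) \<and>
            vnat_iso V B B (vfcomp V F G) (vfid V B))"

definition small_vcat :: "'u rel \<Rightarrow> ('o, 'm) smcat \<Rightarrow> ('a, 'o, 'm) vcat \<Rightarrow> bool" where
  "small_vcat \<kappa> V A \<longleftrightarrow>
     small_set \<kappa> (vob A // {(a, b). a \<in> vob A \<and> b \<in> vob A \<and> viso V A a b})"

definition full_sub :: "('a, 'o, 'm) vcat \<Rightarrow> 'a set \<Rightarrow> ('a, 'o, 'm) vcat" where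
  "full_sub A X = A\<lparr>vob := X\<rparr>"


section \<open>V as a V-category, hom functors, functor categories\<close>

definition self :: "('o, 'm) smcat \<Rightarrow> ('o, 'o, 'm) vcat" where
  "self V = \<lparr>vob = obj V, vhom = ihom V,
             vid = (\<lambda>X. cur V (unt V) X X (lun V X)),
             vcmp = (\<lambda>X Y Z. cur V (ihom V Y Z \<otimes>\<^bsub>V\<^esub> ihom V X Y) X Z
               (ev V Y Z \<cdot>\<^bsub>V\<^esub> (idt V (ihom V Y Z) \<odot>\<^bsub>V\<^esub> ev V X Y) \<cdot>\<^bsub>V\<^esub>
                asc V (ihom V Y Z) (ihom V X Y) X))\<rparr>"

text \<open>
  The covariant hom functor \<open>A(c, -) : A \<rightarrow> V\<close>.  The contravariant one \<open>A(-, c) : A\<^sup>o\<^sup>p \<rightarrow> V\<close> is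
  \<open>A\<^sup>o\<^sup>p(c, -)\<close>.
\<close>

definition vhom_fun ::
  "('o, 'm) smcat \<Rightarrow> ('a, 'o, 'm) vcat \<Rightarrow> 'a \<Rightarrow> ('a, 'o, 'm) vfun" where
  "vhom_fun V A c = \<lparr>fob = (\<lambda>a. vhom A c a),
     fmap = (\<lambda>a b. cur V (vhom A a b) (vhom A c a) (vhom A c b) (vcmp A c a b))\<rparr>"

definition vrep ::
  "('o, 'm) smcat \<Rightarrow> ('a, 'o, 'm) vcat \<Rightarrow> 'a \<Rightarrow> ('a, 'o, 'm) vfun" where
  "vrep V A c = vhom_fun V (vop V A) c"

text \<open>
  \<open>(E, e)\<close> is the end \<open>\<integral>\<^sub>a B(F a, G a)\<close>: the universal family \<open>e a : E \<rightarrow> B(F a, G a)\<close> that is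
  V-natural (extraordinarily) in \<open>a\<close>.
\<close>

definition hom_wedge ::
  "('o, 'm) smcat \<Rightarrow> ('a, 'o, 'm) vcat \<Rightarrow> ('b, 'o, 'm) vcat \<Rightarrow>
   ('a, 'b, 'm) vfun \<Rightarrow> ('a, 'b, 'm) vfun \<Rightarrow> 'o \<Rightarrow> ('a \<Rightarrow> 'm) \<Rightarrow> bool" where
  "hom_wedge V A B F G E e \<longleftrightarrow>
     E \<in> obj V \<and>
     (\<forall>a \<in> vob A. e a \<in> homs V E (vhom B (fob F a) (fob G a))) \<and>
     (\<forall>a \<in> vob A. \<forall>b \<in> vob A.
        vcmp B (fob F a) (fob F b) (fob G b) \<cdot>\<^bsub>V\<^esub> (e b \<odot>\<^bsub>V\<^esub> fmap F a b) =
        vcmp B (fob F a) (fob G a) (fob G b) \<cdot>\<^bsub>V\<^esub> (fmap G a b \<odot>\<^bsub>V\<^esub> e a) \<cdot>\<^bsub>V\<^esub>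
          swp V E (vhom A a b))"

definition hom_end ::
  "('o, 'm) smcat \<Rightarrow> ('a, 'o, 'm) vcat \<Rightarrow> ('b, 'o, 'm) vcat \<Rightarrow>
   ('a, 'b, 'm) vfun \<Rightarrow> ('a, 'b, 'm) vfun \<Rightarrow> 'o \<Rightarrow> ('a \<Rightarrow> 'm) \<Rightarrow> bool" where
  "hom_end V A B F G E e \<longleftrightarrow>
     hom_wedge V A B F G E e \<and>
     (\<forall>E' e'. hom_wedge V A B F G E' e' \<longrightarrow>
        (\<exists>!u. u \<in> homs V E' E \<and> (\<forall>a \<in> vob A. e a \<cdot>\<^bsub>V\<^esub> u = e' a)))"

definition chosen_end ::
  "('o, 'm) smcat \<Rightarrow> ('a, 'o, 'm) vcat \<Rightarrow> ('b, 'o, 'm) vcat \<Rightarrow>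
   ('a, 'b, 'm) vfun \<Rightarrow> ('a, 'b, 'm) vfun \<Rightarrow> 'o \<times> ('a \<Rightarrow> 'm)" where
  "chosen_end V A B F G = (SOME (E, e). hom_end V A B F G E e)"

definition end_obj ::
  "('o, 'm) smcat \<Rightarrow> ('a, 'o, 'm) vcat \<Rightarrow> ('b, 'o, 'm) vcat \<Rightarrow>
   ('a, 'b, 'm) vfun \<Rightarrow> ('a, 'b, 'm) vfun \<Rightarrow> 'o" where
  "end_obj V A B F G = fst (chosen_end V A B F G)"

definition end_prj ::
  "('o, 'm) smcat \<Rightarrow> ('a, 'o, 'm) vcat \<Rightarrow> ('b, 'o, 'm) vcat \<Rightarrow>
   ('a, 'b, 'm) vfun \<Rightarrow> ('a, 'b, 'm) vfun \<Rightarrow> 'a \<Rightarrow> 'm" where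
  "end_prj V A B F G = snd (chosen_end V A B F G)"

text \<open>
  The V-category with objects a set \<open>\<F>\<close> of V-functors \<open>A \<rightarrow> B\<close> and homs the ends
  \<open>\<integral>\<^sub>a B(F a, G a)\<close>.  It is meaningful only if these ends exist, which holds in all the uses
  below; identities and composition are then the unique arrows making the projections of the
  ends compatible with those of \<open>B\<close>.
\<close>

definition funcat ::
  "('o, 'm) smcat \<Rightarrow> ('a, 'o, 'm) vcat \<Rightarrow> ('b, 'o, 'm) vcat \<Rightarrow>
   ('a, 'b, 'm) vfun set \<Rightarrow> (('a, 'b, 'm) vfun, 'o, 'm) vcat" where
  "funcat V A B \<F> = \<lparr>vob = \<F>, vhom = end_obj V A B,
     vid = (\<lambda>F. THE u. u \<in> homs V (unt V) (end_obj V A B F F) \<and>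
              (\<forall>a \<in> vob A. end_prj V A B F F a \<cdot>\<^bsub>V\<^esub> u = vid B (fob F a))),
     vcmp = (\<lambda>F G H. THE u.
              u \<in> homs V (end_obj V A B G H \<otimes>\<^bsub>V\<^esub> end_obj V A B F G) (end_obj V A B F H) \<and>
              (\<forall>a \<in> vob A. end_prj V A B F H a \<cdot>\<^bsub>V\<^esub> u =
                 vcmp B (fob F a) (fob G a) (fob H a) \<cdot>\<^bsub>V\<^esub>
                   (end_prj V A B G H a \<odot>\<^bsub>V\<^esub> end_prj V A B F G a)))\<rparr>"

text \<open>\<open>[K\<^sup>o\<^sup>p, V]\<close>, for small \<open>K\<close>.\<close>

definition presheaves ::
  "('o, 'm) smcat \<Rightarrow> ('k, 'o, 'm) vcat \<Rightarrow> (('k, 'o, 'm) vfun, 'o, 'm) vcat" where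
  "presheaves V K = funcat V (vop V K) (self V) {F. vfunctor V (vop V K) (self V) F}"


section \<open>Weighted colimits\<close>

definition weight ::
  "'u rel \<Rightarrow> ('o, 'm) smcat \<Rightarrow> ('u, 'o, 'm) vcat \<Rightarrow> ('u, 'o, 'm) vfun \<Rightarrow> bool" where
  "weight \<kappa> V K \<phi> \<longleftrightarrow> vcategory V K \<and> small_vcat \<kappa> V K \<and> vfunctor V (vop V K) (self V) \<phi>"

text \<open>
  \<open>c\<close> is the \<open>\<phi>\<close>-weighted colimit of \<open>S : K \<rightarrow> A\<close> by way of an isomorphism
  \<open>A(c, a) \<cong> [K\<^sup>o\<^sup>p, V](\<phi>, A(S -, a)) = \<integral>\<^sub>k [\<phi> k, A(S k, a)]\<close>, V-natural in \<open>a\<close>.  The isomorphism is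
  given by its composites \<open>\<omega> a k : A(c, a) \<rightarrow> [\<phi> k, A(S k, a)]\<close> with the projections of the end;
  that it is invertible says that \<open>(A(c, a), \<omega> a)\<close> is itself an end.
\<close>

definition wcolim ::
  "('o, 'm) smcat \<Rightarrow> ('a, 'o, 'm) vcat \<Rightarrow> ('k, 'o, 'm) vcat \<Rightarrow> ('k, 'o, 'm) vfun \<Rightarrow>
   ('k, 'a, 'm) vfun \<Rightarrow> 'a \<Rightarrow> ('a \<Rightarrow> 'k \<Rightarrow> 'm) \<Rightarrow> bool" where
  "wcolim V A K \<phi> S c \<omega> \<longleftrightarrow>
     c \<in> vob A \<and>
     (\<forall>a \<in> vob A. hom_end V (vop V K) (self V) \<phi> (vfcomp V (vhom_fun V (vop V A) a) (vfop S))
                    (vhom A c a) (\<omega> a)) \<and>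
     (\<forall>k \<in> vob K. vnat V A (self V) (vhom_fun V A c)
                    (vfcomp V (vhom_fun V (self V) (fob \<phi> k)) (vhom_fun V A (fob S k)))
                    (\<lambda>a. name_of V (vhom A c a) (ihom V (fob \<phi> k) (vhom A (fob S k) a)) (\<omega> a k)))"

text \<open>
  \<open>F : A \<rightarrow> B\<close> preserves the \<open>\<phi>\<close>-weighted colimit of \<open>S\<close> if every colimit \<open>(c, \<omega>)\<close> is sent to a
  colimit \<open>F c\<close> of \<open>F S\<close>, by way of an isomorphism that is compatible with \<open>\<omega>\<close> under \<open>F\<close>
  (equivalently, whose unit \<open>\<phi> \<rightarrow> B(F S -, F c)\<close> is the image under \<open>F\<close> of the unit of \<open>(c, \<omega>)\<close>).
\<close>

definition preserves_wcolim ::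
  "('o, 'm) smcat \<Rightarrow> ('a, 'o, 'm) vcat \<Rightarrow> ('b, 'o, 'm) vcat \<Rightarrow> ('a, 'b, 'm) vfun \<Rightarrow>
   ('k, 'o, 'm) vcat \<Rightarrow> ('k, 'o, 'm) vfun \<Rightarrow> ('k, 'a, 'm) vfun \<Rightarrow> bool" where
  "preserves_wcolim V A B F K \<phi> S \<longleftrightarrow>
     (\<forall>c \<omega>. wcolim V A K \<phi> S c \<omega> \<longrightarrow>
        (\<exists>\<omega>'. wcolim V B K \<phi> (vfcomp V F S) (fob F c) \<omega>' \<and>
              (\<forall>a \<in> vob A. \<forall>k \<in> vob K.
                 \<omega>' (fob F a) k \<cdot>\<^bsub>V\<^esub> fmap F c a =
                 ihom_post V (fob \<phi> k) (vhom A (fob S k) a)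
                   (vhom B (fob F (fob S k)) (fob F a)) (fmap F (fob S k) a) \<cdot>\<^bsub>V\<^esub> \<omega> a k)))"

definition preserves_small_wcolims ::
  "'u rel \<Rightarrow> ('o, 'm) smcat \<Rightarrow> ('a, 'o, 'm) vcat \<Rightarrow> ('b, 'o, 'm) vcat \<Rightarrow>
   ('a, 'b, 'm) vfun \<Rightarrow> bool" where
  "preserves_small_wcolims \<kappa> V A B F \<longleftrightarrow>
     (\<forall>(K :: ('u, 'o, 'm) vcat) \<phi> S.
        weight \<kappa> V K \<phi> \<and> vfunctor V K A S \<longrightarrow> preserves_wcolim V A B F K \<phi> S)"


section \<open>Accessible functors and free completions\<close>

text \<open>
  \<open>F : A\<^sup>o\<^sup>p \<rightarrow> V\<close> is the left Kan extension of a weight \<open>\<phi> : K\<^sup>o\<^sup>p \<rightarrow> V\<close> along \<open>H\<^sup>o\<^sup>p\<close>, that is,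
  \<open>F a \<cong> \<phi> * A(a, H -)\<close> V-naturally in \<open>a\<close>.  The last conjunct is this naturality: for all \<open>X\<close> and
  \<open>k\<close>, the arrows \<open>\<omega> a X k : [F a, X] \<rightarrow> [\<phi> k, [A(a, H k), X]]\<close> are V-natural in \<open>a \<in> A\<close>.
\<close>

definition accessible ::
  "'u rel \<Rightarrow> ('o, 'm) smcat \<Rightarrow> ('a, 'o, 'm) vcat \<Rightarrow> ('a, 'o, 'm) vfun \<Rightarrow> bool" where
  "accessible \<kappa> V A F \<longleftrightarrow>
     vfunctor V (vop V A) (self V) F \<and>
     (\<exists>(K :: ('u, 'o, 'm) vcat) \<phi> H \<omega>.
        weight \<kappa> V K \<phi> \<and> vfunctor V K A H \<and>
        (\<forall>a \<in> vob A. wcolim V (self V) K \<phi> (vfcomp V (vhom_fun V A a) H) (fob F a) (\<omega> a)) \<and>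
        (\<forall>X \<in> obj V. \<forall>k \<in> vob K.
           vnat V A (self V)
             (vfcomp V (vrep V (self V) X) (vfop F))
             (vfcomp V (vhom_fun V (self V) (fob \<phi> k))
               (vfcomp V (vrep V (self V) X) (vfop (vrep V A (fob H k)))))
             (\<lambda>a. name_of V (ihom V (fob F a) X)
                    (ihom V (fob \<phi> k) (ihom V (vhom A a (fob H k)) X)) (\<omega> a X k))))"

definition PP ::
  "'u rel \<Rightarrow> ('o, 'm) smcat \<Rightarrow> ('a, 'o, 'm) vcat \<Rightarrow> (('a, 'o, 'm) vfun, 'o, 'm) vcat" where
  "PP \<kappa> V A = funcat V (vop V A) (self V) {F. accessible \<kappa> V A F}"

text \<open>
  \<open>X\<close> (the objects of a full subcategory of \<open>\<P>A\<close>) is replete, contains the representables and is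
  closed in \<open>\<P>A\<close> under \<open>\<phi>\<close>-weighted colimits for all \<open>\<phi> \<in> \<Phi>\<close>.
\<close>

definition Phi_closed ::
  "'u rel \<Rightarrow> ('o, 'm) smcat \<Rightarrow> (('u, 'o, 'm) vcat \<times> ('u, 'o, 'm) vfun) set \<Rightarrow>
   ('a, 'o, 'm) vcat \<Rightarrow> ('a, 'o, 'm) vfun set \<Rightarrow> bool" where
  "Phi_closed \<kappa> V \<Phi> A X \<longleftrightarrow>
     X \<subseteq> vob (PP \<kappa> V A) \<and>
     (\<forall>a \<in> vob A. vrep V A a \<in> X) \<and>
     (\<forall>F \<in> X. \<forall>G \<in> vob (PP \<kappa> V A). viso V (PP \<kappa> V A) F G \<longrightarrow> G \<in> X) \<and>
     (\<forall>(K, \<phi>) \<in> \<Phi>. \<forall>S c \<omega>.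
        vfunctor V K (PP \<kappa> V A) S \<and> (\<forall>k \<in> vob K. fob S k \<in> X) \<and>
        wcolim V (PP \<kappa> V A) K \<phi> S c \<omega> \<longrightarrow> c \<in> X)"

definition Phi_completion ::
  "'u rel \<Rightarrow> ('o, 'm) smcat \<Rightarrow> (('u, 'o, 'm) vcat \<times> ('u, 'o, 'm) vfun) set \<Rightarrow>
   ('a, 'o, 'm) vcat \<Rightarrow> (('a, 'o, 'm) vfun, 'o, 'm) vcat" where
  "Phi_completion \<kappa> V \<Phi> A = full_sub (PP \<kappa> V A) (\<Inter>{X. Phi_closed \<kappa> V \<Phi> A X})"

definition small_projectives ::
  "'u rel \<Rightarrow> ('o, 'm) smcat \<Rightarrow> (('u, 'o, 'm) vcat \<times> ('u, 'o, 'm) vfun) set" where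
  "small_projectives \<kappa> V = {(K, \<phi>). weight \<kappa> V K \<phi> \<and>
     preserves_small_wcolims \<kappa> V (presheaves V K) (self V) (vhom_fun V (presheaves V K) \<phi>)}"

definition QQ ::
  "'u rel \<Rightarrow> ('o, 'm) smcat \<Rightarrow> ('a, 'o, 'm) vcat \<Rightarrow> (('a, 'o, 'm) vfun, 'o, 'm) vcat" where
  "QQ \<kappa> V A = Phi_completion \<kappa> V (small_projectives \<kappa> V) A"

end

theory Submission
  imports Defs
begin

text \<open>
  Arrows \<open>X\<^sub>1 \<otimes> \<dots> \<otimes> X\<^sub>n \<rightarrow> Y\<close> are treated as elements of \<open>Y\<close> at the stage \<open>[X\<^sub>1, \<dots>, X\<^sub>n]\<close>, which
  turns the axioms of enriched categories into equations between elements.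

  Put \<open>L M b = [M, A (-, b)]\<close> for an accessible presheaf \<open>M\<close> on \<open>A\<close>. Call \<open>M\<close> atomic if the evaluations
  \<open>M a \<otimes> L M b \<rightarrow> A (a, b)\<close> are part of a dual pair: the identity of \<open>M\<close> comes from a global element of the
  coend of \<open>M a \<otimes> L M a\<close>. Representables are atomic, small projective weighted colimits of atomic presheaves
  are atomic, and an atomic presheaf is a colimit of representables weighted by a small projective. So
  \<open>Q (A)\<close> consists of the atomic presheaves. Dual pairs are symmetric in \<open>A\<close> and its opposite, hence
  \<open>L\<close> maps \<open>Q (A)\<close> to \<open>Q (A\<^sup>o\<^sup>p)\<close> contravariantly, and \<open>M \<cong> L (L M)\<close>.
\<close>

text \<open>Stages are lists of objects rather than objects because lists concatenate strictly:
  associators and unit constraints vanish from every equation between elements, and the only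
  coherence left is the permutation of blocks of a stage. A global element of it is replaced by what
  it does: it sends every dinatural family \<open>M a \<otimes> L M a \<rightarrow> X\<close> to a
  global element of \<open>X\<close>, naturally in \<open>X\<close>. To come back to small weights,
  the index set \<open>J\<close> of these families is kept apart from the objects of
  \<open>A\<close>. An accessible \<open>M\<close> is a left Kan extension along some
  \<open>H\<close> with small domain, and families over the objects \<open>H k\<close> extend to all
  of \<open>A\<close>, so that \<open>J\<close> may be taken small. The restriction of
  \<open>M\<close> to \<open>J\<close> is then the small projective weight that puts
  \<open>M\<close> into every closed class. That \<open>[M, -]\<close> preserves colimits comes from
  its right adjoint, which sends \<open>X\<close> to the presheaf \<open>[L M -, X]\<close>.\<close>

notation fob ("_$_" [1000,1000] 1000)

section \<open>Coherence\<close>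

context category
begin

lemma homs_iff: "f : homs C X Y \<longleftrightarrow> f : arr C & src C f = X & tgt C f = Y"
 by (simp add: homs_def)

lemma arr_typing [simp]:
 assumes "f : arr C"
 shows "src C f : obj C" "tgt C f : obj C"
 using assms src_obj tgt_obj by auto

lemma homs_objs:
 assumes "f : homs C X Y"
 shows "X : obj C" "Y : obj C"
 using assms unfolding homs_iff by auto

lemma idt_typing [simp]:
 assumes "X : obj C"
 shows "idt C X : arr C" "src C (idt C X) = X" "tgt C (idt C X) = X"
 using idt_homs[OF assms] unfolding homs_iff by auto

lemma cmp_typing [simp]:
 assumes "f : arr C" "g : arr C" "src C g = tgt C f"
 shows "g \<cdot> f : arr C" "src C (g \<cdot> f) = src C f" "tgt C (g \<cdot> f) = tgt C g"
 using cmp_homs[of f "src C f" "tgt C f" g "tgt C g"] assms unfolding homs_iff by auto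

lemma cmp_idt [simp]:
 "f : arr C ==> tgt C f = Y ==> idt C Y \<cdot> f = f"
 "f : arr C ==> src C f = X ==> f \<cdot> idt C X = f"
 using cmp_idt_left[of f "src C f" "tgt C f"] cmp_idt_right[of f "src C f" "tgt C f"]
 unfolding homs_iff by auto

lemma cmp_assoc_arr [simp]:
 "f : arr C ==> g : arr C ==> h : arr C ==> src C g = tgt C f ==> src C h = tgt C g ==>
 (h \<cdot> g) \<cdot> f = h \<cdot> g \<cdot> f"
 using cmp_assoc[of f "src C f" "tgt C f" g "tgt C g" h "tgt C h"] unfolding homs_iff by auto

lemma inverse_arrows_unique:
 assumes "inverse_arrows C f g" "inverse_arrows C f h"
 shows "g = h"
proof -
 have f: "f : arr C" and g: "g : arr C" "src C g = tgt C f" "tgt C g = src C f"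
  and h: "h : arr C" "src C h = tgt C f" "tgt C h = src C f"
  and e: "g \<cdot> f = idt C (src C f)" "f \<cdot> h = idt C (tgt C f)"
  using assms unfolding inverse_arrows_def homs_iff by auto
 have "g = g \<cdot> (f \<cdot> h)" using e g by simp
 also have "... = (g \<cdot> f) \<cdot> h" using f g h by simp
 also have "... = h" using e h by simp
 finally show ?thesis .
qed

lemma inv_arr_inverse: "iso_arr C f ==> inverse_arrows C f (inv_arr C f)"
 unfolding iso_arr_def inv_arr_def using inverse_arrows_unique by (metis theI)

lemma inv_arr_facts:
 assumes "iso_arr C f"
 shows "inv_arr C f : arr C" "src C (inv_arr C f) = tgt C f" "tgt C (inv_arr C f) = src C f"
  "inv_arr C f \<cdot> f = idt C (src C f)" "f \<cdot> inv_arr C f = idt C (tgt C f)"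
 using inv_arr_inverse[OF assms] unfolding inverse_arrows_def homs_iff by auto

lemma iso_cancel_left:
 assumes "inverse_arrows C f g" "h : arr C" "k : arr C" "tgt C h = src C f" "tgt C k = src C f"
  and "f \<cdot> h = f \<cdot> k"
 shows "h = k"
proof -
 have fg: "f : arr C" "g : arr C" "src C g = tgt C f" "tgt C g = src C f" "g \<cdot> f = idt C (src C f)"
  using assms(1) unfolding inverse_arrows_def homs_iff by auto
 have "(g \<cdot> f) \<cdot> h = (g \<cdot> f) \<cdot> k"
  using fg(1-4) assms by simp
 then show ?thesis unfolding fg(5) using assms by simp
qed

lemma iso_cancel_right:
 assumes "inverse_arrows C f g" "h : arr C" "k : arr C" "src C h = tgt C f" "src C k = tgt C f"
  and "h \<cdot> f = k \<cdot> f"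
 shows "h = k"
proof -
 have fg: "f : arr C" "g : arr C" "src C g = tgt C f" "tgt C g = src C f" "f \<cdot> g = idt C (tgt C f)"
  using assms(1) unfolding inverse_arrows_def homs_iff by auto
 have "h \<cdot> (f \<cdot> g) = k \<cdot> (f \<cdot> g)"
  using fg(1-4) assms by (metis cmp_assoc_arr)
 then show ?thesis unfolding fg(5) using assms by simp
qed

text \<open>Composites are normalised by bracketing to the right, which hides
  \<open>g \<cdot> f\<close> inside \<open>g \<cdot> f \<cdot> h\<close>. The variants with a tail
  \<open>h\<close>, here and in \<open>cmp_eq_tail\<close>, make inverse laws and naturality squares
  applicable there.\<close>

lemma cmp_cancel_tail:
 assumes "g \<cdot> f = idt C X" "f : arr C" "g : arr C" "h : arr C" "src C g = tgt C f"
  "src C f = tgt C h" "X = tgt C h"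
 shows "g \<cdot> f \<cdot> h = h"
proof -
 have "g \<cdot> f \<cdot> h = (g \<cdot> f) \<cdot> h" using assms(2-) by simp
 then show ?thesis using assms(1,4,7) by simp
qed

lemma cmp_eq_tail:
 assumes "g \<cdot> f = g' \<cdot> f'" "f : arr C" "g : arr C" "h : arr C" "src C g = tgt C f"
  "src C f = tgt C h" "f' : arr C" "g' : arr C" "src C g' = tgt C f'" "src C f' = tgt C h"
 shows "g \<cdot> f \<cdot> h = g' \<cdot> f' \<cdot> h"
proof -
 have "g \<cdot> f \<cdot> h = (g \<cdot> f) \<cdot> h" using assms(2-) by simp
 also have "... = (g' \<cdot> f') \<cdot> h" by (simp only: assms(1))
 also have "... = g' \<cdot> f' \<cdot> h" using assms(2-) by simp
 finally show ?thesis .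
qed

end

context symmetric_monoidal_closed
begin

abbreviation "I == unt V"
abbreviation "one == idt V"

definition "lui X = inv_arr V (lun V X)"
definition "rui X = inv_arr V (run V X)"
definition "asi X Y Z = inv_arr V (asc V X Y Z)"

lemma obj_typing [simp]: "I : obj V" "X : obj V ==> Y : obj V ==> X \<otimes> Y : obj V"
 "X : obj V ==> Y : obj V ==> ihom V X Y : obj V"
 by (auto simp: unt_obj ten_obj ihom_obj)

lemma tena_typing [simp]:
 assumes "f : arr V" "g : arr V"
 shows "f \<odot> g : arr V" "src V (f \<odot> g) = src V f \<otimes> src V g" "tgt V (f \<odot> g) = tgt V f \<otimes> tgt V g"
 using tena_homs[of f "src V f" "tgt V f" g "src V g" "tgt V g"] assms unfolding homs_iff by auto

lemma const_typing [simp]: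
 assumes "X : obj V"
 shows "lun V X : arr V" "src V (lun V X) = I \<otimes> X" "tgt V (lun V X) = X"
  "run V X : arr V" "src V (run V X) = X \<otimes> I" "tgt V (run V X) = X"
  "lui X : arr V" "src V (lui X) = X" "tgt V (lui X) = I \<otimes> X"
  "rui X : arr V" "src V (rui X) = X" "tgt V (rui X) = X \<otimes> I"
 using lun_homs[OF assms] run_homs[OF assms] inv_arr_facts[OF lun_iso[OF assms]]
  inv_arr_facts[OF run_iso[OF assms]]
 unfolding homs_iff lui_def rui_def by auto

lemma asc_typing [simp]:
 assumes "X : obj V" "Y : obj V" "Z : obj V"
 shows "asc V X Y Z : arr V" "src V (asc V X Y Z) = (X \<otimes> Y) \<otimes> Z"
  "tgt V (asc V X Y Z) = X \<otimes> Y \<otimes> Z"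
  "asi X Y Z : arr V" "tgt V (asi X Y Z) = (X \<otimes> Y) \<otimes> Z" "src V (asi X Y Z) = X \<otimes> Y \<otimes> Z"
 using asc_homs[OF assms] inv_arr_facts[OF asc_iso[OF assms]] unfolding homs_iff asi_def by auto

lemma swp_typing [simp]:
 assumes "X : obj V" "Y : obj V"
 shows "swp V X Y : arr V" "src V (swp V X Y) = X \<otimes> Y" "tgt V (swp V X Y) = Y \<otimes> X"
 using swp_homs[OF assms] unfolding homs_iff by auto

lemma ev_typing [simp]:
 assumes "X : obj V" "Y : obj V"
 shows "ev V X Y : arr V" "src V (ev V X Y) = ihom V X Y \<otimes> X" "tgt V (ev V X Y) = Y"
 using ev_homs[OF assms] unfolding homs_iff by auto

lemma inverse_laws [simp]:
 "X : obj V ==> lui X \<cdot> lun V X = one (I \<otimes> X)" "X : obj V ==> lun V X \<cdot> lui X = one X"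
 "X : obj V ==> rui X \<cdot> run V X = one (X \<otimes> I)" "X : obj V ==> run V X \<cdot> rui X = one X"
 "X : obj V ==> Y : obj V ==> Z : obj V ==> asi X Y Z \<cdot> asc V X Y Z = one ((X \<otimes> Y) \<otimes> Z)"
 "X : obj V ==> Y : obj V ==> Z : obj V ==> asc V X Y Z \<cdot> asi X Y Z = one (X \<otimes> Y \<otimes> Z)"
 "X : obj V ==> Y : obj V ==> swp V Y X \<cdot> swp V X Y = one (X \<otimes> Y)"
 using inv_arr_facts[OF lun_iso] inv_arr_facts[OF run_iso] inv_arr_facts[OF asc_iso] swp_swp
 unfolding lui_def rui_def asi_def by auto

lemma inverse_laws_tail [simp]:
 "X : obj V ==> h : arr V ==> tgt V h = I \<otimes> X ==> lui X \<cdot> lun V X \<cdot> h = h"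
 "X : obj V ==> h : arr V ==> tgt V h = X ==> lun V X \<cdot> lui X \<cdot> h = h"
 "X : obj V ==> h : arr V ==> tgt V h = X \<otimes> I ==> rui X \<cdot> run V X \<cdot> h = h"
 "X : obj V ==> h : arr V ==> tgt V h = X ==> run V X \<cdot> rui X \<cdot> h = h"
 "X : obj V ==> Y : obj V ==> Z : obj V ==> h : arr V ==> tgt V h = (X \<otimes> Y) \<otimes> Z ==>
  asi X Y Z \<cdot> asc V X Y Z \<cdot> h = h"
 "X : obj V ==> Y : obj V ==> Z : obj V ==> h : arr V ==> tgt V h = X \<otimes> Y \<otimes> Z ==>
  asc V X Y Z \<cdot> asi X Y Z \<cdot> h = h"
 "X : obj V ==> Y : obj V ==> h : arr V ==> tgt V h = X \<otimes> Y ==> swp V Y X \<cdot> swp V X Y \<cdot> h = h"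
 by (auto intro!: cmp_cancel_tail)

lemma tena_one [simp]: "X : obj V ==> Y : obj V ==> one X \<odot> one Y = one (X \<otimes> Y)"
 by (rule tena_idt)

lemma interchange [simp]:
 "f : arr V ==> f' : arr V ==> g : arr V ==> g' : arr V ==> src V f' = tgt V f ==>
 src V g' = tgt V g ==> (f' \<odot> g') \<cdot> (f \<odot> g) = (f' \<cdot> f) \<odot> (g' \<cdot> g)"
 using tena_cmp[of f "src V f" "tgt V f" f' "tgt V f'" g "src V g" "tgt V g" g' "tgt V g'"]
 unfolding homs_iff by auto

lemma interchange_tail [simp]:
 assumes "f : arr V" "f' : arr V" "g : arr V" "g' : arr V" "src V f' = tgt V f"
 "src V g' = tgt V g" "h : arr V" "tgt V h = src V f \<otimes> src V g"
 shows "(f' \<odot> g') \<cdot> (f \<odot> g) \<cdot> h = ((f' \<cdot> f) \<odot> (g' \<cdot> g)) \<cdot> h"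
proof -
 have "(f' \<odot> g') \<cdot> (f \<odot> g) \<cdot> h = ((f' \<odot> g') \<cdot> (f \<odot> g)) \<cdot> h"
  using assms by (subst cmp_assoc_arr) simp_all
 then show ?thesis using assms by simp
qed

lemma asc_natural:
 assumes "f : arr V" "g : arr V" "h : arr V" "X = tgt V f" "Y = tgt V g" "Z = tgt V h"
 shows "asc V X Y Z \<cdot> ((f \<odot> g) \<odot> h) = (f \<odot> g \<odot> h) \<cdot> asc V (src V f) (src V g) (src V h)"
 using asc_nat[of f "src V f" X g "src V g" Y h "src V h" Z] assms unfolding homs_iff by auto

lemma lun_natural:
 assumes "f : arr V" "Y = tgt V f"
 shows "lun V Y \<cdot> (one I \<odot> f) = f \<cdot> lun V (src V f)"
 using lun_nat[of f "src V f" Y] assms unfolding homs_iff by auto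

lemma run_natural:
 assumes "f : arr V" "Y = tgt V f"
 shows "run V Y \<cdot> (f \<odot> one I) = f \<cdot> run V (src V f)"
 using run_nat[of f "src V f" Y] assms unfolding homs_iff by auto

lemma swp_natural:
 assumes "f : arr V" "g : arr V" "X = tgt V f" "Y = tgt V g"
 shows "swp V X Y \<cdot> (f \<odot> g) = (g \<odot> f) \<cdot> swp V (src V f) (src V g)"
 using swp_nat[of f "src V f" X g "src V g" Y] assms unfolding homs_iff by auto

lemma lui_natural:
 assumes "f : arr V" "X = src V f"
 shows "(one I \<odot> f) \<cdot> lui X = lui (tgt V f) \<cdot> f"
proof (rule iso_cancel_left[of "lun V (tgt V f)" "lui (tgt V f)"])
 show "lun V (tgt V f) \<cdot> (one I \<odot> f) \<cdot> lui X = lun V (tgt V f) \<cdot> lui (tgt V f) \<cdot> f"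
  using assms by (subst cmp_eq_tail[OF lun_natural[of f "tgt V f"]]) simp_all
qed (use assms in "auto simp: inverse_arrows_def homs_iff")

lemma rui_natural:
 assumes "f : arr V" "X = src V f"
 shows "(f \<odot> one I) \<cdot> rui X = rui (tgt V f) \<cdot> f"
proof (rule iso_cancel_left[of "run V (tgt V f)" "rui (tgt V f)"])
 show "run V (tgt V f) \<cdot> (f \<odot> one I) \<cdot> rui X = run V (tgt V f) \<cdot> rui (tgt V f) \<cdot> f"
  using assms by (subst cmp_eq_tail[OF run_natural[of f "tgt V f"]]) simp_all
qed (use assms in "auto simp: inverse_arrows_def homs_iff")

text \<open>Conjugation by the natural isomorphism \<open>lun\<close> recovers \<open>f\<close> from
  \<open>one I \<odot> f\<close>. Identities between unit constraints may thus be checked after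
  tensoring with the unit, where the pentagon and the triangle apply.\<close>

lemma unit_left_faithful:
 assumes "f : arr V" "g : arr V" "src V f = src V g" "tgt V f = tgt V g" "one I \<odot> f = one I \<odot> g"
 shows "f = g"
proof (rule iso_cancel_right)
 have "f \<cdot> lun V (src V f) = lun V (tgt V f) \<cdot> (one I \<odot> f)"
  using lun_natural[OF assms(1)] by simp
 also have "... = g \<cdot> lun V (src V f)"
  unfolding assms using lun_natural[OF assms(2)] by simp
 finally show "f \<cdot> lun V (src V f) = g \<cdot> lun V (src V f)" .
 show "inverse_arrows V (lun V (src V f)) (lui (src V f))"
  using assms(1) by (simp add: inverse_arrows_def homs_iff)
qed (use assms(1,2) in "simp_all add: assms(3,4)")

lemma unit_right_faithful:
 assumes "f : arr V" "g : arr V" "src V f = src V g" "tgt V f = tgt V g" "f \<odot> one I = g \<odot> one I"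
 shows "f = g"
proof (rule iso_cancel_right)
 have "f \<cdot> run V (src V f) = run V (tgt V f) \<cdot> (f \<odot> one I)"
  using run_natural[OF assms(1)] by simp
 also have "... = g \<cdot> run V (src V f)"
  unfolding assms using run_natural[OF assms(2)] by simp
 finally show "f \<cdot> run V (src V f) = g \<cdot> run V (src V f)" .
 show "inverse_arrows V (run V (src V f)) (rui (src V f))"
  using assms(1) by (simp add: inverse_arrows_def homs_iff)
qed (use assms(1,2) in "simp_all add: assms(3,4)")

lemma asc_inverse_arrows:
 "X : obj V ==> Y : obj V ==> Z : obj V ==> inverse_arrows V (asc V X Y Z) (asi X Y Z)"
 by (simp add: inverse_arrows_def homs_iff)

text \<open>Kelly's argument: after tensoring with \<open>I\<close>, the pentagon for
  \<open>I\<close>, \<open>I\<close>, \<open>X\<close>, \<open>Y\<close> and two triangles turn both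
  sides into composites with the same isomorphism \<open>?a\<close>, which is then
  cancelled.\<close>

lemma lun_ten:
 assumes [simp]: "X : obj V" "Y : obj V"
 shows "lun V (X \<otimes> Y) \<cdot> asc V I X Y = lun V X \<odot> one Y"
proof (rule unit_left_faithful)
 let ?a = "asc V I (I \<otimes> X) Y \<cdot> (asc V I I X \<odot> one Y)"
 let ?b = "(asi I I X \<odot> one Y) \<cdot> asi I (I \<otimes> X) Y"
 have "(one I \<odot> (lun V (X \<otimes> Y) \<cdot> asc V I X Y)) \<cdot> ?a
   = (one I \<odot> lun V (X \<otimes> Y)) \<cdot> (one I \<odot> asc V I X Y) \<cdot> ?a"
  by simp
 also have "... = (one I \<odot> lun V (X \<otimes> Y)) \<cdot> asc V I I (X \<otimes> Y) \<cdot> asc V (I \<otimes> I) X Y"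
  using pentagon by simp
 also have "... = ((one I \<odot> lun V (X \<otimes> Y)) \<cdot> asc V I I (X \<otimes> Y)) \<cdot> asc V (I \<otimes> I) X Y"
  by simp
 also have "... = (run V I \<odot> one (X \<otimes> Y)) \<cdot> asc V (I \<otimes> I) X Y"
  by (subst triangle) simp_all
 also have "... = asc V I X Y \<cdot> ((run V I \<odot> one X) \<odot> one Y)"
  using asc_natural[of "run V I" "one X" "one Y"] by simp
 also have "... = asc V I X Y \<cdot> (((one I \<odot> lun V X) \<cdot> asc V I I X) \<odot> one Y)"
  by (subst triangle) simp_all
 also have "... = asc V I X Y \<cdot> ((one I \<odot> lun V X) \<odot> one Y) \<cdot> (asc V I I X \<odot> one Y)"
  by simp
 also have "... = (one I \<odot> lun V X \<odot> one Y) \<cdot> ?a"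
  by (rule cmp_eq_tail, subst asc_natural) simp_all
 finally show "one I \<odot> (lun V (X \<otimes> Y) \<cdot> asc V I X Y) = one I \<odot> lun V X \<odot> one Y"
  by (rule iso_cancel_right[of ?a ?b, rotated -1]) (simp_all add: inverse_arrows_def homs_iff)
qed simp_all

lemma run_ten:
 assumes [simp]: "X : obj V" "Y : obj V"
 shows "(one X \<odot> run V Y) \<cdot> asc V X Y I = run V (X \<otimes> Y)"
proof (rule unit_right_faithful)
 have "asc V X Y I \<cdot> (run V (X \<otimes> Y) \<odot> one I)
  = asc V X Y I \<cdot> (((one X \<odot> one Y) \<odot> lun V I) \<cdot> asc V (X \<otimes> Y) I I)"
  using triangle by simp
 also have "... = (one X \<odot> one Y \<odot> lun V I) \<cdot> asc V X Y (I \<otimes> I) \<cdot> asc V (X \<otimes> Y) I I"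
  by (rule cmp_eq_tail, subst asc_natural) simp_all
 also have "... = (one X \<odot> ((one Y \<odot> lun V I) \<cdot> asc V Y I I)) \<cdot> asc V X (Y \<otimes> I) I \<cdot> (asc V X Y I \<odot> one I)"
  using pentagon by simp
 also have "... = (one X \<odot> run V Y \<odot> one I) \<cdot> asc V X (Y \<otimes> I) I \<cdot> (asc V X Y I \<odot> one I)"
  using triangle by simp
 also have "... = asc V X Y I \<cdot> ((one X \<odot> run V Y) \<odot> one I) \<cdot> (asc V X Y I \<odot> one I)"
  by (rule cmp_eq_tail, subst asc_natural) simp_all
 also have "... = asc V X Y I \<cdot> (((one X \<odot> run V Y) \<cdot> asc V X Y I) \<odot> one I)"
  by simp
 finally show "((one X \<odot> run V Y) \<cdot> asc V X Y I) \<odot> one I = run V (X \<otimes> Y) \<odot> one I"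
  by (rule iso_cancel_left[OF asc_inverse_arrows[of X Y I], rotated -1, THEN sym]) simp_all
qed simp_all

text \<open>Naturality of \<open>lun\<close> at the arrow \<open>lun V I\<close> itself gives
  \<open>lun V (I \<otimes> I) = one I \<odot> lun V I\<close>. Then \<open>lun_ten\<close> brings
  \<open>lun V I \<odot> one I\<close> into the form whose value the triangle gives as
  \<open>run V I \<odot> one I\<close>.\<close>

lemma lun_run_unit: "lun V I = run V I"
proof (rule unit_right_faithful)
 have "lun V I \<cdot> lun V (I \<otimes> I) = lun V I \<cdot> (one I \<odot> lun V I)"
  using lun_natural[of "lun V I" I] by simp
 then have "lun V (I \<otimes> I) = one I \<odot> lun V I"
  by (rule iso_cancel_left[of "lun V I" "lui I", rotated -1]) (simp_all add: inverse_arrows_def homs_iff)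
 then have "lun V I \<odot> one I = (one I \<odot> lun V I) \<cdot> asc V I I I"
  using lun_ten[of I I] by simp
 also have "... = run V I \<odot> one I"
  by (rule triangle) simp_all
 finally show "lun V I \<odot> one I = run V I \<odot> one I" .
qed simp_all

section \<open>Strictification: tensor products indexed by lists\<close>

primrec T :: "'o list => 'o" where
 "T [] = I"
| "T (X # ws) = X \<otimes> T ws"

abbreviation ok :: "'o list => bool" where "ok ws == set ws <= obj V"

text \<open>The comparison isomorphism that makes \<open>T\<close> monoidal from lists under append
  to \<open>V\<close>; \<open>spl\<close> is its inverse.\<close>

primrec jn :: "'o list => 'o list => 'm" where
 "jn [] vs = lun V (T vs)"
| "jn (X # ws) vs = (one X \<odot> jn ws vs) \<cdot> asc V X (T ws) (T vs)"

primrec spl :: "'o list => 'o list => 'm" where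
 "spl [] vs = lui (T vs)"
| "spl (X # ws) vs = asi X (T ws) (T vs) \<cdot> (one X \<odot> spl ws vs)"

lemma T_obj [simp]: "ok ws ==> T ws : obj V"
 by (induction ws) auto

lemma jn_typing [simp]:
 assumes "ok ws" "ok vs"
 shows "jn ws vs : arr V" "src V (jn ws vs) = T ws \<otimes> T vs" "tgt V (jn ws vs) = T (ws @ vs)"
 using assms by (induction ws) auto

lemma spl_typing [simp]:
 assumes "ok ws" "ok vs"
 shows "spl ws vs : arr V" "tgt V (spl ws vs) = T ws \<otimes> T vs" "src V (spl ws vs) = T (ws @ vs)"
 using assms by (induction ws) auto

lemma jn_spl [simp]: "ok ws ==> ok vs ==> jn ws vs \<cdot> spl ws vs = one (T (ws @ vs))"
 by (induction ws) auto

lemma spl_jn [simp]: "ok ws ==> ok vs ==> spl ws vs \<cdot> jn ws vs = one (T ws \<otimes> T vs)"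
 by (induction ws) auto

lemma jn_spl_tail [simp]:
 "ok ws ==> ok vs ==> h : arr V ==> tgt V h = T (ws @ vs) ==> jn ws vs \<cdot> spl ws vs \<cdot> h = h"
 "ok ws ==> ok vs ==> h : arr V ==> tgt V h = T ws \<otimes> T vs ==> spl ws vs \<cdot> jn ws vs \<cdot> h = h"
 by (auto intro!: cmp_cancel_tail)

text \<open>Append is strictly associative, so the coherence of \<open>jn\<close> contains a single
  associator. The induction on \<open>ws\<close> rests on the pentagon in the step and on
  \<open>lun_ten\<close> for the empty list.\<close>

lemma jn_assoc:
 assumes [simp]: "ok ws" "ok vs" "ok us"
 shows "jn (ws @ vs) us \<cdot> (jn ws vs \<odot> one (T us)) =
    jn ws (vs @ us) \<cdot> (one (T ws) \<odot> jn vs us) \<cdot> asc V (T ws) (T vs) (T us)"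
 using assms(1)
proof (induction ws)
 case Nil
 have "lun V (T (vs @ us)) \<cdot> (one I \<odot> jn vs us) \<cdot> asc V I (T vs) (T us)
  = jn vs us \<cdot> lun V (T vs \<otimes> T us) \<cdot> asc V I (T vs) (T us)"
  by (rule cmp_eq_tail, subst lun_natural) simp_all
 then show ?case using lun_ten by simp
next
 case (Cons X ws)
 then have [simp]: "X : obj V" "ok ws" by auto
 note IH = Cons.IH[OF `ok ws`]
 let ?W = "T ws" and ?V = "T vs" and ?U = "T us"
 have "jn ((X # ws) @ vs) us \<cdot> (jn (X # ws) vs \<odot> one ?U)
   = (one X \<odot> jn (ws @ vs) us) \<cdot> asc V X (T (ws @ vs)) ?U \<cdot> ((one X \<odot> jn ws vs) \<odot> one ?U)
     \<cdot> (asc V X ?W ?V \<odot> one ?U)"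
  by simp
 also have "... = (one X \<odot> jn (ws @ vs) us) \<cdot> (one X \<odot> jn ws vs \<odot> one ?U) \<cdot> asc V X (?W \<otimes> ?V) ?U
     \<cdot> (asc V X ?W ?V \<odot> one ?U)"
  using cmp_eq_tail[OF asc_natural[of "one X" "jn ws vs" "one ?U" X "T (ws @ vs)" ?U],
   of "asc V X ?W ?V \<odot> one ?U"] by simp
 also have "... = (one X \<odot> (jn (ws @ vs) us \<cdot> (jn ws vs \<odot> one ?U))) \<cdot> asc V X (?W \<otimes> ?V) ?U
     \<cdot> (asc V X ?W ?V \<odot> one ?U)"
  by simp
 also have "... = (one X \<odot> jn ws (vs @ us)) \<cdot> (one X \<odot> one ?W \<odot> jn vs us) \<cdot> (one X \<odot> asc V ?W ?V ?U) \<cdot>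
   asc V X (?W \<otimes> ?V) ?U \<cdot> (asc V X ?W ?V \<odot> one ?U)"
  unfolding IH by simp
 also have "... = (one X \<odot> jn ws (vs @ us)) \<cdot> (one X \<odot> one ?W \<odot> jn vs us) \<cdot> asc V X ?W (?V \<otimes> ?U) \<cdot>
   asc V (X \<otimes> ?W) ?V ?U"
  using pentagon by simp
 also have "... = (one X \<odot> jn ws (vs @ us)) \<cdot> asc V X ?W (T (vs @ us)) \<cdot> ((one X \<odot> one ?W) \<odot> jn vs us) \<cdot>
   asc V (X \<otimes> ?W) ?V ?U"
  using cmp_eq_tail[OF asc_natural[of "one X" "one ?W" "jn vs us" X ?W "T (vs @ us)"], of "asc V (X \<otimes> ?W) ?V ?U"] by simp
 finally show ?case by simp
qed

text \<open>For the empty list this is the coincidence \<open>lun_run_unit\<close>; each further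
  object is absorbed by \<open>run_ten\<close>.\<close>

lemma jn_Nil_right: "ok ws ==> jn ws [] = run V (T ws)"
proof (induction ws)
 case (Cons X ws)
 then show ?case using run_ten by simp
qed (simp add: lun_run_unit)

lemma spl_Nil_right:
 assumes [simp]: "ok ws" shows "spl ws [] = rui (T ws)"
proof (rule iso_cancel_left[of "run V (T ws)" "rui (T ws)"])
 show "run V (T ws) \<cdot> spl ws [] = run V (T ws) \<cdot> rui (T ws)"
  using jn_spl[of ws "[]"] by (simp add: jn_Nil_right)
qed (simp_all add: inverse_arrows_def homs_iff)

lemma spl_assoc:
 assumes [simp]: "ok ws" "ok vs" "ok us"
 shows "asc V (T ws) (T vs) (T us) \<cdot> (spl ws vs \<odot> one (T us)) \<cdot> spl (ws @ vs) us =
    (one (T ws) \<odot> spl vs us) \<cdot> spl ws (vs @ us)"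
proof (rule iso_cancel_left[of "jn ws (vs @ us) \<cdot> (one (T ws) \<odot> jn vs us)" "(one (T ws) \<odot> spl vs us) \<cdot> spl ws (vs @ us)"])
 have "(jn ws (vs @ us) \<cdot> (one (T ws) \<odot> jn vs us)) \<cdot> asc V (T ws) (T vs) (T us) \<cdot> (spl ws vs \<odot> one (T us)) \<cdot> spl (ws @ vs) us
  = (jn ws (vs @ us) \<cdot> (one (T ws) \<odot> jn vs us) \<cdot> asc V (T ws) (T vs) (T us)) \<cdot> (spl ws vs \<odot> one (T us)) \<cdot> spl (ws @ vs) us"
  by simp
 also have "... = (jn (ws @ vs) us \<cdot> (jn ws vs \<odot> one (T us))) \<cdot> (spl ws vs \<odot> one (T us)) \<cdot> spl (ws @ vs) us"
  unfolding jn_assoc[OF assms] ..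
 also have "... = (jn ws (vs @ us) \<cdot> (one (T ws) \<odot> jn vs us)) \<cdot> (one (T ws) \<odot> spl vs us) \<cdot> spl ws (vs @ us)"
  by simp
 finally show "(jn ws (vs @ us) \<cdot> (one (T ws) \<odot> jn vs us)) \<cdot> asc V (T ws) (T vs) (T us) \<cdot> (spl ws vs \<odot> one (T us)) \<cdot> spl (ws @ vs) us
  = (jn ws (vs @ us) \<cdot> (one (T ws) \<odot> jn vs us)) \<cdot> (one (T ws) \<odot> spl vs us) \<cdot> spl ws (vs @ us)" .
qed (simp_all add: inverse_arrows_def homs_iff)

text \<open>The strictly associative tensor product of arrows between list objects.\<close>

definition tt :: "'o list => 'o list => 'o list => 'o list => 'm => 'm => 'm" where
 "tt as as' bs bs' f g = jn as' bs' \<cdot> (f \<odot> g) \<cdot> spl as bs"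

definition sg :: "'o list => 'o list => 'm" where
 "sg ws vs = jn vs ws \<cdot> swp V (T ws) (T vs) \<cdot> spl ws vs"

definition lhom :: "'o list => 'o list => 'm => bool" where
 "lhom ws vs f == ok ws & ok vs & f : homs V (T ws) (T vs)"

lemma lhomD:
 assumes "lhom ws vs f"
 shows "ok ws" "ok vs" "f : arr V" "src V f = T ws" "tgt V f = T vs"
 using assms unfolding lhom_def homs_iff by auto

lemma lhom_one [simp]: "ok ws ==> lhom ws ws (one (T ws))"
 unfolding lhom_def homs_iff by simp

lemma lhom_tt [simp]: "lhom as as' f ==> lhom bs bs' g ==> lhom (as @ bs) (as' @ bs') (tt as as' bs bs' f g)"
 unfolding lhom_def homs_iff tt_def by simp

lemma lhom_sg [simp]: "ok ws ==> ok vs ==> lhom (ws @ vs) (vs @ ws) (sg ws vs)"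
 unfolding lhom_def homs_iff sg_def by simp

lemma tt_one [simp]: "ok as ==> ok bs ==> tt as as bs bs (one (T as)) (one (T bs)) = one (T (as @ bs))"
 unfolding tt_def by simp

lemma tt_cmp:
 "lhom as as' f ==> lhom as' as'' f' ==> lhom bs bs' g ==> lhom bs' bs'' g' ==>
 tt as' as'' bs' bs'' f' g' \<cdot> tt as as' bs bs' f g = tt as as'' bs bs'' (f' \<cdot> f) (g' \<cdot> g)"
 unfolding tt_def lhom_def homs_iff by simp

lemma tt_assoc:
 assumes "lhom as as' f" "lhom bs bs' g" "lhom cs cs' h"
 shows "tt (as @ bs) (as' @ bs') cs cs' (tt as as' bs bs' f g) h =
    tt as as' (bs @ cs) (bs' @ cs') f (tt bs bs' cs cs' g h)"
proof -
 note [simp] = lhomD[OF assms(1)] lhomD[OF assms(2)] lhomD[OF assms(3)]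
 have "tt as as' (bs @ cs) (bs' @ cs') f (tt bs bs' cs cs' g h)
  = jn as' (bs' @ cs') \<cdot> (one (T as') \<odot> jn bs' cs') \<cdot> (f \<odot> g \<odot> h) \<cdot> ((one (T as) \<odot> spl bs cs) \<cdot> spl as (bs @ cs))"
  unfolding tt_def by simp
 also have "... = jn as' (bs' @ cs') \<cdot> (one (T as') \<odot> jn bs' cs') \<cdot> (f \<odot> g \<odot> h) \<cdot>
   (asc V (T as) (T bs) (T cs) \<cdot> (spl as bs \<odot> one (T cs)) \<cdot> spl (as @ bs) cs)"
  by (subst spl_assoc) simp_all
 also have "... = jn as' (bs' @ cs') \<cdot> (one (T as') \<odot> jn bs' cs') \<cdot> (asc V (T as') (T bs') (T cs') \<cdot> ((f \<odot> g) \<odot> h) \<cdot>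
   ((spl as bs \<odot> one (T cs)) \<cdot> spl (as @ bs) cs))"
  by (subst cmp_eq_tail[OF asc_natural[of f g h "T as'" "T bs'" "T cs'"]]) simp_all
 also have "... = (jn as' (bs' @ cs') \<cdot> (one (T as') \<odot> jn bs' cs') \<cdot> asc V (T as') (T bs') (T cs')) \<cdot> ((f \<odot> g) \<odot> h) \<cdot>
   ((spl as bs \<odot> one (T cs)) \<cdot> spl (as @ bs) cs)"
  by simp
 also have "... = (jn (as' @ bs') cs' \<cdot> (jn as' bs' \<odot> one (T cs'))) \<cdot> ((f \<odot> g) \<odot> h) \<cdot>
   ((spl as bs \<odot> one (T cs)) \<cdot> spl (as @ bs) cs)"
  by (subst jn_assoc) simp_all
 also have "... = tt (as @ bs) (as' @ bs') cs cs' (tt as as' bs bs' f g) h"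
  unfolding tt_def by simp
 finally show ?thesis by simp
qed

lemma tt_Nil_left: "lhom ws vs f ==> tt [] [] ws vs (one I) f = f"
 using lui_natural[of f "T ws"] unfolding tt_def lhom_def homs_iff by simp

lemma tt_Nil_right: "lhom ws vs f ==> tt ws vs [] [] f (one I) = f"
 using rui_natural[of f "T ws"] unfolding tt_def lhom_def homs_iff
 by (simp add: spl_Nil_right jn_Nil_right)

lemma sg_natural:
 assumes "lhom as as' f" "lhom bs bs' g"
 shows "sg as' bs' \<cdot> tt as as' bs bs' f g = tt bs bs' as as' g f \<cdot> sg as bs"
proof -
 note [simp] = lhomD[OF assms(1)] lhomD[OF assms(2)]
 have "sg as' bs' \<cdot> tt as as' bs bs' f g = jn bs' as' \<cdot> swp V (T as') (T bs') \<cdot> (f \<odot> g) \<cdot> spl as bs"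
  unfolding sg_def tt_def by simp
 also have "... = jn bs' as' \<cdot> (g \<odot> f) \<cdot> swp V (T as) (T bs) \<cdot> spl as bs"
  by (subst cmp_eq_tail[OF swp_natural[of f g "T as'" "T bs'"]]) simp_all
 also have "... = tt bs bs' as as' g f \<cdot> sg as bs"
  unfolding sg_def tt_def by simp
 finally show ?thesis .
qed

lemma sg_sg [simp]: "ok ws ==> ok vs ==> sg vs ws \<cdot> sg ws vs = one (T (ws @ vs))"
 unfolding sg_def by simp

text \<open>This is the hexagon. Its outer associators are absorbed by append, and the middle one,
  between the two crossings, is produced from \<open>spl\<close> and \<open>jn\<close> by the first
  fact of the proof.\<close>

lemma sg_append_right:
 assumes [simp]: "ok ws" "ok vs" "ok us"
 shows "sg ws (vs @ us) =
  tt vs vs (ws @ us) (us @ ws) (one (T vs)) (sg ws us) \<cdot> tt (ws @ vs) (vs @ ws) us us (sg ws vs) (one (T us))"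
proof -
 let ?W = "T ws" and ?V = "T vs" and ?U = "T us"
 have *: "(one ?V \<odot> spl ws us) \<cdot> spl vs (ws @ us) \<cdot> jn (vs @ ws) us \<cdot> (jn vs ws \<odot> one ?U) = asc V ?V ?W ?U"
 proof -
  have "(one ?V \<odot> spl ws us) \<cdot> spl vs (ws @ us) \<cdot> jn (vs @ ws) us \<cdot> (jn vs ws \<odot> one ?U) =
   ((one ?V \<odot> spl ws us) \<cdot> spl vs (ws @ us)) \<cdot> jn (vs @ ws) us \<cdot> (jn vs ws \<odot> one ?U)"
   by simp
  also have "... = asc V ?V ?W ?U"
   by (subst spl_assoc[symmetric]) simp_all
  finally show ?thesis .
 qed
 have "tt vs vs (ws @ us) (us @ ws) (one ?V) (sg ws us) \<cdot> tt (ws @ vs) (vs @ ws) us us (sg ws vs) (one ?U)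
  = jn vs (us @ ws) \<cdot> (one ?V \<odot> jn us ws) \<cdot> (one ?V \<odot> swp V ?W ?U) \<cdot>
   ((one ?V \<odot> spl ws us) \<cdot> spl vs (ws @ us) \<cdot> jn (vs @ ws) us \<cdot> (jn vs ws \<odot> one ?U)) \<cdot>
   (swp V ?W ?V \<odot> one ?U) \<cdot> (spl ws vs \<odot> one ?U) \<cdot> spl (ws @ vs) us"
  unfolding tt_def sg_def by simp
 also have "... = jn vs (us @ ws) \<cdot> (one ?V \<odot> jn us ws) \<cdot> ((one ?V \<odot> swp V ?W ?U) \<cdot>
   asc V ?V ?W ?U \<cdot> (swp V ?W ?V \<odot> one ?U)) \<cdot> (spl ws vs \<odot> one ?U) \<cdot> spl (ws @ vs) us"
  unfolding * by simp
 also have "... = jn vs (us @ ws) \<cdot> (one ?V \<odot> jn us ws) \<cdot> (asc V ?V ?U ?W \<cdot> swp V ?W (?V \<otimes> ?U) \<cdot>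
   asc V ?W ?V ?U) \<cdot> (spl ws vs \<odot> one ?U) \<cdot> spl (ws @ vs) us"
  by (subst hexagon) simp_all
 also have "... = (jn vs (us @ ws) \<cdot> (one ?V \<odot> jn us ws) \<cdot> asc V ?V ?U ?W) \<cdot> swp V ?W (?V \<otimes> ?U) \<cdot>
   (asc V ?W ?V ?U \<cdot> (spl ws vs \<odot> one ?U) \<cdot> spl (ws @ vs) us)"
  by simp
 also have "... = (jn (vs @ us) ws \<cdot> (jn vs us \<odot> one ?W)) \<cdot> swp V ?W (?V \<otimes> ?U) \<cdot>
   ((one ?W \<odot> spl vs us) \<cdot> spl ws (vs @ us))"
  by (subst jn_assoc[symmetric], simp_all, subst spl_assoc, simp_all)
 also have "... = jn (vs @ us) ws \<cdot> ((jn vs us \<odot> one ?W) \<cdot> swp V ?W (?V \<otimes> ?U) \<cdot>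
   ((one ?W \<odot> spl vs us) \<cdot> spl ws (vs @ us)))"
  by simp
 also have "... = jn (vs @ us) ws \<cdot> (swp V ?W (T (vs @ us)) \<cdot> (one ?W \<odot> jn vs us) \<cdot>
   ((one ?W \<odot> spl vs us) \<cdot> spl ws (vs @ us)))"
  by (subst cmp_eq_tail[OF swp_natural[of "one ?W" "jn vs us" ?W "T (vs @ us)"]]) simp_all
 also have "... = sg ws (vs @ us)"
  unfolding sg_def by simp
 finally show ?thesis by simp
qed

text \<open>The hexagon with two empty lists makes \<open>sg ws []\<close> idempotent. It is also
  invertible, and an invertible idempotent is an identity.\<close>

lemma sg_Nil_right [simp]:
 assumes [simp]: "ok ws" shows "sg ws [] = one (T ws)"
proof -
 have l: "lhom ws ws (sg ws [])" using lhom_sg[of ws "[]"] by simp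
 have "sg ws [] \<cdot> sg ws [] = sg ws [] \<cdot> one (T ws)"
  using sg_append_right[of ws "[]" "[]"] tt_Nil_left[OF l] tt_Nil_right[OF l] lhomD[OF l] by simp
 then show ?thesis
  using sg_sg[of "[]" ws] sg_sg[of ws "[]"] lhomD[OF l] lhomD[OF lhom_sg[of "[]" ws]]
  by (intro iso_cancel_left[of "sg ws []" "sg [] ws" "sg ws []" "one (T ws)"])
   (simp_all add: inverse_arrows_def homs_iff)
qed

lemma sg_Nil_left [simp]:
 assumes [simp]: "ok ws" shows "sg [] ws = one (T ws)"
 using sg_sg[of ws "[]"] lhomD[OF lhom_sg] by simp

section \<open>Generalised elements\<close>


text \<open>The stage is recorded as a list, since its tensor product would not determine the blocks
  that are to be permuted or substituted.\<close>

definition El :: "'o => ('o list * 'm) set" where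
 "El X = {x. ok (fst x) & snd x : homs V (T (fst x)) X}"

abbreviation st :: "('o list * 'm) => 'o list" where "st == fst"
abbreviation "ob X == X : obj V"
abbreviation "hom == ihom V"
abbreviation "VV == self V"
abbreviation "yo == vrep V"
abbreviation "EH A a b == El (vhom A a b)"
abbreviation "cat == vcategory V"
abbreviation "func == vfunctor V"
abbreviation "homf == vhom_fun V"
abbreviation "Op == vop V"
abbreviation "fc == vfcomp V"

definition lin :: "'m => 'o list * 'm => 'o list * 'm" where
 "lin f x = (st x, f \<cdot> snd x)"

definition bil :: "'m => 'o list * 'm => 'o list * 'm => 'o list * 'm" where
 "bil f x y = (st x @ st y, f \<cdot> (snd x \<odot> snd y) \<cdot> spl (st x) (st y))"

definition glb :: "'m => 'o list * 'm" where "glb f = ([], f)"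

definition re :: "'o list => 'm => 'o list * 'm => 'o list * 'm" where
 "re vs s x = (vs, snd x \<cdot> s)"

text \<open>Substitution for one block of variables: in a stage \<open>ps @ ws @ rs\<close> the
  block \<open>ws\<close> is replaced along an arrow \<open>s\<close> from \<open>T vs\<close> to
  \<open>T ws\<close>. The block permutation \<open>sw\<close> is the instance in which
  \<open>s\<close> is a symmetry.\<close>

definition rmid :: "'o list => 'o list => 'o list => 'o list => 'm => 'o list * 'm => 'o list * 'm" where
 "rmid ps ws vs rs s = re (ps @ vs @ rs) (tt ps ps (vs @ rs) (ws @ rs) (one (T ps)) (tt vs ws rs rs s (one (T rs))))"

definition sw :: "'o list => 'o list => 'o list => 'o list => 'o list * 'm => 'o list * 'm" where
 "sw as ws vs bs = rmid as (ws @ vs) (vs @ ws) bs (sg vs ws)"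

text \<open>The generic element of \<open>X\<close>, a variable of that type; \<open>run\<close>
  appears because \<open>T [X]\<close> is \<open>X \<otimes> I\<close>.\<close>

definition gen :: "'o => 'o list * 'm" where "gen X = ([X], run V X)"

definition gq :: "'o list => 'o list * 'm" where "gq ws = (ws, one (T ws))"

lemma El_D:
 assumes "x : El X"
 shows "ok (st x)" "snd x : arr V" "src V (snd x) = T (st x)" "tgt V (snd x) = X" "ob X"
 using assms homs_objs(2) unfolding El_def homs_iff by auto

lemma El_ok [simp]: "x : El X ==> ok (st x)"
 by (rule El_D)

lemma El_I: "ok (st x) ==> snd x : arr V ==> src V (snd x) = T (st x) ==> tgt V (snd x) = X ==> x : El X"
 unfolding El_def homs_iff by auto

lemma homs_D:
 assumes "f : homs V X Y"
 shows "f : arr V" "src V f = X" "tgt V f = Y" "ob X" "ob Y"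
 using assms homs_objs unfolding homs_iff by auto

lemma st_simps [simp]:
 "st (lin f x) = st x" "st (bil f x y) = st x @ st y" "st (glb g) = []" "st (re vs s x) = vs"
 "st (rmid ps ws vs rs s x) = ps @ vs @ rs" "st (gen X) = [X]" "st (gq ws) = ws"
 "st (sw as ws vs bs x) = as @ vs @ ws @ bs"
 by (simp_all add: lin_def bil_def glb_def re_def rmid_def gen_def gq_def sw_def)

lemma lin_El: "f : homs V X Y ==> x : El X ==> lin f x : El Y"
 using El_D[of x X] homs_D[of f X Y] by (intro El_I) (simp_all add: lin_def)

lemma bil_El:
 assumes "f : homs V (X \<otimes> Y) Z" "x : El X" "y : El Y"
 shows "bil f x y : El Z"
proof -
 note [simp] = homs_D[OF assms(1)] El_D[OF assms(2)] El_D[OF assms(3)]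
 show ?thesis by (intro El_I) (simp_all add: bil_def)
qed

lemma glb_El: "f : homs V I X ==> glb f : El X"
 using homs_D[of f I X] by (intro El_I) (simp_all add: glb_def)

lemma gen_El [simp]: "ob X ==> gen X : El X"
 by (intro El_I) (simp_all add: gen_def)

lemma gq_El [simp]: "ok ws ==> gq ws : El (T ws)"
 by (intro El_I) (simp_all add: gq_def)

lemma re_El: "x : El X ==> lhom vs (st x) s ==> re vs s x : El X"
 using El_D[of x X] lhomD[of vs "st x" s] by (intro El_I) (simp_all add: re_def)

lemma rmid_lhom:
 "lhom vs ws s ==> ok ps ==> ok rs ==>
 lhom (ps @ vs @ rs) (ps @ ws @ rs) (tt ps ps (vs @ rs) (ws @ rs) (one (T ps)) (tt vs ws rs rs s (one (T rs))))"
 by simp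

lemma rmid_El: "x : El X ==> st x = ps @ ws @ rs ==> lhom vs ws s ==> rmid ps ws vs rs s x : El X"
 unfolding rmid_def using El_ok[of x X] by (intro re_El) simp_all

lemma sw_El: "x : El X ==> st x = as @ ws @ vs @ bs ==> sw as ws vs bs x : El X"
 unfolding sw_def using El_ok[of x X] by (intro rmid_El) auto

lemma re_re: "x : El X ==> lhom vs (st x) s ==> lhom us vs t ==> re us t (re vs s x) = re us (s \<cdot> t) x"
 using El_D lhomD by (simp add: re_def)

lemma re_one: "x : El X ==> st x = ws ==> re ws (one (T ws)) x = x"
 using El_D by (auto simp: re_def)

lemma re_gen: "x : El X ==> x = re (st x) (rui X \<cdot> snd x) (gen X)"
 using El_D by (simp add: re_def gen_def)

lemma re_gen_lhom: "x : El X ==> lhom (st x) [X] (rui X \<cdot> snd x)"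
 using El_D by (simp add: lhom_def homs_iff)

lemma lin_lin: "x : El X ==> f : homs V X Y ==> g : homs V Y Z ==> lin g (lin f x) = lin (g \<cdot> f) x"
 using El_D homs_D homs_D by (simp add: lin_def)

lemma lin_one: "x : El X ==> lin (one X) x = x"
 using El_D by (simp add: lin_def)

lemma lin_bil:
 assumes "f : homs V (X \<otimes> Y) Z" "x : El X" "y : El Y" "g : homs V Z W"
 shows "lin g (bil f x y) = bil (g \<cdot> f) x y"
proof -
 note [simp] = homs_D[OF assms(1)] El_D[OF assms(2)] El_D[OF assms(3)] homs_D[OF assms(4)]
 show ?thesis by (simp add: lin_def bil_def)
qed

lemma bil_lin:
 assumes "f : homs V (X' \<otimes> Y') Z" "x : El X" "y : El Y" "g : homs V X X'" "h : homs V Y Y'"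
 shows "bil f (lin g x) (lin h y) = bil (f \<cdot> (g \<odot> h)) x y"
proof -
 note [simp] = homs_D[OF assms(1)] El_D[OF assms(2)] El_D[OF assms(3)] homs_D[OF assms(4)] homs_D[OF assms(5)]
 show ?thesis by (simp add: lin_def bil_def)
qed

lemma bil_lin_left:
 assumes "f : homs V (X' \<otimes> Y) Z" "x : El X" "y : El Y" "g : homs V X X'"
 shows "bil f (lin g x) y = bil (f \<cdot> (g \<odot> one Y)) x y"
 using bil_lin[OF assms(1-4), of "one Y"] lin_one[OF assms(3)] El_D(5)[OF assms(3)] idt_homs by simp

lemma bil_lin_right:
 assumes "f : homs V (X \<otimes> Y') Z" "x : El X" "y : El Y" "g : homs V Y Y'"
 shows "bil f x (lin g y) = bil (f \<cdot> (one X \<odot> g)) x y"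
 using bil_lin[OF assms(1-3), of "one X" g] assms(4) lin_one[OF assms(2)] El_D(5)[OF assms(2)] idt_homs by simp

lemma bil_assoc_left:
 assumes "f : homs V (W \<otimes> Z) U" "g : homs V (X \<otimes> Y) W" "x : El X" "y : El Y" "z : El Z"
 shows "bil f (bil g x y) z = bil (f \<cdot> (g \<odot> one Z) \<cdot> asi X Y Z) x (bil (one (Y \<otimes> Z)) y z)"
proof -
 note [simp] = homs_D[OF assms(1)] homs_D[OF assms(2)] El_D[OF assms(3)] El_D[OF assms(4)] El_D[OF assms(5)]
 let ?x = "snd x" and ?y = "snd y" and ?z = "snd z"
 have "bil f (bil g x y) z = (st x @ st y @ st z, f \<cdot> (g \<odot> one Z) \<cdot> ((?x \<odot> ?y) \<odot> ?z) \<cdot>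
   (spl (st x) (st y) \<odot> one (T (st z))) \<cdot> spl (st x @ st y) (st z))"
  by (simp add: bil_def)
 also have "... = (st x @ st y @ st z, f \<cdot> (g \<odot> one Z) \<cdot> asi X Y Z \<cdot> (asc V X Y Z \<cdot> ((?x \<odot> ?y) \<odot> ?z) \<cdot>
   (spl (st x) (st y) \<odot> one (T (st z))) \<cdot> spl (st x @ st y) (st z)))"
  by simp
 also have "... = (st x @ st y @ st z, f \<cdot> (g \<odot> one Z) \<cdot> asi X Y Z \<cdot> (?x \<odot> ?y \<odot> ?z) \<cdot>
   (asc V (T (st x)) (T (st y)) (T (st z)) \<cdot>
   (spl (st x) (st y) \<odot> one (T (st z))) \<cdot> spl (st x @ st y) (st z)))"
  by (subst cmp_eq_tail[OF asc_natural[of ?x ?y ?z X Y Z]]) simp_all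
 also have "... = (st x @ st y @ st z, f \<cdot> (g \<odot> one Z) \<cdot> asi X Y Z \<cdot> (?x \<odot> ?y \<odot> ?z) \<cdot>
   ((one (T (st x)) \<odot> spl (st y) (st z)) \<cdot> spl (st x) (st y @ st z)))"
  by (subst spl_assoc) simp_all
 also have "... = bil (f \<cdot> (g \<odot> one Z) \<cdot> asi X Y Z) x (bil (one (Y \<otimes> Z)) y z)"
  by (simp add: bil_def)
 finally show ?thesis .
qed

text \<open>Here the associator of the hypothesis disappears: both nested applications have the same
  list as their stage, and \<open>spl_assoc\<close> contributes the same associator on the side of
  the stage.\<close>

lemma bil_assoc:
 assumes "f : homs V (W \<otimes> Z) U" "g : homs V (X \<otimes> Y) W" "f' : homs V (X \<otimes> W') U" "g' : homs V (Y \<otimes> Z) W'"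
  "x : El X" "y : El Y" "z : El Z"
  "f \<cdot> (g \<odot> one Z) = f' \<cdot> (one X \<odot> g') \<cdot> asc V X Y Z"
 shows "bil f (bil g x y) z = bil f' x (bil g' y z)"
proof -
 note [simp] = homs_D[OF assms(1)] homs_D[OF assms(2)] homs_D[OF assms(3)] homs_D[OF assms(4)]
  El_D[OF assms(5)] El_D[OF assms(6)] El_D[OF assms(7)]
 have "f \<cdot> (g \<odot> one Z) \<cdot> asi X Y Z = (f \<cdot> (g \<odot> one Z)) \<cdot> asi X Y Z" by simp
 also have "... = f' \<cdot> (one X \<odot> g')" unfolding assms(8) by simp
 finally have *: "f \<cdot> (g \<odot> one Z) \<cdot> asi X Y Z = f' \<cdot> (one X \<odot> g')" .
 have "bil f (bil g x y) z = bil (f' \<cdot> (one X \<odot> g')) x (bil (one (Y \<otimes> Z)) y z)"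
  unfolding bil_assoc_left[OF assms(1,2,5,6,7)] * ..
 also have "... = bil f' x (lin g' (bil (one (Y \<otimes> Z)) y z))"
  by (rule bil_lin_right[OF assms(3,5) _ assms(4), symmetric], rule bil_El[OF _ assms(6,7)], simp add: homs_iff)
 also have "lin g' (bil (one (Y \<otimes> Z)) y z) = bil g' y z"
  by (subst lin_bil[OF _ assms(6,7,4)]) (simp_all add: homs_iff)
 finally show ?thesis .
qed

lemma bil_glb_left:
 assumes "f : homs V (X \<otimes> Y) Z" "i : homs V I X" "y : El Y"
 shows "bil f (glb i) y = lin (f \<cdot> (i \<odot> one Y) \<cdot> lui Y) y"
proof -
 note [simp] = homs_D[OF assms(1)] homs_D[OF assms(2)] El_D[OF assms(3)]
 have "bil f (glb i) y = (st y, f \<cdot> (i \<odot> one Y) \<cdot> (one I \<odot> snd y) \<cdot> lui (T (st y)))"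
  by (simp add: bil_def glb_def)
 then show ?thesis
  using lui_natural by (simp add: lin_def)
qed

lemma bil_glb_right:
 assumes "f : homs V (X \<otimes> Y) Z" "i : homs V I Y" "x : El X"
 shows "bil f x (glb i) = lin (f \<cdot> (one X \<odot> i) \<cdot> rui X) x"
proof -
 note [simp] = homs_D[OF assms(1)] homs_D[OF assms(2)] El_D[OF assms(3)]
 have "bil f x (glb i) = (st x, f \<cdot> (one X \<odot> i) \<cdot> (snd x \<odot> one I) \<cdot> rui (T (st x)))"
  by (simp add: bil_def glb_def spl_Nil_right)
 then show ?thesis
  using rui_natural by (simp add: lin_def)
qed

text \<open>A symmetry inside an arrow becomes a permutation of the stage, by naturality of
  \<open>swp\<close> in the two elements. The symmetries in the definitions of opposites and wedges
  enter element equations in this way.\<close>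

lemma bil_swp:
 assumes "f : homs V (Y \<otimes> X) Z" "x : El X" "y : El Y"
 shows "bil (f \<cdot> swp V X Y) x y = sw [] (st y) (st x) [] (bil f y x)"
proof -
 note [simp] = homs_D[OF assms(1)] El_D[OF assms(2)] El_D[OF assms(3)]
 have *: "swp V X Y \<cdot> (snd x \<odot> snd y) \<cdot> spl (st x) (st y) = (snd y \<odot> snd x) \<cdot> swp V (T (st x)) (T (st y)) \<cdot> spl (st x) (st y)"
  by (rule cmp_eq_tail, subst swp_natural) simp_all
 show ?thesis
  by (simp add: bil_def sw_def rmid_def re_def tt_Nil_right[OF lhom_sg] tt_Nil_left[OF lhom_sg] *)
   (simp add: sg_def)
qed

lemma lin_re: "x : El X ==> f : homs V X Y ==> lhom vs (st x) s ==> lin f (re vs s x) = re vs s (lin f x)"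
 using El_D[of x X] lhomD[of vs "st x" s] homs_D by (simp add: re_def lin_def)

lemma bil_re_re:
 assumes "f : homs V (X \<otimes> Y) Z" "x : El X" "y : El Y" "lhom vs (st x) s" "lhom us (st y) t"
 shows "bil f (re vs s x) (re us t y) = re (vs @ us) (tt vs (st x) us (st y) s t) (bil f x y)"
proof -
 note [simp] = homs_D[OF assms(1)] El_D[OF assms(2)] El_D[OF assms(3)] lhomD[OF assms(4)] lhomD[OF assms(5)]
 show ?thesis by (simp add: bil_def re_def tt_def)
qed

lemma bil_rmid_left:
 assumes "f : homs V (X \<otimes> Y) Z" "x : El X" "y : El Y" "st x = ps @ ws @ rs" "lhom vs ws s"
 shows "bil f (rmid ps ws vs rs s x) y = rmid ps ws vs (rs @ st y) s (bil f x y)"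
proof -
 have o: "ok ps" "ok ws" "ok rs" "ok (st y)" using El_D(1)[OF assms(2)] El_D(1)[OF assms(3)] assms(4) by auto
 let ?u = "tt vs ws rs rs s (one (T rs))"
 have u: "lhom (vs @ rs) (ws @ rs) ?u" using o assms by simp
 have "bil f (rmid ps ws vs rs s x) y = bil f (rmid ps ws vs rs s x) (re (st y) (one (T (st y))) y)"
  using re_one[OF assms(3)] by simp
 also have "... = re ((ps @ vs @ rs) @ st y)
  (tt (ps @ vs @ rs) (ps @ ws @ rs) (st y) (st y) (tt ps ps (vs @ rs) (ws @ rs) (one (T ps)) ?u) (one (T (st y)))) (bil f x y)"
  unfolding rmid_def using bil_re_re[OF assms(1-3)] assms(4,5) o by simp
 also have "... = rmid ps ws vs (rs @ st y) s (bil f x y)"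
  unfolding rmid_def using o tt_assoc[OF lhom_one u] tt_assoc[OF assms(5) lhom_one] by simp
 finally show ?thesis .
qed

lemma bil_rmid_right:
 assumes "f : homs V (X \<otimes> Y) Z" "x : El X" "y : El Y" "st y = ps @ ws @ rs" "lhom vs ws s"
 shows "bil f x (rmid ps ws vs rs s y) = rmid (st x @ ps) ws vs rs s (bil f x y)"
proof -
 have o: "ok ps" "ok ws" "ok rs" "ok (st x)" using El_D(1)[OF assms(2)] El_D(1)[OF assms(3)] assms(4) by auto
 let ?u = "tt vs ws rs rs s (one (T rs))"
 have u: "lhom (vs @ rs) (ws @ rs) ?u" using o assms by simp
 have "bil f x (rmid ps ws vs rs s y) = bil f (re (st x) (one (T (st x))) x) (rmid ps ws vs rs s y)"
  using re_one[OF assms(2)] by simp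
 also have "... = re (st x @ ps @ vs @ rs)
  (tt (st x) (st x) (ps @ vs @ rs) (ps @ ws @ rs) (one (T (st x))) (tt ps ps (vs @ rs) (ws @ rs) (one (T ps)) ?u)) (bil f x y)"
  unfolding rmid_def using bil_re_re[OF assms(1-3)] assms(4,5) o by simp
 also have "... = rmid (st x @ ps) ws vs rs s (bil f x y)"
  unfolding rmid_def using o tt_assoc[OF lhom_one lhom_one u] by simp
 finally show ?thesis .
qed

lemma lin_rmid:
 assumes "f : homs V X Y" "x : El X" "st x = ps @ ws @ rs" "lhom vs ws s"
 shows "lin f (rmid ps ws vs rs s x) = rmid ps ws vs rs s (lin f x)"
 unfolding rmid_def using El_D(1)[OF assms(2)] assms by (intro lin_re) auto

lemma rmid_rmid:
 assumes "x : El X" "st x = ps @ ws @ rs" "lhom vs ws s" "lhom us vs t"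
 shows "rmid ps vs us rs t (rmid ps ws vs rs s x) = rmid ps ws us rs (s \<cdot> t) x"
proof -
 have o: "ok ps" "ok rs" using El_D(1)[OF assms(1)] assms(2) by auto
 show ?thesis
  unfolding rmid_def by (subst re_re[OF assms(1)]) (simp_all add: o assms tt_cmp[where as''=ps] tt_cmp[where bs''=rs] tt_cmp)
qed

lemma rmid_one: "x : El X ==> st x = ps @ ws @ rs ==> rmid ps ws ws rs (one (T ws)) x = x"
 unfolding rmid_def using El_D(1)[of x X] by (simp add: re_one)

lemma rmid_Nil: "x : El X ==> st x = ws ==> lhom vs ws s ==> rmid [] ws vs [] s x = re vs s x"
 unfolding rmid_def by (simp add: tt_Nil_right tt_Nil_left)

lemma rmid_nested:
 assumes "ok as" "ok bs" "ok ps" "ok rs" "lhom vs ws s"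
 shows "rmid ps (as @ ws @ bs) (as @ vs @ bs) rs (tt as as (vs @ bs) (ws @ bs) (one (T as)) (tt vs ws bs bs s (one (T bs))))
  = rmid (ps @ as) ws vs (bs @ rs) s"
proof -
 let ?u = "tt vs ws bs bs s (one (T bs))"
 have u: "lhom (vs @ bs) (ws @ bs) ?u" using assms by simp
 have u': "lhom (vs @ bs @ rs) (ws @ bs @ rs) (tt vs ws (bs @ rs) (bs @ rs) s (one (T (bs @ rs))))" using assms by simp
 show ?thesis
  unfolding rmid_def
  using assms tt_assoc tt_assoc[OF lhom_one lhom_one] by simp
qed

lemma rmid_commute:
 assumes "x : El X" "st x = ps @ ws @ qs @ us @ rs" "lhom vs ws s" "lhom ts us t"
 shows "rmid ps ws vs (qs @ ts @ rs) s (rmid (ps @ ws @ qs) us ts rs t x) =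
    rmid (ps @ vs @ qs) us ts rs t (rmid ps ws vs (qs @ us @ rs) s x)"
proof -
 have o [simp]: "ok ps" "ok ws" "ok qs" "ok us" "ok rs" "ok vs" "ok ts"
  using El_D(1)[OF assms(1)] assms(2) lhomD[OF assms(3)] lhomD[OF assms(4)] by auto
 let ?q = "%t us ts. tt qs qs (ts @ rs) (us @ rs) (one (T qs)) (tt ts us rs rs t (one (T rs)))"
 have q: "lhom (qs @ ts @ rs) (qs @ us @ rs) (?q t us ts)" using assms by simp
 have 1: "rmid ps ws vs (qs @ us @ rs) s x =
   re (ps @ vs @ qs @ us @ rs) (tt ps ps (vs @ qs @ us @ rs) (ws @ qs @ us @ rs) (one (T ps))
    (tt vs ws (qs @ us @ rs) (qs @ us @ rs) s (one (T (qs @ us @ rs))))) x" for us x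
  unfolding rmid_def by simp
 have 2: "rmid (ps @ ws @ qs) us ts rs t x =
   re (ps @ ws @ qs @ ts @ rs) (tt ps ps (ws @ qs @ ts @ rs) (ws @ qs @ us @ rs) (one (T ps))
    (tt ws ws (qs @ ts @ rs) (qs @ us @ rs) (one (T ws)) (?q t us ts))) x" if "ok ws" for ws x
 proof -
  have u: "lhom (ts @ rs) (us @ rs) (tt ts us rs rs t (one (T rs)))" using assms by simp
  show ?thesis
   unfolding rmid_def using that tt_assoc[OF lhom_one lhom_one u] tt_assoc by simp
 qed
 show ?thesis
  unfolding 1 2[OF o(2)] 2[OF o(6)]
  by (subst (1 2) re_re[OF assms(1)])
   (simp_all add: assms q tt_cmp[where as''=ps] tt_cmp[OF _ _ q lhom_one] tt_cmp[OF _ _ lhom_one q]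
   lhomD[OF assms(3)] lhomD[OF q])
qed

lemma rmid_sw_left:
 assumes "x : El X" "st x = as @ ws @ vs @ bs" "lhom us ws s"
 shows "sw as us vs bs (rmid as ws us (vs @ bs) s x) = rmid (as @ vs) ws us bs s (sw as ws vs bs x)"
proof -
 have o [simp]: "ok as" "ok ws" "ok vs" "ok bs" "ok us"
  using El_D(1)[OF assms(1)] assms(2) lhomD[OF assms(3)] by auto
 have a: "rmid as ws us (vs @ bs) s = rmid as (ws @ vs) (us @ vs) bs (tt us ws vs vs s (one (T vs)))"
  using rmid_nested[of "[]" vs as bs us ws s] assms(3) tt_Nil_left by simp
 have b: "rmid (as @ vs) ws us bs s = rmid as (vs @ ws) (vs @ us) bs (tt vs vs us ws (one (T vs)) s)"
  using rmid_nested[of vs "[]" as bs us ws s] assms(3) by (simp add: tt_Nil_right)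
 show ?thesis
  unfolding a b sw_def
  using rmid_rmid rmid_rmid sg_natural assms by simp
qed

lemma sw_sw:
 assumes "x : El X" "st x = as @ ws @ vs @ bs"
 shows "sw as vs ws bs (sw as ws vs bs x) = x"
proof -
 have o [simp]: "ok as" "ok ws" "ok vs" "ok bs" using El_D(1)[OF assms(1)] assms(2) by auto
 show ?thesis
  unfolding sw_def using assms(2) rmid_rmid[OF assms(1)] rmid_one[OF assms(1)] by simp
qed

lemma rmid_sw_right:
 assumes "x : El X" "st x = as @ ws @ vs @ bs" "lhom us vs s"
 shows "sw as ws us bs (rmid (as @ ws) vs us bs s x) = rmid as vs us (ws @ bs) s (sw as ws vs bs x)"
proof -
 have o [simp]: "ok as" "ok ws" "ok vs" "ok bs" "ok us"
  using El_D(1)[OF assms(1)] assms(2) lhomD[OF assms(3)] by auto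
 have y: "sw as ws vs bs x : El X" using assms by (simp add: sw_El)
 have "sw as ws us bs (rmid (as @ ws) vs us bs s x) = sw as ws us bs (rmid (as @ ws) vs us bs s (sw as vs ws bs (sw as ws vs bs x)))"
  using sw_sw[OF assms(1,2)] by simp
 also have "... = sw as ws us bs (sw as us ws bs (rmid as vs us (ws @ bs) s (sw as ws vs bs x)))"
  using rmid_sw_left[OF y] assms(3) by simp
 also have "... = rmid as vs us (ws @ bs) s (sw as ws vs bs x)"
  by (rule sw_sw, rule rmid_El[OF y]) (simp_all add: assms)
 finally show ?thesis .
qed

lemma sw_Nil_left: "x : El X ==> st x = as @ vs @ bs ==> sw as [] vs bs x = x"
 unfolding sw_def using El_D(1)[of x X] rmid_one by simp

lemma sw_Nil_right: "x : El X ==> st x = as @ ws @ bs ==> sw as ws [] bs x = x"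
 unfolding sw_def using El_D(1)[of x X] rmid_one by simp

lemma sw_append_left:
 assumes "x : El X" "st x = as @ ws @ vs @ us @ bs"
 shows "sw as (ws @ vs) us bs x = sw as ws us (vs @ bs) (sw (as @ ws) vs us bs x)"
proof -
 have o [simp]: "ok as" "ok ws" "ok vs" "ok bs" "ok us" using El_D(1)[OF assms(1)] assms(2) by auto
 have a: "sw as ws us (vs @ bs) = rmid as (ws @ us @ vs) (us @ ws @ vs) bs (tt (us @ ws) (ws @ us) vs vs (sg us ws) (one (T vs)))"
  unfolding sw_def using rmid_nested[of "[]" vs as bs "us @ ws" "ws @ us" "sg us ws"]
   tt_Nil_left[of "us @ ws @ vs" "ws @ us @ vs" "tt (us @ ws) (ws @ us) vs vs (sg us ws) (one (T vs))"]
  using lhom_tt[OF lhom_sg] by simp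
 have b: "sw (as @ ws) vs us bs = rmid as (ws @ vs @ us) (ws @ us @ vs) bs (tt ws ws (us @ vs) (vs @ us) (one (T ws)) (sg us vs))"
  unfolding sw_def using rmid_nested[of ws "[]" as bs "us @ vs" "vs @ us" "sg us vs"] by (simp add: tt_Nil_right)
 have l1: "lhom (ws @ us @ vs) (ws @ vs @ us) (tt ws ws (us @ vs) (vs @ us) (one (T ws)) (sg us vs))" by simp
 have l2: "lhom (us @ ws @ vs) (ws @ us @ vs) (tt (us @ ws) (ws @ us) vs vs (sg us ws) (one (T vs)))"
  using lhom_tt[OF lhom_sg] by simp
 show ?thesis
  unfolding a b unfolding sw_def
  using rmid_rmid[OF assms(1) _ l1 l2] assms(2) sg_append_right by simp
qed

text \<open>Obtained by inverting \<open>sw_append_left\<close> with \<open>sw_sw\<close>, so that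
  one hexagon serves both rules.\<close>

lemma sw_append_right:
 assumes "x : El X" "st x = as @ ws @ vs @ us @ bs"
 shows "sw as ws (vs @ us) bs x = sw (as @ vs) ws us bs (sw as ws vs (us @ bs) x)"
proof -
 let ?y = "sw as ws (vs @ us) bs x"
 have y: "?y : El X" using assms by (simp add: sw_El)
 have z: "sw as (vs @ us) ws bs ?y = x" using sw_sw[OF assms(1)] assms(2) by simp
 have z': "x = sw as vs ws (us @ bs) (sw (as @ vs) us ws bs ?y)"
  using sw_append_left[OF y] z by simp
 have "sw (as @ vs) us ws bs ?y : El X" using y by (simp add: sw_El)
 then have "sw as ws vs (us @ bs) x = sw (as @ vs) us ws bs ?y"
  using sw_sw[of "sw (as @ vs) us ws bs ?y" X as vs ws "us @ bs"] z' by simp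
 then show ?thesis using sw_sw[OF y] by simp
qed

lemma bil_sw_left:
 assumes "f : homs V (X \<otimes> Y) Z" "x : El X" "y : El Y" "st x = as @ ws @ vs @ bs"
 shows "bil f (sw as ws vs bs x) y = sw as ws vs (bs @ st y) (bil f x y)"
 unfolding sw_def using El_D(1)[OF assms(2)] assms(4) by (intro bil_rmid_left[OF assms(1-3)]) auto

lemma bil_sw_right:
 assumes "f : homs V (X \<otimes> Y) Z" "x : El X" "y : El Y" "st y = as @ ws @ vs @ bs"
 shows "bil f x (sw as ws vs bs y) = sw (st x @ as) ws vs bs (bil f x y)"
 unfolding sw_def using El_D(1)[OF assms(3)] assms(4) by (intro bil_rmid_right[OF assms(1-3)]) auto

lemma lin_sw:
 assumes "f : homs V X Y" "x : El X" "st x = as @ ws @ vs @ bs"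
 shows "lin f (sw as ws vs bs x) = sw as ws vs bs (lin f x)"
 unfolding sw_def using El_D(1)[OF assms(2)] assms(3) by (intro lin_rmid[OF assms(1,2)]) auto

section \<open>Internal homs: application, abstraction, extensionality\<close>

lemma cur_props:
 assumes "f : homs V (X \<otimes> Y) Z" "ob X" "ob Y"
 shows "cur V X Y Z f : homs V X (hom Y Z)" "ev V Y Z \<cdot> (cur V X Y Z f \<odot> one Y) = f"
 using theI'[OF ev_universal[OF assms(2,3) homs_objs(2)[OF assms(1)] assms(1)]]
 unfolding cur_def by auto

lemma cur_unique:
 assumes "f : homs V X (hom Y Z)" "g : homs V X (hom Y Z)" "ob Y" "ob Z"
  "ev V Y Z \<cdot> (f \<odot> one Y) = ev V Y Z \<cdot> (g \<odot> one Y)"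
 shows "f = g"
proof -
 have X: "ob X" using homs_objs[OF assms(1)] by simp
 have "ev V Y Z \<cdot> (f \<odot> one Y) : homs V (X \<otimes> Y) Z"
  using homs_D[OF assms(1)] assms(3,4) by (simp add: homs_iff)
 from ev_universal[OF X assms(3,4) this] show ?thesis using assms by auto
qed

definition ap :: "'o => 'o => 'o list * 'm => 'o list * 'm => 'o list * 'm" where
 "ap X Y = bil (ev V X Y)"

lemma ev_homs' [simp]: "ob X ==> ob Y ==> ev V X Y : homs V (hom X Y \<otimes> X) Y"
 by (rule ev_homs)

lemma ap_El [simp]: "ob X ==> ob Y ==> f : El (hom X Y) ==> x : El X ==> ap X Y f x : El Y"
 unfolding ap_def by (rule bil_El) auto

lemma st_ap [simp]: "st (ap X Y f x) = st f @ st x"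
 by (simp add: ap_def)

text \<open>
  \<open>nat1 ps rs X Y t\<close>: the function \<open>t\<close> on elements of \<open>X\<close> is induced by an arrow
  \<open>T ps \<otimes> X \<otimes> T rs \<rightarrow> Y\<close>; equivalently, it commutes with reindexing of its argument.
\<close>

definition nat1 :: "'o list => 'o list => 'o => 'o => ('o list * 'm => 'o list * 'm) => bool" where
 "nat1 ps rs X Y t = (ALL x : El X. t x : El Y & st (t x) = ps @ st x @ rs &
  (ALL vs s. lhom vs (st x) s --> t (re vs s x) = rmid ps (st x) vs rs s (t x)))"

lemma nat1D:
 assumes "nat1 ps rs X Y t" "x : El X"
 shows "t x : El Y" "st (t x) = ps @ st x @ rs" "lhom vs (st x) s ==> t (re vs s x) = rmid ps (st x) vs rs s (t x)"
 using assms unfolding nat1_def by auto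

lemma nat1I:
 assumes "!!x. x : El X ==> t x : El Y" "!!x. x : El X ==> st (t x) = ps @ st x @ rs"
  "!!x vs s. x : El X ==> lhom vs (st x) s ==> re vs s x : El X ==> t (re vs s x) = rmid ps (st x) vs rs s (t x)"
 shows "nat1 ps rs X Y t"
 using assms re_El unfolding nat1_def by blast

lemma nat1_cong:
 assumes "nat1 ps rs X Y t" "!!x. x : El X ==> t' x = t x"
 shows "nat1 ps rs X Y t'"
 using assms re_El unfolding nat1_def by (metis (no_types, lifting))

lemma nat1_id: "nat1 [] [] X X (%x. x)"
 by (rule nat1I) (simp_all add: rmid_Nil)

lemma nat1_lin:
 assumes "nat1 ps rs X Y t" "g : homs V Y Z"
 shows "nat1 ps rs X Z (%x. lin g (t x))"
 by (rule nat1I) (simp_all add: nat1D[OF assms(1)] lin_El[OF assms(2)] lin_rmid[OF assms(2)])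

lemma nat1_bil1:
 assumes "nat1 ps rs X Y t" "f : homs V (Y \<otimes> Z) W" "c : El Z" "rs' = rs @ st c"
 shows "nat1 ps rs' X W (%x. bil f (t x) c)"
 by (rule nat1I) (simp_all add: nat1D[OF assms(1)] bil_El[OF assms(2) _ assms(3)]
  bil_rmid_left[OF assms(2) _ assms(3)] assms(4))

lemma nat1_bil2:
 assumes "nat1 ps rs X Y t" "f : homs V (Z \<otimes> Y) W" "c : El Z" "ps' = st c @ ps"
 shows "nat1 ps' rs X W (%x. bil f c (t x))"
 by (rule nat1I) (simp_all add: nat1D[OF assms(1)] bil_El[OF assms(2,3)]
  bil_rmid_right[OF assms(2,3)] assms(4))

lemma nat1_ap1:
 "nat1 ps rs X (hom Y Z) t ==> ob Y ==> ob Z ==> c : El Y ==> rs' = rs @ st c ==>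
 nat1 ps rs' X Z (%x. ap Y Z (t x) c)"
 unfolding ap_def by (rule nat1_bil1) auto

lemma nat1_ap2:
 "nat1 ps rs X Y t ==> ob Y ==> ob Z ==> c : El (hom Y Z) ==> ps' = st c @ ps ==>
 nat1 ps' rs X Z (%x. ap Y Z c (t x))"
 unfolding ap_def by (rule nat1_bil2) auto

lemma nat1_ok:
 assumes "nat1 ps rs X Y t" "ob X"
 shows "ok ps" "ok rs" "ob Y"
 using nat1D(1,2)[OF assms(1) gen_El[OF assms(2)]] El_D[of "t (gen X)" Y] by auto

lemma nat1_comp:
 assumes "nat1 ps rs X Y t" "nat1 as bs Y Z u"  "ps' = as @ ps" "rs' = rs @ bs" "ob X"
 shows "nat1 ps' rs' X Z (%x. u (t x))"
proof (rule nat1I)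
 note o = nat1_ok[OF assms(1,5)]
 fix x assume x: "x : El X"
 show "u (t x) : El Z" "st (u (t x)) = ps' @ st x @ rs'"
  using nat1D nat1D[OF assms(1) x] assms by auto
 fix vs s assume s: "lhom vs (st x) s"
 have o': "ok as" "ok bs" using El_D(1)[OF `u (t x) : El Z`] `st (u (t x)) = ps' @ st x @ rs'` assms by auto
 have "t (re vs s x) = re (ps @ vs @ rs) (tt ps ps (vs @ rs) (st x @ rs) (one (T ps)) (tt vs (st x) rs rs s (one (T rs)))) (t x)"
  using nat1D(3)[OF assms(1) x s] unfolding rmid_def .
 then have "u (t (re vs s x)) = rmid as (ps @ st x @ rs) (ps @ vs @ rs) bs
  (tt ps ps (vs @ rs) (st x @ rs) (one (T ps)) (tt vs (st x) rs rs s (one (T rs)))) (u (t x))"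
  using nat1D(3)[OF assms(2) nat1D(1)[OF assms(1) x]] nat1D(2)[OF assms(1) x] s o by simp
 then show "u (t (re vs s x)) = rmid ps' (st x) vs rs' s (u (t x))"
  using rmid_nested[OF o(1,2) o' s] assms by simp
qed

lemma nat1_rmid_before:
 assumes "nat1 ps rs X Y t" "ps = as @ ws @ bs" "lhom vs ws s" "ps' = as @ vs @ bs" "ob X"
  "!!x. R x = bs @ st x @ rs"
 shows "nat1 ps' rs X Y (%x. rmid as ws vs (R x) s (t x))"
proof (rule nat1I)
 fix x assume x: "x : El X"
 note t = nat1D[OF assms(1) x]
 show "rmid as ws vs (R x) s (t x) : El Y" "st (rmid as ws vs (R x) s (t x)) = ps' @ st x @ rs"
  using t assms(2-4,6) by (auto intro!: rmid_El)
 fix us r assume r: "lhom us (st x) r" and "re us r x : El X"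
 show "rmid as ws vs (R (re us r x)) s (t (re us r x)) = rmid ps' (st x) us rs r (rmid as ws vs (R x) s (t x))"
  using rmid_commute[OF t(1) _ assms(3) r] t(2) t(3)[OF r] assms(2,4,6) by simp
qed

lemma nat1_rmid_after:
 assumes "nat1 ps rs X Y t" "rs = as @ ws @ bs" "lhom vs ws s" "rs' = as @ vs @ bs" "ob X"
  "!!x. P x = ps @ st x @ as"
 shows "nat1 ps rs' X Y (%x. rmid (P x) ws vs bs s (t x))"
proof (rule nat1I)
 fix x assume x: "x : El X"
 note t = nat1D[OF assms(1) x]
 show "rmid (P x) ws vs bs s (t x) : El Y" "st (rmid (P x) ws vs bs s (t x)) = ps @ st x @ rs'"
  using t assms(2-4,6) by (auto intro!: rmid_El)
 fix us r assume r: "lhom us (st x) r" and "re us r x : El X"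
 show "rmid (P (re us r x)) ws vs bs s (t (re us r x)) = rmid ps (st x) us rs' r (rmid (P x) ws vs bs s (t x))"
  using rmid_commute[OF t(1) _ r assms(3)] t(2) t(3)[OF r] assms(2,4,6) by simp
qed

lemma nat1_sw_left:
 assumes t: "nat1 ps rs X Y t" and ps: "ps = as @ w1" and rs: "rs = w2 @ vs @ bs" and "ps' = as @ vs @ w1"
  "rs' = w2 @ bs" and X: "ob X" and W: "!!x. W x = w1 @ st x @ w2"
 shows "nat1 ps' rs' X Y (%x. sw as (W x) vs bs (t x))"
proof (rule nat1I)
 fix x assume x: "x : El X"
 note o = nat1_ok[OF t X]
 note tx = nat1D[OF t x]
 show "sw as (W x) vs bs (t x) : El Y" "st (sw as (W x) vs bs (t x)) = ps' @ st x @ rs'"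
  using tx assms by (auto intro!: sw_El)
 fix us r assume r: "lhom us (st x) r" and "re us r x : El X"
 let ?r = "tt w1 w1 (us @ w2) (st x @ w2) (one (T w1)) (tt us (st x) w2 w2 r (one (T w2)))"
 have 1: "rmid as (w1 @ st x @ w2) (w1 @ us @ w2) (vs @ bs) ?r = rmid ps (st x) us rs r"
  using rmid_nested o ps rs r by simp
 have 2: "rmid (as @ vs) (w1 @ st x @ w2) (w1 @ us @ w2) bs ?r = rmid ps' (st x) us rs' r"
  using rmid_nested o assms r by simp
 show "sw as (W (re us r x)) vs bs (t (re us r x)) = rmid ps' (st x) us rs' r (sw as (W x) vs bs (t x))"
  using rmid_sw_left[OF tx(1), of as "w1 @ st x @ w2" vs bs "w1 @ us @ w2" ?r] tx(2) tx(3)[OF r] o r ps rs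
  unfolding 1[symmetric] 2[symmetric] W by simp
qed

lemma nat1_sw_right:
 assumes t: "nat1 ps rs X Y t" and ps: "ps = as @ ws @ w1" and rs: "rs = w2 @ bs" and "ps' = as @ w1"
  "rs' = w2 @ ws @ bs" and X: "ob X" and W: "!!x. W x = w1 @ st x @ w2"
 shows "nat1 ps' rs' X Y (%x. sw as ws (W x) bs (t x))"
proof (rule nat1I)
 fix x assume x: "x : El X"
 note o = nat1_ok[OF t X]
 note tx = nat1D[OF t x]
 show "sw as ws (W x) bs (t x) : El Y" "st (sw as ws (W x) bs (t x)) = ps' @ st x @ rs'"
  using tx assms by (auto intro!: sw_El)
 fix us r assume r: "lhom us (st x) r" and "re us r x : El X"
 let ?r = "tt w1 w1 (us @ w2) (st x @ w2) (one (T w1)) (tt us (st x) w2 w2 r (one (T w2)))"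
 have 1: "rmid (as @ ws) (w1 @ st x @ w2) (w1 @ us @ w2) bs ?r = rmid ps (st x) us rs r"
  using rmid_nested o ps rs r by simp
 have 2: "rmid as (w1 @ st x @ w2) (w1 @ us @ w2) (ws @ bs) ?r = rmid ps' (st x) us rs' r"
  using rmid_nested o assms r by simp
 show "sw as ws (W (re us r x)) bs (t (re us r x)) = rmid ps' (st x) us rs' r (sw as ws (W x) bs (t x))"
  using rmid_sw_right[OF tx(1), of as ws "w1 @ st x @ w2" bs "w1 @ us @ w2" ?r] tx(2) tx(3)[OF r] o r ps rs
  unfolding 1[symmetric] 2[symmetric] W by simp
qed

text \<open>Yoneda: every element is a reindexing of the generic one, and natural functions commute
  with reindexing.\<close>

lemma nat1_eqI:
 assumes "nat1 ps rs X Y t" "nat1 ps rs X Y u" "ob X" "t (gen X) = u (gen X)" "x : El X"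
 shows "t x = u x"
 using nat1D(3)[OF assms(1) gen_El[OF assms(3)], of "st x" "rui X \<cdot> snd x"]
  nat1D(3)[OF assms(2) gen_El[OF assms(3)], of "st x" "rui X \<cdot> snd x"]
  re_gen[OF assms(5)] re_gen_lhom[OF assms(5)] assms(4) by simp

text \<open>Lambda abstraction: the body is taken at the generic variable, \<open>jn\<close> and
  \<open>rui\<close> turn its stage \<open>ps @ [X]\<close> into \<open>T ps \<otimes> X\<close>,
  and the result is curried. The lemma of the same name contains the beta rule, and
  \<open>ap_ext\<close> is extensionality.\<close>

definition lamF :: "'o list => 'o => 'o => ('o list * 'm => 'o list * 'm) => 'o list * 'm" where
 "lamF ps X Y t = (ps, cur V (T ps) X Y (snd (t (gen X)) \<cdot> jn ps [X] \<cdot> (one (T ps) \<odot> rui X)))"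

lemma El_pair [simp]: "(ws, f) : El X \<longleftrightarrow> ok ws & f : homs V (T ws) X"
 by (simp add: El_def del: El_ok)

lemma snd_gen [simp]: "snd (gen X) = run V X"
 by (simp add: gen_def)

lemma El_snd: "x : El X ==> snd x : homs V (T (st x)) X"
 by (simp add: El_def del: El_ok)

lemma st_lamF [simp]: "st (lamF ps X Y t) = ps"
 by (simp add: lamF_def)

lemma lamF:
 assumes t: "nat1 ps [] X Y t" and X [simp]: "ob X"
 shows "lamF ps X Y t : El (hom X Y)" "x : El X ==> ap X Y (lamF ps X Y t) x = t x"
proof -
 note o [simp] = nat1_ok[OF assms]
 note g [simp] = nat1D(1)[OF t gen_El[OF X]]
 have [simp]: "st (t (gen X)) = ps @ [X]" using nat1D(2)[OF t] by simp
 note d [simp] = El_D[OF g]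
 let ?f = "snd (t (gen X)) \<cdot> jn ps [X] \<cdot> (one (T ps) \<odot> rui X)"
 have f: "?f : homs V (T ps \<otimes> X) Y"
  by (simp add: homs_iff)
 note c = cur_props[OF f T_obj[OF o(1)] X]
 note [simp] = homs_D[OF c(1)]
 show *: "lamF ps X Y t : El (hom X Y)"
  using c(1) by (simp add: lamF_def)
 show "ap X Y (lamF ps X Y t) x = t x" if x: "x : El X"
 proof (rule nat1_eqI[OF _ t X _ x])
  show "nat1 ps [] X Y (ap X Y (lamF ps X Y t))"
   by (rule nat1_ap2[OF nat1_id]) (simp_all add: *)
  have "ap X Y (lamF ps X Y t) (gen X) =
   (ps @ [X], ev V X Y \<cdot> (cur V (T ps) X Y ?f \<odot> one X) \<cdot> (one (T ps) \<odot> run V X) \<cdot> spl ps [X])"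
   by (simp add: ap_def bil_def lamF_def)
  also have "... = (ps @ [X], (ev V X Y \<cdot> (cur V (T ps) X Y ?f \<odot> one X)) \<cdot> (one (T ps) \<odot> run V X) \<cdot> spl ps [X])"
   by simp
  also have "... = (ps @ [X], ?f \<cdot> (one (T ps) \<odot> run V X) \<cdot> spl ps [X])"
   unfolding c(2) ..
  also have "... = t (gen X)"
   by (simp add: prod_eq_iff)
  finally show "ap X Y (lamF ps X Y t) (gen X) = t (gen X)" .
 qed
qed

lemma ap_ext:
 assumes "f : El (hom X Y)" "g : El (hom X Y)" "st f = st g" "ob X" "ob Y"
  "!!x. x : El X ==> ap X Y f x = ap X Y g x"
 shows "f = g"
proof -
 note [simp] = assms(3,4,5) El_D[OF assms(1)] El_D[OF assms(2), unfolded assms(3)[symmetric]]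
 have *: "(ev V X Y \<cdot> (snd f \<odot> one X)) = (snd (ap X Y f (gen X)) \<cdot> jn (st f) [X] \<cdot> (one (T (st f)) \<odot> rui X))"
  if "f : El (hom X Y)" for f
  using El_D[OF that] by (simp add: ap_def bil_def)
 have "snd f = snd g"
  using El_snd[OF assms(1)] El_snd[OF assms(2)]
  by (intro cur_unique[of "snd f" "T (st f)" X Y "snd g"]) (simp_all add: *[OF assms(1)] *[OF assms(2)] assms(6))
 then show ?thesis by (simp add: prod_eq_iff)
qed

text \<open>Naturality of an abstraction in the parameter \<open>x\<close> is tested by applying it
  to a variable \<open>y\<close>. This is why naturality in \<open>x\<close> is assumed for each
  fixed \<open>y\<close>, with the stage of \<open>y\<close> appended.\<close>

lemma nat1_lamF:
 assumes "!!x. x : El X ==> nat1 (ps @ st x @ rs) [] Y Z (t x)"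
  "!!y. y : El Y ==> nat1 ps (rs @ st y) X Z (%x. t x y)" "ob Y" "ob X" "ob Z"
  "!!x. P x = ps @ st x @ rs"
 shows "nat1 ps rs X (hom Y Z) (%x. lamF (P x) Y Z (t x))"
proof (rule nat1I)
 fix x assume x: "x : El X"
 note l = lamF[OF assms(1) assms(3)]
 show "lamF (P x) Y Z (t x) : El (hom Y Z)" "st (lamF (P x) Y Z (t x)) = ps @ st x @ rs"
  using l(1)[OF x] assms(6) by simp_all
 fix vs s assume s: "lhom vs (st x) s" and rx: "re vs s x : El X"
 have r: "rmid ps (st x) vs rs s (lamF (ps @ st x @ rs) Y Z (t x)) : El (hom Y Z)"
  using l(1)[OF x] s by (intro rmid_El) auto
 show "lamF (P (re vs s x)) Y Z (t (re vs s x)) = rmid ps (st x) vs rs s (lamF (P x) Y Z (t x))"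
  unfolding assms(6)
 proof (rule ap_ext[OF l(1)[OF rx] r _ assms(3,5)])
  fix y assume y: "y : El Y"
  have "ap Y Z (rmid ps (st x) vs rs s (lamF (ps @ st x @ rs) Y Z (t x))) y =
   rmid ps (st x) vs (rs @ st y) s (t x y)"
   using bil_rmid_left[OF ev_homs'[OF assms(3,5)] l(1)[OF x] y _ s, of ps rs] l(2)[OF x y]
   unfolding ap_def by simp
  then show "ap Y Z (lamF (ps @ st (re vs s x) @ rs) Y Z (t (re vs s x))) y =
   ap Y Z (rmid ps (st x) vs rs s (lamF (ps @ st x @ rs) Y Z (t x))) y"
   using l(2)[OF rx y] nat1D(3)[OF assms(2)[OF y] x s] by simp
 qed simp
qed

text \<open>The arrow represented by a natural function, read off at the generic element; it inverts
  \<open>lin\<close>. Arrows of \<open>V\<close> are constructed in this way from formulas on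
  elements.\<close>

definition arr1 :: "'o => ('o list * 'm => 'o list * 'm) => 'm" where
 "arr1 X t = snd (t (gen X)) \<cdot> rui X"

definition arr2 :: "'o => 'o => ('o list * 'm => 'o list * 'm => 'o list * 'm) => 'm" where
 "arr2 X Y t = snd (t (gen X) (gen Y)) \<cdot> jn [X] [Y] \<cdot> (rui X \<odot> rui Y)"

lemma lin_gen: "f : homs V X Y ==> lin f (gen X) = ([X], f \<cdot> run V X)"
 by (simp add: lin_def)

lemma arr1:
 assumes t: "nat1 [] [] X Y t" and X [simp]: "ob X"
 shows "arr1 X t : homs V X Y" "x : El X ==> lin (arr1 X t) x = t x"
proof -
 note g [simp] = nat1D(1)[OF t gen_El[OF X]]
 have [simp]: "st (t (gen X)) = [X]" using nat1D(2)[OF t] by simp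
 note d [simp] = El_D[OF g]
 show *: "arr1 X t : homs V X Y" by (simp add: arr1_def homs_iff)
 show "lin (arr1 X t) x = t x" if x: "x : El X"
  by (rule nat1_eqI[OF nat1_lin[OF nat1_id *] t X _ x]) (simp add: lin_gen[OF *], simp add: arr1_def prod_eq_iff)
qed

lemma arr2:
 assumes t: "!!y. y : El Y ==> nat1 [] (st y) X Z (%x. t x y)" "!!x. x : El X ==> nat1 (st x) [] Y Z (t x)"
  and X [simp]: "ob X" and Y [simp]: "ob Y"
 shows "arr2 X Y t : homs V (X \<otimes> Y) Z" "x : El X ==> y : El Y ==> bil (arr2 X Y t) x y = t x y"
proof -
 note g [simp] = nat1D(1)[OF t(2)[OF gen_El[OF X]] gen_El[OF Y]]
 have [simp]: "st (t (gen X) (gen Y)) = [X,Y]" using nat1D(2)[OF t(2)[OF gen_El[OF X]]] by simp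
 note d [simp] = El_D[OF g]
 have o: "ok [X]" "ok [Y]" "T [X] = X \<otimes> I" "T [Y] = Y \<otimes> I" by simp_all
 note [simp] = jn_typing[OF o(1,2), unfolded o(3,4)] spl_typing[OF o(1,2), unfolded o(3,4)]
  jn_spl[OF o(1,2), unfolded o(3,4)]
 show *: "arr2 X Y t : homs V (X \<otimes> Y) Z" by (simp add: arr2_def homs_iff)
 show "bil (arr2 X Y t) x y = t x y" if x: "x : El X" and y: "y : El Y"
 proof -
  have "bil (arr2 X Y t) (gen X) (gen Y) = t (gen X) (gen Y)"
   by (simp add: bil_def arr2_def prod_eq_iff del: jn.simps spl.simps)
  then have "bil (arr2 X Y t) x (gen Y) = t x (gen Y)"
   using nat1_eqI[OF nat1_bil1[OF nat1_id * gen_El[OF Y]] t(1)[OF gen_El[OF Y]] X _ x] by simp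
  then show ?thesis
   using nat1_eqI[OF nat1_bil2[OF nat1_id * x] t(2)[OF x] Y _ y] by simp
 qed
qed

lemma lin_ext:
 assumes "f : homs V X Y" "g : homs V X Y" "!!x. x : El X ==> lin f x = lin g x"
 shows "f = g"
proof (rule iso_cancel_right[of "run V X" "rui X"])
 note [simp] = homs_D[OF assms(1)] homs_D[OF assms(2)]
 show "f \<cdot> run V X = g \<cdot> run V X"
  using assms(3)[OF gen_El] by (simp add: lin_def)
qed (use homs_D[OF assms(1)] homs_D[OF assms(2)] in "simp_all add: inverse_arrows_def homs_iff")

text \<open>All elements of \<open>X \<otimes> Y\<close> are reindexings of one pure tensor, that of
  the two generic elements. Natural functions on a tensor product are therefore determined by pure
  tensors, although a general element is not one.\<close>

lemma pair_gen:
 assumes "z : El (X \<otimes> Y)" and [simp]: "ob X" "ob Y"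
 obtains s where "lhom (st z) [X, Y] s" "z = re (st z) s (bil (one (X \<otimes> Y)) (gen X) (gen Y))"
proof
 have o: "ok [X]" "ok [Y]" "T [X] = X \<otimes> I" "T [Y] = Y \<otimes> I" by simp_all
 note [simp] = jn_typing[OF o(1,2), unfolded o(3,4)] spl_typing[OF o(1,2), unfolded o(3,4)]
  jn_spl_tail[OF o(1,2), unfolded o(3,4)] El_D[OF assms(1)]
 let ?s = "jn [X] [Y] \<cdot> (rui X \<odot> rui Y) \<cdot> snd z"
 show "lhom (st z) [X, Y] ?s" unfolding lhom_def homs_iff
  by simp
 show "z = re (st z) ?s (bil (one (X \<otimes> Y)) (gen X) (gen Y))"
  by (simp add: bil_def re_def del: jn.simps spl.simps)
qed

lemma nat1_pair_eqI:
 assumes "nat1 ps rs (X \<otimes> Y) Z t" "nat1 ps rs (X \<otimes> Y) Z u" and X [simp]: "ob X" "ob Y"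
  and "!!x y. x : El X ==> y : El Y ==> t (bil (one (X \<otimes> Y)) x y) = u (bil (one (X \<otimes> Y)) x y)"
  and "z : El (X \<otimes> Y)"
 shows "t z = u z"
proof -
 obtain s where s: "lhom (st z) [X, Y] s" "z = re (st z) s (bil (one (X \<otimes> Y)) (gen X) (gen Y))"
  using pair_gen[OF assms(6) X] by blast
 have p: "bil (one (X \<otimes> Y)) (gen X) (gen Y) : El (X \<otimes> Y)"
  by (rule bil_El[of _ X Y]) (simp_all add: homs_iff)
 show ?thesis
  using nat1D(3)[OF assms(1) p, of "st z" s] nat1D(3)[OF assms(2) p, of "st z" s] s assms(5) by simp
qed

lemma lin_pair:
 assumes "f : homs V (X \<otimes> Y) Z" "x : El X" "y : El Y"
 shows "lin f (bil (one (X \<otimes> Y)) x y) = bil f x y"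
 using lin_bil assms homs_D[OF assms(1)] by (simp add: homs_iff)

lemma pair_El [simp]: "x : El X ==> y : El Y ==> bil (one (X \<otimes> Y)) x y : El (X \<otimes> Y)"
 using El_D(5)[of x X] El_D(5)[of y Y] by (intro bil_El[of _ X Y]) (simp_all add: homs_iff)

lemma bil_ext:
 assumes "f : homs V (X \<otimes> Y) Z" "g : homs V (X \<otimes> Y) Z" "ob X" "ob Y"
  "!!x y. x : El X ==> y : El Y ==> bil f x y = bil g x y"
 shows "f = g"
 by (rule lin_ext[OF assms(1,2)], rule nat1_pair_eqI[OF nat1_lin[OF nat1_id assms(1)] nat1_lin[OF nat1_id assms(2)] assms(3,4)])
  (simp_all add: lin_pair[OF assms(1)] lin_pair[OF assms(2)] assms(5))

lemma tri_ext:
 assumes "f : homs V ((X \<otimes> Y) \<otimes> Z) W" "g : homs V ((X \<otimes> Y) \<otimes> Z) W" "ob X" "ob Y" "ob Z"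
  "!!x y z. x : El X ==> y : El Y ==> z : El Z ==> bil f (bil (one (X \<otimes> Y)) x y) z = bil g (bil (one (X \<otimes> Y)) x y) z"
 shows "f = g"
proof (rule bil_ext[OF assms(1,2)])
 fix p z assume p: "p : El (X \<otimes> Y)" and z: "z : El Z"
 show "bil f p z = bil g p z"
  by (rule nat1_pair_eqI[OF nat1_bil1[OF nat1_id assms(1) z refl] nat1_bil1[OF nat1_id assms(2) z refl] assms(3,4) _ p])
   (simp_all add: assms(6) z)
qed (use assms in simp_all)

lemma glb_inj: "glb f = glb g ==> f = g"
 by (simp add: glb_def)

lemma El_Nil: "x : El X ==> st x = [] ==> x = glb (snd x)" "x : El X ==> st x = [] ==> snd x : homs V I X"
 using El_snd[of x X] by (auto simp: glb_def prod_eq_iff)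

lemma lin_glb: "lin f (glb i) = glb (f \<cdot> i)"
 by (simp add: lin_def glb_def)

lemma lin_one' [simp]: "x : El X ==> lin (one X) x = x" by (rule lin_one)

lemma name_of:
 assumes "f : homs V X Y"
 shows "name_of V X Y f : homs V I (hom X Y)" "x : El X ==> ap X Y (glb (name_of V X Y f)) x = lin f x"
proof -
 note d [simp] = homs_D[OF assms]
 have f: "f \<cdot> lun V X : homs V (I \<otimes> X) Y" by (simp add: homs_iff)
 note c = cur_props[OF f obj_typing(1) d(4)]
 show n: "name_of V X Y f : homs V I (hom X Y)" unfolding name_of_def by (rule c)
 note [simp] = homs_D[OF n]
 show "ap X Y (glb (name_of V X Y f)) x = lin f x" if x: "x : El X"
 proof -
  have "ev V X Y \<cdot> (name_of V X Y f \<odot> one X) \<cdot> lui X = (ev V X Y \<cdot> (name_of V X Y f \<odot> one X)) \<cdot> lui X"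
   by simp
  also have "... = f" unfolding name_of_def c(2) by simp
  finally show ?thesis unfolding ap_def by (simp add: bil_glb_left[OF ev_homs'[OF d(4,5)] n x])
 qed
qed

section \<open>V-categories, V-functors and modules in terms of elements\<close>


lemma nat1_conv: "nat1 ps rs X Y t ==> ps' = ps ==> rs' = rs ==> nat1 ps' rs' X Y t"
 by simp

text \<open>Two factorisations of the reversal of three adjacent blocks \<open>f\<close>,
  \<open>g\<close>, \<open>h\<close>. It accounts for the associativity of every reversed
  composition: opposites, right actions, swapped pairings.\<close>

lemma sw_rev3':
 assumes "e : El X" "st e = as @ f @ g @ h @ bs"
 shows "sw as f (h @ g) bs (sw (as @ f) g h bs e) = sw as (g @ f) h bs (sw as f g (h @ bs) e)"
proof -
 have o: "ok as" "ok f" "ok g" "ok h" "ok bs" using El_D(1)[OF assms(1)] assms(2) by auto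
 have "sw as f (h @ g) bs (sw (as @ f) g h bs e) = sw as g h (f @ bs) (sw as f (g @ h) bs e)"
  using rmid_sw_right[OF assms(1), of as f "g @ h" bs "h @ g" "sg h g"] assms(2) o
  unfolding sw_def[of "as @ f" g h bs] sw_def[of as g h "f @ bs"] by simp
 also have "sw as f (g @ h) bs e = sw (as @ g) f h bs (sw as f g (h @ bs) e)"
  using sw_append_right[OF assms(1)] assms(2) by simp
 also have "sw as g h (f @ bs) (sw (as @ g) f h bs (sw as f g (h @ bs) e)) = sw as (g @ f) h bs (sw as f g (h @ bs) e)"
  using sw_append_left[OF sw_El[OF assms(1)]] assms(2) by simp
 finally show ?thesis .
qed

lemmas sw_rev3 = sw_rev3'[where as = "[]" and bs = "[]", simplified]

definition "cp A a b c = bil (vcmp A a b c)"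
definition "idg A a = glb (vid A a)"
definition "fm F a b = lin (fmap F a b)"

lemma vcategoryD:
 assumes "cat A"
 shows "a : vob A ==> b : vob A ==> vhom A a b : obj V"
  "a : vob A ==> vid A a : homs V I (vhom A a a)"
  "a : vob A ==> b : vob A ==> c : vob A ==> vcmp A a b c : homs V (vhom A b c \<otimes> vhom A a b) (vhom A a c)"
 using assms unfolding vcategory_def by auto

declare vcategoryD(1) [simp]

lemma cp_El [simp]:
 "cat A ==> a : vob A ==> b : vob A ==> c : vob A ==> g : EH A b c ==> f : EH A a b ==>
 cp A a b c g f : EH A a c"
 unfolding cp_def by (rule bil_El[OF vcategoryD(3)])

lemma idg_El [simp]: "cat A ==> a : vob A ==> idg A a : EH A a a"
 unfolding idg_def by (rule glb_El[OF vcategoryD(2)])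

lemma st_cp [simp]: "st (cp A a b c g f) = st g @ st f" "st (idg A a) = []" "st (fm F a b f) = st f"
 by (simp_all add: cp_def idg_def fm_def)

lemma cp_assoc:
 assumes "cat A" "a : vob A" "b : vob A" "c : vob A" "d : vob A"
  "h : EH A c d" "g : EH A b c" "f : EH A a b"
 shows "cp A a b d (cp A b c d h g) f = cp A a c d h (cp A a b c g f)"
 unfolding cp_def
 by (rule bil_assoc[OF vcategoryD(3) vcategoryD(3) vcategoryD(3) vcategoryD(3)])
  (use assms in "simp_all add: vcategory_def")

lemma cp_idg:
 assumes "cat A" "a : vob A" "b : vob A" "f : EH A a b"
 shows "cp A a b b (idg A b) f = f" "cp A a a b f (idg A a) = f"
proof -
 have *: "vcmp A a b b \<cdot> (vid A b \<odot> one (vhom A a b)) = lun V (vhom A a b)"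
  "vcmp A a a b \<cdot> (one (vhom A a b) \<odot> vid A a) = run V (vhom A a b)"
  using assms unfolding vcategory_def by auto
 note h = homs_D[OF vcategoryD(3)[OF assms(1)]] homs_D[OF vcategoryD(2)[OF assms(1)]]
 have o: "vhom A a b : obj V" using assms by simp
 have "vcmp A a b b \<cdot> (vid A b \<odot> one (vhom A a b)) \<cdot> lui (vhom A a b) = one (vhom A a b)"
  using assms o h cmp_assoc_arr[of "lui (vhom A a b)" "vid A b \<odot> one (vhom A a b)" "vcmp A a b b"] * by simp
 then show "cp A a b b (idg A b) f = f"
  unfolding cp_def idg_def by (subst bil_glb_left[OF vcategoryD(3) vcategoryD(2)]) (use assms in simp_all)
 have "vcmp A a a b \<cdot> (one (vhom A a b) \<odot> vid A a) \<cdot> rui (vhom A a b) = one (vhom A a b)"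
  using assms o h cmp_assoc_arr[of "rui (vhom A a b)" "one (vhom A a b) \<odot> vid A a" "vcmp A a a b"] * by simp
 then show "cp A a a b f (idg A a) = f"
  unfolding cp_def idg_def by (subst bil_glb_right[OF vcategoryD(3) vcategoryD(2)]) (use assms in simp_all)
qed

text \<open>Elements separate arrows, also out of triple tensor products (\<open>tri_ext\<close>),
  so the axioms may be verified as equations that contain no associator.\<close>

lemma vcategoryI:
 assumes obj: "!!a b. a : vob A ==> b : vob A ==> vhom A a b : obj V"
  and idt: "!!a. a : vob A ==> vid A a : homs V I (vhom A a a)"
  and cmp: "!!a b c. a : vob A ==> b : vob A ==> c : vob A ==>
   vcmp A a b c : homs V (vhom A b c \<otimes> vhom A a b) (vhom A a c)"
  and assoc: "!!a b c d h g f. a : vob A ==> b : vob A ==> c : vob A ==> d : vob A ==>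
   h : EH A c d ==> g : EH A b c ==> f : EH A a b ==>
   cp A a b d (cp A b c d h g) f = cp A a c d h (cp A a b c g f)"
  and unitl: "!!a b f. a : vob A ==> b : vob A ==> f : EH A a b ==> cp A a b b (idg A b) f = f"
  and unitr: "!!a b f. a : vob A ==> b : vob A ==> f : EH A a b ==> cp A a a b f (idg A a) = f"
 shows "cat A"
 unfolding vcategory_def
proof (intro conjI ballI)
 fix a b c d assume o [simp]: "a : vob A" "b : vob A" "c : vob A" "d : vob A"
 note [simp] = obj
 note h = homs_D[OF cmp]
 let ?X = "vhom A c d" and ?Y = "vhom A b c" and ?Z = "vhom A a b"
 show "vcmp A a b d \<cdot> (vcmp A b c d \<odot> one ?Z) =
    vcmp A a c d \<cdot> (one ?X \<odot> vcmp A a b c) \<cdot> asc V ?X ?Y ?Z"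
 proof (rule tri_ext[of _ ?X ?Y ?Z "vhom A a d"])
  show L: "vcmp A a b d \<cdot> (vcmp A b c d \<odot> one ?Z) : homs V ((?X \<otimes> ?Y) \<otimes> ?Z) (vhom A a d)"
   and R: "vcmp A a c d \<cdot> (one ?X \<odot> vcmp A a b c) \<cdot> asc V ?X ?Y ?Z : homs V ((?X \<otimes> ?Y) \<otimes> ?Z) (vhom A a d)"
   by (simp_all add: homs_iff h)
  fix x y z assume x: "x : El ?X" and y: "y : El ?Y" and z: "z : El ?Z"
  let ?p = "bil (one (?X \<otimes> ?Y)) x y"
  have p: "?p : El (?X \<otimes> ?Y)" using x y by simp
  have oh: "one (?X \<otimes> ?Y) : homs V (?X \<otimes> ?Y) (?X \<otimes> ?Y)" by (simp add: homs_iff)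
  have "bil (vcmp A a b d \<cdot> (vcmp A b c d \<odot> one ?Z)) ?p z = cp A a b d (lin (vcmp A b c d) ?p) z"
   unfolding cp_def using p z cmp by (simp add: bil_lin_left[of "vcmp A a b d" "vhom A b d" ?Z "vhom A a d" ?p "?X \<otimes> ?Y"])
  also have "... = cp A a c d x (cp A a b c y z)"
   using assoc[OF o x y z] lin_pair[OF cmp x y] by (simp add: cp_def)
  also have "... = bil (vcmp A a c d \<cdot> (one ?X \<odot> vcmp A a b c) \<cdot> asc V ?X ?Y ?Z) ?p z"
   unfolding cp_def by (rule bil_assoc[OF R oh cmp cmp x y z, symmetric]) (simp_all add: h)
  finally show "bil (vcmp A a b d \<cdot> (vcmp A b c d \<odot> one ?Z)) ?p z =
   bil (vcmp A a c d \<cdot> (one ?X \<odot> vcmp A a b c) \<cdot> asc V ?X ?Y ?Z) ?p z" .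
 qed simp_all
next
 fix a b assume o [simp]: "a : vob A" "b : vob A"
 note [simp] = obj homs_D[OF cmp] homs_D[OF idt]
 let ?Z = "vhom A a b"
 have one: "one ?Z : homs V ?Z ?Z" by (simp add: homs_iff)
 have "vcmp A a b b \<cdot> (vid A b \<odot> one ?Z) \<cdot> lui ?Z = one ?Z"
  by (rule lin_ext[OF _ one], simp add: homs_iff)
   (simp add: unitl[unfolded cp_def idg_def bil_glb_left[OF cmp idt]]
    bil_glb_left[OF cmp idt, symmetric] flip: cp_def idg_def, simp add: unitl)
 then have "(vcmp A a b b \<cdot> (vid A b \<odot> one ?Z) \<cdot> lui ?Z) \<cdot> lun V ?Z = lun V ?Z" by simp
 then show "vcmp A a b b \<cdot> (vid A b \<odot> one ?Z) = lun V ?Z" by simp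
 have "vcmp A a a b \<cdot> (one ?Z \<odot> vid A a) \<cdot> rui ?Z = one ?Z"
  by (rule lin_ext[OF _ one], simp add: homs_iff)
   (simp add: bil_glb_right[OF cmp idt, symmetric] flip: cp_def idg_def, simp add: unitr)
 then have "(vcmp A a a b \<cdot> (one ?Z \<odot> vid A a) \<cdot> rui ?Z) \<cdot> run V ?Z = run V ?Z" by simp
 then show "vcmp A a a b \<cdot> (one ?Z \<odot> vid A a) = run V ?Z" by simp
qed (use assms in auto)

lemma vfunctorD:
 assumes "func A B F"
 shows "a : vob A ==> F$a : vob B"
  "a : vob A ==> b : vob A ==> fmap F a b : homs V (vhom A a b) (vhom B F$a F$b)"
 using assms unfolding vfunctor_def by auto

declare vfunctorD(1) [simp]

lemma fm_El [simp]:
 "func A B F ==> a : vob A ==> b : vob A ==> f : EH A a b ==> fm F a b f : EH B F$a F$b"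
 unfolding fm_def by (rule lin_El[OF vfunctorD(2)])

lemma fm_idg: "func A B F ==> a : vob A ==> fm F a a (idg A a) = idg B F$a"
 unfolding fm_def idg_def vfunctor_def by (simp add: lin_glb)

lemma fm_cp:
 assumes "cat A" "cat B" "func A B F" "a : vob A" "b : vob A" "c : vob A"
  "g : EH A b c" "f : EH A a b"
 shows "fm F a c (cp A a b c g f) = cp B F$a F$b F$c (fm F b c g) (fm F a b f)"
proof -
 have "fmap F a c \<cdot> vcmp A a b c = vcmp B F$a F$b F$c \<cdot> (fmap F b c \<odot> fmap F a b)"
  using assms unfolding vfunctor_def by auto
 moreover note o = vfunctorD(1)[OF assms(3)]
 ultimately show ?thesis
  unfolding fm_def cp_def
  by (subst lin_bil[OF vcategoryD(3)[OF assms(1)] assms(7,8) vfunctorD(2)[OF assms(3)]])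
   (simp_all add: assms(4-6) bil_lin[OF vcategoryD(3)[OF assms(2) o o o] assms(7,8)
    vfunctorD(2)[OF assms(3)] vfunctorD(2)[OF assms(3)]])
qed

lemma vfunctorI:
 assumes A: "cat A" and B: "cat B"
  and o: "!!a. a : vob A ==> F$a : vob B"
  and m: "!!a b. a : vob A ==> b : vob A ==> fmap F a b : homs V (vhom A a b) (vhom B F$a F$b)"
  and i: "!!a. a : vob A ==> fm F a a (idg A a) = idg B F$a"
  and c: "!!a b c g f. a : vob A ==> b : vob A ==> c : vob A ==> g : EH A b c ==> f : EH A a b ==>
   fm F a c (cp A a b c g f) = cp B F$a F$b F$c (fm F b c g) (fm F a b f)"
 shows "func A B F"
 unfolding vfunctor_def
proof (intro conjI ballI)
 fix a assume a: "a : vob A"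
 show "fmap F a a \<cdot> vid A a = vid B F$a"
  using i[OF a] unfolding fm_def idg_def lin_glb by (rule glb_inj)
next
 fix a b d assume [simp]: "a : vob A" "b : vob A" "d : vob A"
 note [simp] = homs_D[OF vcategoryD(3)[OF A]] homs_D[OF vcategoryD(3)[OF B]] homs_D[OF m] o A B
 show "fmap F a d \<cdot> vcmp A a b d = vcmp B F$a F$b F$d \<cdot> (fmap F b d \<odot> fmap F a b)"
 proof (rule bil_ext)
  fix x y assume x: "x : EH A b d" and y: "y : EH A a b"
  show "bil (fmap F a d \<cdot> vcmp A a b d) x y = bil (vcmp B F$a F$b F$d \<cdot> (fmap F b d \<odot> fmap F a b)) x y"
   using c[OF _ _ _ x y] bil_lin[OF vcategoryD(3)[OF B] x y m m] lin_bil[OF vcategoryD(3)[OF A] x y m]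
   unfolding fm_def cp_def by simp
 qed (simp_all add: homs_iff)
qed (use o m in auto)

lemma nat1_cp1:
 "nat1 ps rs X (vhom A b c) t ==> cat A ==> a : vob A ==> b : vob A ==> c : vob A ==> f : EH A a b ==>
 nat1 ps (rs @ st f) X (vhom A a c) (%x. cp A a b c (t x) f)"
 unfolding cp_def by (rule nat1_bil1[OF _ vcategoryD(3)]) auto

lemma nat1_cp2:
 "nat1 ps rs X (vhom A a b) t ==> cat A ==> a : vob A ==> b : vob A ==> c : vob A ==> g : EH A b c ==>
 nat1 (st g @ ps) rs X (vhom A a c) (%x. cp A a b c g (t x))"
 unfolding cp_def by (rule nat1_bil2[OF _ vcategoryD(3)]) auto

lemma nat1_fm:
 "nat1 ps rs X (vhom A a b) t ==> func A B F ==> a : vob A ==> b : vob A ==>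
 nat1 ps rs X (vhom B F$a F$b) (%x. fm F a b (t x))"
 unfolding fm_def by (rule nat1_lin[OF _ vfunctorD(2)])

lemma self_simps [simp]: "vob VV = obj V" "vhom VV X Y = hom X Y"
 by (simp_all add: self_def)

lemma vcmp_self:
 assumes [simp]: "ob X" "ob Y" "ob Z"
 shows "vcmp VV X Y Z : homs V (hom Y Z \<otimes> hom X Y) (hom X Z)"
  "g : El (hom Y Z) ==> f : El (hom X Y) ==> x : El X ==>
   ap X Z (cp VV X Y Z g f) x = ap Y Z g (ap X Y f x)"
proof -
 let ?f = "ev V Y Z \<cdot> (one (hom Y Z) \<odot> ev V X Y) \<cdot> asc V (hom Y Z) (hom X Y) X"
 have f: "?f : homs V ((hom Y Z \<otimes> hom X Y) \<otimes> X) Z" by (simp add: homs_iff)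
 note c = cur_props[OF f]
 show *: "vcmp VV X Y Z : homs V (hom Y Z \<otimes> hom X Y) (hom X Z)"
  unfolding self_def by (simp, rule c) simp_all
 assume "g : El (hom Y Z)" "f : El (hom X Y)" "x : El X"
 then show "ap X Z (cp VV X Y Z g f) x = ap Y Z g (ap X Y f x)"
  unfolding ap_def cp_def
  by (intro bil_assoc[OF ev_homs * ev_homs ev_homs]) (simp_all add: self_def c)
qed

lemma vid_self:
 assumes [simp]: "ob X"
 shows "vid VV X : homs V I (hom X X)" "x : El X ==> ap X X (idg VV X) x = x"
proof -
 have *: "vid VV X = name_of V X X (one X)" by (simp add: self_def name_of_def)
 have "one X : homs V X X" by (simp add: homs_iff)
 note n = name_of[OF this]
 show "vid VV X : homs V I (hom X X)" unfolding * by (rule n)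
 show "x : El X ==> ap X X (idg VV X) x = x" unfolding * idg_def using n(2) by simp
qed

lemma cp_self_El [simp]:
 "ob X ==> ob Y ==> ob Z ==> g : El (hom Y Z) ==> f : El (hom X Y) ==>
 cp VV X Y Z g f : El (hom X Z)"
 unfolding cp_def by (rule bil_El[OF vcmp_self(1)])

lemma idg_self_El [simp]: "ob X ==> idg VV X : El (hom X X)"
 unfolding idg_def by (rule glb_El[OF vid_self(1)])

text \<open>Composition in \<open>V\<close> becomes composition of the functions \<open>ap\<close>,
  so each axiom holds after application to an element, and \<open>ap_ext\<close> removes that
  element again.\<close>

lemma vcategory_self [simp]: "cat VV"
proof (rule vcategoryI)
 fix a b c d h g f
 assume "a : vob VV" "b : vob VV" "c : vob VV" "d : vob VV"
  "h : EH VV c d" "g : EH VV b c" "f : EH VV a b"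
 then show "cp VV a b d (cp VV b c d h g) f = cp VV a c d h (cp VV a b c g f)"
  by - (rule ap_ext[of _ a d]; simp add: vcmp_self(2))
next
 fix a b f assume "a : vob VV" "b : vob VV" "f : EH VV a b"
 then show "cp VV a b b (idg VV b) f = f" "cp VV a a b f (idg VV a) = f"
  by - (rule ap_ext[of _ a b]; simp add: vcmp_self(2) vid_self(2))+
qed (auto intro: vcmp_self vid_self)

section \<open>Opposite categories and composite functors\<close>

lemma vop_simps [simp]: "vob (Op A) = vob A" "vhom (Op A) a b = vhom A b a" "vid (Op A) = vid A"
 "idg (Op A) = idg A"
 by (simp_all add: vop_def idg_def fun_eq_iff)

lemma vcmp_vop:
 assumes "cat A" "a : vob A" "b : vob A" "c : vob A"
 shows "vcmp (Op A) a b c : homs V (vhom A c b \<otimes> vhom A b a) (vhom A c a)"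
  "g : EH A c b ==> f : EH A b a ==> cp (Op A) a b c g f = sw [] (st f) (st g) [] (cp A c b a f g)"
proof -
 show "vcmp (Op A) a b c : homs V (vhom A c b \<otimes> vhom A b a) (vhom A c a)"
  using homs_D[OF vcategoryD(3)[OF assms(1)]] assms by (simp add: vop_def homs_iff)
 assume "g : EH A c b" "f : EH A b a"
 then show "cp (Op A) a b c g f = sw [] (st f) (st g) [] (cp A c b a f g)"
  using bil_swp[OF vcategoryD(3)[OF assms(1), of c b a], of g f] assms unfolding cp_def by (simp add: vop_def)
qed

lemma cp_sw_left:
 assumes "cat A" "a : vob A" "b : vob A" "c : vob A" "g : EH A b c" "f : EH A a b"
  "st g = as @ ws @ vs @ bs"
 shows "cp A a b c (sw as ws vs bs g) f = sw as ws vs (bs @ st f) (cp A a b c g f)"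
 unfolding cp_def using assms by (intro bil_sw_left[OF vcategoryD(3)]) auto

lemma cp_sw_right:
 assumes "cat A" "a : vob A" "b : vob A" "c : vob A" "g : EH A b c" "f : EH A a b"
  "st f = as @ ws @ vs @ bs"
 shows "cp A a b c g (sw as ws vs bs f) = sw (st g @ as) ws vs bs (cp A a b c g f)"
 unfolding cp_def using assms by (intro bil_sw_right[OF vcategoryD(3)]) auto

text \<open>Both bracketings are the composite of \<open>f\<close>, \<open>g\<close>,
  \<open>h\<close> in \<open>A\<close> with the three blocks of the stage reversed, and
  \<open>sw_rev3\<close> identifies the two ways of reversing them.\<close>

lemma vcategory_vop [simp]:
 assumes A: "cat A"
 shows "cat (Op A)"
proof (rule vcategoryI; (unfold vop_simps)?)
 fix a b c d h g f
 assume o [simp]: "a : vob A" "b : vob A" "c : vob A" "d : vob A"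
  "h : EH A d c" "g : EH A c b" "f : EH A b a"
 have e: "cp A d b a f (cp A d c b g h) : EH A d a" using A by simp
 have "cp (Op A) a b d (cp (Op A) b c d h g) f =
  sw [] (st f) (st h @ st g) [] (cp A d b a f (sw [] (st g) (st h) [] (cp A d c b g h)))"
  using A by (simp add: vcmp_vop(2) sw_El)
 also have "... = sw [] (st f) (st h @ st g) [] (sw (st f) (st g) (st h) [] (cp A d b a f (cp A d c b g h)))"
  using A by (subst cp_sw_right[OF A]) simp_all
 also have "... = sw [] (st g @ st f) (st h) [] (sw [] (st f) (st g) (st h) (cp A d b a f (cp A d c b g h)))"
  by (rule sw_rev3[OF e]) simp
 also have "... = sw [] (st g @ st f) (st h) [] (cp A d c a (sw [] (st f) (st g) [] (cp A c b a f g)) h)"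
  using A by (subst cp_sw_left[OF A]) (simp_all add: cp_assoc)
 also have "... = cp (Op A) a c d h (cp (Op A) a b c g f)"
  using A by (simp add: vcmp_vop(2) sw_El)
 finally show "cp (Op A) a b d (cp (Op A) b c d h g) f = cp (Op A) a c d h (cp (Op A) a b c g f)" .
next
 fix a b f assume o: "a : vob A" "b : vob A" "f : EH A b a"
 then show "cp (Op A) a b b (idg A b) f = f" "cp (Op A) a a b f (idg A a) = f"
  using A by (simp_all add: vcmp_vop(2) cp_idg sw_Nil_right sw_Nil_left)
qed (use A vcategoryD vcmp_vop(1) in auto)

lemma vfunctor_vfcomp:
 assumes "cat A" "cat B" "cat C" "func B C G" "func A B F"
 shows "func A C (fc G F)"
  "a : vob A ==> b : vob A ==> f : EH A a b ==> fm (fc G F) a b f = fm G F$a F$b (fm F a b f)"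
proof -
 have *: "fm (fc G F) a b f = fm G F$a F$b (fm F a b f)"
  if "a : vob A" "b : vob A" "f : EH A a b" for a b f
  unfolding fm_def vfcomp_def using that assms
  by (simp add: lin_lin[OF that(3) vfunctorD(2)[OF assms(5)] vfunctorD(2)[OF assms(4)]])
 then show "a : vob A ==> b : vob A ==> f : EH A a b ==> fm (fc G F) a b f = fm G F$a F$b (fm F a b f)" .
 show "func A C (fc G F)"
 proof (rule vfunctorI[OF assms(1,3)])
  fix a b assume "a : vob A" "b : vob A"
  then show "fmap (fc G F) a b : homs V (vhom A a b) (vhom C (fc G F)$a (fc G F)$b)"
   using cmp_homs[OF vfunctorD(2)[OF assms(5)] vfunctorD(2)[OF assms(4)]] assms by (simp add: vfcomp_def)
 next
  fix a assume "a : vob A"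
  then show "fm (fc G F) a a (idg A a) = idg C (fc G F)$a"
   using assms by (simp add: * fm_idg[OF assms(4)] fm_idg[OF assms(5)]) (simp add: vfcomp_def)
 next
  fix a b c g f assume "a : vob A" "b : vob A" "c : vob A" "g : EH A b c" "f : EH A a b"
  then show "fm (fc G F) a c (cp A a b c g f) = cp C (fc G F)$a (fc G F)$b (fc G F)$c
    (fm (fc G F) b c g) (fm (fc G F) a b f)"
   using assms by (simp add: * fm_cp[OF assms(1,2,5)] fm_cp[OF assms(2,3,4)]) (simp add: vfcomp_def)
 qed (use assms in "simp add: vfcomp_def")
qed

lemma fob_vfcomp [simp]: "(fc G F)$a = G$(F$a)"
 by (simp add: vfcomp_def)

lemma vfop_simps [simp]: "fob (vfop F) = fob F" "fmap (vfop F) a b = fmap F b a" "fm (vfop F) a b = fm F b a"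
 by (simp_all add: vfop_def fm_def)

lemma fm_sw:
 assumes "func A B F" "a : vob A" "b : vob A" "f : EH A a b" "st f = as @ ws @ vs @ bs"
 shows "fm F a b (sw as ws vs bs f) = sw as ws vs bs (fm F a b f)"
 unfolding fm_def using assms by (intro lin_sw[OF vfunctorD(2)]) auto

lemma vfunctor_vfop:
 assumes A: "cat A" and B: "cat B" and F: "func A B F"
 shows "func (Op A) (Op B) (vfop F)"
 by (rule vfunctorI)
  (use assms vfunctorD[OF F] in "auto simp: fm_idg[OF F] fm_cp[OF A B F] vcmp_vop(2) fm_sw[OF F]")

text \<open>
  A V-functor \<open>N : C \<rightarrow> V\<close> is a left \<open>C\<close>-module with action \<open>lact\<close>; a V-functor \<open>M : A\<^sup>o\<^sup>p \<rightarrow> V\<close> is a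
  right \<open>A\<close>-module with action \<open>ract\<close>.
\<close>

definition "lact N a b f n = ap N$a N$b (fm N a b f) n"

abbreviation "smod C N == func C VV N"
abbreviation "rmod A M == func (Op A) VV M"

definition "ract A M a b m f =
  bil ((ev V M$b M$a \<cdot> (fmap M b a \<odot> one M$b)) \<cdot> swp V M$b (vhom A a b)) m f"

lemma smod_obj [simp]: "smod C N ==> a : vob C ==> N$a : obj V"
 using vfunctorD(1)[of C "VV" N a] by simp

lemma rmod_obj [simp]: "rmod A M ==> a : vob A ==> M$a : obj V"
 by simp

lemma smod_fm_El [simp]: "smod C N ==> a : vob C ==> b : vob C ==> f : EH C a b ==> fm N a b f : El (hom N$a N$b)"
 using fm_El[of C "VV" N a b f] by simp

lemma lact_El [simp]:
 "smod C N ==> a : vob C ==> b : vob C ==> f : EH C a b ==> n : El N$a ==> lact N a b f n : El N$b"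
 unfolding lact_def by simp

lemma st_lact [simp]: "st (lact N a b f n) = st f @ st n" "st (ract A M a b m f) = st m @ st f"
 by (simp_all add: lact_def ract_def)

lemma lact_idg: "smod C N ==> a : vob C ==> n : El N$a ==> lact N a a (idg C a) n = n"
 unfolding lact_def by (simp add: fm_idg vid_self)

lemma lact_cp:
 assumes "cat C" "smod C N" "a : vob C" "b : vob C" "c : vob C" "g : EH C b c" "f : EH C a b" "n : El N$a"
 shows "lact N a c (cp C a b c g f) n = lact N b c g (lact N a b f n)"
 unfolding lact_def using assms by (simp add: fm_cp[OF assms(1) _ assms(2)] vcmp_self)

lemma nat1_lact1:
 "nat1 ps rs X (vhom C a b) t ==> smod C N ==> a : vob C ==> b : vob C ==> n : El N$a ==>
 nat1 ps (rs @ st n) X N$b (%x. lact N a b (t x) n)"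
 unfolding lact_def using nat1_fm[of ps rs X C a b t "VV" N]
 by (intro nat1_ap1[OF _ _ _ _ refl]) auto

lemma nat1_lact2:
 "nat1 ps rs X N$a t ==> smod C N ==> a : vob C ==> b : vob C ==> f : EH C a b ==>
 nat1 (st f @ ps) rs X N$b (%x. lact N a b f (t x))"
 unfolding lact_def by (intro nat1_ap2) auto

lemma lact_bil:
 assumes "smod C N" "a : vob C" "b : vob C" "f : EH C a b" "n : El N$a"
 shows "lact N a b f n = bil (ev V N$a N$b \<cdot> (fmap N a b \<odot> one N$a)) f n"
  "ev V N$a N$b \<cdot> (fmap N a b \<odot> one N$a) : homs V (vhom C a b \<otimes> N$a) N$b"
 using homs_D[OF vfunctorD(2)[OF assms(1-3)]] assms bil_lin_left by (simp_all add: lact_def ap_def fm_def homs_iff)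

lemma ract_lact:
 assumes "rmod A M" "a : vob A" "b : vob A" "m : El M$b" "f : EH A a b"
 shows "ract A M a b m f = sw [] (st f) (st m) [] (lact M b a f m)"
proof -
 have f: "f : EH (Op A) b a" "b : vob (Op A)" "a : vob (Op A)" using assms by auto
 show ?thesis
  unfolding ract_def lact_bil(1)[OF assms(1) f(2,3,1) assms(4)]
  using bil_swp[OF lact_bil(2)[OF assms(1) f(2,3,1) assms(4)] assms(4) f(1)] by simp
qed

lemma lact_ract:
 assumes "rmod A M" "a : vob A" "b : vob A" "m : El M$b" "f : EH A a b"
 shows "lact M b a f m = sw [] (st m) (st f) [] (ract A M a b m f)"
 unfolding ract_lact[OF assms] using assms
 by (subst sw_sw[of _ "M$a"]) (simp_all add: lact_El[of "Op A"])

lemma ract_El [simp]: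
 assumes "rmod A M" "a : vob A" "b : vob A" "m : El M$b" "f : EH A a b"
 shows "ract A M a b m f : El M$a"
 unfolding ract_lact[OF assms] using assms by (intro sw_El) (simp_all add: lact_El[of "Op A"])

lemma ract_homs:
 assumes "rmod A M" "a : vob A" "b : vob A" "cat A"
 shows "(ev V M$b M$a \<cdot> (fmap M b a \<odot> one M$b)) \<cdot> swp V M$b (vhom A a b) : homs V (M$b \<otimes> vhom A a b) M$a"
 using homs_D[OF vfunctorD(2)[OF assms(1)]] assms by (simp add: homs_iff)

lemma nat1_ract1:
 "nat1 ps rs X M$b t ==> rmod A M ==> cat A ==> a : vob A ==> b : vob A ==> f : EH A a b ==>
 nat1 ps (rs @ st f) X M$a (%x. ract A M a b (t x) f)"
 unfolding ract_def by (rule nat1_bil1[OF _ ract_homs]) auto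

lemma nat1_ract2:
 "nat1 ps rs X (vhom A a b) t ==> rmod A M ==> cat A ==> a : vob A ==> b : vob A ==> m : El M$b ==>
 nat1 (st m @ ps) rs X M$a (%x. ract A M a b m (t x))"
 unfolding ract_def by (rule nat1_bil2[OF _ ract_homs]) auto

lemma ract_sw_right:
 assumes "rmod A M" "cat A" "a : vob A" "b : vob A" "m : El M$b" "f : EH A a b"
  "st f = as @ ws @ vs @ bs"
 shows "ract A M a b m (sw as ws vs bs f) = sw (st m @ as) ws vs bs (ract A M a b m f)"
 unfolding ract_def using assms by (intro bil_sw_right[OF ract_homs]) auto

lemma lact_sw_left:
 assumes "smod C N" "a : vob C" "b : vob C" "f : EH C a b" "n : El N$a"
  "st f = as @ ws @ vs @ bs"
 shows "lact N a b (sw as ws vs bs f) n = sw as ws vs (bs @ st n) (lact N a b f n)"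
 unfolding lact_bil(1)[OF assms(1-5)]
 by (subst lact_bil(1)[OF assms(1-3) sw_El[OF assms(4,6)] assms(5)], rule bil_sw_left[OF lact_bil(2)[OF assms(1-5)] assms(4-6)])

lemma lact_sw_right:
 assumes "smod C N" "a : vob C" "b : vob C" "f : EH C a b" "n : El N$a"
  "st n = as @ ws @ vs @ bs"
 shows "lact N a b f (sw as ws vs bs n) = sw (st f @ as) ws vs bs (lact N a b f n)"
 unfolding lact_bil(1)[OF assms(1-5)]
 by (subst lact_bil(1)[OF assms(1-4) sw_El[OF assms(5,6)]], rule bil_sw_right[OF lact_bil(2)[OF assms(1-5)] assms(4-6)])

lemma ract_idg:
 assumes "rmod A M" "cat A" "a : vob A" "m : El M$a"
 shows "ract A M a a m (idg A a) = m"
 using assms lact_idg[OF assms(1)] by (simp add: ract_lact sw_Nil_left)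

text \<open>The law of the left action over \<open>Op A\<close>, rewritten: the permutations of the
  two right actions reverse three blocks, and the one hidden in the composition of
  \<open>Op A\<close> cancels.\<close>

lemma ract_ract:
 assumes M: "rmod A M" and A: "cat A" and o [simp]: "a : vob A" "b : vob A" "c : vob A"
  and [simp]: "m : El M$c" "g : EH A b c" "f : EH A a b"
 shows "ract A M a b (ract A M b c m g) f = ract A M a c m (cp A a b c g f)"
proof -
 note [simp] = M A lact_El[of "Op A"]
 let ?e0 = "lact M c a (cp A a b c g f) m"
 have e0: "?e0 : El M$a" "st ?e0 = [] @ st g @ st f @ st m" by simp_all
 have e: "sw [] (st g) (st f) (st m) ?e0 : El M$a" by (intro sw_El[OF e0(1)]) simp
 have g: "lact M c b g m : El M$b" by simp
 have "ract A M a b (ract A M b c m g) f = sw [] (st f) (st m @ st g) [] (lact M b a f (sw [] (st g) (st m) [] (lact M c b g m)))"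
  by (subst ract_lact) (simp_all add: ract_lact sw_El[OF g])
 also have "... = sw [] (st f) (st m @ st g) [] (sw (st f) (st g) (st m) [] (lact M b a f (lact M c b g m)))"
  by (subst lact_sw_right[OF M]) simp_all
 also have "lact M b a f (lact M c b g m) = lact M c a (cp (Op A) c b a f g) m"
  by (subst lact_cp[OF vcategory_vop[OF A] M]) simp_all
 also have "... = sw [] (st g) (st f) (st m) ?e0"
  by (simp add: vcmp_vop, subst lact_sw_left[OF M]) simp_all
 also have "sw [] (st f) (st m @ st g) [] (sw (st f) (st g) (st m) [] (sw [] (st g) (st f) (st m) ?e0)) =
  sw [] (st g @ st f) (st m) [] ?e0"
  using sw_rev3[OF e] sw_sw[OF e0] by simp
 also have "... = ract A M a c m (cp A a b c g f)"
  by (subst ract_lact) simp_all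
 finally show ?thesis .
qed

lemma smodI:
 assumes C: "cat C" and o: "!!a. a : vob C ==> N$a : obj V"
  and m: "!!a b. a : vob C ==> b : vob C ==> fmap N a b : homs V (vhom C a b) (hom N$a N$b)"
  and i: "!!a n. a : vob C ==> n : El N$a ==> lact N a a (idg C a) n = n"
  and c: "!!a b c g f n. a : vob C ==> b : vob C ==> c : vob C ==> g : EH C b c ==> f : EH C a b ==>
   n : El N$a ==> lact N a c (cp C a b c g f) n = lact N b c g (lact N a b f n)"
 shows "smod C N"
proof (rule vfunctorI[OF C])
 have fmE: "fm N a b f : El (hom N$a N$b)" if "a : vob C" "b : vob C" "f : EH C a b" for a b f
  unfolding fm_def by (rule lin_El[OF m]) (use that in auto)
 note [simp] = C o fmE
 fix a assume [simp]: "a : vob C"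
 show "fm N a a (idg C a) = idg VV N$a"
  by (rule ap_ext[of _ "N$a" "N$a"]) (simp_all add: vid_self i[unfolded lact_def])
next
 have fmE: "fm N a b f : El (hom N$a N$b)" if "a : vob C" "b : vob C" "f : EH C a b" for a b f
  unfolding fm_def by (rule lin_El[OF m]) (use that in auto)
 note [simp] = C o fmE
 fix a b d g f assume [simp]: "a : vob C" "b : vob C" "d : vob C" "g : EH C b d" "f : EH C a b"
 show "fm N a d (cp C a b d g f) = cp VV N$a N$b N$d (fm N b d g) (fm N a b f)"
  by (rule ap_ext[of _ "N$a" "N$d"]) (simp_all add: vcmp_self c[unfolded lact_def])
qed (use o m in auto)

section \<open>Hom functors, representable modules, opposite pairs of categories\<close>

lemma vhom_fun_simps [simp]: "(homf C c)$a = vhom C c a"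
 by (simp add: vhom_fun_def)

lemma vhom_fun:
 assumes C: "cat C" and c: "c : vob C"
 shows "smod C (homf C c)"
  "a : vob C ==> b : vob C ==> f : EH C a b ==> x : EH C c a ==> lact (homf C c) a b f x = cp C c a b f x"
proof -
 have m: "fmap (homf C c) a b : homs V (vhom C a b) (hom (vhom C c a) (vhom C c b))"
  "ev V (vhom C c a) (vhom C c b) \<cdot> (fmap (homf C c) a b \<odot> one (vhom C c a)) = vcmp C c a b" if "a : vob C" "b : vob C" for a b
  unfolding vhom_fun_def using cur_props[OF vcategoryD(3)[OF C c that]] that C c by simp_all
 have *: "lact (homf C c) a b f x = cp C c a b f x" if "a : vob C" "b : vob C" "f : EH C a b" "x : EH C c a" for a b f x
  unfolding lact_def ap_def fm_def cp_def
  using bil_lin_left[OF ev_homs that(3,4) m(1)[OF that(1,2)]] m(2) that C c by simp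
 then show "a : vob C ==> b : vob C ==> f : EH C a b ==> x : EH C c a ==> lact (homf C c) a b f x = cp C c a b f x" .
 show "smod C (homf C c)"
  by (rule smodI) (use C c m in "simp_all add: * cp_idg cp_assoc")
qed

lemma vrep_simps [simp]: "(yo A c)$a = vhom A a c"
 by (simp add: vrep_def)

lemma vrep:
 assumes A: "cat A" and c: "c : vob A"
 shows "rmod A (yo A c)"
  "a : vob A ==> b : vob A ==> f : EH A a b ==> m : EH A b c ==> ract A (yo A c) a b m f = cp A a b c m f"
proof -
 show r: "rmod A (yo A c)" unfolding vrep_def by (rule vhom_fun) (simp_all add: A c)
 assume h: "a : vob A" "b : vob A" "f : EH A a b" "m : EH A b c"
 show "ract A (yo A c) a b m f = cp A a b c m f"
  using ract_lact[OF r h(1,2) _] vhom_fun(2)[of "Op A" c b a f m] A c h by (simp add: vrep_def vcmp_vop sw_sw[of _ "vhom A a c"])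
qed

text \<open>A relation takes the place of \<open>Op\<close>, because \<open>Op (Op A)\<close> agrees
  with \<open>A\<close> only at objects and the fields are arbitrary elsewhere. Being symmetric on
  V-categories, it lets every result about \<open>A\<close> and its opposite be used in both
  directions.\<close>

definition "opp A B == vob B = vob A & (ALL a : vob A. ALL b : vob A. vhom B a b = vhom A b a) &
  (ALL a : vob A. vid B a = vid A a) &
  (ALL a : vob A. ALL b : vob A. ALL c : vob A. vcmp B a b c = vcmp A c b a \<cdot> swp V (vhom A c b) (vhom A b a))"

lemma opp_vop: "opp A (Op A)"
 by (simp add: opp_def) (simp add: vop_def)

lemma opp_sym:
 assumes "cat A" "opp A B" shows "opp B A"
 using assms homs_D[OF vcategoryD(3)[OF assms(1)]] unfolding opp_def by simp

lemma oppD: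
 assumes "opp A B"
 shows "vob B = vob A" "a : vob A ==> b : vob A ==> vhom B a b = vhom A b a" "a : vob A ==> idg B a = idg A a"
 using assms unfolding opp_def idg_def by auto

lemma opp_cp:
 assumes "opp A B" "cat A" "a : vob A" "b : vob A" "c : vob A" "g : EH A c b" "f : EH A b a"
 shows "cp B a b c g f = sw [] (st f) (st g) [] (cp A c b a f g)"
proof -
 have "cp B a b c g f = cp (Op A) a b c g f"
  using assms unfolding cp_def opp_def vop_def by simp
 then show ?thesis using assms by (simp add: vcmp_vop)
qed

lemma vcategory_cong:
 assumes "cat A" "vob B = vob A" "!!a b. a : vob A ==> b : vob A ==> vhom B a b = vhom A a b"
  "!!a. a : vob A ==> vid B a = vid A a"
  "!!a b c. a : vob A ==> b : vob A ==> c : vob A ==> vcmp B a b c = vcmp A a b c"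
 shows "cat B"
 using assms unfolding vcategory_def by simp

lemma opp_vcategory: "opp A B ==> cat A ==> cat B"
 by (rule vcategory_cong[OF vcategory_vop[of A]]) (auto simp: opp_def vop_def)

text \<open>The axioms of a V-functor inspect its domain at objects only, where \<open>Op B\<close>
  and \<open>A\<close> agree. Hence the same record is a right module over one and a left module
  over the other.\<close>

lemma opp_smod:
 assumes "opp A B" "cat A"
 shows "rmod B N \<longleftrightarrow> smod A N"
 using assms homs_D[OF vcategoryD(3)[OF assms(2)]] unfolding opp_def vfunctor_def by (simp add: vop_def)

section \<open>Ends and functor categories\<close>


lemma nat1_gq_eqI:
 assumes "nat1 ps rs (T ws) Y t" "nat1 ps rs (T ws) Y u" and ws: "ok ws" and "t (gq ws) = u (gq ws)" and x: "x : El (T ws)"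
 shows "t x = u x"
proof -
 have l: "lhom (st x) (st (gq ws)) (snd x)" using El_D[OF x] ws by (simp add: lhom_def homs_iff)
 have r: "re (st x) (snd x) (gq ws) = x" using El_D[OF x] by (simp add: re_def gq_def)
 show ?thesis
  using nat1D(3)[OF assms(1) gq_El[OF ws] l] nat1D(3)[OF assms(2) gq_El[OF ws] l] assms(4) unfolding r by simp
qed

lemma lin_gq: "f : homs V (T ws) Y ==> lin f (gq ws) = (ws, f)"
 using homs_D by (simp add: lin_def gq_def)

lemma ap_sw_left:
 assumes "f : El (hom X Y)" "x : El X" "ob X" "ob Y" "st f = as @ ws @ vs @ bs"
 shows "ap X Y (sw as ws vs bs f) x = sw as ws vs (bs @ st x) (ap X Y f x)"
 unfolding ap_def by (rule bil_sw_left[OF ev_homs]) (use assms in auto)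

lemma ap_sw_right:
 assumes "f : El (hom X Y)" "x : El X" "ob X" "ob Y" "st x = as @ ws @ vs @ bs"
 shows "ap X Y f (sw as ws vs bs x) = sw (st f @ as) ws vs bs (ap X Y f x)"
 unfolding ap_def by (rule bil_sw_right[OF ev_homs]) (use assms in auto)

text \<open>The wedge equation relates arrows
  \<open>E \<otimes> A(a, b) \<rightarrow> [F b, G a]\<close>. Applied to elements \<open>t\<close>,
  \<open>f\<close>, \<open>m\<close> it says that the components of \<open>t\<close> commute with
  the right actions.\<close>

lemma hom_wedge_iff:
 assumes A: "cat A" and F: "rmod A F" and G: "rmod A G"
 shows "hom_wedge V (Op A) VV F G E e \<longleftrightarrow> E : obj V &
  (ALL a : vob A. e a : homs V E (hom F$a G$a)) &
  (ALL a : vob A. ALL b : vob A. ALL t : El E. ALL m : El F$b. ALL f : EH A a b.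
   ap F$a G$a (lin (e a) t) (ract A F a b m f) = ract A G a b (ap F$b G$b (lin (e b) t) m) f)"
proof -
 note [simp] = A F G rmod_obj[OF F] rmod_obj[OF G] lact_El[of "Op A"]
 have "(vcmp VV F$b F$a G$a \<cdot> (e a \<odot> fmap F b a) =
    vcmp VV F$b G$b G$a \<cdot> (fmap G b a \<odot> e b) \<cdot> swp V E (vhom A a b)) \<longleftrightarrow>
  (ALL t : El E. ALL m : El F$b. ALL f : EH A a b.
   ap F$a G$a (lin (e a) t) (ract A F a b m f) = ract A G a b (ap F$b G$b (lin (e b) t) m) f)"
  (is "?L = ?R \<longleftrightarrow> ?P")
  if E [simp]: "ob E" and a [simp]: "a : vob A" and b [simp]: "b : vob A" and
   e: "!!a. a : vob A ==> e a : homs V E (hom F$a G$a)" for a b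
 proof -
  have Fh: "fmap F b a : homs V (vhom A a b) (hom F$b F$a)"
   and Gh: "fmap G b a : homs V (vhom A a b) (hom G$b G$a)"
   using vfunctorD(2)[OF F] vfunctorD(2)[OF G] by simp_all
  have L: "?L : homs V (E \<otimes> vhom A a b) (hom F$b G$a)"
   using homs_D[OF e] homs_D[OF Fh] homs_D[OF vcmp_self(1)] by (simp add: homs_iff)
  have R': "vcmp VV F$b G$b G$a \<cdot> (fmap G b a \<odot> e b) : homs V (vhom A a b \<otimes> E) (hom F$b G$a)"
   using homs_D[OF e] homs_D[OF Gh] homs_D[OF vcmp_self(1)] by (simp add: homs_iff)
  then have R: "?R : homs V (E \<otimes> vhom A a b) (hom F$b G$a)"
   using homs_D[OF e] homs_D[OF Gh] homs_D[OF vcmp_self(1)] by (simp add: homs_iff)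
  have eE [simp]: "lin (e a) t : El (hom F$a G$a)" if "t : El E" "a : vob A" for t a
   by (rule lin_El[OF e]) (use that in auto)
  have fF [simp]: "fm F b a f : El (hom F$b F$a)" "fm G b a f : El (hom G$b G$a)" if "f : EH A a b" for f
   using fm_El[OF F] fm_El[OF G] that by simp_all
  have Lm: "ap F$b G$a (bil ?L t f) m = ap F$a G$a (lin (e a) t) (lact F b a f m)"
   if "t : El E" "f : EH A a b" "m : El F$b" for t f m
  proof -
   have "bil ?L t f = cp VV F$b F$a G$a (lin (e a) t) (fm F b a f)"
    using bil_lin[OF vcmp_self(1) that(1,2) e Fh] by (simp add: fm_def cp_def)
   then show ?thesis using that by (simp add: vcmp_self(2) lact_def)
  qed
  have Rm: "ap F$b G$a (bil ?R t f) m = sw [] (st f) (st t) (st m) (lact G b a f (ap F$b G$b (lin (e b) t) m))"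
   if "t : El E" "f : EH A a b" "m : El F$b" for t f m
  proof -
   have "bil ?R t f = bil ((vcmp VV F$b G$b G$a \<cdot> (fmap G b a \<odot> e b)) \<cdot> swp V E (vhom A a b)) t f"
    using homs_D[OF e] homs_D[OF Gh] homs_D[OF vcmp_self(1)] by simp
   also have "... = sw [] (st f) (st t) [] (cp VV F$b G$b G$a (fm G b a f) (lin (e b) t))"
    using bil_swp[OF R' that(1,2)] bil_lin[OF vcmp_self(1) that(2,1) Gh e] by (simp add: fm_def cp_def)
   finally show ?thesis
    using that ap_sw_left vcmp_self(2) by (simp add: lact_def)
  qed
  \<comment> \<open>Passing from left to right actions exchanges the blocks of \<open>f\<close> and
    \<open>m\<close> by the same invertible permutation on both sides.\<close>
  have eq: "(ap F$a G$a (lin (e a) t) (lact F b a f m) = sw [] (st f) (st t) (st m) (lact G b a f (ap F$b G$b (lin (e b) t) m)))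
   \<longleftrightarrow> (ap F$a G$a (lin (e a) t) (ract A F a b m f) = ract A G a b (ap F$b G$b (lin (e b) t) m) f)"
   (is "?x = ?y \<longleftrightarrow> ?x' = ?y'")
   if t: "t : El E" "f : EH A a b" "m : El F$b" for t f m
  proof -
   have x: "?x : El G$a" "st ?x = st t @ st f @ st m" using t by simp_all
   have y: "?y : El G$a" "st ?y = st t @ st f @ st m" using t by (auto intro: sw_El)
   have x': "?x' = sw (st t) (st f) (st m) [] ?x"
    using t by (simp add: ract_lact, subst ap_sw_right) simp_all
   have y': "?y' = sw (st t) (st f) (st m) [] ?y"
    using t sw_append_right[of "lact G b a f (ap F$b G$b (lin (e b) t) m)" "G$a" "[]" "st f" "st t" "st m" "[]"]
    by (simp add: ract_lact)
   show ?thesis unfolding x' y' using sw_sw[OF x(1)] sw_sw[OF y(1)] x(2) y(2) by (metis append_Nil2)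
  qed
  show ?thesis
  proof
   assume "?L = ?R" then show ?P using eq Lm Rm by metis
  next
   assume P: ?P
   show "?L = ?R"
   proof (rule bil_ext[OF L R])
    fix t f assume t: "t : El E" and f: "f : EH A a b"
    show "bil ?L t f = bil ?R t f"
     by (rule ap_ext[OF bil_El[OF L t f] bil_El[OF R t f]]) (use t f P eq Lm Rm in simp_all)
   qed simp_all
  qed
 qed
 note * = this
 show ?thesis
  unfolding hom_wedge_def vop_simps self_simps
 proof (intro conj_cong refl)
  assume o: "ob E" "ALL a : vob A. e a : homs V E (hom F$a G$a)"
  note ** = *[OF o(1) _ _ o(2)[rule_format]]
  show "(ALL a:vob A. ALL b:vob A.
    vcmp VV F$a F$b G$b \<cdot> e b \<odot> fmap F a b =
    vcmp VV F$a G$a G$b \<cdot> fmap G a b \<odot> e a \<cdot> swp V E (vhom A b a)) =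
   (ALL a:vob A. ALL b:vob A. ALL t:El E. ALL m:El F$b. ALL f:EH A a b.
    ap F$a G$a (lin (e a) t) (ract A F a b m f) = ract A G a b (ap F$b G$b (lin (e b) t) m) f)"
   (is "(ALL a:_. ALL b:_. ?L a b) = (ALL a:_. ALL b:_. ?R a b)")
  proof -
   have "?L a b = ?R b a" if "a : vob A" "b : vob A" for a b
    by (rule **) (use that in auto)
   then show ?thesis by blast
  qed
 qed
qed

text \<open>A natural transformation from \<open>F\<close> to \<open>G\<close> with parameters in
  \<open>ws\<close>: what an element of the end at stage \<open>ws\<close> would be, stated without
  assuming that the end exists. Ends, colimits and Kan extensions are all tested on such
  families.\<close>

definition "eqv A F G ws t == (ALL a : vob A. nat1 ws [] F$a G$a (t a)) &
  (ALL a : vob A. ALL b : vob A. ALL m : El F$b. ALL f : EH A a b.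
   t a (ract A F a b m f) = ract A G a b (t b m) f)"

lemma hom_end_wedge:
 assumes "cat A" "rmod A F" "rmod A G" "hom_end V (Op A) VV F G E e"
 shows "ob E" "a : vob A ==> e a : homs V E (hom F$a G$a)"
  "a : vob A ==> b : vob A ==> t : El E ==> m : El F$b ==> f : EH A a b ==>
   ap F$a G$a (lin (e a) t) (ract A F a b m f) = ract A G a b (ap F$b G$b (lin (e b) t) m) f"
 using assms(4) unfolding hom_end_def hom_wedge_iff[OF assms(1-3)] by auto

text \<open>Currying the components gives a wedge with vertex \<open>T ws\<close>, and its mediating
  arrow into the end is the wanted element.\<close>

lemma hom_end_ex:
 assumes A: "cat A" and F: "rmod A F" and G: "rmod A G" and E: "hom_end V (Op A) VV F G E e"
  and t: "eqv A F G ws t" and ws: "ok ws"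
 shows "EX u : El E. st u = ws & (ALL a : vob A. ALL m : El F$a. ap F$a G$a (lin (e a) u) m = t a m)"
proof -
 note [simp] = A F G ws rmod_obj[OF F] rmod_obj[OF G]
 have n: "nat1 ws [] F$a G$a (t a)" if "a : vob A" for a using t that unfolding eqv_def by auto
 define e' where "e' a = snd (lamF ws F$a G$a (t a))" for a
 have l: "lamF ws F$a G$a (t a) : El (hom F$a G$a)" if "a : vob A" for a
  by (rule lamF[OF n[OF that]]) (use that in simp)
 have e': "e' a : homs V (T ws) (hom F$a G$a)" if "a : vob A" for a
  using El_snd[OF l[OF that]] unfolding e'_def by simp
 have g: "lin (e' a) (gq ws) = lamF ws F$a G$a (t a)" if "a : vob A" for a
  using lin_gq[OF e'[OF that]] unfolding e'_def by (simp add: prod_eq_iff)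
 have "hom_wedge V (Op A) VV F G (T ws) e'"
  unfolding hom_wedge_iff[OF A F G]
 proof (intro conjI ballI)
  fix a b u m f assume h: "a : vob A" "b : vob A" "u : El (T ws)" "m : El F$b" "f : EH A a b"
  show "ap F$a G$a (lin (e' a) u) (ract A F a b m f) = ract A G a b (ap F$b G$b (lin (e' b) u) m) f"
  proof (rule nat1_gq_eqI[of "[]" "st m @ st f" ws "G$a" "%u. ap F$a G$a (lin (e' a) u) (ract A F a b m f)" _ u])
   show "nat1 [] (st m @ st f) (T ws) G$a (%u. ap F$a G$a (lin (e' a) u) (ract A F a b m f))"
    by (rule nat1_conv, rule nat1_ap1[OF nat1_lin[OF nat1_id e'] _ _ _ refl]) (use h in simp_all)
   show "nat1 [] (st m @ st f) (T ws) G$a (%u. ract A G a b (ap F$b G$b (lin (e' b) u) m) f)"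
    by (rule nat1_conv, rule nat1_ract1, rule nat1_ap1[OF nat1_lin[OF nat1_id e'] _ _ _ refl]) (use h in simp_all)
   show "ap F$a G$a (lin (e' a) (gq ws)) (ract A F a b m f) = ract A G a b (ap F$b G$b (lin (e' b) (gq ws)) m) f"
    using t h unfolding eqv_def by (simp add: g lamF(2))
  qed (use h in simp_all)
 qed (use e' in simp_all)
 then obtain u where u: "u : homs V (T ws) E" "!!a. a : vob A ==> e a \<cdot> u = e' a"
  using E unfolding hom_end_def vop_simps by blast
 have "lin (e a) (ws, u) = lamF ws F$a G$a (t a)" if "a : vob A" for a
  using u(2)[OF that] by (simp add: lin_def e'_def prod_eq_iff)
 then show ?thesis using u(1) lamF(2)[OF n] by (intro bexI[of _ "(ws, u)"]) simp_all
qed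

lemma hom_end_ext:
 assumes A: "cat A" and F: "rmod A F" and G: "rmod A G" and E: "hom_end V (Op A) VV F G E e"
  and u: "u : El E" and v: "v : El E" and "st u = st v"
  and eq: "!!a m. a : vob A ==> m : El F$a ==> ap F$a G$a (lin (e a) u) m = ap F$a G$a (lin (e a) v) m"
 shows "u = v"
proof -
 note [simp] = A F G hom_end_wedge(1)[OF A F G E] rmod_obj[OF F] rmod_obj[OF G]
 note e = hom_end_wedge(2)[OF A F G E]
 have eq': "lin (e a) u = lin (e a) v" if "a : vob A" for a
  by (rule ap_ext[OF lin_El[OF e u] lin_El[OF e v]]) (use that assms in simp_all)
 \<comment> \<open>Uniqueness is available for mediating arrows of wedges only, so the end is
   composed with \<open>u\<close>: for the resulting wedge both \<open>snd u\<close> and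
   \<open>snd v\<close> are mediating.\<close>
 have W: "hom_wedge V (Op A) VV F G (T (st u)) (%a. e a \<cdot> snd u)"
  unfolding hom_wedge_iff[OF A F G]
 proof (intro conjI ballI)
  fix a assume a: "a : vob A"
  show "e a \<cdot> snd u : homs V (T (st u)) (hom F$a G$a)"
   by (rule cmp_homs[OF El_snd[OF u] e[OF a]])
 next
  fix a b x m f assume h: "a : vob A" "b : vob A" "x : El (T (st u))" "m : El F$b" "f : EH A a b"
  show "ap F$a G$a (lin (e a \<cdot> snd u) x) (ract A F a b m f) = ract A G a b (ap F$b G$b (lin (e b \<cdot> snd u) x) m) f"
   using hom_end_wedge(3)[OF A F G E h(1,2) lin_El[OF El_snd[OF u] h(3)] h(4,5)]
   by (simp add: lin_lin[OF h(3) El_snd[OF u] e[OF h(1)]] lin_lin[OF h(3) El_snd[OF u] e[OF h(2)]])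
 qed (use u in simp)
 have *: "e a \<cdot> snd v = e a \<cdot> snd u" if "a : vob A" for a
  using eq'[OF that] by (simp add: lin_def)
 have "EX! w. w : homs V (T (st u)) E & (ALL a : vob A. e a \<cdot> w = e a \<cdot> snd u)"
  using E W unfolding hom_end_def vop_simps by blast
 moreover have "snd u : homs V (T (st u)) E" "snd v : homs V (T (st u)) E"
  using El_snd[OF u] El_snd[OF v] `st u = st v` by auto
 ultimately have "snd u = snd v"
  using * by blast
 then show ?thesis using `st u = st v` by (simp add: prod_eq_iff)
qed

lemma hom_endI:
 assumes A: "cat A" and F: "rmod A F" and G: "rmod A G" and o: "ob E"
  and e: "!!a. a : vob A ==> e a : homs V E (hom F$a G$a)"
  and w: "!!a b t m f. a : vob A ==> b : vob A ==> t : El E ==> m : El F$b ==> f : EH A a b ==>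
   ap F$a G$a (lin (e a) t) (ract A F a b m f) = ract A G a b (ap F$b G$b (lin (e b) t) m) f"
  and ex: "!!ws t. ok ws ==> eqv A F G ws t ==>
   EX u : El E. st u = ws & (ALL a : vob A. ALL m : El F$a. ap F$a G$a (lin (e a) u) m = t a m)"
  and ext: "!!u v. u : El E ==> v : El E ==> st u = st v ==>
   (!!a m. a : vob A ==> m : El F$a ==> ap F$a G$a (lin (e a) u) m = ap F$a G$a (lin (e a) v) m) ==> u = v"
 shows "hom_end V (Op A) VV F G E e"
 unfolding hom_end_def vop_simps
proof (intro conjI allI impI)
 show "hom_wedge V (Op A) VV F G E e"
  unfolding hom_wedge_iff[OF A F G] using assms by blast
 fix E' e' assume "hom_wedge V (Op A) VV F G E' e'"
 then have o' [simp]: "ob E'" and e': "!!a. a : vob A ==> e' a : homs V E' (hom F$a G$a)"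
  and w': "!!a b t m f. a : vob A ==> b : vob A ==> t : El E' ==> m : El F$b ==> f : EH A a b ==>
   ap F$a G$a (lin (e' a) t) (ract A F a b m f) = ract A G a b (ap F$b G$b (lin (e' b) t) m) f"
  unfolding hom_wedge_iff[OF A F G] by auto
 note [simp] = A F G rmod_obj[OF F] rmod_obj[OF G]
 \<comment> \<open>A wedge with vertex \<open>E'\<close> is a family at the one-variable stage
   \<open>[E']\<close>. The element that represents it is turned into an arrow from
   \<open>E'\<close> by \<open>rui\<close>.\<close>
 have "eqv A F G [E'] (%a. ap F$a G$a (lin (e' a) (gen E')))"
  unfolding eqv_def using w'
  by (auto intro!: nat1_conv[OF nat1_ap2[OF nat1_id _ _ lin_El[OF e'] refl]])
 from ex[OF _ this] obtain u where u: "u : El E" "st u = [E']"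
  "!!a m. a : vob A ==> m : El F$a ==> ap F$a G$a (lin (e a) u) m = ap F$a G$a (lin (e' a) (gen E')) m"
  by auto
 note ud = El_D[OF u(1), unfolded u(2)]
 have uh: "snd u \<cdot> rui E' : homs V E' E" using ud by (simp add: homs_iff)
 have lu: "lin (snd u \<cdot> rui E') (gen E') = u" using ud u(2) by (simp add: lin_def prod_eq_iff)
 have *: "x = snd u \<cdot> rui E'" if "x : homs V E' E" "ALL a:vob A. e a \<cdot> x = e' a" for x
 proof (rule lin_ext[OF that(1) uh])
  fix y assume y: "y : El E'"
  show "lin x y = lin (snd u \<cdot> rui E') y"
  proof (rule nat1_eqI[OF nat1_lin[OF nat1_id that(1)] nat1_lin[OF nat1_id uh] o' _ y], unfold lu)
   show "lin x (gen E') = u"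
    by (rule ext) (use lin_El[OF that(1)] u that in "auto simp: lin_lin[OF gen_El[OF o'] that(1) e]")
  qed
 qed
 show "EX! u. u : homs V E' E & (ALL a:vob A. e a \<cdot> u = e' a)"
 proof (rule ex1I[of _ "snd u \<cdot> rui E'"], intro conjI ballI uh)
  fix a assume a: "a : vob A"
  show "e a \<cdot> snd u \<cdot> rui E' = e' a"
  proof (rule lin_ext[OF cmp_homs[OF uh e[OF a]] e'[OF a]])
   fix y assume y: "y : El E'"
   show "lin (e a \<cdot> snd u \<cdot> rui E') y = lin (e' a) y"
   proof (rule nat1_eqI[OF nat1_lin[OF nat1_id cmp_homs[OF uh e[OF a]]] nat1_lin[OF nat1_id e'[OF a]] o' _ y])
    show "lin (e a \<cdot> snd u \<cdot> rui E') (gen E') = lin (e' a) (gen E')"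
     unfolding lin_lin[OF gen_El[OF o'] uh e[OF a], symmetric] lu
     by (rule ap_ext[OF lin_El[OF e[OF a] u(1)] lin_El[OF e'[OF a] gen_El[OF o']]]) (use a u in simp_all)
   qed
  qed
 qed (use * in blast)
qed

section \<open>Functor categories whose homs are ends\<close>

definition "mcat A FF == cat A & (ALL F : FF. rmod A F) &
  (ALL F : FF. ALL G : FF. EX E e. hom_end V (Op A) VV F G E e)"

abbreviation "Fun A FF == funcat V (Op A) VV FF"
abbreviation "eo A == end_obj V (Op A) VV"
abbreviation "ep A == end_prj V (Op A) VV"

definition "Ea A F G a t m = ap F$a G$a (lin (ep A F G a) t) m"

lemma Fun_simps [simp]: "vob (Fun A FF) = FF" "vhom (Fun A FF) F G = eo A F G"
 by (simp_all add: funcat_def)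

text \<open>Existence of the ends turns the choice in \<open>chosen_end\<close> into an actual end.
  Presheaves on a small category and accessible presheaves on an arbitrary one are the two
  instances.\<close>

lemma mcatD:
 assumes "mcat A FF"
 shows "cat A" "F : FF ==> rmod A F"
  "F : FF ==> G : FF ==> hom_end V (Op A) VV F G (eo A F G) (ep A F G)"
proof -
 show "cat A" "F : FF ==> rmod A F" using assms unfolding mcat_def by auto
 assume "F : FF" "G : FF"
 then have "EX p. case p of (E, e) => hom_end V (Op A) VV F G E e" using assms unfolding mcat_def by auto
 from someI_ex[OF this] show "hom_end V (Op A) VV F G (eo A F G) (ep A F G)"
  unfolding end_obj_def end_prj_def chosen_end_def by (simp add: case_prod_unfold)
qed

lemma st_Ea [simp]: "st (Ea A F G a t m) = st t @ st m"
 by (simp add: Ea_def)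

context
 fixes A :: "('a, 'o, 'm) vcat" and FF
 assumes mc: "mcat A FF"
begin

lemmas mc_A [simp] = mcatD(1)[OF mc]
lemmas mc_rmod [simp] = mcatD(2)[OF mc]
lemmas mc_end = mcatD(3)[OF mc]

lemma mc_obj [simp]: "F : FF ==> a : vob A ==> F$a : obj V"
 by (rule rmod_obj[OF mc_rmod])

lemma eo_obj [simp]: "F : FF ==> G : FF ==> eo A F G : obj V"
 using hom_end_wedge(1)[OF _ _ _ mc_end] by simp

lemma ep_homs: "F : FF ==> G : FF ==> a : vob A ==> ep A F G a : homs V (eo A F G) (hom F$a G$a)"
 using hom_end_wedge(2)[OF _ _ _ mc_end] by simp

lemma Ea_El [simp]: "F : FF ==> G : FF ==> a : vob A ==> t : El (eo A F G) ==> m : El F$a ==> Ea A F G a t m : El G$a"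
 unfolding Ea_def using lin_El[OF ep_homs] by simp

lemma Ea_ract: "F : FF ==> G : FF ==> a : vob A ==> b : vob A ==> t : El (eo A F G) ==> m : El F$b ==> f : EH A a b ==>
  Ea A F G a t (ract A F a b m f) = ract A G a b (Ea A F G b t m) f"
 unfolding Ea_def using hom_end_wedge(3)[OF _ _ _ mc_end] by simp

lemma nat1_Ea1:
 "nat1 ps rs X (eo A F G) t ==> F : FF ==> G : FF ==> a : vob A ==> m : El F$a ==>
 nat1 ps (rs @ st m) X G$a (%x. Ea A F G a (t x) m)"
 unfolding Ea_def by (intro nat1_ap1[OF nat1_lin[OF _ ep_homs] _ _ _ refl]) auto

lemma nat1_Ea2:
 "nat1 ps rs X F$a m ==> F : FF ==> G : FF ==> a : vob A ==> t : El (eo A F G) ==>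
 nat1 (st t @ ps) rs X G$a (%x. Ea A F G a t (m x))"
 unfolding Ea_def by (rule nat1_conv, rule nat1_ap2[OF _ _ _ _ refl]) (auto intro: lin_El[OF ep_homs])

lemma Ea_ext:
 assumes "F : FF" "G : FF" "s : El (eo A F G)" "t : El (eo A F G)" "st s = st t"
  "!!a m. a : vob A ==> m : El F$a ==> Ea A F G a s m = Ea A F G a t m"
 shows "s = t"
 using assms hom_end_ext[OF _ _ _ mc_end, of F G s t] unfolding Ea_def by simp

text \<open>Abstraction for ends: \<open>Ea\<close>, \<open>EL\<close> and \<open>Ea_ext\<close>
  play for transformations the parts of \<open>ap\<close>, \<open>lamF\<close> and
  \<open>ap_ext\<close>.\<close>

definition "EL F G ws t = (SOME u. u : El (eo A F G) & st u = ws & (ALL a : vob A. ALL m : El F$a. Ea A F G a u m = t a m))"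

lemma EL:
 assumes "F : FF" "G : FF" "eqv A F G ws t" "ok ws"
 shows "EL F G ws t : El (eo A F G)" "st (EL F G ws t) = ws"
  "a : vob A ==> m : El F$a ==> Ea A F G a (EL F G ws t) m = t a m"
proof -
 have "EX u. u : El (eo A F G) & st u = ws & (ALL a : vob A. ALL m : El F$a. Ea A F G a u m = t a m)"
  using hom_end_ex[OF mc_A mc_rmod[OF assms(1)] mc_rmod[OF assms(2)] mc_end[OF assms(1,2)] assms(3,4)]
  unfolding Ea_def Bex_def .
 from someI_ex[OF this] show "EL F G ws t : El (eo A F G)" "st (EL F G ws t) = ws"
  "a : vob A ==> m : El F$a ==> Ea A F G a (EL F G ws t) m = t a m"
  unfolding EL_def[symmetric] by auto
qed

lemma Ea_rmid:
 assumes "F : FF" "G : FF" "a : vob A" "t : El (eo A F G)" "m : El F$a" "st t = ps @ ws @ rs" "lhom vs ws s"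
 shows "Ea A F G a (rmid ps ws vs rs s t) m = rmid ps ws vs (rs @ st m) s (Ea A F G a t m)"
 unfolding Ea_def ap_def using assms
 by (simp add: lin_rmid[OF ep_homs] bil_rmid_left[OF ev_homs lin_El[OF ep_homs]])

lemma Ea_sw:
 assumes "F : FF" "G : FF" "a : vob A" "t : El (eo A F G)" "m : El F$a" "st t = ps @ ws @ vs @ rs"
 shows "Ea A F G a (sw ps ws vs rs t) m = sw ps ws vs (rs @ st m) (Ea A F G a t m)"
 unfolding sw_def using El_D(1)[OF assms(4)] assms by (intro Ea_rmid) auto

lemma Ea_sw_right:
 assumes "F : FF" "G : FF" "a : vob A" "t : El (eo A F G)" "m : El F$a" "st m = ps @ ws @ vs @ rs"
 shows "Ea A F G a t (sw ps ws vs rs m) = sw (st t @ ps) ws vs rs (Ea A F G a t m)"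
 unfolding Ea_def using assms lin_El[OF ep_homs] by (simp add: ap_sw_right)

lemma nat1_EL:
 assumes "F : FF" "G : FF" and X: "ob X" and "!!x. x : El X ==> eqv A F G (ps @ st x @ rs) (t x)"
  and "!!a m. a : vob A ==> m : El F$a ==> nat1 ps (rs @ st m) X G$a (%x. t x a m)"
  and "!!x. P x = ps @ st x @ rs" and o: "ok ps" "ok rs"
 shows "nat1 ps rs X (eo A F G) (%x. EL F G (P x) (t x))"
proof (rule nat1I)
 have e: "eqv A F G (P x) (t x)" "ok (P x)" if "x : El X" for x
  using that assms(4,6) o by simp_all
 fix x assume x: "x : El X"
 show "EL F G (P x) (t x) : El (eo A F G)" "st (EL F G (P x) (t x)) = ps @ st x @ rs"
  using EL[OF assms(1,2) e[OF x]] assms(6) by auto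
 fix vs s assume s: "lhom vs (st x) s" and rx: "re vs s x : El X"
 show "EL F G (P (re vs s x)) (t (re vs s x)) = rmid ps (st x) vs rs s (EL F G (P x) (t x))"
 proof (rule Ea_ext[OF assms(1,2)])
  show "rmid ps (st x) vs rs s (EL F G (P x) (t x)) : El (eo A F G)"
   using EL[OF assms(1,2) e[OF x]] assms(6) s by (intro rmid_El) auto
  fix a m assume "a : vob A" "m : El F$a"
  then show "Ea A F G a (EL F G (P (re vs s x)) (t (re vs s x))) m = Ea A F G a (rmid ps (st x) vs rs s (EL F G (P x) (t x))) m"
   using EL[OF assms(1,2) e[OF x]] EL[OF assms(1,2) e[OF rx]] assms(1,2,6) s nat1D(3)[OF assms(5) x] by (simp add: Ea_rmid)
 qed (use EL[OF assms(1,2) e[OF x]] EL[OF assms(1,2) e[OF rx]] assms(6) in simp_all)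
qed

text \<open>The description of the identity in \<open>funcat\<close> speaks of projections. Read on
  elements, its solution exists by \<open>EL\<close> and is unique by \<open>Ea_ext\<close>, so the
  definite description denotes it. Composition is treated alike in \<open>vcmp_Fun\<close>.\<close>

lemma vid_Fun:
 assumes F: "F : FF"
 shows "vid (Fun A FF) F : homs V I (eo A F F)"
  "a : vob A ==> m : El F$a ==> Ea A F F a (idg (Fun A FF) F) m = m"
proof -
 let ?P = "%u. u : homs V I (eo A F F) & (ALL a : vob A. ep A F F a \<cdot> u = vid VV F$a)"
 have eq: "(ep A F F a \<cdot> u = vid VV F$a) \<longleftrightarrow> (ALL m : El F$a. Ea A F F a (glb u) m = m)"
  if u: "u : homs V I (eo A F F)" and a: "a : vob A" for u a
 proof
  assume "ep A F F a \<cdot> u = vid VV F$a"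
  then have "lin (ep A F F a) (glb u) = idg VV F$a" by (simp add: lin_glb idg_def)
  then show "ALL m : El F$a. Ea A F F a (glb u) m = m" using a F by (simp add: Ea_def vid_self)
 next
  assume *: "ALL m : El F$a. Ea A F F a (glb u) m = m"
  have "lin (ep A F F a) (glb u) = idg VV F$a"
   by (rule ap_ext[OF lin_El[OF ep_homs glb_El[OF u]]]) (use * a F in "simp_all add: Ea_def vid_self")
  then show "ep A F F a \<cdot> u = vid VV F$a" unfolding lin_glb idg_def by (rule glb_inj)
 qed
 have e: "eqv A F F [] (%a m. m)" unfolding eqv_def using nat1_id by auto
 note E = EL[OF F F e]
 have ex: "?P (snd (EL F F [] (%a m. m)))"
  using El_Nil[OF E(1,2)] E(3) eq by auto
 have un: "u = v" if "?P u" "?P v" for u v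
 proof -
  have "glb u = glb v"
   by (rule Ea_ext[OF F F]) (use that eq glb_El in auto)
  then show ?thesis by (rule glb_inj)
 qed
 have "?P (vid (Fun A FF) F)"
  using theI[of ?P, OF ex un[OF _ ex]] by (simp add: funcat_def)
 then show "vid (Fun A FF) F : homs V I (eo A F F)"
  "a : vob A ==> m : El F$a ==> Ea A F F a (idg (Fun A FF) F) m = m"
  using eq unfolding idg_def by auto
qed

lemma vcmp_Fun:
 assumes F: "F : FF" and G: "G : FF" and H: "H : FF"
 shows "vcmp (Fun A FF) F G H : homs V (eo A G H \<otimes> eo A F G) (eo A F H)"
  "a : vob A ==> s : El (eo A G H) ==> t : El (eo A F G) ==> m : El F$a ==>
   Ea A F H a (cp (Fun A FF) F G H s t) m = Ea A G H a s (Ea A F G a t m)"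
proof -
 let ?X = "eo A G H" and ?Y = "eo A F G"
 note [simp] = F G H
 let ?r = "%a. vcmp VV F$a G$a H$a \<cdot> (ep A G H a \<odot> ep A F G a)"
 let ?P = "%u. u : homs V (?X \<otimes> ?Y) (eo A F H) & (ALL a : vob A. ep A F H a \<cdot> u = ?r a)"
 have rh: "?r a : homs V (?X \<otimes> ?Y) (hom F$a H$a)" if "a : vob A" for a
  using homs_D[OF ep_homs[OF F G that]] homs_D[OF ep_homs[OF G H that]] homs_D[OF vcmp_self(1)] that by (simp add: homs_iff)
 have rm: "ap F$a H$a (bil (?r a) s t) m = Ea A G H a s (Ea A F G a t m)"
  if "a : vob A" "s : El ?X" "t : El ?Y" "m : El F$a" for a s t m
 proof -
  have "bil (?r a) s t = cp VV F$a G$a H$a (lin (ep A G H a) s) (lin (ep A F G a) t)"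
   unfolding cp_def
   by (rule bil_lin[OF vcmp_self(1) that(2,3) ep_homs[OF G H that(1)] ep_homs[OF F G that(1)], symmetric]) (use that in simp_all)
  then show ?thesis
   unfolding Ea_def using that lin_El[OF ep_homs] by (simp add: vcmp_self(2))
 qed
 have eq: "(ep A F H a \<cdot> u = ?r a) \<longleftrightarrow> (ALL s : El ?X. ALL t : El ?Y. ALL m : El F$a.
   Ea A F H a (bil u s t) m = Ea A G H a s (Ea A F G a t m))"
  if u: "u : homs V (?X \<otimes> ?Y) (eo A F H)" and a: "a : vob A" for u a
 proof
  assume *: "ep A F H a \<cdot> u = ?r a"
  show "ALL s : El ?X. ALL t : El ?Y. ALL m : El F$a. Ea A F H a (bil u s t) m = Ea A G H a s (Ea A F G a t m)"
   using rm[OF a] unfolding Ea_def[of A F H] using lin_bil[OF u _ _ ep_homs[OF F H a]] * by simp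
 next
  assume *: "ALL s : El ?X. ALL t : El ?Y. ALL m : El F$a. Ea A F H a (bil u s t) m = Ea A G H a s (Ea A F G a t m)"
  show "ep A F H a \<cdot> u = ?r a"
  proof (rule bil_ext[OF cmp_homs[OF u ep_homs[OF F H a]] rh[OF a]])
   fix s t assume st: "s : El ?X" "t : El ?Y"
   show "bil (ep A F H a \<cdot> u) s t = bil (?r a) s t"
   proof (rule ap_ext[OF bil_El[OF cmp_homs[OF u ep_homs[OF F H a]] st] bil_El[OF rh[OF a] st]])
    fix m assume "m : El F$a"
    then show "ap F$a H$a (bil (ep A F H a \<cdot> u) s t) m = ap F$a H$a (bil (?r a) s t) m"
     using rm[OF a st] * st unfolding Ea_def[of A F H] lin_bil[OF u st ep_homs[OF F H a], symmetric] by simp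
   qed (use a in simp_all)
  qed simp_all
 qed
 let ?t = "%s t a m. Ea A G H a s (Ea A F G a t m)"
 have ev: "eqv A F H (st s @ st t) (?t s t)" if "s : El ?X" "t : El ?Y" for s t
  unfolding eqv_def
 proof (intro conjI ballI)
  fix a assume "a : vob A"
  then show "nat1 (st s @ st t) [] F$a H$a (?t s t a)"
   by (intro nat1_conv[OF nat1_Ea2[OF nat1_Ea2[OF nat1_id]]]) (use that in simp_all)
 qed (use that in "simp add: Ea_ract")
 note E = EL[OF F H ev]
 let ?T = "%s t. EL F H (st s @ st t) (?t s t)"
 have n1: "nat1 [] (st t) ?X (eo A F H) (%s. ?T s t)" if "t : El ?Y" for t
  by (rule nat1_EL) (use that ev in "simp_all add: nat1_conv[OF nat1_Ea1[OF nat1_id]]")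
 have n2: "nat1 (st s) [] ?Y (eo A F H) (?T s)" if s: "s : El ?X" for s
 proof (rule nat1_EL[OF F H])
  fix a m assume "a : vob A" "m : El F$a"
  then show "nat1 (st s) ([] @ st m) ?Y H$a (%t. ?t s t a m)"
   by (intro nat1_conv[OF nat1_Ea2[OF nat1_Ea1[OF nat1_id]]]) (use s in simp_all)
 qed (use s ev in simp_all)
 note ar = arr2[OF n1 n2 eo_obj eo_obj]
 have ex: "?P (arr2 ?X ?Y ?T)"
  using ar(1) eq ar(2) E(3) by auto
 have un: "u = v" if u: "?P u" and v: "?P v" for u v
 proof (rule bil_ext)
  show "u : homs V (?X \<otimes> ?Y) (eo A F H)" "v : homs V (?X \<otimes> ?Y) (eo A F H)" using u v by auto
  fix s t assume st: "s : El ?X" "t : El ?Y"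
  have uv: "u : homs V (?X \<otimes> ?Y) (eo A F H)" "v : homs V (?X \<otimes> ?Y) (eo A F H)" using u v by auto
  show "bil u s t = bil v s t"
  proof (rule Ea_ext[OF F H bil_El[OF uv(1) st] bil_El[OF uv(2) st]])
   fix a m assume am: "a : vob A" "m : El F$a"
   have "Ea A F H a (bil u s t) m = Ea A G H a s (Ea A F G a t m)"
    using eq u am st by blast
   moreover have "Ea A F H a (bil v s t) m = Ea A G H a s (Ea A F G a t m)"
    using eq v am st by blast
   ultimately show "Ea A F H a (bil u s t) m = Ea A F H a (bil v s t) m" by simp
  qed simp
 qed simp_all
 have P: "?P (vcmp (Fun A FF) F G H)"
  using theI[of ?P, OF ex un[OF _ ex]] by (simp add: funcat_def)
 then show "vcmp (Fun A FF) F G H : homs V (?X \<otimes> ?Y) (eo A F H)" by simp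
 show "a : vob A ==> s : El ?X ==> t : El ?Y ==> m : El F$a ==>
   Ea A F H a (cp (Fun A FF) F G H s t) m = Ea A G H a s (Ea A F G a t m)"
  using P eq[of "vcmp (Fun A FF) F G H" a] unfolding cp_def by blast
qed

lemma cp_Fun_El [simp]: "F : FF ==> G : FF ==> H : FF ==> s : El (eo A G H) ==> t : El (eo A F G) ==>
  cp (Fun A FF) F G H s t : El (eo A F H)"
 unfolding cp_def by (rule bil_El[OF vcmp_Fun(1)])

lemma idg_Fun_El [simp]: "F : FF ==> idg (Fun A FF) F : El (eo A F F)"
 unfolding idg_def by (rule glb_El[OF vid_Fun(1)])

lemma vcategory_Fun [simp]: "cat (Fun A FF)"
proof (rule vcategoryI; (unfold Fun_simps)?)
 fix F G H J h g f assume "F : FF" "G : FF" "H : FF" "J : FF"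
  "h : El (eo A H J)" "g : El (eo A G H)" "f : El (eo A F G)"
 then show "cp (Fun A FF) F G J (cp (Fun A FF) G H J h g) f = cp (Fun A FF) F H J h (cp (Fun A FF) F G H g f)"
  by - (rule Ea_ext[of F J]; simp add: vcmp_Fun(2))
next
 fix F G f assume "F : FF" "G : FF" "f : El (eo A F G)"
 then show "cp (Fun A FF) F G G (idg (Fun A FF) G) f = f" "cp (Fun A FF) F F G f (idg (Fun A FF) F) = f"
  by - (rule Ea_ext[of F G]; simp add: vcmp_Fun(2) vid_Fun(2))+
qed (use vid_Fun(1) vcmp_Fun(1) in simp_all)

end

section \<open>The Yoneda embedding and weighted colimits in terms of elements\<close>


context
 fixes A :: "('a, 'o, 'm) vcat" and FF
 assumes mc: "mcat A FF"
begin

text \<open>The Yoneda correspondence from elements of \<open>F b\<close> to transformations out of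
  \<open>A(-, b)\<close>. Its inverse evaluates at the identity of \<open>b\<close>, as
  \<open>Ea_rep\<close> shows.\<close>

definition "yon F b x = EL A (yo A b) F (st x) (%a. ract A F a b x)"

lemma yon_eqv:
 assumes F: "F : FF" and b: "b : vob A" "yo A b : FF" and x: "x : El F$b"
 shows "eqv A (yo A b) F (st x) (%a. ract A F a b x)"
 unfolding eqv_def
proof (intro conjI ballI)
 note [simp] = mc_A[OF mc] mc_rmod[OF mc F]
 fix a assume "a : vob A"
 then show "nat1 (st x) [] (yo A b)$a F$a (ract A F a b x)"
  using b x by (simp add: nat1_conv[OF nat1_ract2[OF nat1_id]])
next
 fix a a' m f assume "a : vob A" "a' : vob A" "m : El (yo A b)$a'" "f : EH A a a'"
 then show "ract A F a b x (ract A (yo A b) a a' m f) = ract A F a a' (ract A F a' b x m) f"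
  using b x mc_A[OF mc] mc_rmod[OF mc F] by (simp add: vrep ract_ract)
qed

lemma yon:
 assumes F: "F : FF" and b: "b : vob A" "yo A b : FF" and x: "x : El F$b"
 shows "yon F b x : El (eo A (yo A b) F)" "st (yon F b x) = st x"
  "a : vob A ==> g : EH A a b ==> Ea A (yo A b) F a (yon F b x) g = ract A F a b x g"
 using EL[OF mc b(2) F yon_eqv[OF assms]] x unfolding yon_def by simp_all

lemma Ea_rep:
 assumes F: "F : FF" and b: "b : vob A" "yo A b : FF" and t: "t : El (eo A (yo A b) F)"
  and a: "a : vob A" "g : EH A a b"
 shows "Ea A (yo A b) F a t g = ract A F a b (Ea A (yo A b) F b t (idg A b)) g"
 using Ea_ract[OF mc b(2) F a(1) b(1) t _ a(2), of "idg A b"] mc_A[OF mc] a b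
 by (simp add: vrep cp_idg)

lemma rep_ext:
 assumes F: "F : FF" and b: "b : vob A" "yo A b : FF" and t: "t : El (eo A (yo A b) F)" "s : El (eo A (yo A b) F)"
  "st s = st t" "Ea A (yo A b) F b s (idg A b) = Ea A (yo A b) F b t (idg A b)"
 shows "s = t"
 by (rule Ea_ext[OF mc b(2) F]) (use assms in "simp_all add: Ea_rep")

lemma nat1_yon:
 assumes F: "F : FF" and b: "b : vob A" "yo A b : FF"
 shows "nat1 [] [] F$b (eo A (yo A b) F) (yon F b)"
 unfolding yon_def
proof (rule nat1_EL[OF mc b(2) F])
 fix a m assume "a : vob A" "m : El (yo A b)$a"
 then show "nat1 [] ([] @ st m) F$b F$a (%x. ract A F a b x m)"
  using b mc_A[OF mc] mc_rmod[OF mc F] by (simp add: nat1_conv[OF nat1_ract1[OF nat1_id]])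
qed (use mc_obj[OF mc F] b yon_eqv[OF F b] in simp_all)

definition "Yf = \<lparr>fob = yo A, fmap = %b c. arr1 (vhom A b c) (yon (yo A c) b)\<rparr>"

lemma fob_Yf [simp]: "fob Yf = yo A" by (simp add: Yf_def)

lemma Yf:
 assumes r: "!!a. a : vob A ==> yo A a : FF"
 shows "func A (Fun A FF) Yf"
  "b : vob A ==> c : vob A ==> f : EH A b c ==> fm Yf b c f = yon (yo A c) b f"
  "b : vob A ==> c : vob A ==> f : EH A b c ==> a : vob A ==> g : EH A a b ==>
   Ea A (yo A b) (yo A c) a (fm Yf b c f) g = cp A a b c f g"
proof -
 note [simp] = r mc_A[OF mc]
 have n: "nat1 [] [] (vhom A b c) (eo A (yo A b) (yo A c)) (yon (yo A c) b)" if "b : vob A" "c : vob A" for b c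
  using nat1_yon[of "yo A c" b] that by simp
 note ar = arr1[OF n]
 show *: "fm Yf b c f = yon (yo A c) b f" if "b : vob A" "c : vob A" "f : EH A b c" for b c f
  using ar(2) that by (simp add: fm_def Yf_def)
 show **: "Ea A (yo A b) (yo A c) a (fm Yf b c f) g = cp A a b c f g"
  if "b : vob A" "c : vob A" "f : EH A b c" "a : vob A" "g : EH A a b" for a b c f g
  using that *[OF that(1-3)] yon(3)[of "yo A c" b f a g] by (simp add: vrep)
 have fE: "fm Yf b c f : El (eo A (yo A b) (yo A c))" if "b : vob A" "c : vob A" "f : EH A b c" for b c f
  using *[OF that] yon(1)[of "yo A c" b f] that by simp
 show "func A (Fun A FF) Yf"
 proof (rule vfunctorI; (unfold Fun_simps fob_Yf)?)
  fix a assume a: "a : vob A"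
  show "fm Yf a a (idg A a) = idg (Fun A FF) (yo A a)"
   by (rule Ea_ext[OF mc r[OF a] r[OF a]]) (use a mc fE in "simp_all add: ** vid_Fun cp_idg")
 next
  fix a b c g f assume h: "a : vob A" "b : vob A" "c : vob A" "g : EH A b c" "f : EH A a b"
  show "fm Yf a c (cp A a b c g f) = cp (Fun A FF) (yo A a) (yo A b) (yo A c) (fm Yf b c g) (fm Yf a b f)"
   by (rule Ea_ext[OF mc r[OF h(1)] r[OF h(3)]]) (use h mc fE in "simp_all add: ** vcmp_Fun cp_assoc")
 next
  fix a b assume "a : vob A" "b : vob A"
  then show "fmap Yf a b : homs V (vhom A a b) (eo A (yo A a) (yo A b))"
   using ar(1) by (simp add: Yf_def)
 qed (use mc in simp_all)
qed

end

section \<open>Natural transformations, and weighted colimits through their units\<close>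

lemma vnat_iff:
 assumes A: "cat A" and B: "cat B" and F: "func A B F" and G: "func A B G"
 shows "vnat V A B F G alp \<longleftrightarrow> (ALL a : vob A. alp a : homs V I (vhom B F$a G$a)) &
  (ALL a : vob A. ALL b : vob A. ALL f : EH A a b.
   cp B F$a F$b G$b (glb (alp b)) (fm F a b f) = cp B F$a G$a G$b (fm G a b f) (glb (alp a)))"
proof -
 have "(vcmp B F$a F$b G$b \<cdot> (alp b \<odot> fmap F a b) \<cdot> lui (vhom A a b) =
    vcmp B F$a G$a G$b \<cdot> (fmap G a b \<odot> alp a) \<cdot> rui (vhom A a b)) \<longleftrightarrow>
   (ALL f : EH A a b.
   cp B F$a F$b G$b (glb (alp b)) (fm F a b f) = cp B F$a G$a G$b (fm G a b f) (glb (alp a)))"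
  (is "?L = ?R \<longleftrightarrow> _")
  if [simp]: "a : vob A" "b : vob A" and al: "alp a : homs V I (vhom B F$a G$a)" "alp b : homs V I (vhom B F$b G$b)" for a b
 proof -
  note [simp] = A B vfunctorD(1)[OF F] vfunctorD(1)[OF G]
  note Fh = vfunctorD(2)[OF F that(1,2)] and Gh = vfunctorD(2)[OF G that(1,2)]
  note d [simp] = homs_D[OF vcategoryD(3)[OF B]] homs_D[OF al(1)] homs_D[OF al(2)] homs_D[OF Fh] homs_D[OF Gh]
  have Lh: "?L : homs V (vhom A a b) (vhom B F$a G$b)" and Rh: "?R : homs V (vhom A a b) (vhom B F$a G$b)"
   by (simp_all add: homs_iff)
  have L: "lin ?L f = cp B F$a F$b G$b (glb (alp b)) (fm F a b f)" if f: "f : EH A a b" for f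
  proof -
   have "cp B F$a F$b G$b (glb (alp b)) (fm F a b f) =
    bil (vcmp B F$a F$b G$b \<cdot> (one (vhom B F$b G$b) \<odot> fmap F a b)) (glb (alp b)) f"
    unfolding cp_def fm_def by (rule bil_lin_right[OF vcategoryD(3) glb_El[OF al(2)] f Fh]) simp_all
   also have "... = lin ?L f"
    by (subst bil_glb_left[OF _ al(2) f, where Z = "vhom B F$a G$b"]) (simp_all add: homs_iff)
   finally show ?thesis by simp
  qed
  have R: "lin ?R f = cp B F$a G$a G$b (fm G a b f) (glb (alp a))" if f: "f : EH A a b" for f
  proof -
   have "cp B F$a G$a G$b (fm G a b f) (glb (alp a)) =
    bil (vcmp B F$a G$a G$b \<cdot> (fmap G a b \<odot> one (vhom B F$a G$a))) f (glb (alp a))"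
    unfolding cp_def fm_def by (rule bil_lin_left[OF vcategoryD(3) f glb_El[OF al(1)] Gh]) simp_all
   also have "... = lin ?R f"
    by (subst bil_glb_right[OF _ al(1) f, where Z = "vhom B F$a G$b"]) (simp_all add: homs_iff)
   finally show ?thesis by simp
  qed
  show ?thesis using L R lin_ext[OF Lh Rh] by metis
 qed
 note * = this
 show ?thesis
  unfolding vnat_def lui_def[symmetric] rui_def[symmetric]
  using * by (intro conj_cong refl ball_cong) auto
qed

lemma vnat_self_iff:
 assumes A: "cat A" and F: "smod A F" and G: "smod A G"
 shows "vnat V A VV F G alp \<longleftrightarrow> (ALL a : vob A. alp a : homs V I (hom F$a G$a)) &
  (ALL a : vob A. ALL b : vob A. ALL f : EH A a b. ALL x : El F$a.
   ap F$b G$b (glb (alp b)) (lact F a b f x) = lact G a b f (ap F$a G$a (glb (alp a)) x))"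
proof -
 note [simp] = smod_obj[OF F] smod_obj[OF G] smod_fm_El[OF F] smod_fm_El[OF G]
 have "(cp VV F$a F$b G$b (glb (alp b)) (fm F a b f) = cp VV F$a G$a G$b (fm G a b f) (glb (alp a)))
  \<longleftrightarrow> (ALL x : El F$a. ap F$b G$b (glb (alp b)) (lact F a b f x) = lact G a b f (ap F$a G$a (glb (alp a)) x))"
  (is "?l = ?r \<longleftrightarrow> ?P") if [simp]: "a : vob A" "b : vob A" "f : EH A a b" and al: "alp a : homs V I (hom F$a G$a)"
  "alp b : homs V I (hom F$b G$b)" for a b f
 proof
  note [simp] = glb_El[OF al(1)] glb_El[OF al(2)]
  have l: "ap F$a G$b ?l x = ap F$b G$b (glb (alp b)) (lact F a b f x)"
   and r: "ap F$a G$b ?r x = lact G a b f (ap F$a G$a (glb (alp a)) x)" if "x : El F$a" for x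
   using that by (simp_all add: vcmp_self lact_def)
  show "?l = ?r ==> ?P" using l r by auto
  assume ?P
  then show "?l = ?r"
   by - (rule ap_ext[of _ "F$a" "G$b"]; simp add: l r)
 qed
 then show ?thesis
  unfolding vnat_iff[OF A vcategory_self F G] self_simps by (intro conj_cong refl ball_cong) auto
qed

lemma glb_ucomp:
 assumes "cat A" "a : vob A" "b : vob A" "c : vob A"
 shows "glb (ucomp V A a b c g f) = cp A a b c (glb g) (glb f)"
 by (simp add: ucomp_def glb_def cp_def bil_def lui_def)

lemma viso_arr_iff:
 assumes "cat A" "a : vob A" "b : vob A"
 shows "viso_arr V A a b f \<longleftrightarrow> f : homs V I (vhom A a b) & (EX g : homs V I (vhom A b a).
  cp A a b a (glb g) (glb f) = idg A a & cp A b a b (glb f) (glb g) = idg A b)"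
 unfolding viso_arr_def using glb_ucomp[OF assms(1)] glb_inj assms unfolding idg_def by metis

text \<open>The right \<open>K\<close>-module \<open>C(S -, a)\<close>.\<close>

definition "homS C S a = fc (homf (Op C) a) (vfop S)"

lemma fob_homS [simp]: "(homS C S a)$k = vhom C S$k a"
 by (simp add: homS_def)

lemma homS:
 assumes C: "cat C" and K: "cat K" and S: "func K C S" and a: "a : vob C"
 shows "rmod K (homS C S a)"
  "k : vob K ==> l : vob K ==> g : EH C S$l a ==> h : EH K k l ==>
   ract K (homS C S a) k l g h = cp C S$k S$l a g (fm S k l h)"
proof -
 have v: "func (Op C) VV (homf (Op C) a)" by (rule vhom_fun) (use C a in simp_all)
 note f = vfunctor_vfcomp[OF vcategory_vop[OF K] vcategory_vop[OF C] vcategory_self v vfunctor_vfop[OF K C S]]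
 show r: "rmod K (homS C S a)" unfolding homS_def by (rule f)
 assume h: "k : vob K" "l : vob K" "g : EH C S$l a" "h : EH K k l"
 have Sh: "fm S k l h : EH C S$k S$l" using h S by simp
 have "lact (homS C S a) l k h g = lact (homf (Op C) a) S$l S$k (fm S k l h) g"
  unfolding lact_def homS_def using f(2) h by simp
 also have "... = cp (Op C) a S$l S$k (fm S k l h) g"
  using vhom_fun(2)[of "Op C" a "S$l" "S$k" "fm S k l h" g] h C a Sh vfunctorD(1)[OF S] by simp
 also have "... = sw [] (st g) (st h) [] (cp C S$k S$l a g (fm S k l h))"
  using vcmp_vop(2)[OF C] h a Sh vfunctorD(1)[OF S] by simp
 finally show "ract K (homS C S a) k l g h = cp C S$k S$l a g (fm S k l h)"
  using ract_lact[OF r h(1,2) _] h C a Sh vfunctorD(1)[OF S] by (simp add: sw_sw[of _ "vhom C S$k a"])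
qed

text \<open>
  \<open>c\<close> is the \<open>fi\<close>-weighted colimit of \<open>S\<close> with unit \<open>io k : fi k \<rightarrow> C (S k, c)\<close>.
\<close>

definition "ecolim C K fi S c io == c : vob C & eqv K fi (homS C S c) [] io &
  (ALL a : vob C. ALL ws t. ok ws --> eqv K fi (homS C S a) ws t -->
   (EX u : EH C c a. st u = ws & (ALL k : vob K. ALL p : El fi$k. cp C S$k c a u (io k p) = t k p))) &
  (ALL a : vob C. ALL u : EH C c a. ALL v : EH C c a. st u = st v -->
   (ALL k : vob K. ALL p : El fi$k. cp C S$k c a u (io k p) = cp C S$k c a v (io k p)) --> u = v)"

lemma eqv_cong:
 assumes t: "eqv K fi G ws t" and e: "!!k p. k : vob K ==> p : El fi$k ==> u k p = t k p" and "rmod K fi"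
 shows "eqv K fi G ws u"
 unfolding eqv_def
proof (intro conjI ballI)
 fix k assume k: "k : vob K"
 show "nat1 ws [] fi$k G$k (u k)"
  by (rule nat1_cong[of _ _ _ _ "t k"]) (use t k e in "auto simp: eqv_def")
next
 fix k l p f assume "k : vob K" "l : vob K" "p : El fi$l" "f : EH K k l"
 then show "u k (ract K fi k l p f) = ract K G k l (u l p) f"
  using t e assms(3) by (simp add: eqv_def)
qed

lemma ecolim_cong:
 assumes e: "!!k p. k : vob K ==> p : El fi$k ==> io' k p = io k p" and "rmod K fi"
 shows "ecolim C K fi S c io' \<longleftrightarrow> ecolim C K fi S c io"
proof -
 have "eqv K fi (homS C S c) [] io' \<longleftrightarrow> eqv K fi (homS C S c) [] io"
  using eqv_cong[OF _ _ assms(2)] e by metis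
 then show ?thesis unfolding ecolim_def using e by simp
qed

lemma ecolimD:
 assumes "ecolim C K fi S c io"
 shows "c : vob C" "eqv K fi (homS C S c) [] io"
  "k : vob K ==> nat1 [] [] fi$k (vhom C S$k c) (io k)"
  "k : vob K ==> p : El fi$k ==> io k p : EH C S$k c"
  "k : vob K ==> p : El fi$k ==> st (io k p) = st p"
  "a : vob C ==> ok ws ==> eqv K fi (homS C S a) ws t ==>
   EX u : EH C c a. st u = ws & (ALL k : vob K. ALL p : El fi$k. cp C S$k c a u (io k p) = t k p)"
  "a : vob C ==> u : EH C c a ==> v : EH C c a ==> st u = st v ==>
   (!!k p. k : vob K ==> p : El fi$k ==> cp C S$k c a u (io k p) = cp C S$k c a v (io k p)) ==> u = v"
proof -
 show n: "nat1 [] [] fi$k (vhom C S$k c) (io k)" if "k : vob K" for k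
  using assms that unfolding ecolim_def eqv_def by auto
 show "k : vob K ==> p : El fi$k ==> io k p : EH C S$k c"
  "k : vob K ==> p : El fi$k ==> st (io k p) = st p"
  using nat1D[OF n] by auto
qed (use assms in "auto simp: ecolim_def")

context
 fixes C :: "('c, 'o, 'm) vcat" and K :: "('k, 'o, 'm) vcat" and fi S
 assumes C [simp]: "cat C" and K [simp]: "cat K" and fi: "rmod K fi" and S: "func K C S"
begin

lemma wc_simps [simp]: "k : vob K ==> fi$k : obj V" "k : vob K ==> S$k : vob C"
 using rmod_obj[OF fi] vfunctorD(1)[OF S] by auto

text \<open>Yoneda: a family that is natural on the representable \<open>C(c, -)\<close> is
  determined by its value at the identity of \<open>c\<close>. Hence naturality of \<open>om\<close>
  means that it composes \<open>f\<close> with a fixed unit.\<close>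

lemma wcolim_vnat_iff:
 assumes c [simp]: "c : vob C" and k [simp]: "k : vob K"
  and om: "!!a. a : vob C ==> om a : homs V (vhom C c a) (hom fi$k (vhom C S$k a))"
 shows "vnat V C VV (homf C c)
          (fc (homf VV fi$k) (homf C S$k))
          (%a. name_of V (vhom C c a) (hom fi$k (vhom C S$k a)) (om a))
  \<longleftrightarrow> (ALL a : vob C. ALL f : EH C c a. ALL p : El fi$k.
   ap fi$k (vhom C S$k a) (lin (om a) f) p = cp C S$k c a f (ap fi$k (vhom C S$k c) (lin (om c) (idg C c)) p))"
proof -
 let ?G = "fc (homf VV fi$k) (homf C S$k)"
 have hs: "smod C (homf C S$k)" "func VV VV (homf VV fi$k)"
  by (rule vhom_fun; simp)+
 note G = vfunctor_vfcomp[OF C vcategory_self vcategory_self hs(2,1)]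
 have lG: "ap fi$k (vhom C S$k b) (lact ?G a b f x) p = cp C S$k a b f (ap fi$k (vhom C S$k a) x p)"
  if "a : vob C" "b : vob C" "f : EH C a b" "x : El (hom fi$k (vhom C S$k a))" "p : El fi$k" for a b f x p
 proof -
  have fE: "fm (homf C S$k) a b f : El (hom (vhom C S$k a) (vhom C S$k b))"
   using smod_fm_El[OF hs(1) that(1-3)] by simp
  have "lact ?G a b f x = lact (homf VV fi$k) (vhom C S$k a) (vhom C S$k b) (fm (homf C S$k) a b f) x"
   unfolding lact_def using G(2)[OF that(1-3)] by simp
  also have "... = cp VV fi$k (vhom C S$k a) (vhom C S$k b) (fm (homf C S$k) a b f) x"
   using vhom_fun(2)[of "VV" "fi$k"] fE that by simp
  finally show ?thesis
   using that fE vhom_fun(2)[OF C] by (simp add: vcmp_self lact_def)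
 qed
 note n = name_of[OF om]
 note h = vhom_fun[OF C c]
 have omE [simp]: "lin (om a) f : El (hom fi$k (vhom C S$k a))" if "a : vob C" "f : EH C c a" for a f
  using lin_El[OF om] that by simp
 have GE [simp]: "lact ?G a b f x : El (hom fi$k (vhom C S$k b))"
  if "a : vob C" "b : vob C" "f : EH C a b" "x : El (hom fi$k (vhom C S$k a))" for a b f x
  using lact_El[OF G(1) that(1,2,3)] that(4) by simp
 have "vnat V C VV (homf C c) ?G
          (%a. name_of V (vhom C c a) (hom fi$k (vhom C S$k a)) (om a)) \<longleftrightarrow>
   (ALL a : vob C. ALL b : vob C. ALL f : EH C a b. ALL x : EH C c a. lin (om b) (cp C c a b f x) = lact ?G a b f (lin (om a) x))"
  unfolding vnat_self_iff[OF C h(1) G(1)] using n h by simp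
 also have "... = (ALL a : vob C. ALL f : EH C c a. ALL p : El fi$k.
   ap fi$k (vhom C S$k a) (lin (om a) f) p = cp C S$k c a f (ap fi$k (vhom C S$k c) (lin (om c) (idg C c)) p))"
  (is "?P \<longleftrightarrow> ?Q")
 proof
  assume P: ?P
  show ?Q
  proof (intro ballI)
   fix a f p assume h: "a : vob C" "f : EH C c a" "p : El fi$k"
   have "lin (om a) f = lact ?G c a f (lin (om c) (idg C c))"
    using P[rule_format, of c a f "idg C c"] h by (simp add: cp_idg)
   then show "ap fi$k (vhom C S$k a) (lin (om a) f) p = cp C S$k c a f (ap fi$k (vhom C S$k c) (lin (om c) (idg C c)) p)"
    using h lG by simp
  qed
 next
  assume Q: ?Q
  show ?P
  proof (intro ballI)
   fix a b f x assume h: "a : vob C" "b : vob C" "f : EH C a b" "x : EH C c a"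
   show "lin (om b) (cp C c a b f x) = lact ?G a b f (lin (om a) x)"
   proof (rule ap_ext[of _ "fi$k" "vhom C S$k b"])
    fix p assume p: "p : El fi$k"
    show "ap fi$k (vhom C S$k b) (lin (om b) (cp C c a b f x)) p = ap fi$k (vhom C S$k b) (lact ?G a b f (lin (om a) x)) p"
     using h p Q[rule_format, of b "cp C c a b f x" p] Q[rule_format, of a x p] by (simp add: lG cp_assoc)
   qed (use h in simp_all)
  qed
 qed
 finally show ?thesis .
qed

text \<open>The unit is the image of the identity of \<open>c\<close>. Once \<open>om\<close> is
  known to be composition with it, the end conditions become the universal property of this
  unit.\<close>

lemma wcolim_ecolim:
 assumes w: "wcolim V C K fi S c om"
 defines "io == %k. ap fi$k (vhom C S$k c) (lin (om c k) (idg C c))"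
 shows "ecolim C K fi S c io"
  "a : vob C ==> k : vob K ==> om a k : homs V (vhom C c a) (hom fi$k (vhom C S$k a))"
  "a : vob C ==> k : vob K ==> f : EH C c a ==> p : El fi$k ==>
   ap fi$k (vhom C S$k a) (lin (om a k) f) p = cp C S$k c a f (io k p)"
proof -
 have c [simp]: "c : vob C" and
  e: "!!a. a : vob C ==> hom_end V (Op K) VV fi (homS C S a) (vhom C c a) (om a)" and
  n: "!!k. k : vob K ==> vnat V C VV (homf C c)
          (fc (homf VV fi$k) (homf C S$k))
          (%a. name_of V (vhom C c a) (hom fi$k (vhom C S$k a)) (om a k))"
  using w unfolding wcolim_def homS_def by auto
 note h = homS(1)[OF C K S]
 show om: "om a k : homs V (vhom C c a) (hom fi$k (vhom C S$k a))" if "a : vob C" "k : vob K" for a k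
  using hom_end_wedge(2)[OF K fi h e] that by simp
 show f: "ap fi$k (vhom C S$k a) (lin (om a k) f) p = cp C S$k c a f (io k p)"
  if "a : vob C" "k : vob K" "f : EH C c a" "p : El fi$k" for a k f p
  using iffD1[OF wcolim_vnat_iff[OF c that(2), of "%a. om a k", OF om[OF _ that(2)]] n[OF that(2)]] that(1,3,4)
  unfolding io_def by blast
 have io: "eqv K fi (homS C S c) [] io"
  unfolding eqv_def io_def
 proof (intro conjI ballI)
  fix k assume k: "k : vob K"
  show "nat1 [] [] fi$k (homS C S c)$k (ap fi$k (vhom C S$k c) (lin (om c k) (idg C c)))"
   using k lin_El[OF om] by (simp add: nat1_conv[OF nat1_ap2[OF nat1_id _ _ _ refl]])
 next
  fix k l p f assume "k : vob K" "l : vob K" "p : El fi$l" "f : EH K k l"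
  then show "ap fi$k (vhom C S$k c) (lin (om c k) (idg C c)) (ract K fi k l p f) =
   ract K (homS C S c) k l (ap fi$l (vhom C S$l c) (lin (om c l) (idg C c)) p) f"
   using hom_end_wedge(3)[OF K fi h e] by simp
 qed
 show "ecolim C K fi S c io"
  unfolding ecolim_def
 proof (intro conjI ballI allI impI)
  fix a ws t assume a: "a : vob C" and ws: "ok ws" and t: "eqv K fi (homS C S a) ws t"
  from hom_end_ex[OF K fi h[OF a] e[OF a] t ws] show
   "EX u:EH C c a. st u = ws & (ALL k:vob K. ALL p:El fi$k. cp C S$k c a u (io k p) = t k p)"
   using f[OF a] by (metis fob_homS)
 next
  fix a u v assume *: "a : vob C" "u : EH C c a" "v : EH C c a" "st u = st v"
   "ALL k : vob K. ALL p : El fi$k. cp C S$k c a u (io k p) = cp C S$k c a v (io k p)"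
  show "u = v"
   by (rule hom_end_ext[OF K fi h[OF *(1)] e[OF *(1)] *(2-4)]) (use * f in simp)
 qed (use io in simp_all)
qed

definition "om c io a k = arr1 (vhom C c a) (%f. lamF (st f) fi$k (vhom C S$k a) (%p. cp C S$k c a f (io k p)))"

lemma ecolim_wcolim:
 assumes E: "ecolim C K fi S c io"
 shows "wcolim V C K fi S c (om c io)"
  "a : vob C ==> k : vob K ==> om c io a k : homs V (vhom C c a) (hom fi$k (vhom C S$k a))"
  "a : vob C ==> k : vob K ==> f : EH C c a ==> p : El fi$k ==>
   ap fi$k (vhom C S$k a) (lin (om c io a k) f) p = cp C S$k c a f (io k p)"
proof -
 note d = ecolimD[OF E]
 note [simp] = d(1,4,5)
 have n1: "nat1 (st f) [] fi$k (vhom C S$k a) (%p. cp C S$k c a f (io k p))"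
  if "a : vob C" "k : vob K" "f : EH C c a" for a k f
  by (rule nat1_conv, rule nat1_cp2[OF d(3)]) (use that in simp_all)
 have n2: "nat1 [] [] (vhom C c a) (hom fi$k (vhom C S$k a))
  (%f. lamF (st f) fi$k (vhom C S$k a) (%p. cp C S$k c a f (io k p)))"
  if "a : vob C" "k : vob K" for a k
 proof (rule nat1_lamF)
  fix y assume "y : El fi$k"
  then show "nat1 [] ([] @ st y) (vhom C c a) (vhom C S$k a) (%x. cp C S$k c a x (io k y))"
   by (intro nat1_conv[OF nat1_cp1[OF nat1_id]]) (use that in simp_all)
 qed (use n1 that in simp_all)
 note a = arr1[OF n2]
 show h: "om c io a k : homs V (vhom C c a) (hom fi$k (vhom C S$k a))" if "a : vob C" "k : vob K" for a k
  unfolding om_def using a(1) that by simp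
 show f: "ap fi$k (vhom C S$k a) (lin (om c io a k) f) p = cp C S$k c a f (io k p)"
  if "a : vob C" "k : vob K" "f : EH C c a" "p : El fi$k" for a k f p
  unfolding om_def using a(2) lamF(2)[OF n1[OF that(1-3)] _] that by simp
 show "wcolim V C K fi S c (om c io)"
  unfolding wcolim_def homS_def[symmetric]
 proof (intro conjI ballI)
  fix b assume b: "b : vob C"
  show "hom_end V (Op K) VV fi (homS C S b) (vhom C c b) (om c io b)"
  proof (rule hom_endI[OF K fi homS(1)[OF C K S b]])
   fix k l t m h assume *: "k : vob K" "l : vob K" "t : EH C c b" "m : El fi$l" "h : EH K k l"
   have "io k (ract K fi k l m h) = cp C S$k S$l c (io l m) (fm S k l h)"
    using d(2) * homS(2)[OF C K S d(1) *(1,2), of "io l m" h] unfolding eqv_def by simp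
   then show "ap fi$k (homS C S b)$k (lin (om c io b k) t) (ract K fi k l m h) =
    ract K (homS C S b) k l (ap fi$l (homS C S b)$l (lin (om c io b l) t) m) h"
    using * b fi S by (simp add: f homS(2) cp_assoc)
  next
   fix ws t assume "ok ws" "eqv K fi (homS C S b) ws t"
   from d(6)[OF b this] show "EX u:EH C c b. st u = ws & (ALL k:vob K. ALL m:El fi$k.
     ap fi$k (homS C S b)$k (lin (om c io b k) u) m = t k m)"
    using f[OF b] by (metis fob_homS)
  next
   fix u v assume *: "u : EH C c b" "v : EH C c b" "st u = st v" "!!k m. k : vob K ==> m : El fi$k ==>
    ap fi$k (homS C S b)$k (lin (om c io b k) u) m = ap fi$k (homS C S b)$k (lin (om c io b k) v) m"
   show "u = v" by (rule d(7)[OF b *(1-3)]) (use *(1,2,4) f b in simp)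
  qed (use h b in simp_all)
 next
  fix k assume k: "k : vob K"
  show "vnat V C VV (homf C c) (fc (homf VV fi$k) (homf C S$k))
    (%a. name_of V (vhom C c a) (hom fi$k (vhom C S$k a)) (om c io a k))"
   by (rule iffD2[OF wcolim_vnat_iff[OF d(1) k, of "%a. om c io a k", OF h[OF _ k]]]) (use k f in "simp_all add: cp_idg")
 qed simp
qed

end

lemma ihom_post:
 assumes f: "f : homs V Y Z" and X [simp]: "ob X"
 shows "ihom_post V X Y Z f : homs V (hom X Y) (hom X Z)"
  "h : El (hom X Y) ==> x : El X ==> ap X Z (lin (ihom_post V X Y Z f) h) x = lin f (ap X Y h x)"
proof -
 note [simp] = homs_D[OF f]
 have e: "f \<cdot> ev V X Y : homs V (hom X Y \<otimes> X) Z" by (simp add: homs_iff)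
 note c = cur_props[OF e]
 show p: "ihom_post V X Y Z f : homs V (hom X Y) (hom X Z)" unfolding ihom_post_def by (rule c) simp_all
 assume "h : El (hom X Y)" "x : El X"
 then show "ap X Z (lin (ihom_post V X Y Z f) h) x = lin f (ap X Y h x)"
  unfolding ap_def using bil_lin_left[OF ev_homs _ _ p] lin_bil[OF ev_homs _ _ f] c(2)
  unfolding ihom_post_def by simp
qed

text \<open>Under the translation, compatibility of the two structure maps is one equation for every
  \<open>f\<close>. By functoriality of \<open>F\<close> it is equivalent to its case at the
  identity, which says that the unit of \<open>F c\<close> is the image of the unit of
  \<open>c\<close>.\<close>

lemma preserves_wcolim_iff:
 assumes C: "cat C" and D: "cat D" and F: "func C D F"
  and K: "cat K" and fi: "rmod K fi" and S: "func K C S"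
 shows "preserves_wcolim V C D F K fi S = (ALL c io. ecolim C K fi S c io -->
  ecolim D K fi (fc F S) F$c (%k p. fm F S$k c (io k p)))"
proof -
 note FS = vfunctor_vfcomp(1)[OF K C D F S]
 note [simp] = C D K vfunctorD(1)[OF F] vfunctorD(1)[OF S] rmod_obj[OF fi] fm_El[OF F]
 have *: "(omg' F$a k \<cdot> fmap F c a = ihom_post V fi$k (vhom C S$k a)
         (vhom D F$(S$k) F$a) (fmap F S$k a) \<cdot> omg a k) \<longleftrightarrow>
  (ALL f : EH C c a. ALL p : El fi$k. cp D F$(S$k) F$c F$a (fm F c a f) (io' k p) =
   fm F S$k a (cp C S$k c a f (io k p)))"
  (is "?l = ?r \<longleftrightarrow> ?R")
  if c [simp]: "c : vob C" "a : vob C" "k : vob K" and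
   o: "omg a k : homs V (vhom C c a) (hom fi$k (vhom C S$k a))" and
   o': "omg' F$a k : homs V (vhom D F$c F$a) (hom fi$k (vhom D F$(S$k) F$a))"
   and w: "!!f p. f : EH C c a ==> p : El fi$k ==>
    ap fi$k (vhom C S$k a) (lin (omg a k) f) p = cp C S$k c a f (io k p)"
   and w': "!!f p. f : EH D F$c F$a ==> p : El fi$k ==>
    ap fi$k (vhom D F$(S$k) F$a) (lin (omg' F$a k) f) p = cp D F$(S$k) F$c F$a f (io' k p)"
  for c a k omg omg' io io'
 proof -
  have fh: "fmap F c a : homs V (vhom C c a) (vhom D F$c F$a)" and
   gh: "fmap F S$k a : homs V (vhom C S$k a) (vhom D F$(S$k) F$a)"
   using vfunctorD(2)[OF F] by simp_all
  have ph: "fi$k : obj V" by simp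
  note post = ihom_post[OF gh ph]
  note lh = cmp_homs[OF fh o'] and rh = cmp_homs[OF o post(1)]
  have L: "ap fi$k (vhom D F$(S$k) F$a) (lin ?l f) p = cp D F$(S$k) F$c F$a (fm F c a f) (io' k p)"
   and R: "ap fi$k (vhom D F$(S$k) F$a) (lin ?r f) p = fm F S$k a (cp C S$k c a f (io k p))"
   if "f : EH C c a" "p : El fi$k" for f p
   using that lin_lin[OF that(1) fh o'] lin_lin[OF that(1) o post(1)] w'[of "fm F c a f" p] post(2)[OF lin_El[OF o that(1)]] w by (simp_all add: fm_def[symmetric])
  show ?thesis
  proof
   show "?l = ?r ==> ?R" using L R by metis
   assume "?R"
   show "?l = ?r"
   proof (rule lin_ext[OF lh rh])
    fix f assume f: "f : EH C c a"
    show "lin ?l f = lin ?r f"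
     by (rule ap_ext[OF lin_El[OF lh f] lin_El[OF rh f]]) (use `?R` L R f in simp_all)
   qed
  qed
 qed
 show ?thesis
 proof
  assume P: "preserves_wcolim V C D F K fi S"
  show "ALL c io. ecolim C K fi S c io --> ecolim D K fi (fc F S) F$c (%k p. fm F S$k c (io k p))"
  proof (intro allI impI)
   fix c io assume E: "ecolim C K fi S c io"
   note w = ecolim_wcolim[OF C K fi S E]
   note d = ecolimD[OF E]
   obtain omg' where w': "wcolim V D K fi (fc F S) F$c omg'" and
    e: "!!a k. a : vob C ==> k : vob K ==> omg' F$a k \<cdot> fmap F c a = ihom_post V fi$k (vhom C S$k a)
         (vhom D F$(S$k) F$a) (fmap F S$k a) \<cdot> om C fi S c io a k"
    using P w(1) unfolding preserves_wcolim_def by blast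
   let ?io = "%k. ap fi$k (vhom D F$(S$k) F$c) (lin (omg' F$c k) (idg D F$c))"
   note v = wcolim_ecolim[OF D K fi FS w', unfolded fob_vfcomp]
   have "?io k p = fm F S$k c (io k p)" if k: "k : vob K" and p: "p : El fi$k" for k p
   proof -
    have "ALL f : EH C c c. ALL p : El fi$k. cp D F$(S$k) F$c F$c (fm F c c f) (?io k p) =
     fm F S$k c (cp C S$k c c f (io k p))"
     by (rule iffD1[OF *[of c c k "om C fi S c io" omg' io ?io, OF d(1) d(1) k w(2)[OF d(1) k] v(2)[OF _ k] w(3)[OF d(1) k] v(3)[OF _ k]]
      e[OF d(1) k]]) (use d(1) in simp_all)
    from this[rule_format, of "idg C c" p] show ?thesis
     using p d(1) d(4) v(1)[THEN ecolimD(4), OF k p] k by (simp add: fm_idg[OF F] cp_idg)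
   qed
   then show "ecolim D K fi (fc F S) F$c (%k p. fm F S$k c (io k p))"
    using iffD1[OF ecolim_cong[OF _ fi] v(1)] by simp
  qed
 next
  assume P: "ALL c io. ecolim C K fi S c io --> ecolim D K fi (fc F S) F$c (%k p. fm F S$k c (io k p))"
  show "preserves_wcolim V C D F K fi S"
   unfolding preserves_wcolim_def
  proof (intro allI impI)
   fix c omg assume W: "wcolim V C K fi S c omg"
   note v = wcolim_ecolim[OF C K fi S W]
   note d = ecolimD[OF v(1)]
   let ?io = "%k. ap fi$k (vhom C S$k c) (lin (omg c k) (idg C c))"
   let ?io' = "%k p. fm F S$k c (?io k p)"
   have "ecolim D K fi (fc F S) F$c ?io'" using P v(1) by blast
   note w = ecolim_wcolim[OF D K fi FS this, unfolded fob_vfcomp]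
   show "EX omg'. wcolim V D K fi (fc F S) F$c omg' & (ALL a:vob C. ALL k:vob K.
     omg' F$a k \<cdot> fmap F c a = ihom_post V fi$k (vhom C S$k a)
         (vhom D F$(S$k) F$a) (fmap F S$k a) \<cdot> omg a k)"
   proof (intro exI conjI ballI)
    fix a k assume ak: "a : vob C" "k : vob K"
    show "om D fi (fc F S) F$c ?io' F$a k \<cdot> fmap F c a = ihom_post V fi$k (vhom C S$k a)
         (vhom D F$(S$k) F$a) (fmap F S$k a) \<cdot> omg a k"
    proof (rule iffD2[OF *[of c a k omg "om D fi (fc F S) F$c ?io'" ?io ?io', OF d(1) ak v(2)[OF ak] w(2)[OF _ ak(2)] v(3)[OF ak] w(3)[OF _ ak(2)]]])
     show "ALL f:EH C c a. ALL p:El fi$k. cp D F$(S$k) F$c F$a (fm F c a f) (?io' k p) =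
      fm F S$k a (cp C S$k c a f (?io k p))"
      using ak d(1,4) by (simp add: fm_cp[OF C D F])
    qed (use ak in simp_all)
   qed (rule w(1))
  qed
 qed
qed

end

section \<open>Existence of small ends\<close>

lemma small_set_inj:
 fixes ka :: "'u rel" and X :: "'i set"
 assumes "Card_order ka" "small_set ka X"
 obtains g :: "'i => 'u" where "inj_on g X"
proof -
 have "|X| \<le>o |Field ka|"
  using assms card_of_Field_ordIso ordIso_symmetric ordLess_imp_ordLeq ordLeq_ordIso_trans
  unfolding small_set_def by blast
 then show ?thesis using that unfolding card_of_ordLeq[symmetric] by blast
qed

lemma small_set_image: "small_set ka X ==> small_set ka (f ` X)"
 unfolding small_set_def using card_of_image ordLeq_ordLess_trans by blast

lemma small_set_subset: "small_set ka X ==> Y <= X ==> small_set ka Y"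
 unfolding small_set_def using card_of_mono1 ordLeq_ordLess_trans by blast

text \<open>\<open>complete_cat\<close> provides limits of shapes whose objects and arrows lie in
  \<open>'u\<close>. A small shape on other types is copied there along injections, and the limit
  cone is transported back.\<close>

lemma complete_cat_any:
 fixes ka :: "'u rel" and C :: "('o, 'm, 'x) cat_scheme" and J :: "('i, 'j) cat"
 assumes C: "category C" "complete_cat ka C" and k: "Card_order ka" and J: "category J"
  and s: "small_set ka (obj J)" "small_set ka (arr J)" and d: "diagram J C D d"
 shows "EX L p. limit_cone J C D d L p"
proof -
 obtain g :: "'i => 'u" where g: "inj_on g (obj J)" using small_set_inj[OF k s(1)] by blast
 obtain h :: "'j => 'u" where h: "inj_on h (arr J)" using small_set_inj[OF k s(2)] by blast
 define g' where "g' = the_inv_into (obj J) g"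
 define h' where "h' = the_inv_into (arr J) h"
 have g' [simp]: "g' (g i) = i" if "i : obj J" for i
  unfolding g'_def using the_inv_into_f_f[OF g that] .
 have h' [simp]: "h' (h i) = i" if "i : arr J" for i
  unfolding h'_def using the_inv_into_f_f[OF h that] .
 interpret J: category J by (rule J)
 define J' :: "('u, 'u) cat" where "J' = \<lparr>obj = g ` obj J, arr = h ` arr J, src = %u. g (src J (h' u)),
  tgt = %u. g (tgt J (h' u)), idt = %u. h (idt J (g' u)), cmp = %v u. h (h' v \<cdot>\<^bsub>J\<^esub> h' u)\<rparr>"
 have geq: "g x = g y \<longleftrightarrow> x = y" if "x : obj J" "y : obj J" for x y using g that by (auto simp: inj_on_def)
 have J': "category J'"
 proof
  fix f assume "f : arr J'" then show "src J' f : obj J'" "tgt J' f : obj J'" by (auto simp: J'_def)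
 next
  fix X assume "X : obj J'" then show "idt J' X : homs J' X X" by (auto simp: J'_def homs_def)
 next
  fix X Y Z f k assume "f : homs J' X Y" "k : homs J' Y Z"
  then show "k \<cdot>\<^bsub>J'\<^esub> f : homs J' X Z" by (auto simp: J'_def homs_def geq)
 next
  fix X Y f assume "f : homs J' X Y"
  then show "idt J' Y \<cdot>\<^bsub>J'\<^esub> f = f" "f \<cdot>\<^bsub>J'\<^esub> idt J' X = f" by (auto simp: J'_def homs_def)
 next
  fix W X Y Z f k l assume "f : homs J' W X" "k : homs J' X Y" "l : homs J' Y Z"
  then show "(l \<cdot>\<^bsub>J'\<^esub> k) \<cdot>\<^bsub>J'\<^esub> f = l \<cdot>\<^bsub>J'\<^esub> (k \<cdot>\<^bsub>J'\<^esub> f)" by (auto simp: J'_def homs_def geq)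
 qed
 let ?D = "%u. D (g' u)" and ?d = "%u. d (h' u)"
 have dg: "diagram J' C ?D ?d"
  using d unfolding diagram_def J'_def by (auto simp: geq)
 have "small_set ka (obj J')" "small_set ka (arr J')"
  using s by (simp_all add: J'_def small_set_image)
 then obtain L p where L: "limit_cone J' C ?D ?d L p"
  using C(2) J' dg unfolding complete_cat_def by blast
 have cone: "cone J C D d M q \<longleftrightarrow> cone J' C ?D ?d M (%u. q (g' u))" for M q
  unfolding cone_def J'_def by simp
 have pcone: "cone J C D d L (%i. p (g i))"
  using L unfolding limit_cone_def cone_def J'_def by simp
 have "limit_cone J C D d L (%i. p (g i))"
  unfolding limit_cone_def
 proof (intro conjI allI impI pcone)
  fix M q assume "cone J C D d M q"
  then have "EX! u. u : homs C M L & (ALL i : obj J'. p i \<cdot>\<^bsub>C\<^esub> u = q (g' i))"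
   using L unfolding cone limit_cone_def by blast
  then show "EX! u. u : homs C M L & (ALL i : obj J. p (g i) \<cdot>\<^bsub>C\<^esub> u = q i)"
   by (simp add: J'_def)
 qed
 then show ?thesis by blast
qed

text \<open>
  The shape of the equaliser that computes an end over a category with objects \<open>R\<close>: the arrows
  \<open>Inr (True, k, l)\<close> and \<open>Inr (False, k, l)\<close> go from \<open>Inl k\<close> and \<open>Inl l\<close> to \<open>Inr (k, l)\<close>.
\<close>

definition end_shape :: "'k set => ('k + 'k \<times> 'k, ('k + 'k \<times> 'k) + bool \<times> 'k \<times> 'k) cat" where
 "end_shape R = \<lparr>obj = R <+> R \<times> R, arr = (R <+> R \<times> R) <+> UNIV \<times> R \<times> R,
  src = %f. case f of Inl i => i | Inr (b, k, l) => Inl (if b then k else l),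
  tgt = %f. case f of Inl i => i | Inr (b, k, l) => Inr (k, l),
  idt = Inl, cmp = %g f. case f of Inl i => g | Inr _ => f\<rparr>"

lemma category_end_shape: "category (end_shape R)"
 by unfold_locales (auto simp: end_shape_def homs_def split: sum.splits prod.splits if_splits)

lemma small_set_finite: "Cinfinite ka ==> finite X ==> small_set ka X"
 unfolding small_set_def by (rule Cfinite_ordLess_Cinfinite) (auto simp: cfinite_def Field_card_of card_of_card_order_on)

lemma small_set_Plus: "Cinfinite ka ==> small_set ka X ==> small_set ka Y ==> small_set ka (X <+> Y)"
 unfolding small_set_def cinfinite_def by (auto intro: card_of_Plus_ordLess_infinite_Field)

text \<open>When \<open>X <+> Y\<close> is infinite its square is no larger, and this square maps
  onto a superset of \<open>X \<times> Y\<close>. The finite case is immediate.\<close>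

lemma small_set_Times:
 assumes k: "Cinfinite ka" and X: "small_set ka X" and Y: "small_set ka Y"
 shows "small_set ka (X \<times> Y)"
proof -
 let ?U = "X <+> Y"
 have "small_set ka (?U \<times> ?U)"
 proof (cases "finite ?U")
  case False
  show ?thesis
   using ordIso_ordLess_trans[OF card_of_Times_same_infinite[OF False] small_set_Plus[OF k X Y, unfolded small_set_def]]
   unfolding small_set_def .
 next
  case True
  then show ?thesis by (intro small_set_finite[OF k] finite_SigmaI)
 qed
 then have "small_set ka ((%(u, v). (projl u, projr v)) ` (?U \<times> ?U))" by (rule small_set_image)
 moreover have "X \<times> Y <= (%(u, v). (projl u, projr v)) ` (?U \<times> ?U)"
 proof (clarify)
  fix x y assume "x : X" "y : Y"
  then show "(x, y) : (%(u, v). (projl u, projr v)) ` (?U \<times> ?U)"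
   by (intro image_eqI[of _ _ "(Inl x, Inr y)"]) auto
 qed
 ultimately show ?thesis by (rule small_set_subset)
qed

lemma small_end_shape:
 assumes k: "Cinfinite ka" and R: "small_set ka R"
 shows "small_set ka (obj (end_shape R))" "small_set ka (arr (end_shape R))"
 using R small_set_finite[OF k, of "UNIV :: bool set"] unfolding end_shape_def
 by (auto intro!: small_set_Plus[OF k] small_set_Times[OF k] simp del: UNIV_bool)

context symmetric_monoidal_closed
begin

lemma viso_arr_elem:
 assumes A: "cat A" and [simp]: "a : vob A" "b : vob A"
 shows "viso V A a b = (EX f : EH A a b. EX g : EH A b a. st f = [] & st g = [] &
  cp A a b a g f = idg A a & cp A b a b f g = idg A b)"
proof
 assume "viso V A a b"
 then obtain f g where "f : homs V I (vhom A a b)" "g : homs V I (vhom A b a)"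
  "cp A a b a (glb g) (glb f) = idg A a" "cp A b a b (glb f) (glb g) = idg A b"
  unfolding viso_def viso_arr_iff[OF assms] by blast
 then show "EX f : EH A a b. EX g : EH A b a. st f = [] & st g = [] &
  cp A a b a g f = idg A a & cp A b a b f g = idg A b"
  by (intro bexI[of _ "glb f"] bexI[of _ "glb g"]) (simp_all add: glb_El)
next
 assume "EX f : EH A a b. EX g : EH A b a. st f = [] & st g = [] &
  cp A a b a g f = idg A a & cp A b a b f g = idg A b"
 then obtain f g where f: "f : EH A a b" "st f = []" and g: "g : EH A b a" "st g = []"
  and e: "cp A a b a g f = idg A a" "cp A b a b f g = idg A b" by blast
 show "viso V A a b"
  unfolding viso_def viso_arr_iff[OF assms]
  using El_Nil(2)[OF f] El_Nil(2)[OF g] e El_Nil(1)[OF f, symmetric] El_Nil(1)[OF g, symmetric]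
  by (intro exI[of _ "snd f"] conjI bexI[of _ "snd g"]) simp_all
qed

lemma viso_refl: "cat A ==> a : vob A ==> viso V A a a"
 unfolding viso_arr_elem by (intro bexI[of _ "idg A a"]) (simp_all add: cp_idg)

text \<open>Smallness bounds only the isomorphism classes of \<open>K\<close>. The end is therefore
  computed as a limit over the set \<open>R\<close> of representatives, and its components at other
  objects are obtained by transport along isomorphisms to \<open>R\<close>.\<close>

lemma small_end_exists:
 fixes ka :: "'u rel" and K :: "('k, 'o, 'm) vcat"
 assumes u: "Cinfinite ka" and cc: "complete_cat ka V" and K: "cat K" and sm: "small_vcat ka V K"
  and F: "rmod K F" and G: "rmod K G"
 shows "EX E e. hom_end V (Op K) VV F G E e"
proof -
 note [simp] = K F G rmod_obj[OF F] rmod_obj[OF G]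
 let ?r = "{(a, b). a : vob K & b : vob K & viso V K a b}"
 define pick where "pick X = (SOME x. x : X)" for X :: "'k set"
 define R where "R = pick ` (vob K // ?r)"
 define rep where "rep k = pick (?r `` {k})" for k
 have R: "small_set ka R" using sm unfolding small_vcat_def R_def by (rule small_set_image)
 have pk: "pick (?r `` {k}) : ?r `` {k}" if "k : vob K" for k
  unfolding pick_def by (rule someI[of _ k]) (use viso_refl[OF K] that in auto)
 have rep: "rep k : R" "rep k : vob K" "viso V K k (rep k)" if "k : vob K" for k
  using pk[OF that] quotientI[OF that, of ?r] unfolding rep_def R_def by auto
 have RK: "k : vob K" if k: "k : R" for k
 proof -
  from k obtain l where "l : vob K" "k = pick (?r `` {l})" unfolding R_def by (auto elim!: quotientE)
  then show ?thesis using pk by auto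
 qed
 have "ALL k:vob K. EX i j. i : EH K k (rep k) & j : EH K (rep k) k & st i = [] & st j = [] & cp K k (rep k) k j i = idg K k"
  using rep(2,3) viso_arr_elem[OF K] by blast
 then obtain i j where ij: "!!k. k : vob K ==> i k : EH K k (rep k)" "!!k. k : vob K ==> j k : EH K (rep k) k"
  "!!k. k : vob K ==> st (i k) = []" "!!k. k : vob K ==> st (j k) = []"
  "!!k. k : vob K ==> cp K k (rep k) k (j k) (i k) = idg K k"
  by metis
 note [simp] = ij rep(2) RK
 let ?J = "end_shape R"
 \<comment> \<open>The object at \<open>(k, l)\<close> internalises the wedge equations for arrows
   from \<open>k\<close> to \<open>l\<close>: both sides are maps from
   \<open>F l \<otimes> K(k, l)\<close> to \<open>G k\<close>.\<close>
 define D where "D x = (case x of Inl k => hom F$k G$k | Inr (k, l) => hom (F$l \<otimes> vhom K k l) G$k)" for x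
 define ra where "ra M k l = (ev V M$l M$k \<cdot> (fmap M l k \<odot> one M$l)) \<cdot> swp V M$l (vhom K k l)"
  for M :: "('k, 'o, 'm) vfun" and k l
 have ra: "ra M k l : homs V (M$l \<otimes> vhom K k l) M$k" if "rmod K M" "k : vob K" "l : vob K" for M k l
  unfolding ra_def by (rule ract_homs) (use that in simp_all)
 have rar: "ract K M k l m f = bil (ra M k l) m f" for M k l m f unfolding ract_def ra_def ..
 \<comment> \<open>The two legs: act on the argument in \<open>F\<close> before \<open>t\<close> is
   applied (\<open>ga\<close>), or on the value in \<open>G\<close> afterwards
   (\<open>gb\<close>).\<close>
 define ga where "ga k l = cur V (hom F$k G$k) (F$l \<otimes> vhom K k l) G$k (ev V F$k G$k \<cdot> (one (hom F$k G$k) \<odot> ra F k l))" for k l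
 define gb where "gb k l = cur V (hom F$l G$l) (F$l \<otimes> vhom K k l) G$k
  (ra G k l \<cdot> (ev V F$l G$l \<odot> one (vhom K k l)) \<cdot> asi (hom F$l G$l) F$l (vhom K k l))" for k l
 have ga: "ga k l : homs V (hom F$k G$k) (hom (F$l \<otimes> vhom K k l) G$k)"
  "t : El (hom F$k G$k) ==> m : El F$l ==> f : EH K k l ==>
   ap (F$l \<otimes> vhom K k l) G$k (lin (ga k l) t) (bil (one (F$l \<otimes> vhom K k l)) m f) = ap F$k G$k t (ract K F k l m f)"
  if [simp]: "k : vob K" "l : vob K" for k l t m f
 proof -
  note r = ra[OF F that]
  have "ev V F$k G$k \<cdot> (one (hom F$k G$k) \<odot> ra F k l) : homs V (hom F$k G$k \<otimes> F$l \<otimes> vhom K k l) G$k"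
   using homs_D[OF r] by (simp add: homs_iff)
  note c = cur_props[OF this, folded ga_def]
  show "ga k l : homs V (hom F$k G$k) (hom (F$l \<otimes> vhom K k l) G$k)" by (rule c) simp_all
  assume *: "t : El (hom F$k G$k)" "m : El F$l" "f : EH K k l"
  then show "ap (F$l \<otimes> vhom K k l) G$k (lin (ga k l) t) (bil (one (F$l \<otimes> vhom K k l)) m f) = ap F$k G$k t (ract K F k l m f)"
   using bil_lin_left[OF ev_homs' *(1) pair_El[OF *(2,3)] c(1)] bil_lin_right[OF ev_homs' *(1) pair_El[OF *(2,3)] r] lin_pair[OF r] by (simp add: ap_def rar c(2))
 qed
 have gb: "gb k l : homs V (hom F$l G$l) (hom (F$l \<otimes> vhom K k l) G$k)"
  "t : El (hom F$l G$l) ==> m : El F$l ==> f : EH K k l ==>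
   ap (F$l \<otimes> vhom K k l) G$k (lin (gb k l) t) (bil (one (F$l \<otimes> vhom K k l)) m f) = ract K G k l (ap F$l G$l t m) f"
  if [simp]: "k : vob K" "l : vob K" for k l t m f
 proof -
  note r = ra[OF G that]
  have "ra G k l \<cdot> (ev V F$l G$l \<odot> one (vhom K k l)) \<cdot> asi (hom F$l G$l) F$l (vhom K k l)
    : homs V (hom F$l G$l \<otimes> F$l \<otimes> vhom K k l) G$k"
   using homs_D[OF r] by (simp add: homs_iff)
  note c = cur_props[OF this, folded gb_def]
  show "gb k l : homs V (hom F$l G$l) (hom (F$l \<otimes> vhom K k l) G$k)" by (rule c) simp_all
  assume *: "t : El (hom F$l G$l)" "m : El F$l" "f : EH K k l"
  then show "ap (F$l \<otimes> vhom K k l) G$k (lin (gb k l) t) (bil (one (F$l \<otimes> vhom K k l)) m f) = ract K G k l (ap F$l G$l t m) f"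
   using bil_lin_left[OF ev_homs' *(1) pair_El[OF *(2,3)] c(1)] bil_assoc_left[OF r ev_homs'] by (simp add: ap_def rar c(2))
 qed
 define d where "d x = (case x of Inl y => one (D y) | Inr (b, k, l) => if b then ga k l else gb k l)" for x
 have Do: "D x : obj V" if "x : obj ?J" for x
  using that unfolding D_def end_shape_def by auto
 have dh: "d f : homs V (D (src ?J f)) (D (tgt ?J f))" if f: "f : arr ?J" for f
 proof (cases f)
  case (Inl x)
  then have "x : obj ?J" using f by (auto simp: end_shape_def)
  then show ?thesis using idt_homs[OF Do] Inl by (simp add: end_shape_def d_def)
 next
  case (Inr y)
  then obtain b k l where y: "f = Inr (b, k, l)" "k : R" "l : R" using f by (cases y) (auto simp: end_shape_def)
  then show ?thesis using ga(1)[OF RK[OF y(2)] RK[OF y(3)]] gb(1)[OF RK[OF y(2)] RK[OF y(3)]]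
   by (cases b) (simp_all add: end_shape_def d_def D_def)
 qed
 have dia: "diagram ?J V D d"
  unfolding diagram_def
 proof (intro conjI ballI impI)
  fix f g assume fg: "f : arr ?J" "g : arr ?J" "src ?J g = tgt ?J f"
  show "d (g \<cdot>\<^bsub>?J\<^esub> f) = d g \<cdot> d f"
  proof (cases f)
   case (Inl x)
   then have "x : obj ?J" "src ?J g = x" using fg by (auto simp: end_shape_def)
   then show ?thesis using homs_D[OF dh[OF fg(2)]] Inl by (simp add: d_def) (simp add: end_shape_def)
  next
   case (Inr y)
   then obtain b k l where y: "f = Inr (b, k, l)" by (cases y) auto
   then obtain x where x: "g = Inl x" using fg by (cases g) (auto simp: end_shape_def split: if_splits)
   then have "x = tgt ?J f" using fg by (simp add: end_shape_def)
   then show ?thesis using homs_D[OF dh[OF fg(1)]] x y d_def by (simp add: end_shape_def)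
  qed
 qed (use Do dh in "auto simp: end_shape_def d_def")
 obtain L p where L: "limit_cone ?J V D d L p"
  using complete_cat_any[OF _ cc _ category_end_shape small_end_shape[OF u R] dia] category_axioms u by blast
 have cone: "cone ?J V D d L p" using L unfolding limit_cone_def by blast
 have Lo [simp]: "ob L" using cone unfolding cone_def by blast
 have p: "p (Inl k) : homs V L (hom F$k G$k)" if "k : R" for k
 proof -
  have "Inl k : obj ?J" using that by (auto simp: end_shape_def)
  then have "p (Inl k) : homs V L (D (Inl k))" using cone unfolding cone_def by blast
  then show ?thesis by (simp add: D_def)
 qed
 have pw: "ga k l \<cdot> p (Inl k) = p (Inr (k, l))" "gb k l \<cdot> p (Inl l) = p (Inr (k, l))" if "k : R" "l : R" for k l
 proof -
  have *: "ALL f:arr ?J. d f \<cdot> p (src ?J f) = p (tgt ?J f)" using cone unfolding cone_def by blast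
  show "ga k l \<cdot> p (Inl k) = p (Inr (k, l))" "gb k l \<cdot> p (Inl l) = p (Inr (k, l))"
   using *[rule_format, of "Inr (True, k, l)"] *[rule_format, of "Inr (False, k, l)"] that
   by (simp_all add: end_shape_def d_def InrI)
 qed
 define q where "q k t m = ap F$k G$k (lin (p (Inl k)) t) m" for k t m
 have qE [simp]: "q k t m : El G$k" "st (q k t m) = st t @ st m" if "k : R" "t : El L" "m : El F$k" for k t m
  unfolding q_def using that lin_El[OF p] by simp_all
 have qr: "q k t (ract K F k l m f) = ract K G k l (q l t m) f"
  if "k : R" "l : R" "t : El L" "m : El F$l" "f : EH K k l" for k l t m f
 proof -
  have "lin (ga k l) (lin (p (Inl k)) t) = lin (gb k l) (lin (p (Inl l)) t)"
   using pw that lin_lin[OF that(3) p ga(1)] lin_lin[OF that(3) p gb(1)] by simp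
  then show ?thesis
   unfolding q_def using that ga(2)[of k l "lin (p (Inl k)) t" m f] gb(2) lin_El[OF p] by simp
 qed
 \<comment> \<open>Transport to the representative: \<open>m\<close> is moved along
   \<open>j k\<close>, the component at \<open>rep k\<close> is applied, and the value is moved back
   along \<open>i k\<close>.\<close>
 define c where "c k t m = ract K G k (rep k) (q (rep k) t (ract K F (rep k) k m (j k))) (i k)" for k t m
 have nq: "nat1 ps (rs @ st m) X G$k (%t. q k (x t) m)" if "k : R" "m : El F$k" "nat1 ps rs X L x" for k m ps rs X x
  unfolding q_def by (rule nat1_conv, rule nat1_ap1[OF nat1_lin[OF that(3) p[OF that(1)]] _ _ _ refl]) (use that in simp_all)
 have nq2: "nat1 (st t @ ps) rs X G$k (%m. q k t (x m))" if "k : R" "t : El L" "nat1 ps rs X F$k x" for k t ps rs X x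
  unfolding q_def by (rule nat1_conv, rule nat1_ap2[OF that(3) _ _ lin_El[OF p[OF that(1)] that(2)] refl]) (use that in simp_all)
 have nc2: "nat1 (st t) [] F$k G$k (c k t)" if "k : vob K" "t : El L" for k t
  unfolding c_def by (rule nat1_conv, rule nat1_ract1, rule nq2, rule rep(1), rule that(1), rule that(2), rule nat1_ract1, rule nat1_id)
   (use that in simp_all)
 have nc1: "nat1 [] (st m) L G$k (%t. c k t m)" if "k : vob K" "m : El F$k" for k m
  unfolding c_def by (rule nat1_conv, rule nat1_ract1, rule nq[OF rep(1) _ nat1_id], rule that(1))
   (use that in simp_all)
 define e where "e k = arr1 L (%t. lamF (st t) F$k G$k (c k t))" for k
 have ne: "nat1 [] [] L (hom F$k G$k) (%t. lamF (st t) F$k G$k (c k t))" if "k : vob K" for k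
  by (rule nat1_lamF) (use that nc1 nc2 in simp_all)
 have e: "e k : homs V L (hom F$k G$k)" if "k : vob K" for k
  unfolding e_def by (rule arr1(1)[OF ne[OF that] Lo])
 have ec: "ap F$k G$k (lin (e k) t) m = c k t m" if "k : vob K" "t : El L" "m : El F$k" for k t m
  unfolding e_def arr1(2)[OF ne[OF that(1)] Lo that(2)] by (rule lamF(2)[OF nc2[OF that(1,2)] _ that(3)]) (use that in simp)
 have ji: "ract K M k (rep k) (ract K M (rep k) k m (j k)) (i k) = m" if "rmod K M" "k : vob K" "m : El M$k" for M k m
  using that by (simp add: ract_ract ract_idg)
 have cR: "c k t m = q k t m" if "k : R" "t : El L" "m : El F$k" for k t m
  unfolding c_def using that rep(1) by (subst qr[symmetric]) (simp_all add: ji)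
 have "hom_end V (Op K) VV F G L e"
 proof (rule hom_endI[OF K F G Lo])
  fix a b t m f assume h [simp]: "a : vob K" "b : vob K" "t : El L" "m : El F$b" "f : EH K a b"
  \<comment> \<open>The arrow \<open>f\<close> conjugated to one between representatives, where the
    equaliser condition \<open>qr\<close> is available.\<close>
  let ?f = "cp K (rep a) b (rep b) (i b) (cp K (rep a) a b f (j a))"
  have "c a t (ract K F a b m f) = ract K G a (rep a) (q (rep a) t (ract K F (rep a) (rep b) (ract K F (rep b) b m (j b)) ?f)) (i a)"
   unfolding c_def using ji by (simp add: ract_ract[OF F, symmetric])
  also have "... = ract K G a (rep a) (ract K G (rep a) (rep b) (q (rep b) t (ract K F (rep b) b m (j b))) ?f) (i a)"
   using rep(1) by (simp add: qr)
  also have "... = ract K G a b (c b t m) f"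
   unfolding c_def using ji rep(1) by (simp add: ract_ract[OF G, symmetric])
  finally show "ap F$a G$a (lin (e a) t) (ract K F a b m f) = ract K G a b (ap F$b G$b (lin (e b) t) m) f"
   by (simp add: ec)
 next
  fix ws t assume ws: "ok ws" and t: "eqv K F G ws t"
  have n: "nat1 ws [] F$a G$a (t a)" if "a : vob K" for a using t that unfolding eqv_def by auto
  have tr: "t a (ract K F a b m f) = ract K G a b (t b m) f" if "a : vob K" "b : vob K" "m : El F$b" "f : EH K a b" for a b m f
   using t that unfolding eqv_def by auto
  define lt where "lt k = lamF ws F$k G$k (t k)" for k
  have [simp]: "st (lt k) = ws" for k by (simp add: lt_def)
  have l: "lt a : El (hom F$a G$a)" if "a : vob K" for a
   unfolding lt_def by (rule lamF[OF n[OF that]]) (use that in simp)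
  define s where "s x = (case x of Inl k => snd (lt k)
    | Inr (k, l) => ga k l \<cdot> snd (lt k))" for x
  have s1: "snd (lt k) : homs V (T ws) (hom F$k G$k)" if "k : vob K" for k
   using El_snd[OF l[OF that]] by (simp add: lt_def)
  have ll: "(ws, snd (lt k)) = lt k" for k by (simp add: lt_def prod_eq_iff)
  have s2: "ga k l \<cdot> snd (lt k) = gb k l \<cdot> snd (lt l)" if "k : vob K" "l : vob K" for k l
  proof -
   have gE: "lin (ga k l) (lt k) : El (hom (F$l \<otimes> vhom K k l) G$k)"
    "lin (gb k l) (lt l) : El (hom (F$l \<otimes> vhom K k l) G$k)"
    using lin_El[OF ga(1)] lin_El[OF gb(1)] l that by simp_all
   have "lin (ga k l) (lt k) = lin (gb k l) (lt l)" (is "?x = ?y")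
   proof (rule ap_ext[OF gE])
    fix z assume z: "z : El (F$l \<otimes> vhom K k l)"
    have nx: "nat1 ws [] (F$l \<otimes> vhom K k l) G$k (ap (F$l \<otimes> vhom K k l) G$k ?x)"
     by (rule nat1_conv, rule nat1_ap2[OF nat1_id _ _ gE(1) refl]) (use that in simp_all)
    have ny: "nat1 ws [] (F$l \<otimes> vhom K k l) G$k (ap (F$l \<otimes> vhom K k l) G$k ?y)"
     by (rule nat1_conv, rule nat1_ap2[OF nat1_id _ _ gE(2) refl]) (use that in simp_all)
    show "ap (F$l \<otimes> vhom K k l) G$k ?x z = ap (F$l \<otimes> vhom K k l) G$k ?y z"
     by (rule nat1_pair_eqI[OF nx ny _ _ _ z]) (use that l in "simp_all add: ga(2) gb(2) lt_def lamF(2)[OF n] tr")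
   qed (use that in simp_all)
   then show ?thesis by (simp add: lin_def)
  qed
  have "cone ?J V D d (T ws) s"
   unfolding cone_def
  proof (intro conjI ballI)
   fix x assume "x : obj ?J"
   then show "s x : homs V (T ws) (D x)"
    using s1 cmp_homs[OF s1 ga(1)] by (auto simp: end_shape_def s_def D_def)
  next
   fix f assume "f : arr ?J"
   then show "d f \<cdot> s (src ?J f) = s (tgt ?J f)"
    using homs_D[OF s1] homs_D[OF cmp_homs[OF s1 ga(1)]] s2
    by (auto simp: end_shape_def s_def D_def d_def)
  qed (use ws in simp)
  then obtain u where u: "u : homs V (T ws) L" "!!x. x : obj ?J ==> p x \<cdot> u = s x"
   using L unfolding limit_cone_def by blast
  have qu: "q k (ws, u) m = t k m" if "k : R" "m : El F$k" for k m
   unfolding q_def using that u(2) lamF(2)[OF n, folded lt_def] by (simp add: lin_def s_def end_shape_def ll InlI)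
  have uE: "(ws, u) : El L" using u ws by simp
  have "c a (ws, u) m = t a m" if "a : vob K" "m : El F$a" for a m
   unfolding c_def using that rep(1) by (simp add: qu tr[symmetric] ji)
  then show "EX u:El L. st u = ws & (ALL a:vob K. ALL m:El F$a. ap F$a G$a (lin (e a) u) m = t a m)"
   using uE ec by (intro bexI[OF _ uE]) simp
 next
  fix x y assume x: "x : El L" and y: "y : El L" and xy: "st x = st y" and
   eq: "!!a m. a : vob K ==> m : El F$a ==> ap F$a G$a (lin (e a) x) m = ap F$a G$a (lin (e a) y) m"
  have *: "lin (p (Inl k)) x = lin (p (Inl k)) y" if k: "k : R" for k
  proof (rule ap_ext[OF lin_El[OF p[OF k] x] lin_El[OF p[OF k] y]])
   fix m assume m: "m : El F$k"
   show "ap F$k G$k (lin (p (Inl k)) x) m = ap F$k G$k (lin (p (Inl k)) y) m"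
    using eq[of k m] m k x y by (simp add: ec cR) (simp add: q_def)
  qed (use k xy in simp_all)
  have 1: "p (Inl k) \<cdot> snd x = p (Inl k) \<cdot> snd y" if "k : R" for k using *[OF that] by (simp add: lin_def)
  have 2: "p (Inr (k, l)) \<cdot> snd x = p (Inr (k, l)) \<cdot> snd y" if "k : R" "l : R" for k l
  proof -
   note [simp] = homs_D[OF p[OF that(1)]] homs_D[OF ga(1)[OF RK[OF that(1)] RK[OF that(2)]]] El_D[OF x] El_D[OF y]
   show ?thesis unfolding pw(1)[OF that, symmetric] using 1[OF that(1)] by simp
  qed
  have xc: "cone ?J V D d (T (st x)) (%z. p z \<cdot> snd x)"
   unfolding cone_def
  proof (intro conjI ballI)
   fix z assume "z : obj ?J"
   then show "p z \<cdot> snd x : homs V (T (st x)) (D z)"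
    using cmp_homs[OF El_snd[OF x]] cone unfolding cone_def by blast
  next
   fix f assume f: "f : arr ?J"
   have df: "d f : homs V (D (src ?J f)) (D (tgt ?J f))" using dia f unfolding diagram_def by blast
   have so: "src ?J f : obj ?J" using category.src_obj[OF category_end_shape f] .
   have pf: "p (src ?J f) : homs V L (D (src ?J f))" using cone so unfolding cone_def by blast
   note [simp] = homs_D[OF df] homs_D[OF pf] El_D[OF x]
   have "d f \<cdot> p (src ?J f) \<cdot> snd x = (d f \<cdot> p (src ?J f)) \<cdot> snd x" by simp
   then show "d f \<cdot> p (src ?J f) \<cdot> snd x = p (tgt ?J f) \<cdot> snd x"
    using cone f unfolding cone_def by metis
  qed (use El_ok[OF x] in simp)
  have "EX! w. w : homs V (T (st x)) L & (ALL z : obj ?J. p z \<cdot> w = p z \<cdot> snd x)"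
   using L xc unfolding limit_cone_def by blast
  moreover have "snd x : homs V (T (st x)) L" "snd y : homs V (T (st x)) L" using El_snd[OF x] El_snd[OF y] xy by auto
  moreover have "ALL z : obj ?J. p z \<cdot> snd y = p z \<cdot> snd x" using 1 2 by (auto simp: end_shape_def)
  ultimately have "snd x = snd y" by blast
  then show "x = y" using xy by (simp add: prod_eq_iff)
 qed (use e in simp)
 then show ?thesis by blast
qed

section \<open>Accessible modules in terms of elements\<close>


lemma opp_vfunctor:
 assumes "opp A B" "cat A"
 shows "func (Op B) C F \<longleftrightarrow> func A C F"
 using assms homs_D[OF vcategoryD(3)[OF assms(2)]] unfolding opp_def vfunctor_def by (simp add: vop_def)

text \<open>The left \<open>A\<close>-module \<open>[M -, X]\<close> of a right \<open>A\<close>-module \<open>M\<close>.\<close>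

definition "hmod M X = fc (yo VV X) (vfop M)"

lemma fob_hmod [simp]: "(hmod M X)$a = hom M$a X"
 by (simp add: hmod_def)

lemma hmod:
 assumes A: "cat A" and M: "rmod A M" and X: "ob X"
 shows "smod A (hmod M X)"
  "a : vob A ==> b : vob A ==> f : EH A a b ==> h : El (hom M$a X) ==> m : El M$b ==>
   ap M$b X (lact (hmod M X) a b f h) m = sw [] (st h @ st m) (st f) [] (ap M$a X h (ract A M a b m f))"
proof -
 have v: "func (Op VV) VV (yo VV X)" unfolding vrep_def by (rule vhom_fun) (simp_all add: X)
 have w: "func A (Op VV) (vfop M)"
  by (rule iffD1[OF opp_vfunctor[OF opp_vop A] vfunctor_vfop[OF vcategory_vop[OF A] vcategory_self M]])
 note f = vfunctor_vfcomp[OF A vcategory_vop[OF vcategory_self] vcategory_self v w]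
 show "smod A (hmod M X)" unfolding hmod_def by (rule f)
 assume h [simp]: "a : vob A" "b : vob A" "f : EH A a b" "h : El (hom M$a X)" "m : El M$b"
 note [simp] = A M X rmod_obj[OF M]
 have fE [simp]: "fm M b a f : El (hom M$b M$a)" using fm_El[OF M] by simp
 have "lact (hmod M X) a b f h = lact (homf (Op VV) X) M$a M$b (fm M b a f) h"
  unfolding lact_def hmod_def using f(2) by (simp add: vrep_def)
 also have "... = sw [] (st h) (st f) [] (cp VV M$b M$a X h (fm M b a f))"
  using vhom_fun(2)[of "Op VV" X "M$a" "M$b" "fm M b a f" h] by (simp add: vcmp_vop(2))
 finally have "ap M$b X (lact (hmod M X) a b f h) m = sw [] (st h) (st f) (st m) (ap M$a X h (lact M b a f m))"
  by (simp add: ap_sw_left vcmp_self lact_def)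
 also have "ap M$a X h (lact M b a f m) = sw (st h) (st m) (st f) [] (ap M$a X h (ract A M a b m f))"
  by (simp add: lact_ract[OF M], subst ap_sw_right) simp_all
 finally show "ap M$b X (lact (hmod M X) a b f h) m = sw [] (st h @ st m) (st f) [] (ap M$a X h (ract A M a b m f))"
  using sw_append_left[of "ap M$a X h (ract A M a b m f)" X "[]" "st h" "st m" "st f" "[]"] by simp
qed

text \<open>\<open>M\<close> is the left Kan extension of \<open>fi\<close> along \<open>H\<close>, with unit \<open>u k : fi k \<rightarrow> M (H k)\<close>.\<close>

definition "klan A M K fi H t ws a X ==
  (ALL k : vob K. ALL p : El fi$k. nat1 (ws @ st p) [] (vhom A a H$k) X (t k p)) &
  (ALL k : vob K. ALL g : EH A a H$k. nat1 ws (st g) fi$k X (%p. t k p g)) &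
  (ALL k : vob K. ALL l : vob K. ALL p : El fi$l. ALL h : EH K k l. ALL g : EH A a H$k.
   t k (ract K fi k l p h) g = t l p (cp A a H$k H$l (fm H k l h) g))"

definition "eacc A M K fi H u == (ALL k : vob K. nat1 [] [] fi$k M$(H$k) (u k)) &
  (ALL k : vob K. ALL l : vob K. ALL p : El fi$l. ALL h : EH K k l.
   u k (ract K fi k l p h) = ract A M H$k H$l (u l p) (fm H k l h)) &
  (ALL a : vob A. ALL X : obj V. ALL ws t. ok ws --> klan A M K fi H t ws a X -->
   (EX r. nat1 ws [] M$a X r & (ALL k : vob K. ALL p : El fi$k. ALL g : EH A a H$k.
    r (ract A M a H$k (u k p) g) = t k p g))) &
  (ALL a : vob A. ALL X : obj V. ALL ws r s. nat1 ws [] M$a X r --> nat1 ws [] M$a X s -->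
   (ALL k : vob K. ALL p : El fi$k. ALL g : EH A a H$k.
    r (ract A M a H$k (u k p) g) = s (ract A M a H$k (u k p) g)) --> (ALL m : El M$a. r m = s m))"

lemma eaccD:
 assumes "eacc A M K fi H u"
 shows "k : vob K ==> nat1 [] [] fi$k M$(H$k) (u k)"
  "k : vob K ==> l : vob K ==> p : El fi$l ==> h : EH K k l ==>
   u k (ract K fi k l p h) = ract A M H$k H$l (u l p) (fm H k l h)"
  "a : vob A ==> ob X ==> ok ws ==> klan A M K fi H t ws a X ==>
   EX r. nat1 ws [] M$a X r & (ALL k : vob K. ALL p : El fi$k. ALL g : EH A a H$k.
    r (ract A M a H$k (u k p) g) = t k p g)"
  "a : vob A ==> ob X ==> nat1 ws [] M$a X r ==> nat1 ws [] M$a X s ==>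
   (!!k p g. k : vob K ==> p : El fi$k ==> g : EH A a H$k ==>
    r (ract A M a H$k (u k p) g) = s (ract A M a H$k (u k p) g)) ==> m : El M$a ==> r m = s m"
  "k : vob K ==> p : El fi$k ==> u k p : El M$(H$k)"
  "k : vob K ==> p : El fi$k ==> st (u k p) = st p"
proof -
 show *: "k : vob K ==> nat1 [] [] fi$k M$(H$k) (u k)" for k
  using assms unfolding eacc_def by blast
 show "k : vob K ==> p : El fi$k ==> u k p : El M$(H$k)"
  "k : vob K ==> p : El fi$k ==> st (u k p) = st p"
  using nat1D[OF *] by auto
 show "a : vob A ==> ob X ==> nat1 ws [] M$a X r ==> nat1 ws [] M$a X s ==>
   (!!k p g. k : vob K ==> p : El fi$k ==> g : EH A a H$k ==>
    r (ract A M a H$k (u k p) g) = s (ract A M a H$k (u k p) g)) ==> m : El M$a ==> r m = s m"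
  using assms unfolding eacc_def by meson
qed (use assms in "unfold eacc_def, blast+")

context
 fixes A :: "('a, 'o, 'm) vcat" and K :: "('k, 'o, 'm) vcat" and fi H M
 assumes A [simp]: "cat A" and K [simp]: "cat K" and fi: "rmod K fi" and H: "func K A H" and M: "rmod A M"
begin

lemma ac_simps [simp]: "k : vob K ==> fi$k : obj V" "k : vob K ==> H$k : vob A" "a : vob A ==> M$a : obj V"
 "k : vob K ==> l : vob K ==> h : EH K k l ==> fm H k l h : EH A H$k H$l"
 using rmod_obj[OF fi] vfunctorD(1)[OF H] rmod_obj[OF M] fm_El[OF H] by auto

declare M [simp] fi [simp]

definition "Wf a = fc (homf A a) H"

lemma Wf:
 assumes a [simp]: "a : vob A"
 shows "func K VV (Wf a)" "(Wf a)$k = vhom A a H$k"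
  "k : vob K ==> l : vob K ==> h : EH K k l ==> g : EH A a H$k ==>
   ap (vhom A a H$k) (vhom A a H$l) (fm (Wf a) k l h) g = cp A a H$k H$l (fm H k l h) g"
proof -
 note v = vhom_fun[OF A a]
 note f = vfunctor_vfcomp[OF K A vcategory_self v(1) H]
 show "func K VV (Wf a)" "(Wf a)$k = vhom A a H$k" unfolding Wf_def using f by simp_all
 assume "k : vob K" "l : vob K" "h : EH K k l" "g : EH A a H$k"
 then show "ap (vhom A a H$k) (vhom A a H$l) (fm (Wf a) k l h) g = cp A a H$k H$l (fm H k l h) g"
  unfolding Wf_def using f(2) v(2) by (simp add: lact_def)
qed

lemma Wf_El: "a : vob A ==> k : vob K ==> l : vob K ==> h : EH K k l ==>
  fm (Wf a) k l h : El (hom (vhom A a H$k) (vhom A a H$l))"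
 using fm_El[OF Wf(1)] by (simp add: Wf(2))

lemma eqv_Wf_iff:
 assumes a [simp]: "a : vob A" and X [simp]: "ob X"
 shows "eqv K fi (homS VV (Wf a) X) ws t \<longleftrightarrow> (ALL k : vob K. nat1 ws [] fi$k (hom (vhom A a H$k) X) (t k)) &
  (ALL k : vob K. ALL l : vob K. ALL p : El fi$l. ALL h : EH K k l. ALL g : EH A a H$k.
   ap (vhom A a H$k) X (t k (ract K fi k l p h)) g = ap (vhom A a H$l) X (t l p) (cp A a H$k H$l (fm H k l h) g))"
proof -
 note hS = homS[OF vcategory_self K Wf(1)[OF a], of X, unfolded self_simps, OF X]
 have "(t k (ract K fi k l p h) = ract K (homS VV (Wf a) X) k l (t l p) h) \<longleftrightarrow>
  (ALL g : EH A a H$k. ap (vhom A a H$k) X (t k (ract K fi k l p h)) g =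
    ap (vhom A a H$l) X (t l p) (cp A a H$k H$l (fm H k l h) g))"
  if n: "!!k. k : vob K ==> nat1 ws [] fi$k (hom (vhom A a H$k) X) (t k)"
  and kl [simp]: "k : vob K" "l : vob K" "p : El fi$l" "h : EH K k l" for k l p h
 proof -
  note [simp] = nat1D(1,2)[OF n] Wf(2)[OF a] Wf_El[OF a]
  have r: "ract K (homS VV (Wf a) X) k l (t l p) h = cp VV (vhom A a H$k) (vhom A a H$l) X (t l p) (fm (Wf a) k l h)"
   using hS(2) by simp
  have e: "ap (vhom A a H$k) X (ract K (homS VV (Wf a) X) k l (t l p) h) g =
   ap (vhom A a H$l) X (t l p) (cp A a H$k H$l (fm H k l h) g)" if "g : EH A a H$k" for g
   unfolding r using that vcmp_self(2) by (simp add: Wf(3))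
  show ?thesis
  proof
   assume R: "ALL g : EH A a H$k. ap (vhom A a H$k) X (t k (ract K fi k l p h)) g =
    ap (vhom A a H$l) X (t l p) (cp A a H$k H$l (fm H k l h) g)"
   show "t k (ract K fi k l p h) = ract K (homS VV (Wf a) X) k l (t l p) h"
    by (rule ap_ext[of _ "vhom A a H$k" X]) (use R e in "simp_all add: r")
  qed (use e in metis)
 qed
 note * = this
 show ?thesis unfolding eqv_def fob_homS self_simps Wf(2)[OF a]
  by (intro conj_cong refl ball_cong) (use * in blast)
qed

text \<open>Evaluated on elements and freed of a common permutation, the naturality clause of
  accessibility says that the maps \<open>A(a, H k) \<rightarrow> M a\<close> given by the units
  commute with restriction along arrows of \<open>A\<close>, after composition with any
  \<open>h\<close> into \<open>X\<close>.\<close>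

lemma acc_vnat_iff:
 assumes io: "!!a. a : vob A ==> ecolim VV K fi (Wf a) M$a (io a)" and X [simp]: "ob X" and k [simp]: "k : vob K"
  and o: "!!a. a : vob A ==> oo a : homs V (hom M$a X) (hom fi$k (hom (vhom A a H$k) X))"
  and w: "!!a f p. a : vob A ==> f : El (hom M$a X) ==> p : El fi$k ==>
   ap fi$k (hom (vhom A a H$k) X) (lin (oo a) f) p = cp VV (vhom A a H$k) M$a X f (io a k p)"
 shows "vnat V A VV (fc (yo VV X) (vfop M)) (fc (homf VV fi$k)
       (fc (yo VV X) (vfop (yo A H$k))))
   (%a. name_of V (hom M$a X) (hom fi$k (hom (vhom A a H$k) X)) (oo a)) \<longleftrightarrow>
  (ALL a : vob A. ALL b : vob A. ALL f : EH A a b. ALL h : El (hom M$a X). ALL p : El fi$k. ALL g : EH A b H$k.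
   ap M$a X h (ract A M a b (ap (vhom A b H$k) M$b (io b k p) g) f) =
   ap M$a X h (ap (vhom A a H$k) M$a (io a k p) (cp A a b H$k g f)))"
proof -
 let ?H = "hmod (yo A H$k) X"
 let ?G = "fc (homf VV fi$k) ?H"
 have rv: "rmod A (yo A H$k)" by (rule vrep) simp_all
 have hs: "func VV VV (homf VV fi$k)" by (rule vhom_fun; simp)
 note hm = hmod[OF A M X] and hr = hmod[OF A rv X]
 note G = vfunctor_vfcomp[OF A vcategory_self vcategory_self hs hr(1)]
 have ioE [simp]: "io a k p : El (hom (vhom A a H$k) M$a)" "st (io a k p) = st p" if "a : vob A" "p : El fi$k" for a p
  using ecolimD(4,5)[OF io[OF that(1)] k that(2)] that(1) by (simp_all add: Wf(2))
 have oE [simp]: "lin (oo a) h : El (hom fi$k (hom (vhom A a H$k) X))" if "a : vob A" "h : El (hom M$a X)" for a h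
  by (rule lin_El[OF o]) (use that in auto)
 have lG: "ap fi$k (hom (vhom A b H$k) X) (lact ?G a b f y) p = lact ?H a b f (ap fi$k (hom (vhom A a H$k) X) y p)"
  if "a : vob A" "b : vob A" "f : EH A a b" "y : El (hom fi$k (hom (vhom A a H$k) X))" "p : El fi$k" for a b f y p
 proof -
  have fE: "fm ?H a b f : El (hom (hom (vhom A a H$k) X) (hom (vhom A b H$k) X))"
   using smod_fm_El[OF hr(1) that(1-3)] by simp
  have "lact ?G a b f y = lact (homf VV fi$k) (hom (vhom A a H$k) X) (hom (vhom A b H$k) X) (fm ?H a b f) y"
   unfolding lact_def using G(2)[OF that(1-3)] by simp
  then show ?thesis
   using that fE vhom_fun(2)[of "VV" "fi$k"] by (simp add: vcmp_self lact_def)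
 qed
 have GE [simp]: "lact ?G a b f y : El (hom fi$k (hom (vhom A b H$k) X))"
  if "a : vob A" "b : vob A" "f : EH A a b" "y : El (hom fi$k (hom (vhom A a H$k) X))" for a b f y
  using lact_El[OF G(1) that(1-3)] that(4) by simp
 have HE [simp]: "lact ?H a b f y : El (hom (vhom A b H$k) X)"
  if "a : vob A" "b : vob A" "f : EH A a b" "y : El (hom (vhom A a H$k) X)" for a b f y
  using lact_El[OF hr(1) that(1-3)] that(4) by simp
 have ME [simp]: "lact (hmod M X) a b f h : El (hom M$b X)"
  if "a : vob A" "b : vob A" "f : EH A a b" "h : El (hom M$a X)" for a b f h
  using lact_El[OF hm(1) that(1-3)] that(4) by simp
 have "(lin (oo b) (lact (hmod M X) a b f h) = lact ?G a b f (lin (oo a) h)) \<longleftrightarrow>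
  (ALL p : El fi$k. ALL g : EH A b H$k.
   ap M$a X h (ract A M a b (ap (vhom A b H$k) M$b (io b k p) g) f) =
   ap M$a X h (ap (vhom A a H$k) M$a (io a k p) (cp A a b H$k g f)))"
  (is "?l = ?r \<longleftrightarrow> (ALL p:_. ALL g:_. ?L p g = ?R p g)")
  if h [simp]: "a : vob A" "b : vob A" "f : EH A a b" "h : El (hom M$a X)" for a b f h
 proof -
  let ?s = "%p g. sw [] (st h @ st p @ st g) (st f) []" and ?s' = "%p g. sw [] (st f) (st h @ st p @ st g) []"
  let ?Y = "hom (vhom A b H$k) X"
  let ?ev = "%x p g. ap (vhom A b H$k) X (ap fi$k ?Y x p) g"
  have LE: "?L p g : El X" "?R p g : El X" "st (?L p g) = st h @ st p @ st g @ st f" "st (?R p g) = st h @ st p @ st g @ st f"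
   if "p : El fi$k" "g : EH A b H$k" for p g using that by simp_all
  have e: "?ev ?l p g = ?s p g (?L p g)" "?ev ?r p g = ?s p g (?R p g)"
   if [simp]: "p : El fi$k" "g : EH A b H$k" for p g
   using hm(2) hr(2) by (simp_all add: w lG vcmp_self vrep)
  have le: "?l = ?r \<longleftrightarrow> (ALL p : El fi$k. ALL g : EH A b H$k. ?ev ?l p g = ?ev ?r p g)"
  proof (intro iffI ballI)
   assume R: "ALL p : El fi$k. ALL g : EH A b H$k. ?ev ?l p g = ?ev ?r p g"
   show "?l = ?r"
   proof (rule ap_ext[of _ "fi$k" ?Y])
    fix p assume "p : El fi$k"
    then show "ap fi$k ?Y ?l p = ap fi$k ?Y ?r p"
     by - (rule ap_ext[of _ "vhom A b H$k" X]; use R in simp)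
   qed simp_all
  qed simp
  have "(?s p g (?L p g) = ?s p g (?R p g)) = (?L p g = ?R p g)" if "p : El fi$k" "g : EH A b H$k" for p g
   using sw_sw[OF LE(1)[OF that], of "[]" "st h @ st p @ st g" "st f" "[]"] sw_sw[OF LE(2)[OF that], of "[]" "st h @ st p @ st g" "st f" "[]"]
    LE(3,4)[OF that] by simp metis
  then show ?thesis unfolding le by (intro ball_cong refl) (simp add: e)
 qed
 note * = this
 have n: "ap (hom M$a X) (hom fi$k (hom (vhom A a H$k) X))
   (glb (name_of V (hom M$a X) (hom fi$k (hom (vhom A a H$k) X)) (oo a))) h = lin (oo a) h"
  "name_of V (hom M$a X) (hom fi$k (hom (vhom A a H$k) X)) (oo a) :
   homs V I (hom (hom M$a X) (hom fi$k (hom (vhom A a H$k) X)))"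
  if "a : vob A" "h : El (hom M$a X)" for a h
  using name_of[OF o] that by simp_all
 have gx: "gen (hom M$a X) : El (hom M$a X)" if "a : vob A" for a using that by simp
 show ?thesis
  unfolding hmod_def[symmetric] vnat_self_iff[OF A hm(1) G(1)] fob_vfcomp fob_hmod vrep_simps vhom_fun_simps self_simps
  using n(2)[OF _ gx] by (simp add: n(1) *)
qed

text \<open>The pointwise formula for Kan extensions. The unit sends \<open>p\<close> and
  \<open>g\<close> to the restriction of \<open>u k p\<close> along \<open>g\<close>, and a
  \<open>klan\<close> family is, after currying, a transformation from \<open>fi\<close> into
  \<open>[A(a, H -), X]\<close>.\<close>

lemma eacc_ecolim:
 assumes E: "eacc A M K fi H u" and a [simp]: "a : vob A"
 defines "io == %k p. lamF (st p) (vhom A a H$k) M$a (ract A M a H$k (u k p))"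
 shows "ecolim VV K fi (Wf a) M$a io"
  "k : vob K ==> p : El fi$k ==> g : EH A a H$k ==>
   ap (vhom A a H$k) M$a (io k p) g = ract A M a H$k (u k p) g"
proof -
 note d = eaccD[OF E]
 note [simp] = d(5,6)
 have n2: "nat1 (st p) [] (vhom A a H$k) M$a (ract A M a H$k (u k p))" if "k : vob K" "p : El fi$k" for k p
  by (rule nat1_conv, rule nat1_ract2[OF nat1_id]) (use that in simp_all)
 have l: "io k p : El (hom (vhom A a H$k) M$a)" "st (io k p) = st p" if "k : vob K" "p : El fi$k" for k p
  unfolding io_def using lamF(1)[OF n2[OF that]] that by simp_all
 show la: "ap (vhom A a H$k) M$a (io k p) g = ract A M a H$k (u k p) g"
  if "k : vob K" "p : El fi$k" "g : EH A a H$k" for k p g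
  unfolding io_def using lamF(2)[OF n2[OF that(1,2)]] that by simp
 note [simp] = l la
 have n1: "nat1 [] [] fi$k (hom (vhom A a H$k) M$a) (io k)" if "k : vob K" for k
  unfolding io_def
 proof (rule nat1_lamF)
  fix y assume y: "y : EH A a H$k"
  show "nat1 [] ([] @ st y) fi$k M$a (%p. ract A M a H$k (u k p) y)"
   by (rule nat1_conv, rule nat1_ract1, rule d(1)) (use that y in simp_all)
 qed (use n2 that in simp_all)
 have ceq: "ap (vhom A a H$k) X (cp VV (vhom A a H$k) M$a X r (io k p)) g = ap M$a X r (ract A M a H$k (u k p) g)"
  if "ob X" "r : El (hom M$a X)" "k : vob K" "p : El fi$k" "g : EH A a H$k" for X r k p g
  using that by (simp add: vcmp_self)
 show "ecolim VV K fi (Wf a) M$a io"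
  unfolding ecolim_def self_simps Wf(2)[OF a]
 proof (intro conjI ballI allI impI)
  show "eqv K fi (homS VV (Wf a) M$a) [] io"
   unfolding eqv_Wf_iff[OF a ac_simps(3)[OF a]] using n1 by (auto simp: d(2) ract_ract)
 next
  fix X ws t assume X [simp]: "ob X" and ws: "ok ws" and t: "eqv K fi (homS VV (Wf a) X) ws t"
  have tn: "nat1 ws [] fi$k (hom (vhom A a H$k) X) (t k)" if "k : vob K" for k
   using t that unfolding eqv_Wf_iff[OF a X] by blast
  note [simp] = nat1D(1,2)[OF tn]
  have "klan A M K fi H (%k p. ap (vhom A a H$k) X (t k p)) ws a X"
   unfolding klan_def
  proof (intro conjI ballI)
   fix k p assume "k : vob K" "p : El fi$k"
   then show "nat1 (ws @ st p) [] (vhom A a H$k) X (ap (vhom A a H$k) X (t k p))"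
    by (intro nat1_conv[OF nat1_ap2[OF nat1_id _ _ _ refl]]) simp_all
  next
   fix k g assume "k : vob K" "g : EH A a H$k"
   then show "nat1 ws (st g) fi$k X (%p. ap (vhom A a H$k) X (t k p) g)"
    by (intro nat1_conv[OF nat1_ap1[OF tn _ _ _ refl]]) simp_all
  qed (use t in "simp add: eqv_Wf_iff")
  from d(3)[OF a X ws this] obtain r where r: "nat1 ws [] M$a X r"
   "!!k p g. k : vob K ==> p : El fi$k ==> g : EH A a H$k ==>
    r (ract A M a H$k (u k p) g) = ap (vhom A a H$k) X (t k p) g" by blast
  note lr = lamF[OF r(1)]
  have eq: "cp VV (vhom A a H$k) M$a X (lamF ws M$a X r) (io k p) = t k p" if kp: "k : vob K" "p : El fi$k" for k p
  proof (rule ap_ext[of _ "vhom A a H$k" X])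
   fix g assume "g : EH A a H$k"
   then show "ap (vhom A a H$k) X (cp VV (vhom A a H$k) M$a X (lamF ws M$a X r) (io k p)) g = ap (vhom A a H$k) X (t k p) g"
    using kp lr by (subst ceq) (simp_all add: r(2))
  qed (use kp lr in simp_all)
  then show "EX u:El (hom M$a X). st u = ws & (ALL k:vob K. ALL p:El fi$k. cp VV (vhom A a H$k) M$a X u (io k p) = t k p)"
   using lr(1) by (intro bexI[of _ "lamF ws M$a X r"]) simp_all
 next
  fix X r s assume X [simp]: "ob X" and rs: "r : El (hom M$a X)" "s : El (hom M$a X)" "st r = st s"
   "ALL k:vob K. ALL p:El fi$k. cp VV (vhom A a H$k) M$a X r (io k p) = cp VV (vhom A a H$k) M$a X s (io k p)"
  have n: "nat1 (st s) [] M$a X (ap M$a X r)" "nat1 (st s) [] M$a X (ap M$a X s)"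
   by (rule nat1_conv, rule nat1_ap2[OF nat1_id _ _ _ refl]; use rs in simp)+
  show "r = s"
  proof (rule ap_ext[OF rs(1-3)])
   fix m assume "m : El M$a"
   then show "ap M$a X r m = ap M$a X s m"
    by (rule d(4)[OF a X n, rotated -1]) (use rs in "simp flip: ceq")
  qed simp_all
 qed simp
qed

lemma eacc_accessible:
 fixes ka :: "'u rel"
 assumes E: "eacc A M K fi H u"
 shows "EX omg. (ALL a : vob A. wcolim V VV K fi (fc (homf A a) H) M$a (omg a)) &
    (ALL X : obj V. ALL k : vob K.
     vnat V A VV
      (fc (yo VV X) (vfop M))
      (fc (homf VV fi$k)
       (fc (yo VV X) (vfop (yo A H$k))))
      (%a. name_of V (hom M$a X)
          (hom fi$k (hom (vhom A a H$k) X)) (omg a X k)))"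
proof -
 define io where "io a k p = lamF (st p) (vhom A a H$k) M$a (ract A M a H$k (u k p))" for a k p
 have c: "ecolim VV K fi (Wf a) M$a (io a)"
  "!!k p g. k : vob K ==> p : El fi$k ==> g : EH A a H$k ==>
   ap (vhom A a H$k) M$a (io a k p) g = ract A M a H$k (u k p) g" if "a : vob A" for a
  unfolding io_def by (rule eacc_ecolim[OF E that]; assumption)+
 note w = ecolim_wcolim[OF vcategory_self K fi Wf(1) c(1), unfolded self_simps]
 note d = eaccD[OF E]
 let ?o = "%a. om VV fi (Wf a) M$a (io a)"
 show ?thesis
 proof (intro exI[of _ ?o] conjI ballI)
  fix a assume "a : vob A"
  then show "wcolim V VV K fi (fc (homf A a) H) M$a (?o a)" using w(1) by (simp add: Wf_def)
 next
  fix X k assume X: "ob X" and k: "k : vob K"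
  show "vnat V A VV (fc (yo VV X) (vfop M)) (fc (homf VV fi$k)
       (fc (yo VV X) (vfop (yo A H$k))))
      (%a. name_of V (hom M$a X) (hom fi$k (hom (vhom A a H$k) X)) (?o a X k))"
  proof (rule iffD2[OF acc_vnat_iff[OF c(1) X k]])
   fix a assume "a : vob A"
   then show "?o a X k : homs V (hom M$a X) (hom fi$k (hom (vhom A a H$k) X))"
    using w(2) X k by (simp add: Wf(2))
  next
   fix a f p assume "a : vob A" "f : El (hom M$a X)" "p : El fi$k"
   then show "ap fi$k (hom (vhom A a H$k) X) (lin (?o a X k) f) p = cp VV (vhom A a H$k) M$a X f (io a k p)"
    using w(3) X k by (simp add: Wf(2))
  qed (use k c(2) d(5) in "simp_all add: ract_ract")
 qed
qed

text \<open>By Yoneda, units \<open>fi k \<rightarrow> [A(a, H k), M a]\<close> that are compatible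
  with restriction in \<open>a\<close> come from elements of \<open>M (H k)\<close>, their values at
  the identity of \<open>H k\<close>; these are the values of \<open>u\<close>.\<close>

lemma accessible_eacc:
 assumes w: "!!a. a : vob A ==> wcolim V VV K fi (fc (homf A a) H) M$a (omg a)"
  and n: "!!X k. ob X ==> k : vob K ==>
     vnat V A VV
      (fc (yo VV X) (vfop M))
      (fc (homf VV fi$k)
       (fc (yo VV X) (vfop (yo A H$k))))
      (%a. name_of V (hom M$a X)
          (hom fi$k (hom (vhom A a H$k) X)) (omg a X k))"
 shows "EX u. eacc A M K fi H u"
proof -
 define io where "io a k = ap fi$k (hom (vhom A a H$k) M$a) (lin (omg a M$a k) (idg VV M$a))" for a k
 note v = wcolim_ecolim[OF vcategory_self K fi Wf(1) w[folded Wf_def], unfolded self_simps]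
 have c: "ecolim VV K fi (Wf a) M$a (io a)" if "a : vob A" for a
  using v(1)[OF that that] that unfolding io_def by (simp add: Wf(2))
 note d = ecolimD[OF c, unfolded self_simps]
 have ioE [simp]: "io a k p : El (hom (vhom A a H$k) M$a)" "st (io a k p) = st p" if "a : vob A" "k : vob K" "p : El fi$k" for a k p
  using d(4,5)[OF that] that(1) by (simp_all add: Wf(2))
 define u where "u k p = ap (vhom A H$k H$k) M$(H$k) (io H$k k p) (idg A H$k)" for k p
 have uE [simp]: "u k p : El M$(H$k)" "st (u k p) = st p" if "k : vob K" "p : El fi$k" for k p
  unfolding u_def using that by simp_all
 have nat: "ract A M a b (ap (vhom A b H$k) M$b (io b k p) g) f = ap (vhom A a H$k) M$a (io a k p) (cp A a b H$k g f)"
  if h [simp]: "a : vob A" "b : vob A" "k : vob K" "f : EH A a b" "p : El fi$k" "g : EH A b H$k" for a b k f p g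
 proof -
  \<comment> \<open>The naturality clause is taken at \<open>X = M a\<close> and at the identity of
    \<open>M a\<close>, which can then be removed.\<close>
  have "ap M$a M$a (idg VV M$a) (ract A M a b (ap (vhom A b H$k) M$b (io b k p) g) f) =
   ap M$a M$a (idg VV M$a) (ap (vhom A a H$k) M$a (io a k p) (cp A a b H$k g f))"
  proof (rule iffD1[OF acc_vnat_iff[OF c, of "M$a" k "%b. omg b M$a k"] n, rule_format])
   fix b assume "b : vob A"
   then show "omg b M$a k : homs V (hom M$b M$a) (hom fi$k (hom (vhom A b H$k) M$a))"
    using v(2) by (simp add: Wf(2))
  next
   fix b f p assume "b : vob A" "f : El (hom M$b M$a)" "p : El fi$k"
   then show "ap fi$k (hom (vhom A b H$k) M$a) (lin (omg b M$a k) f) p = cp VV (vhom A b H$k) M$b M$a f (io b k p)"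
    using v(3)[of b "M$a" k f p] by (simp add: Wf(2) io_def)
  qed simp_all
  then show ?thesis by (simp add: vid_self)
 qed
 have iou: "ap (vhom A a H$k) M$a (io a k p) g = ract A M a H$k (u k p) g"
  if "a : vob A" "k : vob K" "p : El fi$k" "g : EH A a H$k" for a k p g
  unfolding u_def using that by (subst nat) (simp_all add: cp_idg)
 have ion: "eqv K fi (homS VV (Wf a) M$a) [] (io a)" if "a : vob A" for a using d(2)[OF that] .
 have "eacc A M K fi H u"
  unfolding eacc_def
 proof (intro conjI ballI allI impI)
  fix k assume k: "k : vob K"
  show "nat1 [] [] fi$k M$(H$k) (u k)"
   unfolding u_def by (rule nat1_conv, rule nat1_ap1[OF d(3)[OF ac_simps(2)[OF k] k, unfolded Wf(2)[OF ac_simps(2)[OF k]]] _ _ _ refl]) (use k in simp_all)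
 next
  fix k l p h assume h: "k : vob K" "l : vob K" "p : El fi$l" "h : EH K k l"
  have "u k (ract K fi k l p h) = ap (vhom A H$k H$l) M$(H$k) (io H$k l p) (cp A H$k H$k H$l (fm H k l h) (idg A H$k))"
   using ion[OF ac_simps(2)[OF h(1)]] h unfolding u_def
    eqv_Wf_iff[OF ac_simps(2)[OF h(1)] ac_simps(3)[OF ac_simps(2)[OF h(1)]]] by simp
  then show "u k (ract K fi k l p h) = ract A M H$k H$l (u l p) (fm H k l h)"
   using h by (simp add: cp_idg iou)
 next
  fix a X ws t assume [simp]: "a : vob A" "ob X" "ok ws" and t: "klan A M K fi H t ws a X"
  have t1: "nat1 (ws @ st p) [] (vhom A a H$k) X (t k p)" if "k : vob K" "p : El fi$k" for k p
   using t that unfolding klan_def by blast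
  have t2: "nat1 ws (st g) fi$k X (%p. t k p g)" if "k : vob K" "g : EH A a H$k" for k g
   using t that unfolding klan_def by blast
  note l = lamF[OF t1]
  let ?t = "%k p. lamF (ws @ st p) (vhom A a H$k) X (t k p)"
  have "eqv K fi (homS VV (Wf a) X) ws ?t"
   unfolding eqv_Wf_iff[OF `a : vob A` `X : obj V`]
  proof (intro conjI ballI)
   fix k assume k: "k : vob K"
   show "nat1 ws [] fi$k (hom (vhom A a H$k) X) (?t k)"
    by (rule nat1_lamF) (use k t1 t2 in simp_all)
  next
   fix k l' p h g assume "k : vob K" "l' : vob K" "p : El fi$l'" "h : EH K k l'" "g : EH A a H$k"
   then show "ap (vhom A a H$k) X (?t k (ract K fi k l' p h)) g = ap (vhom A a H$l') X (?t l' p) (cp A a H$k H$l' (fm H k l' h) g)"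
    using l(2)[of k "ract K fi k l' p h" g] t by (simp add: l klan_def)
  qed
  from d(6)[OF _ _ _ this] obtain r where r: "r : El (hom M$a X)" "st r = ws"
   "!!k p. k : vob K ==> p : El fi$k ==> cp VV (vhom A a H$k) M$a X r (io a k p) = ?t k p"
   by (auto simp: Wf(2))
  have "ap M$a X r (ract A M a H$k (u k p) g) = t k p g" if "k : vob K" "p : El fi$k" "g : EH A a H$k" for k p g
   using that r(1) vcmp_self(2)[of "vhom A a H$k" "M$a" X r "io a k p" g] r(3) by (simp add: iou l)
  moreover have "nat1 ws [] M$a X (ap M$a X r)"
   by (rule nat1_conv, rule nat1_ap2[OF nat1_id _ _ _ refl]) (use r in simp_all)
  ultimately show "EX r. nat1 ws [] M$a X r & (ALL k : vob K. ALL p : El fi$k. ALL g : EH A a H$k.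
    r (ract A M a H$k (u k p) g) = t k p g)" by blast
 next
  fix a X ws r s m assume [simp]: "a : vob A" "ob X" and n: "nat1 ws [] M$a X r" "nat1 ws [] M$a X s"
   and e: "ALL k : vob K. ALL p : El fi$k. ALL g : EH A a H$k.
    r (ract A M a H$k (u k p) g) = s (ract A M a H$k (u k p) g)" and m: "m : El M$a"
  note lr = lamF[OF n(1)] and ls = lamF[OF n(2)]
  have "lamF ws M$a X r = lamF ws M$a X s"
  proof (rule d(7)[of a X])
   fix k p assume kp: "k : vob K" "p : El fi$k"
   show "cp VV (Wf a)$k M$a X (lamF ws M$a X r) (io a k p) = cp VV (Wf a)$k M$a X (lamF ws M$a X s) (io a k p)"
    unfolding Wf(2)[OF `a : vob A`]
    by (rule ap_ext[of _ "vhom A a H$k" X]) (use kp lr ls e in "simp_all add: vcmp_self iou")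
  qed (use lr(1) ls(1) in simp_all)
  then show "r m = s m" using lr(2)[OF _ m] ls(2)[OF _ m] by simp
 qed
 then show ?thesis by blast
qed

end

lemma ract_rmid_left:
 assumes "rmod A M" "cat A" "a : vob A" "b : vob A" "m : El M$b" "f : EH A a b"
  "st m = ps @ ws @ rs" "lhom vs ws s"
 shows "ract A M a b (rmid ps ws vs rs s m) f = rmid ps ws vs (rs @ st f) s (ract A M a b m f)"
 unfolding ract_def by (rule bil_rmid_left[OF ract_homs[OF assms(1,3,4,2)] assms(5-8)])

definition "pull M H = fc M (vfop H)"

lemma fob_pull [simp]: "(pull M H)$k = M$(H$k)"
 by (simp add: pull_def)

lemma pull:
 assumes A: "cat A" and K: "cat K" and H: "func K A H" and M: "rmod A M"
 shows "rmod K (pull M H)"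
  "k : vob K ==> l : vob K ==> m : El M$(H$l) ==> h : EH K k l ==>
   ract K (pull M H) k l m h = ract A M H$k H$l m (fm H k l h)"
proof -
 note f = vfunctor_vfcomp[OF vcategory_vop[OF K] vcategory_vop[OF A] vcategory_self M vfunctor_vfop[OF K A H]]
 show r: "rmod K (pull M H)" unfolding pull_def by (rule f)
 assume "k : vob K" "l : vob K" "m : El M$(H$l)" "h : EH K k l"
 then show "ract K (pull M H) k l m h = ract A M H$k H$l m (fm H k l h)"
  using f(2)[of l k h] vfunctorD(1)[OF H] fm_El[OF H]
  by (simp add: ract_lact[OF r] ract_lact[OF M]) (simp add: lact_def pull_def)
qed

context
 fixes A :: "('a, 'o, 'm) vcat" and K :: "('k, 'o, 'm) vcat" and fi H M u
 assumes A [simp]: "cat A" and K [simp]: "cat K" and fi: "rmod K fi" and H: "func K A H" and M: "rmod A M"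
  and E: "eacc A M K fi H u"
begin

lemmas ea_simps [simp] = ac_simps[OF A K fi H M] M fi eaccD(5,6)[OF E]

text \<open>The uniqueness clause of \<open>eacc\<close> admits parameters on the left only, so
  those in \<open>us\<close> are first moved in front of the variable by a permutation.\<close>

lemma eacc_ext:
 assumes a [simp]: "a : vob A" and X [simp]: "ob X" and r: "nat1 ws us M$a X r" and s: "nat1 ws us M$a X s"
  and e: "!!k p g. k : vob K ==> p : El fi$k ==> g : EH A a H$k ==>
    r (ract A M a H$k (u k p) g) = s (ract A M a H$k (u k p) g)" and m: "m : El M$a"
 shows "r m = s m"
proof -
 have n: "nat1 (ws @ us) [] M$a X (%m. sw ws (st m) us [] (r m))" if "nat1 ws us M$a X r" for r
  by (rule nat1_sw_left[where ?w1.0="[]" and ?w2.0="[]", OF that]) simp_all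
 have "sw ws (st m) us [] (r m) = sw ws (st m) us [] (s m)"
  by (rule eaccD(4)[OF E a X n[OF r] n[OF s] _ m]) (simp add: e)
 then show ?thesis
  using sw_sw[OF nat1D(1)[OF r m]] sw_sw[OF nat1D(1)[OF s m]] nat1D(2)[OF r m] nat1D(2)[OF s m] by (metis append_Nil2)
qed

lemma eacc_unique:
 assumes G: "rmod A G" and r: "eqv A M G ws r" "eqv A M G ws s"
  and e: "!!k p. k : vob K ==> p : El fi$k ==> r H$k (u k p) = s H$k (u k p)"
  and a: "a : vob A" "m : El M$a"
 shows "r a m = s a m"
 by (rule eacc_ext[of a "G$a" ws "[]"]) (use r a e rmod_obj[OF G] in "auto simp: eqv_def")

text \<open>The universal property of the left Kan extension. At each \<open>a\<close> the extension
  comes from the \<open>klan\<close> family that restricts \<open>t k p\<close> along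
  \<open>g\<close>, and it is linear because the restrictions of the \<open>u k p\<close> generate
  \<open>M\<close>.\<close>

lemma eacc_extend:
 assumes G: "rmod A G" and ws: "ok ws" and t: "eqv K fi (pull G H) ws t"
 shows "EX r. eqv A M G ws r & (ALL k : vob K. ALL p : El fi$k. r H$k (u k p) = t k p)"
proof -
 note [simp] = G rmod_obj[OF G]
 have n: "nat1 ws [] fi$k G$(H$k) (t k)" if "k : vob K" for k using t that unfolding eqv_def by simp
 note [simp] = nat1D(1,2)[OF n]
 have te: "t k (ract K fi k l p h) = ract A G H$k H$l (t l p) (fm H k l h)"
  if "k : vob K" "l : vob K" "p : El fi$l" "h : EH K k l" for k l p h
  using t that pull(2)[OF A K H G, of k l "t l p" h] unfolding eqv_def by simp
 have "klan A M K fi H (%k p g. ract A G a H$k (t k p) g) ws a G$a" if a [simp]: "a : vob A" for a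
  unfolding klan_def
 proof (intro conjI ballI)
  fix k p assume "k : vob K" "p : El fi$k"
  then show "nat1 (ws @ st p) [] (vhom A a H$k) G$a (ract A G a H$k (t k p))"
   by (intro nat1_conv[OF nat1_ract2[OF nat1_id]]) simp_all
 next
  fix k g assume "k : vob K" "g : EH A a H$k"
  then show "nat1 ws (st g) fi$k G$a (%p. ract A G a H$k (t k p) g)"
   by (intro nat1_conv[OF nat1_ract1[OF n]]) simp_all
 qed (simp add: te ract_ract)
 then have "EX r. nat1 ws [] M$a G$a r & (ALL k : vob K. ALL p : El fi$k. ALL g : EH A a H$k.
    r (ract A M a H$k (u k p) g) = ract A G a H$k (t k p) g)" if "a : vob A" for a
  using eaccD(3)[OF E that _ ws] that by simp
 then obtain r where r: "!!a. a : vob A ==> nat1 ws [] M$a G$a (r a)"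
  "!!a k p g. a : vob A ==> k : vob K ==> p : El fi$k ==> g : EH A a H$k ==>
    r a (ract A M a H$k (u k p) g) = ract A G a H$k (t k p) g" by metis
 have "eqv A M G ws r"
  unfolding eqv_def
 proof (intro conjI ballI)
  fix a b m f assume h [simp]: "a : vob A" "b : vob A" "m : El M$b" "f : EH A a b"
  show "r a (ract A M a b m f) = ract A G a b (r b m) f"
  proof (rule eacc_ext[of b "G$a" ws "st f" "%m. r a (ract A M a b m f)" "%m. ract A G a b (r b m) f"])
   show "nat1 ws (st f) M$b G$a (%m. r a (ract A M a b m f))"
    by (rule nat1_comp[OF nat1_ract1[OF nat1_id] r(1)]) simp_all
   show "nat1 ws (st f) M$b G$a (%m. ract A G a b (r b m) f)"
    by (rule nat1_conv, rule nat1_ract1[OF r(1)]) simp_all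
  qed (simp_all add: ract_ract r(2))
 qed (rule r(1))
 moreover have "r H$k (u k p) = t k p" if "k : vob K" "p : El fi$k" for k p
  using r(2)[of "H$k" k p "idg A H$k"] that by (simp add: ract_idg)
 ultimately show ?thesis by blast
qed

lemma eqv_restrict:
 assumes G: "rmod A G" and r: "eqv A M G ws r"
 shows "eqv K fi (pull G H) ws (%k p. r H$k (u k p))"
 unfolding eqv_def
proof (intro conjI ballI)
 fix k assume k: "k : vob K"
 have "nat1 ws [] M$(H$k) G$(H$k) (r H$k)" using r k unfolding eqv_def by simp
 then show "nat1 ws [] fi$k (pull G H)$k (%p. r H$k (u k p))"
  using nat1_comp[OF eaccD(1)[OF E k]] k by simp
next
 fix k l p h assume h: "k : vob K" "l : vob K" "p : El fi$l" "h : EH K k l"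
 have "r H$l (u l p) : El G$(H$l)" using r h nat1D(1) unfolding eqv_def by (metis ea_simps(2,7))
 then show "r H$k (u k (ract K fi k l p h)) = ract K (pull G H) k l (r H$l (u l p)) h"
  using r h pull(2)[OF A K H G h(1,2)] eaccD(2)[OF E h] unfolding eqv_def by simp
qed

text \<open>\<open>[M, G] \<cong> [fi, G H]\<close>: an end over all of \<open>A\<close> is the same
  as an end over the domain of the weight. For small \<open>K\<close> this makes the homs between
  accessible presheaves exist.\<close>

lemma eacc_end_exists:
 assumes G: "rmod A G" and E0: "hom_end V (Op K) VV fi (pull G H) E0 e0"
 shows "EX E e. hom_end V (Op A) VV M G E e"
proof -
 note [simp] = G rmod_obj[OF G]
 note pr = pull(1)[OF A K H G]
 note w = hom_end_wedge[OF K fi pr E0, unfolded fob_pull]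
 note [simp] = w(1)
 define q where "q t k p = ap fi$k G$(H$k) (lin (e0 k) t) p" for t k p
 have e0E: "lin (e0 k) t : El (hom fi$k G$(H$k))" if "k : vob K" "t : El E0" for k t
  using lin_El[OF w(2)] that by simp
 have qe: "eqv K fi (pull G H) (st t) (q t)" if "t : El E0" for t
  unfolding eqv_def q_def using w(3) that e0E[OF _ that]
  by (auto intro!: nat1_conv[OF nat1_ap2[OF nat1_id _ _ _ refl]])
 have "EX r. ALL t : El E0. eqv A M G (st t) (r t) & (ALL k : vob K. ALL p : El fi$k. r t H$k (u k p) = q t k p)"
  by (rule bchoice) (use eacc_extend[OF G El_ok qe] in blast)
 then obtain r where r: "!!t. t : El E0 ==> eqv A M G (st t) (r t)"
  "!!t k p. t : El E0 ==> k : vob K ==> p : El fi$k ==> r t H$k (u k p) = q t k p" by blast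
 have rn: "nat1 (st t) [] M$a G$a (r t a)" if "t : El E0" "a : vob A" for t a
  using r(1) that unfolding eqv_def by blast
 have re: "r t a (ract A M a b m f) = ract A G a b (r t b m) f"
  if "t : El E0" "a : vob A" "b : vob A" "m : El M$b" "f : EH A a b" for t a b m f
  using r(1) that unfolding eqv_def by blast
 \<comment> \<open>The extensions \<open>r t\<close> were chosen separately for each
   \<open>t\<close>. They nevertheless depend naturally on \<open>t\<close>, since they are
   determined by their values on generators.\<close>
 have rn2: "nat1 [] (st m) E0 G$a (%t. r t a m)" if a [simp]: "a : vob A" and m: "m : El M$a" for a m
 proof (rule nat1I)
  fix t vs s assume t: "t : El E0" and s: "lhom vs (st t) s" and t': "re vs s t : El E0"
  show "r (re vs s t) a m = rmid [] (st t) vs (st m) s (r t a m)"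
  proof (rule eacc_ext[of a "G$a" vs "[]" "r (re vs s t) a" "%m. rmid [] (st t) vs (st m) s (r t a m)" m])
   show "nat1 vs [] M$a G$a (r (re vs s t) a)" using rn[OF t'] by simp
   show "nat1 vs [] M$a G$a (%m. rmid [] (st t) vs (st m) s (r t a m))"
    by (rule nat1_rmid_before[OF rn[OF t], where bs="[]"]) (use s in simp_all)
   fix k p g assume h [simp]: "k : vob K" "p : El fi$k" "g : EH A a H$k"
   have qr: "q (re vs s t) k p = rmid [] (st t) vs (st p) s (q t k p)"
   proof -
    have "nat1 [] (st p) E0 G$(H$k) (%t. q t k p)"
     unfolding q_def by (rule nat1_conv, rule nat1_ap1[OF nat1_lin[OF nat1_id w(2)] _ _ _ refl]) simp_all
    from nat1D(3)[OF this t s] show ?thesis .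
   qed
   have qE: "q t k p : El G$(H$k)" "st (q t k p) = st t @ st p" unfolding q_def using e0E t by simp_all
   show "r (re vs s t) a (ract A M a H$k (u k p) g) = rmid [] (st t) vs (st (ract A M a H$k (u k p) g)) s (r t a (ract A M a H$k (u k p) g))"
    using t t' s qE by (simp add: re r(2) qr ract_rmid_left)
  qed (use m in simp_all)
 qed (use nat1D[OF rn[OF _ a] m] in auto)
 define e where "e a = arr1 E0 (%t. lamF (st t) M$a G$a (r t a))" for a
 have ne: "nat1 [] [] E0 (hom M$a G$a) (%t. lamF (st t) M$a G$a (r t a))" if "a : vob A" for a
  by (rule nat1_lamF) (use that rn rn2 in simp_all)
 note ar = arr1[OF ne w(1)]
 have ev: "ap M$a G$a (lin (e a) t) m = r t a m" if "a : vob A" "t : El E0" "m : El M$a" for a t m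
  unfolding e_def using that by (simp add: ar(2) lamF(2)[OF rn])
 have "hom_end V (Op A) VV M G E0 e"
 proof (rule hom_endI[OF A M G w(1)])
  fix ws t assume ws: "ok ws" and t: "eqv A M G ws t"
  from hom_end_ex[OF K fi pr E0 eqv_restrict[OF G t] ws] obtain x where x: "x : El E0" "st x = ws"
   "!!k p. k : vob K ==> p : El fi$k ==> q x k p = t H$k (u k p)" unfolding q_def by auto
  have "r x a m = t a m" if "a : vob A" "m : El M$a" for a m
   by (rule eacc_unique[OF G _ t _ that]) (use r(1,2)[OF x(1)] x(2,3) in simp_all)
  then show "EX x:El E0. st x = ws & (ALL a:vob A. ALL m:El M$a. ap M$a G$a (lin (e a) x) m = t a m)"
   using x ev by (intro bexI[OF _ x(1)]) simp
 next
  fix x y assume xy: "x : El E0" "y : El E0" "st x = st y" and eq: "!!a m. a : vob A ==> m : El M$a ==>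
   ap M$a G$a (lin (e a) x) m = ap M$a G$a (lin (e a) y) m"
  show "x = y"
  proof (rule hom_end_ext[OF K fi pr E0 xy])
   fix k p assume kp: "k : vob K" "p : El fi$k"
   have "q x k p = q y k p" using eq[of "H$k" "u k p"] kp xy by (simp add: ev r(2))
   then show "ap fi$k (pull G H)$k (lin (e0 k) x) p = ap fi$k (pull G H)$k (lin (e0 k) y) p"
    by (simp add: q_def)
  qed
 qed (use ar(1) in "simp_all add: ev re e_def[symmetric]")
 then show ?thesis by blast
qed

text \<open>By Yoneda, a cocone with vertex \<open>G\<close> under the representables
  \<open>A(-, H k)\<close> is a transformation from \<open>fi\<close> to the restriction of
  \<open>G\<close>, and such transformations extend uniquely to \<open>M\<close>.\<close>

lemma eacc_Fun_ecolim:
 assumes mc: "mcat A FF" and MF: "M : FF" and rp: "!!a. a : vob A ==> yo A a : FF"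
 shows "ecolim (Fun A FF) K fi (fc (Yf A) H) M (%k p. yon A M H$k (u k p))"
proof -
 let ?P = "Fun A FF" and ?S = "fc (Yf A) H"
 note [simp] = mc MF rp vcategory_Fun[OF mc] fob_Yf[OF mc]
 note Y = Yf[OF mc rp]
 note S = vfunctor_vfcomp[OF K A vcategory_Fun[OF mc] Y(1) H]
 note yo = yon[OF mc MF ac_simps(2)[OF A K fi H M] rp[OF ac_simps(2)[OF A K fi H M]] eaccD(5)[OF E]]
 note hS = homS[OF vcategory_Fun[OF mc] K S(1)]
 have SE: "fm ?S k l h : El (eo A (yo A H$k) (yo A H$l))" if "k : vob K" "l : vob K" "h : EH K k l" for k l h
  using fm_El[OF S(1) that] by simp
 have n: "nat1 [] [] fi$k (eo A (yo A H$k) M) (%p. yon A M H$k (u k p))" if "k : vob K" for k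
  using nat1_comp[OF eaccD(1)[OF E that] nat1_yon[OF mc MF]] that by simp
 show ?thesis
  unfolding ecolim_def
 proof (intro conjI ballI allI impI)
  show "eqv K fi (homS ?P ?S M) [] (%k p. yon A M H$k (u k p))"
   unfolding eqv_def
  proof (intro conjI ballI)
   fix k l p h assume h [simp]: "k : vob K" "l : vob K" "p : El fi$l" "h : EH K k l"
   have "yon A M H$k (u k (ract K fi k l p h)) = cp ?P (yo A H$k) (yo A H$l) M (yon A M H$l (u l p)) (fm ?S k l h)"
   proof (rule Ea_ext[OF mc, of "yo A H$k" M])
    fix a m assume "a : vob A" "m : El (yo A H$k)$a"
    then show "Ea A (yo A H$k) M a (yon A M H$k (u k (ract K fi k l p h))) m =
     Ea A (yo A H$k) M a (cp ?P (yo A H$k) (yo A H$l) M (yon A M H$l (u l p)) (fm ?S k l h)) m"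
     using SE by (simp add: vcmp_Fun(2) S(2) Y(3) eaccD(2)[OF E] ract_ract yon[OF mc])
   qed (use SE[OF h(1,2,4)] in "simp_all add: yo cp_Fun_El[OF mc] yon[OF mc MF] eaccD(2)[OF E]")
   then show "yon A M H$k (u k (ract K fi k l p h)) = ract K (homS ?P ?S M) k l (yon A M H$l (u l p)) h"
    using hS(2) by (simp add: yo)
  qed (use n in simp)
 next
  fix G ws t assume G: "G : vob ?P" and ws: "ok ws" and t: "eqv K fi (homS ?P ?S G) ws t"
  from G have [simp]: "G : FF" "rmod A G" using mcatD(2)[OF mc] by auto
  have tn: "nat1 ws [] fi$k (eo A (yo A H$k) G) (t k)" if "k : vob K" for k using t that unfolding eqv_def by simp
  note [simp] = nat1D(1,2)[OF tn]
  have te: "t k (ract K fi k l p h) = cp ?P (yo A H$k) (yo A H$l) G (t l p) (fm ?S k l h)"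
   if "k : vob K" "l : vob K" "p : El fi$l" "h : EH K k l" for k l p h
   using t that hS(2)[of G k l "t l p" h] unfolding eqv_def by simp
  let ?t = "%k p. Ea A (yo A H$k) G H$k (t k p) (idg A H$k)"
  have "eqv K fi (pull G H) ws ?t"
   unfolding eqv_def
  proof (intro conjI ballI)
   fix k assume k: "k : vob K"
   show "nat1 ws [] fi$k (pull G H)$k (?t k)"
    unfolding fob_pull by (rule nat1_conv, rule nat1_Ea1[OF mc tn[OF k]]) (use k in simp_all)
  next
   fix k l p h assume h: "k : vob K" "l : vob K" "p : El fi$l" "h : EH K k l"
   then show "?t k (ract K fi k l p h) = ract K (pull G H) k l (?t l p) h"
    using SE pull(2)[OF A K H] Ea_rep[OF mc `G : FF`, of "H$l" "t l p" "H$k" "fm H k l h"] by (simp add: te vcmp_Fun(2) S(2) Y(3) cp_idg Ea_El[OF mc])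
  qed
  from eacc_extend[OF _ ws this] obtain r where r: "eqv A M G ws r" "!!k p. k : vob K ==> p : El fi$k ==> r H$k (u k p) = ?t k p"
   by auto
  note L = EL[OF mc MF `G : FF` r(1) ws]
  have "cp ?P (yo A H$k) M G (EL A M G ws r) (yon A M H$k (u k p)) = t k p" if "k : vob K" "p : El fi$k" for k p
   by (rule rep_ext[OF mc, of G "H$k"]) (use that L(1,2) in "simp_all add: yo cp_Fun_El[OF mc] vcmp_Fun(2)[OF mc] L(3) ract_idg r(2)")
  then show "EX x:EH ?P M G. st x = ws & (ALL k:vob K. ALL p:El fi$k. cp ?P ?S$k M G x (yon A M H$k (u k p)) = t k p)"
   using L by (intro bexI[of _ "EL A M G ws r"]) simp_all
 next
  fix G x y assume G: "G : vob ?P" and xy: "x : EH ?P M G" "y : EH ?P M G" "st x = st y"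
   and e: "ALL k:vob K. ALL p:El fi$k. cp ?P ?S$k M G x (yon A M H$k (u k p)) = cp ?P ?S$k M G y (yon A M H$k (u k p))"
  from G xy have [simp]: "G : FF" "x : El (eo A M G)" "y : El (eo A M G)" by auto
  have q: "eqv A M G (st x) (%a. Ea A M G a x)" "eqv A M G (st x) (%a. Ea A M G a y)"
   unfolding eqv_def by (auto simp: Ea_ract[OF mc] `st x = st y` intro!: nat1_conv[OF nat1_Ea2[OF mc nat1_id]])
  have eq: "Ea A M G H$k x (u k p) = Ea A M G H$k y (u k p)" if kp: "k : vob K" "p : El fi$k" for k p
  proof -
   have "Ea A (yo A H$k) G H$k (cp ?P (yo A H$k) M G x (yon A M H$k (u k p))) (idg A H$k) =
    Ea A (yo A H$k) G H$k (cp ?P (yo A H$k) M G y (yon A M H$k (u k p))) (idg A H$k)"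
    using e kp by simp
   then show ?thesis using kp by (simp add: vcmp_Fun(2) yo ract_idg)
  qed
  show "x = y"
  proof (rule Ea_ext[OF mc MF `G : FF`])
   fix a m assume am: "a : vob A" "m : El M$a"
   show "Ea A M G a x m = Ea A M G a y m"
    by (rule eacc_unique[OF mcatD(2)[OF mc `G : FF`] q _ am]) (rule eq)
  qed (use xy in simp_all)
 qed simp
qed

end

text \<open>Density, again by Yoneda: the extension of a family \<open>t\<close> is its value at the
  identity arrow of \<open>a\<close>.\<close>

lemma eacc_id:
 assumes K [simp]: "cat K" and fi: "rmod K fi"
 shows "func K K (vfid V K)" "eacc K fi K fi (vfid V K) (%k p. p)"
proof -
 have f: "fm (vfid V K) k l h = h" if "h : EH K k l" for k l h using that by (simp add: fm_def vfid_def)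
 have o [simp]: "(vfid V K)$k = k" for k by (simp add: vfid_def)
 note [simp] = fi rmod_obj[OF fi]
 show "func K K (vfid V K)"
  by (rule vfunctorI) (auto simp: f, simp add: vfid_def idt_homs)
 show "eacc K fi K fi (vfid V K) (%k p. p)"
  unfolding eacc_def o
 proof (intro conjI ballI allI impI)
  fix a X ws t assume "a : vob K" "ob X" "ok ws" and t: "klan K fi K fi (vfid V K) t ws a X"
  then show "EX r. nat1 ws [] fi$a X r & (ALL k:vob K. ALL p:El fi$k. ALL g:EH K a k. r (ract K fi a k p g) = t k p g)"
   using t unfolding klan_def o by (intro exI[of _ "%p. t a p (idg K a)"]) (auto simp: f cp_idg dest!: bspec[of _ _ "idg K a"])
 next
  fix a X ws r s m assume "a : vob K" "m : El fi$a"
   "ALL k:vob K. ALL p:El fi$k. ALL g:EH K a k. r (ract K fi a k p g) = s (ract K fi a k p g)"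
  from this(3)[rule_format, of a m "idg K a"] this(1,2) show "r m = s m" by (simp add: ract_idg)
 qed (auto simp: f intro: nat1_id)
qed

section \<open>The two presheaf categories with ends\<close>

lemma mcat_presheaves:
 fixes ka :: "'u rel" and K :: "('k, 'o, 'm) vcat"
 assumes "Cinfinite ka" "complete_cat ka V" "cat K" "small_vcat ka V K"
 shows "mcat K {F. rmod K F}"
 unfolding mcat_def using small_end_exists[OF assms] assms(3) by blast

lemma accessible_iff:
 fixes ka :: "'u rel"
 assumes A: "cat A"
 shows "accessible ka V A M \<longleftrightarrow> rmod A M & (EX (K :: ('u, 'o, 'm) vcat) fi H u. weight ka V K fi & func K A H & eacc A M K fi H u)"
proof
 assume "accessible ka V A M"
 then obtain K :: "('u, 'o, 'm) vcat" and fi H omg where M: "rmod A M" and h: "weight ka V K fi" "func K A H"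
  "!!a. a : vob A ==> wcolim V VV K fi (fc (homf A a) H) M$a (omg a)"
  "!!X k. ob X ==> k : vob K ==> vnat V A VV (fc (yo VV X) (vfop M))
      (fc (homf VV fi$k) (fc (yo VV X) (vfop (yo A H$k))))
      (%a. name_of V (hom M$a X) (hom fi$k (hom (vhom A a H$k) X)) (omg a X k))"
  unfolding accessible_def by blast
 moreover have "cat K" "rmod K fi" using h(1) unfolding weight_def by auto
 ultimately show "rmod A M & (EX (K :: ('u, 'o, 'm) vcat) fi H u. weight ka V K fi & func K A H & eacc A M K fi H u)"
  using accessible_eacc[OF A _ _ h(2) M] by blast
next
 assume *: "rmod A M & (EX (K :: ('u, 'o, 'm) vcat) fi H u. weight ka V K fi & func K A H & eacc A M K fi H u)"
 then obtain K :: "('u, 'o, 'm) vcat" and fi H u where h: "weight ka V K fi" "func K A H" "eacc A M K fi H u" by blast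
 then have K: "cat K" "rmod K fi" unfolding weight_def by auto
 from * have M: "rmod A M" ..
 show "accessible ka V A M"
  unfolding accessible_def using M eacc_accessible[OF A K h(2) M h(3)] h(1,2) by blast
qed

text \<open>\<open>eacc_end_exists\<close> reduces each end to one over the domain of a weight, and
  \<open>small_end_exists\<close> supplies the latter.\<close>

lemma mcat_PP:
 fixes ka :: "'u rel"
 assumes u: "Cinfinite ka" "complete_cat ka V" and A: "cat A"
 shows "mcat A {F. accessible ka V A F}"
 unfolding mcat_def
proof (intro conjI ballI)
 fix M G assume "M : {F. accessible ka V A F}" "G : {F. accessible ka V A F}"
 then have M: "rmod A M" and G: "rmod A G" and "accessible ka V A M" unfolding accessible_iff[OF A] by auto
 then obtain K :: "('u, 'o, 'm) vcat" and fi H u where h: "weight ka V K fi" "func K A H" "eacc A M K fi H u"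
  unfolding accessible_iff[OF A] by blast
 then have K: "cat K" "rmod K fi" "small_vcat ka V K" unfolding weight_def by auto
 obtain E0 e0 where "hom_end V (Op K) VV fi (pull G H) E0 e0"
  using small_end_exists[OF u K(1,3,2) pull(1)[OF A K(1) h(2) G]] by blast
 from eacc_end_exists[OF A K(1,2) h(2) M h(3) G this] show "EX E e. hom_end V (Op A) VV M G E e" .
next
 show "rmod A F" if "F : {F. accessible ka V A F}" for F using that accessible_iff[OF A] by blast
qed (rule A)

section \<open>Dual pairs of modules\<close>


text \<open>Abstraction over a trailing block \<open>qs\<close> of the stage of \<open>e\<close>;
  application to the generic element \<open>gq qs\<close> of \<open>T qs\<close> gives
  \<open>e\<close> back.\<close>

definition "lamB as qs X e = lamF as (T qs) X (%z. rmid as qs (st z) [] (snd z) e)"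

lemma lhom_snd: "z : El (T qs) ==> ok qs ==> lhom (st z) qs (snd z)"
 using El_D by (simp add: lhom_def homs_iff)

lemma nat1_rmid_snd:
 assumes "e : El X" "st e = as @ qs"
 shows "nat1 as [] (T qs) X (%z. rmid as qs (st z) [] (snd z) e)"
proof (rule nat1I)
 have o: "ok as" "ok qs" using El_ok[OF assms(1)] assms(2) by auto
 fix z vs s assume z: "z : El (T qs)" and s: "lhom vs (st z) s"
 show "rmid as qs (st (re vs s z)) [] (snd (re vs s z)) e = rmid as (st z) vs [] s (rmid as qs (st z) [] (snd z) e)"
  using rmid_rmid[OF assms(1) _ lhom_snd[OF z o(2)] s] assms(2) by (simp add: re_def)
qed (use El_ok[OF assms(1)] assms in "auto intro!: rmid_El lhom_snd")

lemma lamB: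
 assumes "e : El X" "st e = as @ qs"
 shows "lamB as qs X e : El (hom (T qs) X)" "st (lamB as qs X e) = as"
  "ap (T qs) X (lamB as qs X e) (gq qs) = e"
proof -
 have o: "ok as" "ok qs" using El_ok[OF assms(1)] assms(2) by auto
 note l = lamF[OF nat1_rmid_snd[OF assms] T_obj[OF o(2)]]
 show "lamB as qs X e : El (hom (T qs) X)" "st (lamB as qs X e) = as" unfolding lamB_def using l by simp_all
 show "ap (T qs) X (lamB as qs X e) (gq qs) = e"
  unfolding lamB_def l(2)[OF gq_El[OF o(2)]] using rmid_one[OF assms(1)] assms(2) by (simp add: gq_def)
qed

lemma nat1_lamB:
 assumes t: "nat1 ps rs' Y X t" and r: "rs' = rs @ qs" and Y [simp]: "ob Y" and P: "!!x. P x = ps @ st x @ rs"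
 shows "nat1 ps rs Y (hom (T qs) X) (%x. lamB (P x) qs X (t x))"
proof -
 note o = nat1_ok[OF t Y]
 have q: "ok qs" "ok rs" using o r by auto
 show ?thesis unfolding lamB_def
 proof (rule nat1_lamF)
  fix x assume x: "x : El Y"
  show "nat1 (ps @ st x @ rs) [] (T qs) X (%z. rmid (P x) qs (st z) [] (snd z) (t x))"
   unfolding P by (rule nat1_rmid_snd[OF nat1D(1)[OF t x]]) (use nat1D(2)[OF t x] r in simp)
 next
  fix z assume z: "z : El (T qs)"
  show "nat1 ps (rs @ st z) Y X (%x. rmid (P x) qs (st z) [] (snd z) (t x))"
   by (rule nat1_rmid_after[OF t _ lhom_snd[OF z q(1)], where as=rs]) (use P r in simp_all)
 qed (use q o P in simp_all)
qed

text \<open>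
  Families \<open>w j : M (h j) \<otimes> N (h j) \<rightarrow> X\<close> that coequalise the two actions, with parameters in
  \<open>ps\<close> on the left and in \<open>rs\<close> on the right.
\<close>

definition "cow A M N J h ps rs X w ==
  (ALL j : J. ALL n : El N$(h j). nat1 ps (st n @ rs) M$(h j) X (%m. w j m n)) &
  (ALL j : J. ALL m : El M$(h j). nat1 (ps @ st m) rs N$(h j) X (w j m)) &
  (ALL i : J. ALL j : J. ALL m : El M$(h j). ALL f : EH A (h i) (h j). ALL n : El N$(h i).
   w i (ract A M (h i) (h j) m f) n = w j m (lact N (h i) (h j) f n))"

lemma cowD:
 assumes "cow A M N J h ps rs X w"
 shows "j : J ==> n : El N$(h j) ==> nat1 ps (st n @ rs) M$(h j) X (%m. w j m n)"
  "j : J ==> m : El M$(h j) ==> nat1 (ps @ st m) rs N$(h j) X (w j m)"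
  "i : J ==> j : J ==> m : El M$(h j) ==> f : EH A (h i) (h j) ==> n : El N$(h i) ==>
   w i (ract A M (h i) (h j) m f) n = w j m (lact N (h i) (h j) f n)"
  "j : J ==> m : El M$(h j) ==> n : El N$(h j) ==> w j m n : El X"
  "j : J ==> m : El M$(h j) ==> n : El N$(h j) ==> st (w j m n) = ps @ st m @ st n @ rs"
proof -
 show n: "j : J ==> m : El M$(h j) ==> nat1 (ps @ st m) rs N$(h j) X (w j m)" for j m
  using assms unfolding cow_def by blast
 show "j : J ==> m : El M$(h j) ==> n : El N$(h j) ==> w j m n : El X"
  "j : J ==> m : El M$(h j) ==> n : El N$(h j) ==> st (w j m n) = ps @ st m @ st n @ rs"
  using nat1D(1,2)[OF n] by auto
qed (use assms in "unfold cow_def, blast+")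

text \<open>
  A functional on such families that is natural in \<open>X\<close> stands for an element of the coend
  \<open>\<integral>\<^sup>j M (h j) \<otimes> N (h j)\<close>, whose existence is not needed.
\<close>

definition "Sfun A M N J h S ==
  (ALL X : obj V. ALL w. cow A M N J h [] [] X w --> S X w : El X & st (S X w) = []) &
  (ALL X : obj V. ALL Y : obj V. ALL g : homs V X Y. ALL w w'. cow A M N J h [] [] X w --> cow A M N J h [] [] Y w' -->
   (ALL j : J. ALL m : El M$(h j). ALL n : El N$(h j). w' j m n = lin g (w j m n)) --> S Y w' = lin g (S X w))"

text \<open>A functional \<open>S\<close> accepts only families without parameters. Hence the
  parameters \<open>ps\<close> and \<open>rs\<close> are gathered behind the arguments and
  abstracted, so that the family takes values in \<open>[T (ps @ rs), X]\<close>.\<close>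

definition "wt ps rs X w j m n = lamB (st m @ st n) (ps @ rs) X (sw [] ps (st m @ st n) rs (w j m n))"

text \<open>The extension of \<open>S\<close> to families with parameters: it is applied to the
  abstracted family and the parameters are put back. It is best read as the sum of the values
  \<open>w j m n\<close> over the coend element.\<close>

definition "sig S ps rs X w = ap (T (ps @ rs)) X (S (hom (T (ps @ rs)) X) (wt ps rs X w)) (gq (ps @ rs))"

text \<open>The natural function that undoes \<open>wt\<close>.\<close>

definition "Ph ps rs X x = sw [] (st x) ps rs (ap (T (ps @ rs)) X x (gq (ps @ rs)))"

lemma nat1_Ph:
 assumes [simp]: "ok ps" "ok rs" "ob X"
 shows "nat1 ps rs (hom (T (ps @ rs)) X) X (Ph ps rs X)"
 unfolding Ph_def
proof (rule nat1_sw_left[where ?w1.0="[]" and ?w2.0="[]"])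
 show "nat1 [] (ps @ rs) (hom (T (ps @ rs)) X) X (%x. ap (T (ps @ rs)) X x (gq (ps @ rs)))"
  by (rule nat1_conv, rule nat1_ap1[OF nat1_id _ _ _ refl]) simp_all
qed simp_all

section \<open>Calculus of coend functionals with parameters\<close>

context
 fixes A :: "('a, 'o, 'm) vcat" and M N :: "('a, 'o, 'm) vfun" and J :: "'j set" and h :: "'j => 'a" and S
 assumes A [simp]: "cat A" and M [simp]: "rmod A M" and N [simp]: "smod A N" and h: "h ` J <= vob A"
  and S: "Sfun A M N J h S"
begin

lemma hJ [simp]: "j : J ==> h j : vob A"
 using h by auto

lemma sg_simps [simp]: "a : vob A ==> M$a : obj V" "a : vob A ==> N$a : obj V"
 "a : vob A ==> b : vob A ==> f : EH A a b ==> n : El N$a ==> lact N a b f n : El N$b"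
 using rmod_obj[OF M] smod_obj[OF N] lact_El[OF N] by auto

lemma cow_comp:
 assumes w: "cow A M N J h ps rs X w" and P: "nat1 as bs X Y P"
  and e: "!!j m n. j : J ==> m : El M$(h j) ==> n : El N$(h j) ==> w' j m n = P (w j m n)"
  and q: "ps' = as @ ps" "rs' = rs @ bs"
 shows "cow A M N J h ps' rs' Y w'"
 unfolding cow_def
proof (intro conjI ballI)
 fix j n assume jn: "j : J" "n : El N$(h j)"
 show "nat1 ps' (st n @ rs') M$(h j) Y (%m. w' j m n)"
  by (rule nat1_cong[OF nat1_comp[OF cowD(1)[OF w jn] P]]) (use jn q e in simp_all)
next
 fix j m assume jm: "j : J" "m : El M$(h j)"
 show "nat1 (ps' @ st m) rs' N$(h j) Y (w' j m)"
  by (rule nat1_cong[OF nat1_comp[OF cowD(2)[OF w jm] P]]) (use jm q e in simp_all)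
next
 fix i j m f n assume "i : J" "j : J" "m : El M$(h j)" "f : EH A (h i) (h j)" "n : El N$(h i)"
 then show "w' i (ract A M (h i) (h j) m f) n = w' j m (lact N (h i) (h j) f n)"
  using cowD(3)[OF w] by (simp add: e)
qed

lemma cow_wt:
 assumes w: "cow A M N J h ps rs X w" and o [simp]: "ok ps" "ok rs" and X [simp]: "ob X"
 shows "cow A M N J h [] [] (hom (T (ps @ rs)) X) (wt ps rs X w)"
  "!!j m n. j : J ==> m : El M$(h j) ==> n : El N$(h j) ==> Ph ps rs X (wt ps rs X w j m n) = w j m n"
  "!!j m n. j : J ==> m : El M$(h j) ==> n : El N$(h j) ==> wt ps rs X w j m n : El (hom (T (ps @ rs)) X)"
  "!!j m n. j : J ==> m : El M$(h j) ==> n : El N$(h j) ==> st (wt ps rs X w j m n) = st m @ st n"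
proof -
 note d = cowD[OF w]
 have sE: "sw [] ps (st m @ st n) rs (w j m n) : El X" if "j : J" "m : El M$(h j)" "n : El N$(h j)" for j m n
  by (rule sw_El[OF d(4)[OF that]]) (simp add: d(5)[OF that])
 show "wt ps rs X w j m n : El (hom (T (ps @ rs)) X)" "st (wt ps rs X w j m n) = st m @ st n"
  if "j : J" "m : El M$(h j)" "n : El N$(h j)" for j m n
  unfolding wt_def by (rule lamB[OF sE[OF that]]; simp)+
 show "Ph ps rs X (wt ps rs X w j m n) = w j m n" if "j : J" "m : El M$(h j)" "n : El N$(h j)" for j m n
  unfolding Ph_def wt_def using lamB(2,3)[OF sE[OF that]] sw_sw[OF d(4)[OF that]] d(5)[OF that] by simp
 show "cow A M N J h [] [] (hom (T (ps @ rs)) X) (wt ps rs X w)"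
  unfolding cow_def
 proof (intro conjI ballI)
  fix j n assume [simp]: "j : J" "n : El N$(h j)"
  show "nat1 [] (st n @ []) M$(h j) (hom (T (ps @ rs)) X) (%m. wt ps rs X w j m n)"
   unfolding wt_def
   by (rule nat1_lamB[where rs' = "st n @ ps @ rs"], rule nat1_sw_right[where ?w1.0="[]" and ?w2.0="st n", OF d(1)]) simp_all
 next
  fix j m assume [simp]: "j : J" "m : El M$(h j)"
  show "nat1 ([] @ st m) [] N$(h j) (hom (T (ps @ rs)) X) (wt ps rs X w j m)"
   unfolding wt_def
   by (rule nat1_lamB[where rs' = "ps @ rs"], rule nat1_sw_right[where ?w1.0="st m" and ?w2.0="[]", OF d(2)]) simp_all
 qed (simp add: wt_def d(3))
qed

lemma SfunD:
 assumes "cow A M N J h [] [] X w" "ob X"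
 shows "S X w : El X" "st (S X w) = []"
 using assms S unfolding Sfun_def by auto

lemma SfunN:
 assumes "cow A M N J h [] [] X w" "cow A M N J h [] [] Y w'" "ob X" "ob Y" "g : homs V X Y"
  "!!j m n. j : J ==> m : El M$(h j) ==> n : El N$(h j) ==> w' j m n = lin g (w j m n)"
 shows "S Y w' = lin g (S X w)"
 using S assms unfolding Sfun_def by blast

lemma sig_Ph:
 assumes w: "cow A M N J h ps rs X w" and o [simp]: "ok ps" "ok rs" and X [simp]: "ob X"
 shows "sig S ps rs X w = Ph ps rs X (S (hom (T (ps @ rs)) X) (wt ps rs X w))"
proof -
 note s = SfunD[OF cow_wt(1)[OF assms]]
 have "ap (T (ps @ rs)) X (S (hom (T (ps @ rs)) X) (wt ps rs X w)) (gq (ps @ rs)) : El X"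
  using s by simp
 from sw_Nil_left[OF this, of "[]" ps rs] s show ?thesis unfolding sig_def Ph_def by simp
qed

text \<open>The source of all laws of \<open>sig\<close>. A natural function \<open>P\<close>, with
  its parameters abstracted, is an arrow of \<open>V\<close>, and \<open>S\<close> is natural along
  arrows; so a family that factors by \<open>P\<close> through a parameter-free one is summed by
  applying \<open>P\<close> to the sum.\<close>

lemma sig_master:
 assumes v: "cow A M N J h [] [] Z v" and P: "nat1 ps rs Z X P" and o [simp]: "ok ps" "ok rs" and X [simp]: "ob X" "ob Z"
  and w: "!!j m n. j : J ==> m : El M$(h j) ==> n : El N$(h j) ==> w j m n = P (v j m n)"
 shows "sig S ps rs X w = P (S Z v)"
proof -
 have wc: "cow A M N J h ps rs X w" by (rule cow_comp[OF v P w]) simp_all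
 let ?g = "%x. lamB (st x) (ps @ rs) X (sw [] ps (st x) rs (P x))"
 have n: "nat1 [] [] Z (hom (T (ps @ rs)) X) ?g"
  by (rule nat1_lamB[where rs' = "ps @ rs"], rule nat1_sw_right[where ?w1.0="[]" and ?w2.0="[]", OF P]) simp_all
 note a = arr1[OF n X(2)]
 note s = SfunD[OF v X(2)]
 note PE = nat1D(1,2)[OF P s(1)]
 have "S (hom (T (ps @ rs)) X) (wt ps rs X w) = lin (arr1 Z ?g) (S Z v)"
 proof (rule SfunN[OF v cow_wt(1)[OF wc o X(1)] X(2) _ a(1)])
  fix j m n assume "j : J" "m : El M$(h j)" "n : El N$(h j)"
  then show "wt ps rs X w j m n = lin (arr1 Z ?g) (v j m n)"
   using a(2)[OF cowD(4)[OF v]] cowD(5)[OF v] w by (simp add: wt_def)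
 qed simp
 then have "sig S ps rs X w = ap (T (ps @ rs)) X (?g (S Z v)) (gq (ps @ rs))"
  unfolding sig_def a(2)[OF s(1)] by simp
 also have "... = P (S Z v)"
  using lamB(3)[OF sw_El[OF PE(1)], of "[]" ps "[]" rs "[]" "ps @ rs"] sw_Nil_right[OF PE(1)] PE(2) s(2) by simp
 finally show ?thesis .
qed

lemma sig_comp:
 assumes w: "cow A M N J h ps rs X w" and o [simp]: "ok ps" "ok rs" "ok as" "ok bs" and X [simp]: "ob X" "ob Y"
  and P: "nat1 as bs X Y P" and q: "ps' = as @ ps" "rs' = rs @ bs"
  and e: "!!j m n. j : J ==> m : El M$(h j) ==> n : El N$(h j) ==> w' j m n = P (w j m n)"
 shows "sig S ps' rs' Y w' = P (sig S ps rs X w)"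
 unfolding sig_Ph[OF w o(1,2) X(1)]
 by (rule sig_master[OF cow_wt(1)[OF w o(1,2) X(1)]])
  (use q e cow_wt(2)[OF w o(1,2) X(1)] in "simp_all add: nat1_comp[OF nat1_Ph P]")

lemma sig_El:
 assumes w: "cow A M N J h ps rs X w" and o [simp]: "ok ps" "ok rs" and X [simp]: "ob X"
 shows "sig S ps rs X w : El X" "st (sig S ps rs X w) = ps @ rs"
 using nat1D(1,2)[OF nat1_Ph[OF o X] SfunD(1)[OF cow_wt(1)[OF assms]]] SfunD(2)[OF cow_wt(1)[OF assms]]
 unfolding sig_Ph[OF assms] by simp_all

lemma sig_cong:
 assumes w: "cow A M N J h ps rs X w" and o [simp]: "ok ps" "ok rs" and X [simp]: "ob X"
  and e: "!!j m n. j : J ==> m : El M$(h j) ==> n : El N$(h j) ==> w' j m n = w j m n"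
 shows "sig S ps rs X w' = sig S ps rs X w"
 by (rule sig_comp[OF w o _ _ X X nat1_id]) (use e in simp_all)

lemma nat1_sig_right:
 assumes w: "!!y. y : El Y ==> cow A M N J h ps (r1 @ st y @ r2) X (w y)"
  and n: "!!j m n. j : J ==> m : El M$(h j) ==> n : El N$(h j) ==> nat1 (ps @ st m @ st n @ r1) r2 Y X (%y. w y j m n)"
  and o [simp]: "ok ps" "ok r1" "ok r2" and X [simp]: "ob X" "ob Y" and R: "!!y. R y = r1 @ st y @ r2" and p: "ps' = ps @ r1"
 shows "nat1 ps' r2 Y X (%y. sig S ps (R y) X (w y))"
 unfolding R p
proof (rule nat1I)
 fix y vs s assume y: "y : El Y" and s: "lhom vs (st y) s" and y': "re vs s y : El Y"
 note s' [simp] = lhomD[OF s]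
 have l: "ok (r1 @ st y @ r2)" by simp
 show "sig S ps (r1 @ st (re vs s y) @ r2) X (w (re vs s y)) = rmid (ps @ r1) (st y) vs r2 s (sig S ps (r1 @ st y @ r2) X (w y))"
  unfolding sig_Ph[OF w[OF y] o(1) l X(1)]
 proof (subst sig_master[OF cow_wt(1)[OF w[OF y] o(1) l X(1)], where P = "%x. rmid (ps @ st x @ r1) (st y) vs r2 s (Ph ps (r1 @ st y @ r2) X x)"])
  show "nat1 ps (r1 @ st (re vs s y) @ r2) (hom (T (ps @ r1 @ st y @ r2)) X) X (%x. rmid (ps @ st x @ r1) (st y) vs r2 s (Ph ps (r1 @ st y @ r2) X x))"
   by (rule nat1_rmid_after[OF nat1_Ph _ s, where as=r1]) simp_all
  fix j m k assume *: "j : J" "m : El M$(h j)" "k : El N$(h j)"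
  show "w (re vs s y) j m k = rmid (ps @ st (wt ps (r1 @ st y @ r2) X (w y) j m k) @ r1) (st y) vs r2 s (Ph ps (r1 @ st y @ r2) X (wt ps (r1 @ st y @ r2) X (w y) j m k))"
   using nat1D(3)[OF n[OF *] y s] cow_wt(2,4)[OF w[OF y] o(1) l X(1) *] by simp
 qed (use SfunD(2)[OF cow_wt(1)[OF w[OF y] o(1) l X(1)]] in simp_all)
qed (use sig_El[OF w] in simp_all)

lemma nat1_sig_left:
 assumes w: "!!y. y : El Y ==> cow A M N J h (p1 @ st y @ p2) rs X (w y)"
  and n: "!!j m n. j : J ==> m : El M$(h j) ==> n : El N$(h j) ==> nat1 p1 (p2 @ st m @ st n @ rs) Y X (%y. w y j m n)"
  and o [simp]: "ok rs" "ok p1" "ok p2" and X [simp]: "ob X" "ob Y" and R: "!!y. R y = p1 @ st y @ p2" and p: "rs' = p2 @ rs"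
 shows "nat1 p1 rs' Y X (%y. sig S (R y) rs X (w y))"
 unfolding R p
proof (rule nat1I)
 fix y vs s assume y: "y : El Y" and s: "lhom vs (st y) s" and y': "re vs s y : El Y"
 note s' [simp] = lhomD[OF s]
 have l: "ok (p1 @ st y @ p2)" by simp
 show "sig S (p1 @ st (re vs s y) @ p2) rs X (w (re vs s y)) = rmid p1 (st y) vs (p2 @ rs) s (sig S (p1 @ st y @ p2) rs X (w y))"
  unfolding sig_Ph[OF w[OF y] l o(1) X(1)]
 proof (subst sig_master[OF cow_wt(1)[OF w[OF y] l o(1) X(1)], where P = "%x. rmid p1 (st y) vs (p2 @ st x @ rs) s (Ph (p1 @ st y @ p2) rs X x)"])
  show "nat1 (p1 @ st (re vs s y) @ p2) rs (hom (T ((p1 @ st y @ p2) @ rs)) X) X (%x. rmid p1 (st y) vs (p2 @ st x @ rs) s (Ph (p1 @ st y @ p2) rs X x))"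
   by (rule nat1_rmid_before[OF nat1_Ph _ s, where bs=p2]) simp_all
  fix j m k assume *: "j : J" "m : El M$(h j)" "k : El N$(h j)"
  show "w (re vs s y) j m k = rmid p1 (st y) vs (p2 @ st (wt (p1 @ st y @ p2) rs X (w y) j m k) @ rs) s (Ph (p1 @ st y @ p2) rs X (wt (p1 @ st y @ p2) rs X (w y) j m k))"
   using nat1D(3)[OF n[OF *] y s] cow_wt(2,4)[OF w[OF y] l o(1) X(1) *] by simp
 qed (use SfunD(2)[OF cow_wt(1)[OF w[OF y] l o(1) X(1)]] in simp_all)
qed (use sig_El[OF w] in simp_all)

text \<open>Parameters may change sides because the summed element has empty stage: after summation
  nothing is left for their block to pass.\<close>

lemma sig_sw_right:
 assumes w: "cow A M N J h ps [] X w" and o [simp]: "ok ps" and X [simp]: "ob X"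
  and e: "!!j m n. j : J ==> m : El M$(h j) ==> n : El N$(h j) ==> w' j m n = sw [] ps (st m @ st n) [] (w j m n)"
 shows "sig S [] ps X w' = sig S ps [] X w"
proof -
 have o': "ok []" by simp
 note s = SfunD[OF cow_wt(1)[OF w o o' X]]
 have "sig S [] ps X w' = sw [] ps (st (S (hom (T (ps @ [])) X) (wt ps [] X w))) [] (Ph ps [] X (S (hom (T (ps @ [])) X) (wt ps [] X w)))"
 proof (rule sig_master[OF cow_wt(1)[OF w o o' X]])
  show "nat1 [] ps (hom (T (ps @ [])) X) X (%x. sw [] ps (st x) [] (Ph ps [] X x))"
   by (rule nat1_sw_right[where ?w1.0="[]" and ?w2.0="[]", OF nat1_Ph[OF o o' X]]) simp_all
 qed (use cow_wt(2,4)[OF w o o' X] e in simp_all)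
 also have "... = sig S ps [] X w"
  using s sw_Nil_right[OF sig_El(1)[OF w o o' X], of "[]" ps "[]"] sig_El(2)[OF w o o'] sig_Ph[OF w o o'] by simp
 finally show ?thesis .
qed

lemma sig_sw_left:
 assumes w: "cow A M N J h [] rs X w" and o [simp]: "ok rs" and X [simp]: "ob X"
  and e: "!!j m n. j : J ==> m : El M$(h j) ==> n : El N$(h j) ==> w' j m n = sw [] (st m @ st n) rs [] (w j m n)"
 shows "sig S rs [] X w' = sig S [] rs X w"
proof -
 have o': "ok []" by simp
 note s = SfunD[OF cow_wt(1)[OF w o' o X]]
 have "sig S rs [] X w' = sw [] (st (S (hom (T ([] @ rs)) X) (wt [] rs X w))) rs [] (Ph [] rs X (S (hom (T ([] @ rs)) X) (wt [] rs X w)))"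
 proof (rule sig_master[OF cow_wt(1)[OF w o' o X]])
  show "nat1 rs [] (hom (T ([] @ rs)) X) X (%x. sw [] (st x) rs [] (Ph [] rs X x))"
   by (rule nat1_sw_left[where ?w1.0="[]" and ?w2.0="[]", OF nat1_Ph[OF o' o X]]) simp_all
 qed (use cow_wt(2,4)[OF w o' o X] e in simp_all)
 also have "... = sig S [] rs X w"
  using s sw_Nil_left[OF sig_El(1)[OF w o' o X], of "[]" rs "[]"] sig_El(2)[OF w o' o] sig_Ph[OF w o' o] by simp
 finally show ?thesis .
qed

end

lemma nat1_sw:
 assumes t: "nat1 ps rs X Y t" and x: "x : El X" "st x = as @ ws @ vs @ bs"
 shows "t (sw as ws vs bs x) = sw (ps @ as) ws vs (bs @ rs) (t x)"
proof -
 have X: "ob X" using El_D[OF x(1)] by simp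
 have o [simp]: "ok as" "ok ws" "ok vs" "ok bs" using El_ok[OF x(1)] x(2) by auto
 note o' [simp] = nat1_ok[OF t X]
 have "t (sw as ws vs bs x) = rmid ps (as @ ws @ vs @ bs) (as @ vs @ ws @ bs) rs
   (tt as as ((vs @ ws) @ bs) ((ws @ vs) @ bs) (one (T as)) (tt (vs @ ws) (ws @ vs) bs bs (sg vs ws) (one (T bs)))) (t x)"
  unfolding sw_def rmid_def[of as] using nat1D(3)[OF t x(1)] x(2) rmid_lhom[OF lhom_sg] by simp
 then show ?thesis
  using rmid_nested[of as bs ps rs "vs @ ws" "ws @ vs" "sg vs ws"] by (simp add: sw_def)
qed

end

text \<open>\<open>e a b\<close> is a map of bimodules
  \<open>N b \<otimes> M a \<rightarrow> A(a, b)\<close>, and \<open>S\<close> is a candidate for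
  the coend element dual to it. The coend runs over the objects \<open>h j\<close> with
  \<open>j\<close> in \<open>J\<close>, so that it can be made small without changing
  \<open>A\<close>.\<close>

locale pairing = symmetric_monoidal_closed V
 for V :: "('o, 'm) smcat" and A :: "('a, 'o, 'm) vcat" and M N :: "('a, 'o, 'm) vfun"
  and e :: "'a => 'a => 'o list * 'm => 'o list * 'm => 'o list * 'm" and J :: "'j set" and h :: "'j => 'a" and S +
 assumes A: "cat A" and M: "rmod A M" and N: "smod A N" and h: "h ` J <= vob A"
  and S: "Sfun A M N J h S"
  and e1: "!!a b n. a : vob A ==> b : vob A ==> n : El N$b ==> nat1 (st n) [] M$a (vhom A a b) (e a b n)"
  and e2: "!!a b m. a : vob A ==> b : vob A ==> m : El M$a ==> nat1 [] (st m) N$b (vhom A a b) (%n. e a b n m)"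
  and eL: "!!a b c f n m. a : vob A ==> b : vob A ==> c : vob A ==> f : EH A b c ==> n : El N$b ==>
   m : El M$a ==> e a c (lact N b c f n) m = cp A a b c f (e a b n m)"
  and eR: "!!a a' b f n m. a : vob A ==> a' : vob A ==> b : vob A ==> f : EH A a a' ==> n : El N$b ==>
   m : El M$a' ==> e a b n (ract A M a a' m f) = cp A a a' b (e a' b n m) f"
begin

declare A [simp] M [simp] N [simp]

lemma pr_simps [simp]: "j : J ==> h j : vob A" "a : vob A ==> M$a : obj V" "a : vob A ==> N$a : obj V"
 "a : vob A ==> b : vob A ==> f : EH A a b ==> n : El N$a ==> lact N a b f n : El N$b"
 "a : vob A ==> b : vob A ==> f : EH A a b ==> m : El M$b ==> ract A M a b m f : El M$a"
 by (use h in blast, rule rmod_obj[OF M], assumption, rule smod_obj[OF N], assumption, rule lact_El[OF N], assumption+,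
  rule ract_El[OF M], assumption+)

lemma e_El [simp]: "a : vob A ==> b : vob A ==> n : El N$b ==> m : El M$a ==> e a b n m : EH A a b"
 "a : vob A ==> b : vob A ==> n : El N$b ==> m : El M$a ==> st (e a b n m) = st n @ st m"
 using nat1D(1,2)[OF e1] by simp_all

text \<open>Evaluation against a fixed \<open>m'\<close> turns a family with arguments in
  \<open>M\<close> and in the homs from \<open>a\<close> into a dinatural family on \<open>M\<close>
  and \<open>N\<close>, to which \<open>S\<close> applies. This is the form in which Kan extension
  data meet the coend.\<close>

lemma cow_klan:
 assumes a [simp]: "a : vob A" and m' [simp]: "m' : El M$a" and X [simp]: "ob X"
  and t1: "!!j m. j : J ==> m : El M$(h j) ==> nat1 (ws @ st m) [] (vhom A a (h j)) X (t j m)"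
  and t2: "!!j g. j : J ==> g : EH A a (h j) ==> nat1 ws (st g) M$(h j) X (%m. t j m g)"
  and t3: "!!i j m f g. i : J ==> j : J ==> m : El M$(h j) ==> f : EH A (h i) (h j) ==> g : EH A a (h i) ==>
   t i (ract A M (h i) (h j) m f) g = t j m (cp A a (h i) (h j) f g)"
 shows "cow A M N J h ws (st m') X (%j m n. t j m (e a (h j) n m'))"
 unfolding cow_def
proof (intro conjI ballI)
 fix j n assume [simp]: "j : J" "n : El N$(h j)"
 show "nat1 ws (st n @ st m') M$(h j) X (%m. t j m (e a (h j) n m'))"
  by (rule nat1_conv[OF t2]) simp_all
next
 fix j m assume [simp]: "j : J" "m : El M$(h j)"
 show "nat1 (ws @ st m) (st m') N$(h j) X (%n. t j m (e a (h j) n m'))"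
  by (rule nat1_comp[OF e2 t1]) simp_all
qed (simp add: t3 eL)

lemma cow_Z1:
 assumes a [simp]: "a : vob A" and m' [simp]: "m' : El M$a"
 shows "cow A M N J h [] (st m') M$a (%j m n. ract A M a (h j) m (e a (h j) n m'))"
proof (rule cow_klan[OF a m'])
 fix j m assume [simp]: "j : J" "m : El M$(h j)"
 show "nat1 ([] @ st m) [] (vhom A a (h j)) M$a (ract A M a (h j) m)"
  by (rule nat1_conv[OF nat1_ract2[OF nat1_id M A]]) simp_all
next
 fix j g assume [simp]: "j : J" "g : EH A a (h j)"
 show "nat1 [] (st g) M$(h j) M$a (%m. ract A M a (h j) m g)"
  by (rule nat1_conv[OF nat1_ract1[OF nat1_id M A]]) simp_all
qed (simp_all add: ract_ract[OF M A])

lemma cow_eqv: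
 assumes b [simp]: "b : vob A" and s: "eqv A M (yo A b) qs s"
 shows "cow A M N J h qs [] N$b (%j m n. lact N (h j) b (s (h j) m) n)"
 unfolding cow_def
proof (intro conjI ballI)
 have n: "nat1 qs [] M$a (vhom A a b) (s a)" if "a : vob A" for a
  using s that unfolding eqv_def by simp
 note sE [simp] = nat1D(1)[OF n]
 note sS [simp] = nat1D(2)[OF n]
 {
  fix j n' assume [simp]: "j : J" "n' : El N$(h j)"
  show "nat1 qs (st n' @ []) M$(h j) N$b (%m. lact N (h j) b (s (h j) m) n')"
   by (rule nat1_conv[OF nat1_lact1[OF n N]]) simp_all
 next
  fix j m assume [simp]: "j : J" "m : El M$(h j)"
  show "nat1 (qs @ st m) [] N$(h j) N$b (lact N (h j) b (s (h j) m))"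
   by (rule nat1_conv[OF nat1_lact2[OF nat1_id N]]) simp_all
 next
  fix i j m f n' assume [simp]: "i : J" "j : J" "m : El M$(h j)" "f : EH A (h i) (h j)" "n' : El N$(h i)"
  have "s (h i) (ract A M (h i) (h j) m f) = cp A (h i) (h j) b (s (h j) m) f"
   using s vrep(2)[OF A b] unfolding eqv_def by simp
  then show "lact N (h i) b (s (h i) (ract A M (h i) (h j) m f)) n' = lact N (h j) b (s (h j) m) (lact N (h i) (h j) f n')"
   by (simp add: lact_cp)
 }
qed

lemma eqv_e: "b : vob A ==> n : El N$b ==> eqv A M (yo A b) (st n) (%a m. e a b n m)"
 unfolding eqv_def using vrep(2)[OF A] e1 by (auto simp: eR)

end

text \<open>The triangle identities of a duality, with the coend element inserted by
  \<open>sig\<close>: \<open>Z1\<close> expands an element of \<open>M\<close>, and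
  \<open>Z2\<close> one of \<open>N\<close>.\<close>

locale dual_pair = pairing V A M N e J h S
 for V :: "('o, 'm) smcat" and A :: "('a, 'o, 'm) vcat" and M N e and J :: "'j set" and h S +
 assumes Z1: "!!a m'. a : vob A ==> m' : El M$a ==>
   sig S [] (st m') M$a (%j m n. ract A M a (h j) m (e a (h j) n m')) = m'"
  and Z2: "!!b n'. b : vob A ==> n' : El N$b ==>
   sig S (st n') [] N$b (%j m n. lact N (h j) b (e (h j) b n' m) n) = n'"

context symmetric_monoidal_closed
begin

section \<open>Symmetry of dual pairs\<close>

definition "dsw S X w = S X (%j m n. sw [] (st n) (st m) [] (w j n m))"

context
 fixes A B :: "('a, 'o, 'm) vcat" and M N J h S
 assumes AB: "opp A B" and A [simp]: "cat A" and M [simp]: "rmod A M" and N [simp]: "smod A N"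
  and h: "h ` J <= vob A" and S: "Sfun A M N J h S"
begin

lemma hv [simp]: "j : J ==> h j : vob A"
 using h by auto

lemma opp_simps [simp]: "vob B = vob A" "a : vob A ==> b : vob A ==> vhom B a b = vhom A b a" "a : vob A ==> idg B a = idg A a"
 using oppD[OF AB] by auto

lemma opp_mods: "cat B" "smod B M" "rmod B N"
proof -
 show B: "cat B" by (rule opp_vcategory[OF AB A])
 show "smod B M" by (rule iffD1[OF opp_smod[OF opp_sym[OF A AB] B] M])
 show "rmod B N" by (rule iffD2[OF opp_smod[OF AB A] N])
qed

lemma ract_opp: "a : vob A ==> b : vob A ==> n : El N$b ==> f : EH A b a ==>
  ract B N a b n f = sw [] (st f) (st n) [] (lact N b a f n)"
 using ract_lact[OF opp_mods(3)] by simp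

lemma ms_simps [simp]: "a : vob A ==> M$a : obj V" "a : vob A ==> N$a : obj V"
 "a : vob A ==> b : vob A ==> f : EH A a b ==> n : El N$a ==> lact N a b f n : El N$b"
 "a : vob A ==> b : vob A ==> f : EH A b a ==> m : El M$a ==> lact M a b f m : El M$b"
 using rmod_obj[OF M] smod_obj[OF N] lact_El[OF N] lact_El[OF M] by simp_all

text \<open>Over \<open>B\<close> the two actions exchange their roles, so the dinaturality equation
  is the same up to the order of its three blocks, which \<open>sw_rev3'\<close> settles.\<close>

lemma cow_swap:
 assumes w: "cow B N M J h ps rs X w"
 shows "cow A M N J h ps rs X (%j m n. sw ps (st n) (st m) rs (w j n m))"
 unfolding cow_def
proof (intro conjI ballI)
 note d = cowD[OF w]
 fix j n assume [simp]: "j : J" "n : El N$(h j)"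
 show "nat1 ps (st n @ rs) M$(h j) X (%m. sw ps (st n) (st m) rs (w j n m))"
  by (rule nat1_sw_right[where ?w1.0="[]" and ?w2.0="[]", OF d(2)]) simp_all
next
 note d = cowD[OF w]
 fix j m assume [simp]: "j : J" "m : El M$(h j)"
 show "nat1 (ps @ st m) rs N$(h j) X (%n. sw ps (st n) (st m) rs (w j n m))"
  by (rule nat1_sw_left[where ?w1.0="[]" and ?w2.0="[]", OF d(1)]) simp_all
next
 note d = cowD[OF w]
 fix i j m f n assume [simp]: "i : J" "j : J" "m : El M$(h j)" "f : EH A (h i) (h j)" "n : El N$(h i)"
 define y where "y = w j (lact N (h i) (h j) f n) m"
 have y: "y : El X" "st y = ps @ st f @ st n @ st m @ rs"
  unfolding y_def using d(4) d(5) by simp_all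
 let ?z = "sw ps (st f) (st n) (st m @ rs) y"
 have z: "?z : El X" using y by (intro sw_El) simp_all
 have "w i n (lact M (h j) (h i) f m) = w j (ract B N (h j) (h i) n f) m"
  using d(3) by simp
 also have "... = ?z"
  unfolding y_def ract_opp[OF hv[OF `j : J`] hv[OF `i : J`] `n : _` `f : _`]
  by (subst nat1_sw[OF d(1)]) simp_all
 finally have 1: "w i n (lact M (h j) (h i) f m) = ?z" .
 have "w i n (ract A M (h i) (h j) m f) = sw (ps @ st n) (st f) (st m) rs ?z"
  unfolding ract_lact[OF M hv[OF `i : J`] hv[OF `j : J`] `m : _` `f : _`]
  by (subst nat1_sw[OF d(2)]) (simp_all add: 1)
 moreover have "sw ps (st n) (st m @ st f) rs (sw (ps @ st n) (st f) (st m) rs ?z) = sw ps (st f @ st n) (st m) rs y"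
  using sw_rev3'[OF z] sw_sw y by simp
 ultimately show "sw ps (st n) (st (ract A M (h i) (h j) m f)) rs (w i n (ract A M (h i) (h j) m f)) =
   sw ps (st (lact N (h i) (h j) f n)) (st m) rs (w j (lact N (h i) (h j) f n) m)"
  unfolding y_def by simp
qed

lemma Sfun_dsw: "Sfun B N M J h (dsw S)"
 unfolding Sfun_def dsw_def
proof (intro conjI ballI allI impI)
 fix X w assume X: "ob X" and w: "cow B N M J h [] [] X w"
 show "S X (%j m n. sw [] (st n) (st m) [] (w j n m)) : El X" "st (S X (%j m n. sw [] (st n) (st m) [] (w j n m))) = []"
  using SfunD[OF A M N h S cow_swap[OF w] X] by simp_all
next
 fix X Y g w w' assume X: "ob X" "ob Y" and g: "g : homs V X Y" and w: "cow B N M J h [] [] X w" "cow B N M J h [] [] Y w'"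
  and e: "ALL j:J. ALL m:El N$(h j). ALL n:El M$(h j). w' j m n = lin g (w j m n)"
 show "S Y (%j m n. sw [] (st n) (st m) [] (w' j n m)) = lin g (S X (%j m n. sw [] (st n) (st m) [] (w j n m)))"
 proof (rule SfunN[OF A M N h S cow_swap[OF w(1)] cow_swap[OF w(2)] X g])
  fix j m n assume "j : J" "m : El M$(h j)" "n : El N$(h j)"
  then show "sw [] (st n) (st m) [] (w' j n m) = lin g (sw [] (st n) (st m) [] (w j n m))"
   using e cowD(4,5)[OF w(1)] by (simp add: lin_sw[OF g])
 qed
qed

lemma sig_dsw:
 assumes w: "cow B N M J h ps rs X w" and o [simp]: "ok ps" "ok rs" and X [simp]: "ob X"
 shows "sig (dsw S) ps rs X w = sig S ps rs X (%j m n. sw ps (st n) (st m) rs (w j n m))"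
proof -
 note B = opp_mods(1) and rN = opp_mods(3)
 note sM = opp_mods(2)
 have h': "h ` J <= vob B" using h by simp
 note c = cow_wt[OF B rN sM h' Sfun_dsw w o X]
 have "sig S ps rs X (%j m n. sw ps (st n) (st m) rs (w j n m)) =
  Ph ps rs X (S (hom (T (ps @ rs)) X) (%j m n. sw [] (st n) (st m) [] (wt ps rs X w j n m)))"
 proof (rule sig_master[OF A M N h S cow_swap[OF c(1)] nat1_Ph])
  fix j m n assume *: "j : J" "m : El M$(h j)" "n : El N$(h j)"
  show "sw ps (st n) (st m) rs (w j n m) = Ph ps rs X (sw [] (st n) (st m) [] (wt ps rs X w j n m))"
   using nat1_sw[OF nat1_Ph[OF o X] c(3)[OF *(1,3,2)]] c(2,4)[OF *(1,3,2)] by simp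
 qed simp_all
 then show ?thesis using sig_Ph[OF B rN sM h' Sfun_dsw w o] by (simp add: dsw_def)
qed

end

definition "esw e a b m n = sw [] (st n) (st m) [] (e b a n m)"

lemma pairing_swap:
 assumes D: "pairing V A M N e J h S" and AB: "opp A B"
 shows "pairing V B N M (esw e) J h (dsw S)"
proof -
 note A [simp] = pairing.A[OF D] and M [simp] = pairing.M[OF D] and N [simp] = pairing.N[OF D]
  and h = pairing.h[OF D] and S = pairing.S[OF D] and e1 = pairing.e1[OF D] and e2 = pairing.e2[OF D]
 note eL = pairing.eL[OF D] and eR = pairing.eR[OF D]
 note [simp] = opp_simps[OF AB A M N h S] ms_simps[OF AB A M N h S] hv[OF AB A M N h S]
 note B [simp] = opp_mods(1)[OF AB A M N h S] and sM = opp_mods(2)[OF AB A M N h S] and rN = opp_mods(3)[OF AB A M N h S]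
 note rop = ract_opp[OF AB A M N h S]
 have E [simp]: "e a b n m : EH A a b" "st (e a b n m) = st n @ st m"
  if "a : vob A" "b : vob A" "n : El N$b" "m : El M$a" for a b n m
  using nat1D(1,2)[OF e1[OF that(1-3)] that(4)] by simp_all
 have lop: "lact M a b f m = sw [] (st m) (st f) [] (ract A M b a m f)"
  if "a : vob A" "b : vob A" "f : EH A b a" "m : El M$a" for a b f m
  by (rule lact_ract[OF M that(2,1,4,3)])
 have G [simp]: "esw e a b m n : EH A b a" "st (esw e a b m n) = st m @ st n"
  if "a : vob A" "b : vob A" "n : El N$a" "m : El M$b" for a b n m
  unfolding esw_def using E[OF that(2,1,3,4)] by (simp_all add: sw_El)

 show ?thesis
 proof (rule pairing.intro[OF symmetric_monoidal_closed_axioms pairing_axioms.intro])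
  show "cat B" "rmod B N" "smod B M" by (rule B rN sM)+
  show "h ` J <= vob B" using h by simp
  show "Sfun B N M J h (dsw S)" by (rule Sfun_dsw[OF AB A M N h S])
 next
  fix a b m assume "a : vob B" "b : vob B" and m: "m : El M$b"
  then have [simp]: "a : vob A" "b : vob A" by simp_all
  show "nat1 (st m) [] N$a (vhom B a b) (esw e a b m)" unfolding esw_def
   by (simp, rule nat1_sw_left[where ?w1.0="[]" and ?w2.0="[]", OF e2]) (use m in simp_all)
 next
  fix a b n assume "a : vob B" "b : vob B" and n: "n : El N$a"
  then have [simp]: "a : vob A" "b : vob A" by simp_all
  show "nat1 [] (st n) M$b (vhom B a b) (%m. esw e a b m n)" unfolding esw_def
   by (simp, rule nat1_sw_right[where ?w1.0="[]" and ?w2.0="[]", OF e1]) (use n in simp_all)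
 next
  fix a b c f m n assume "a : vob B" "b : vob B" "c : vob B" "f : EH B b c" "m : El M$b" "n : El N$a"
  then have * [simp]: "a : vob A" "b : vob A" "c : vob A" "f : EH A c b" "m : El M$b" "n : El N$a" by simp_all
  define y where "y = cp A c b a (e b a n m) f"
  have y: "y : EH A c a" "st y = [] @ st n @ st m @ st f @ []" by (simp_all add: y_def)
  have "e c a n (lact M b c f m) = sw (st n) (st m) (st f) [] y"
   unfolding lop[OF *(2-5)] y_def by (subst nat1_sw[OF e1]) (simp_all add: eR)
  moreover have "cp A c b a (esw e a b m n) f = sw [] (st n) (st m) (st f) y"
   unfolding esw_def y_def by (subst cp_sw_left) simp_all
  ultimately show "esw e a c (lact M b c f m) n = cp B a b c f (esw e a b m n)"
   using opp_cp[OF AB A *(1-4) G(1)[OF *(1,2,6,5)]] sw_rev3'[OF y] by (simp add: esw_def)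
 next
  fix a a' b f m n assume "a : vob B" "a' : vob B" "b : vob B" "f : EH B a a'" "m : El M$b" "n : El N$a'"
  then have * [simp]: "a : vob A" "a' : vob A" "b : vob A" "f : EH A a' a" "m : El M$b" "n : El N$a'" by simp_all
  define y where "y = cp A b a' a f (e b a' n m)"
  have y: "y : EH A b a" "st y = [] @ st f @ st n @ st m @ []" by (simp_all add: y_def)
  have "e b a (ract B N a a' n f) m = sw [] (st f) (st n) (st m) y"
   unfolding rop[OF *(1,2,6,4)] y_def by (subst nat1_sw[OF e2]) (simp_all add: eL)
  moreover have "cp A b a' a f (esw e a' b m n) = sw (st f) (st n) (st m) [] y"
   unfolding esw_def y_def by (subst cp_sw_right) simp_all
  ultimately show "esw e a b m (ract B N a a' n f) = cp B a a' b (esw e a' b m n) f"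
   using opp_cp[OF AB A *(1-3) G(1)[OF *(2,3,6,5)]] sw_rev3'[OF y] by (simp add: esw_def)
 qed
qed

text \<open>Exchanging the modules exchanges the triangle identities: the first one over
  \<open>B\<close> is the second one over \<open>A\<close>, up to permutations that
  \<open>sig\<close> lets through.\<close>

lemma dual_pair_swap:
 assumes D: "dual_pair V A M N e J h S" and AB: "opp A B"
 shows "dual_pair V B N M (esw e) J h (dsw S)"
proof -
 note P = dual_pair.axioms(1)[OF D]
 note P' = pairing_swap[OF P AB]
 note A [simp] = pairing.A[OF P] and M [simp] = pairing.M[OF P] and N [simp] = pairing.N[OF P]
  and h = pairing.h[OF P] and S = pairing.S[OF P]
 note [simp] = opp_simps[OF AB A M N h S] pairing.pr_simps[OF P] pairing.e_El[OF P]
 note rop = ract_opp[OF AB A M N h S] and cw = pairing.pr_simps(1)[OF P]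
 have lop: "lact M a b f m = sw [] (st m) (st f) [] (ract A M b a m f)"
  if "a : vob A" "b : vob A" "f : EH A b a" "m : El M$a" for a b f m
  by (rule lact_ract[OF M that(2,1,4,3)])
 have G [simp]: "esw e a b m n : EH A b a" "st (esw e a b m n) = st m @ st n"
  if "a : vob A" "b : vob A" "m : El M$b" "n : El N$a" for a b n m
  using pairing.e_El[OF P'] that by simp_all
 show ?thesis
 proof (rule dual_pair.intro[OF P' dual_pair_axioms.intro])
  fix a n' assume "a : vob B" and n' [simp]: "n' : El N$a"
  then have a [simp]: "a : vob A" by simp
  note [simp] = El_ok[OF n']
  let ?W = "%j n m. ract B N a (h j) n (esw e a (h j) m n')"
  have w: "cow B N M J h [] (st n') N$a ?W"
   by (rule pairing.cow_Z1[OF P']) simp_all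
  have w0: "cow A M N J h (st n') [] N$a (%j m n. lact N (h j) a (e (h j) a n' m) n)"
   by (rule pairing.cow_eqv[OF P a pairing.eqv_e[OF P a n']])
  have "sig (dsw S) [] (st n') N$a ?W = sig S [] (st n') N$a (%j m n. sw [] (st n) (st m) (st n') (?W j n m))"
   by (rule sig_dsw[OF AB A M N h S w]) simp_all
  \<comment> \<open>Only the block of the parameter \<open>n'\<close> still has to pass from the
    right end of the stage to the left end, which \<open>sig_sw_right\<close> permits.\<close>
  also have "... = sig S (st n') [] N$a (%j m n. lact N (h j) a (e (h j) a n' m) n)"
  proof (rule sig_sw_right[OF A M N h S w0])
   fix j m n assume * [simp]: "j : J" "m : El M$(h j)" "n : El N$(h j)"
   define y where "y = lact N (h j) a (e (h j) a n' m) n"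
   have y: "y : El N$a" "st y = st n' @ st m @ st n" by (simp_all add: y_def)
   let ?z = "sw [] (st n') (st m) (st n) y"
   have z: "?z : El N$a" using y by (intro sw_El) simp_all
   have "?W j n m = sw [] (st m @ st n') (st n) [] ?z"
    unfolding rop[OF a cw[OF *(1)] *(3) G(1)[OF a cw[OF *(1)] *(2) n']]
    unfolding esw_def y_def by (subst lact_sw_left[OF N]) simp_all
   also have "... = sw [] (st m) (st n) (st n') (sw (st m) (st n') (st n) [] ?z)"
    using sw_append_left[OF z] by simp
   also have "sw (st m) (st n') (st n) [] ?z = sw [] (st n') (st m @ st n) [] y"
    using sw_append_right y by simp
   finally show "sw [] (st n) (st m) (st n') (?W j n m) = sw [] (st n') (st m @ st n) [] (lact N (h j) a (e (h j) a n' m) n)"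
    using sw_sw[OF sw_El[OF y(1)], of "[]" "st n'" "st m @ st n" "[]" "[]" "st m" "st n" "st n'"] y unfolding y_def by simp
  qed simp_all
  also have "... = n'" by (rule dual_pair.Z2[OF D a n'])
  finally show "sig (dsw S) [] (st n') N$a ?W = n'" .
 next
  fix b m' assume "b : vob B" and m' [simp]: "m' : El M$b"
  then have b [simp]: "b : vob A" and b': "b : vob B" by simp_all
  note [simp] = El_ok[OF m']
  let ?W = "%j n m. lact M (h j) b (esw e (h j) b m' n) m"
  have w: "cow B N M J h (st m') [] M$b ?W"
   by (rule pairing.cow_eqv[OF P' b' pairing.eqv_e[OF P' b' m']])
  have w0: "cow A M N J h [] (st m') M$b (%j m n. ract A M b (h j) m (e b (h j) n m'))"
   by (rule pairing.cow_Z1[OF P]) simp_all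
  have "sig (dsw S) (st m') [] M$b ?W = sig S (st m') [] M$b (%j m n. sw (st m') (st n) (st m) [] (?W j n m))"
   by (rule sig_dsw[OF AB A M N h S w]) simp_all
  also have "... = sig S [] (st m') M$b (%j m n. ract A M b (h j) m (e b (h j) n m'))"
  proof (rule sig_sw_left[OF A M N h S w0])
   fix j m n assume * [simp]: "j : J" "m : El M$(h j)" "n : El N$(h j)"
   define y where "y = ract A M b (h j) m (e b (h j) n m')"
   have y: "y : El M$b" "st y = st m @ st n @ st m'" by (simp_all add: y_def)
   let ?z = "sw (st m) (st n) (st m') [] y"
   have z: "?z : El M$b" using y by (intro sw_El) simp_all
   have "?W j n m = sw [] (st m) (st m' @ st n) [] ?z"
    unfolding lop[OF cw[OF *(1)] b G(1)[OF cw[OF *(1)] b m' *(3)] *(2)]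
    unfolding esw_def y_def by (subst ract_sw_right[OF M]) simp_all
   also have "... = sw (st m') (st m) (st n) [] (sw [] (st m) (st m') (st n) ?z)"
    using sw_append_right[OF z] by simp
   also have "sw [] (st m) (st m') (st n) ?z = sw [] (st m @ st n) (st m') [] y"
    using sw_append_left y by simp
   finally show "sw (st m') (st n) (st m) [] (?W j n m) = sw [] (st m @ st n) (st m') [] (ract A M b (h j) m (e b (h j) n m'))"
    using sw_sw[OF sw_El[OF y(1)], of "[]" "st m @ st n" "st m'" "[]" "st m'" "st m" "st n" "[]"] y unfolding y_def by simp
  qed simp_all
  also have "... = m'" by (rule dual_pair.Z1[OF D b m'])
  finally show "sig (dsw S) (st m') [] M$b ?W = m'" .
 qed
qed

end

section \<open>Restriction to the index set and the Kan extension property\<close>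

context symmetric_monoidal_closed
begin

text \<open>The full subcategory of \<open>A\<close> on the objects \<open>h j\<close>, with the
  indices themselves as objects. It may repeat objects of \<open>A\<close>, and when
  \<open>J\<close> is a set of elements of \<open>'u\<close> it can be the domain of a
  weight.\<close>

definition "vpull A J h = \<lparr>vob = J, vhom = %i j. vhom A (h i) (h j), vid = %i. vid A (h i), vcmp = %i j k. vcmp A (h i) (h j) (h k)\<rparr>"

definition "vincl A h = \<lparr>fob = h, fmap = %i j. one (vhom A (h i) (h j))\<rparr>"

lemma vpull_simps [simp]: "vob (vpull A J h) = J" "vhom (vpull A J h) i j = vhom A (h i) (h j)"
 "idg (vpull A J h) i = idg A (h i)" "cp (vpull A J h) i j k = cp A (h i) (h j) (h k)"
 "fob (vincl A h) = h" "f : EH A (h i) (h j) ==> fm (vincl A h) i j f = f"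
 by (simp_all add: vpull_def vincl_def idg_def cp_def fm_def)

lemma vpull:
 assumes A [simp]: "cat A" and h: "h ` J <= vob A"
 shows "cat (vpull A J h)" "func (vpull A J h) A (vincl A h)"
proof -
 have [simp]: "h j : vob A" if "j : J" for j using that h by auto
 show K: "cat (vpull A J h)"
  by (rule vcategoryI) (use vcategoryD[OF A] in "simp_all add: cp_assoc[OF A] cp_idg[OF A], simp_all add: vpull_def")
 show "func (vpull A J h) A (vincl A h)"
  by (rule vfunctorI[OF K A]) (simp_all add: idt_homs, simp add: vincl_def idt_homs)
qed

end

context pairing
begin

text \<open>The transformation \<open>s\<close> is represented by the sum of the actions of
  \<open>s m\<close> on \<open>n\<close>: moving \<open>e\<close> under the sum and then
  \<open>s\<close> out of it leaves the expansion of \<open>m'\<close> given by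
  \<open>Z\<close>.\<close>

lemma eval_inverse:
 assumes b [simp]: "b : vob A" and ws [simp]: "ok ws" and s: "eqv A M (yo A b) ws s" and a [simp]: "a : vob A" and m' [simp]: "m' : El M$a"
  and Z: "sig S [] (st m') M$a (%j m n. ract A M a (h j) m (e a (h j) n m')) = m'"
 shows "e a b (sig S ws [] N$b (%j m n. lact N (h j) b (s (h j) m) n)) m' = s a m'"
proof -
 have n: "nat1 ws [] M$a (vhom A a b) (s a)" if "a : vob A" for a
  using s that unfolding eqv_def by simp
 note [simp] = nat1D(1)[OF n] El_ok[OF m']
 have o: "ok []" by simp
 have "e a b (sig S ws [] N$b (%j m n. lact N (h j) b (s (h j) m) n)) m' =
  sig S ws (st m') (vhom A a b) (%j m n. e a b (lact N (h j) b (s (h j) m) n) m')"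
  by (rule sig_comp[OF A M N h S cow_eqv[OF b s] ws o _ _ _ _ e2[OF a b m'], symmetric]) simp_all
 also have "... = s a (sig S [] (st m') M$a (%j m n. ract A M a (h j) m (e a (h j) n m')))"
  by (rule sig_comp[OF A M N h S cow_Z1[OF a m'] _ _ _ _ _ _ n])
   (use s in "simp_all add: eL eqv_def vrep(2)[OF A b]")
 finally show ?thesis unfolding Z .
qed

end

context dual_pair
begin

text \<open>An extension of \<open>t\<close> is obtained by expanding the argument:
  \<open>m'\<close> goes to the sum of the values of \<open>t j m\<close> at
  \<open>e a (h j) n m'\<close>. Uniqueness holds because \<open>Z1\<close> writes each
  \<open>m'\<close> as a sum of restrictions of elements over \<open>J\<close>.\<close>

lemma dual_eacc:
 "eacc A M (vpull A J h) (pull M (vincl A h)) (vincl A h) (%k p. p)"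
proof -
 let ?K = "vpull A J h" and ?H = "vincl A h"
 note K = vpull(1)[OF A h] and H = vpull(2)[OF A h]
 note p = pull[OF A K H M]
 show ?thesis unfolding eacc_def
 proof (intro conjI ballI allI impI)
  fix k show "nat1 [] [] (pull M ?H)$k M$(?H$k) (%p. p)" by (simp add: nat1_id)
 next
  fix k l p' f assume "k : vob ?K" "l : vob ?K" "p' : El (pull M ?H)$l" "f : EH ?K k l"
  then show "ract ?K (pull M ?H) k l p' f = ract A M ?H$k ?H$l p' (fm ?H k l f)"
   using p(2) by simp
 next
  fix a X ws t assume a [simp]: "a : vob A" and X [simp]: "ob X" and ws [simp]: "ok ws" and t: "klan A M ?K (pull M ?H) ?H t ws a X"
  have t1: "nat1 (ws @ st m) [] (vhom A a (h j)) X (t j m)" if "j : J" "m : El M$(h j)" for j m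
   using t that unfolding klan_def by simp
  have t2: "nat1 ws (st g) M$(h j) X (%m. t j m g)" if "j : J" "g : EH A a (h j)" for j g
   using t that unfolding klan_def by simp
  have t3: "t i (ract A M (h i) (h j) m f) g = t j m (cp A a (h i) (h j) f g)"
   if "i : J" "j : J" "m : El M$(h j)" "f : EH A (h i) (h j)" "g : EH A a (h i)" for i j m f g
   using t that unfolding klan_def by (simp add: p(2))
  have c: "cow A M N J h ws (st m') X (%j m n. t j m (e a (h j) n m'))" if "m' : El M$a" for m'
   by (rule cow_klan[OF a that X t1 t2 t3])
  let ?r = "%m'. sig S ws (st m') X (%j m n. t j m (e a (h j) n m'))"
  have r: "nat1 ws [] M$a X ?r"
  proof (rule nat1_sig_right[OF A M N h S, where ?r1.0="[]"])
   fix j m n assume [simp]: "j : J" "m : El M$(h j)" "n : El N$(h j)"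
   show "nat1 (ws @ st m @ st n @ []) [] M$a X (%m'. t j m (e a (h j) n m'))"
    by (rule nat1_comp[OF e1 t1]) simp_all
  qed (use c in simp_all)
  moreover have "?r (ract A M a ?H$k p' g) = t k p' g"
   if "k : vob ?K" "p' : El (pull M ?H)$k" "g : EH A a ?H$k" for k p' g
  proof -
   have * [simp]: "k : J" "p' : El M$(h k)" "g : EH A a (h k)" "ok (st p')" "ok (st g)"
    using that by simp_all
   have "?r (ract A M a (h k) p' g) =
    t k (sig S [] (st p') M$(h k) (%j m n. ract A M (h k) (h j) m (e (h k) (h j) n p'))) g"
   proof (rule sig_comp[OF A M N h S cow_Z1[OF _ *(2)] _ _ _ _ _ _ t2[OF *(1,3)]])
    fix j m n assume [simp]: "j : J" "m : El M$(h j)" "n : El N$(h j)"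
    show "t j m (e a (h j) n (ract A M a (h k) p' g)) = t k (ract A M (h k) (h j) m (e (h k) (h j) n p')) g"
     by (simp add: t3 eR)
   qed simp_all
   then show ?thesis using Z1 by simp
  qed
  ultimately show "EX r. nat1 ws [] M$a X r &
   (ALL k:vob ?K. ALL p:El (pull M ?H)$k. ALL g:EH A a ?H$k. r (ract A M a ?H$k p g) = t k p g)"
   by blast
 next
  fix a X ws r s m' assume a [simp]: "a : vob A" and X [simp]: "ob X" and r: "nat1 ws [] M$a X r" and s: "nat1 ws [] M$a X s"
   and q: "ALL k:vob ?K. ALL p:El (pull M ?H)$k. ALL g:EH A a ?H$k.
     r (ract A M a ?H$k p g) = s (ract A M a ?H$k p g)" and m' [simp]: "m' : El M$a"
  note [simp] = El_ok[OF m'] nat1_ok[OF r]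
  have "r m' = sig S ws (st m') X (%j m n. r (ract A M a (h j) m (e a (h j) n m')))" if r: "nat1 ws [] M$a X r" for r
   by (subst Z1[OF a m', symmetric], rule sig_comp[OF A M N h S cow_Z1[OF a m'] _ _ _ _ _ _ r, symmetric]) simp_all
  from this[OF r] this[OF s] show "r m' = s m'"
   using sig_comp[OF A M N h S cow_Z1[OF a m'] _ _ _ _ _ _ s] sig_comp q by simp
 qed
qed

text \<open>Dinatural families over \<open>J\<close> involve only homs between the objects
  \<open>h j\<close>. Those for the restricted modules are literally the old ones, so the same
  \<open>S\<close> serves.\<close>

lemma dual_restrict:
 "dual_pair V (vpull A J h) (pull M (vincl A h)) (fc N (vincl A h)) (%i j. e (h i) (h j)) J (%j. j) S"
proof -
 let ?K = "vpull A J h" and ?H = "vincl A h"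
 let ?M = "pull M ?H" and ?N = "fc N ?H"
 note K [simp] = vpull(1)[OF A h] and H = vpull(2)[OF A h]
 note p [simp] = pull(1)[OF A K H M] and q [simp] = vfunctor_vfcomp(1)[OF K A vcategory_self N H]
 have r [simp]: "ract ?K ?M i j m f = ract A M (h i) (h j) m f" if "i : J" "j : J" "m : El M$(h j)" "f : EH A (h i) (h j)" for i j m f
  using pull(2)[OF A K H] that by simp
 have l [simp]: "lact ?N i j f n = lact N (h i) (h j) f n" if "i : J" "j : J" "n : El N$(h i)" "f : EH A (h i) (h j)" for i j n f
  using vfunctor_vfcomp(2)[OF K A vcategory_self N H] that by (simp add: lact_def)
 have c: "cow ?K ?M ?N J (%j. j) = cow A M N J h"
  by (intro ext) (simp add: cow_def)
 show ?thesis
 proof (rule dual_pair.intro[OF pairing.intro[OF symmetric_monoidal_closed_axioms pairing_axioms.intro] dual_pair_axioms.intro])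
  show "Sfun ?K ?M ?N J (%j. j) S" using S unfolding Sfun_def c by simp
 next
  fix a m' assume a: "a : vob ?K" "m' : El ?M$a"
  then have [simp]: "a : J" "m' : El M$(h a)" "ok (st m')" by simp_all
  have "sig S [] (st m') M$(h a) (%j m n. ract ?K ?M a j m (e (h a) (h j) n m')) =
    sig S [] (st m') M$(h a) (%j m n. ract A M (h a) (h j) m (e (h a) (h j) n m'))"
   by (rule sig_cong[OF A M N h S cow_Z1]) simp_all
  then show "sig S [] (st m') ?M$a (%j m n. ract ?K ?M a j m (e (h a) (h j) n m')) = m'"
   using Z1 by simp
 next
  fix b n' assume b: "b : vob ?K" "n' : El ?N$b"
  then have [simp]: "b : J" "n' : El N$(h b)" "ok (st n')" by simp_all
  have "sig S (st n') [] N$(h b) (%j m n. lact ?N j b (e (h j) (h b) n' m) n) =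
    sig S (st n') [] N$(h b) (%j m n. lact N (h j) (h b) (e (h j) (h b) n' m) n)"
   by (rule sig_cong[OF A M N h S cow_eqv[OF _ eqv_e]]) simp_all
  then show "sig S (st n') [] ?N$b (%j m n. lact ?N j b (e (h j) (h b) n' m) n) = n'"
   using Z2 by simp
 qed (simp_all add: e1 e2 eL eR)
qed

text \<open>The value at \<open>X\<close> of the right adjoint of \<open>[M, -]\<close>: since
  \<open>[M, F]\<close> is the coend of \<open>F a \<otimes> N a\<close>, maps from it to
  \<open>X\<close> are transformations from \<open>F\<close> to \<open>[N -, X]\<close>.\<close>

definition "RX X = hmod N X"

lemma fob_RX [simp]: "(RX X)$a = hom N$a X"
 by (simp add: RX_def)

lemma RX:
 assumes X [simp]: "ob X"
 shows "rmod A (RX X)"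
  "a : vob A ==> b : vob A ==> f : EH A a b ==> r : El (hom N$b X) ==> n : El N$a ==>
   ap N$a X (ract A (RX X) a b r f) n = ap N$b X r (lact N a b f n)"
proof -
 have N': "rmod (Op A) N" by (rule iffD2[OF opp_smod[OF opp_vop A] N])
 note H = hmod[OF vcategory_vop[OF A] N' X, folded RX_def, simplified]
 show R: "rmod A (RX X)" by (rule H(1))
 assume * [simp]: "a : vob A" "b : vob A" "f : EH A a b" "r : El (hom N$b X)" "n : El N$a"
 define y where "y = ap N$b X r (lact N a b f n)"
 have y: "y : El X" "st y = [] @ st r @ st f @ st n @ []" by (simp_all add: y_def)
 have "ap N$a X (lact (RX X) b a f r) n = sw [] (st r @ st n) (st f) [] (sw (st r) (st f) (st n) [] y)"
  using H(2)[OF *(2,1,3,4,5)] ract_lact[OF N' , of b a n f]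
  by (simp add: y_def) (subst ap_sw_right, simp_all)
 also have "... = sw [] (st r) (st f) (st n) y"
  using sw_append_left[OF sw_El[OF y(1)]] y sw_sw by simp
 finally have e: "ap N$a X (lact (RX X) b a f r) n = sw [] (st r) (st f) (st n) y" .
 have l: "lact (RX X) b a f r : El (hom N$a X)" using lact_El[OF R] by simp
 show "ap N$a X (ract A (RX X) a b r f) n = y"
  using ract_lact[OF R] ap_sw_left[OF l] sw_sw y e by simp
qed

context
 fixes FF
 assumes mc: "mcat A FF" and MF [simp]: "M : FF"
begin

text \<open>The image of \<open>s \<otimes> n\<close> under the canonical map
  \<open>F a \<otimes> N a \<rightarrow> [M, F]\<close>. For \<open>F = M\<close> these are the
  rank-one endomorphisms, whose sum is the identity.\<close>

definition "xe F a s n = EL A M F (st s @ st n) (%b m. ract A F b a s (e b a n m))"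

abbreviation "theta j m n == xe M (h j) m n"

lemmas fun_simps [simp] = mc_rmod[OF mc] mc_obj[OF mc] eo_obj[OF mc] Ea_El[OF mc] cp_Fun_El[OF mc] idg_Fun_El[OF mc]

context
 fixes F assumes F [simp]: "F : FF"
begin

lemma rF: "rmod A F" "a : vob A ==> b : vob A ==> s : El F$b ==> f : EH A a b ==> ract A F a b s f : El F$a"
 by simp_all

lemma xe_eqv:
 assumes [simp]: "a : vob A" "s : El F$a" "n : El N$a"
 shows "eqv A M F (st s @ st n) (%b m. ract A F b a s (e b a n m))"
 unfolding eqv_def
proof (intro conjI ballI)
 fix b assume [simp]: "b : vob A"
 show "nat1 (st s @ st n) [] M$b F$b (%m. ract A F b a s (e b a n m))"
  by (rule nat1_conv[OF nat1_ract2[OF e1 rF(1) A]]) simp_all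
qed (simp add: eR ract_ract[OF rF(1) A])

lemma xe [simp]:
 assumes [simp]: "a : vob A" "s : El F$a" "n : El N$a"
 shows "xe F a s n : El (eo A M F)" "st (xe F a s n) = st s @ st n"
  "b : vob A ==> m : El M$b ==> Ea A M F b (xe F a s n) m = ract A F b a s (e b a n m)"
proof -
 have "ok (st s @ st n)" using El_ok[OF assms(2)] El_ok[OF assms(3)] by simp
 note E = EL[OF mc MF F xe_eqv[OF assms] this]
 show "xe F a s n : El (eo A M F)" "st (xe F a s n) = st s @ st n"
  "b : vob A ==> m : El M$b ==> Ea A M F b (xe F a s n) m = ract A F b a s (e b a n m)"
  unfolding xe_def by (rule E; assumption?)+
qed

lemma nat1_xe1:
 assumes [simp]: "a : vob A" "n : El N$a"
 shows "nat1 [] (st n) F$a (eo A M F) (%s. xe F a s n)"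
 unfolding xe_def
proof (rule nat1_EL[OF mc MF F])
 fix b m assume [simp]: "b : vob A" "m : El M$b"
 show "nat1 [] (st n @ st m) F$a F$b (%s. ract A F b a s (e b a n m))"
  by (rule nat1_conv[OF nat1_ract1[OF nat1_id rF(1) A]]) simp_all
qed (use xe_eqv El_ok[OF assms(2)] in simp_all)

lemma nat1_xe2:
 assumes [simp]: "a : vob A" "s : El F$a"
 shows "nat1 (st s) [] N$a (eo A M F) (xe F a s)"
 unfolding xe_def
proof (rule nat1_EL[OF mc MF F])
 fix b m assume [simp]: "b : vob A" "m : El M$b"
 show "nat1 (st s) ([] @ st m) N$a F$b (%n. ract A F b a s (e b a n m))"
  by (rule nat1_conv[OF nat1_ract2[OF e2 rF(1) A]]) simp_all
qed (use xe_eqv El_ok[OF assms(2)] in simp_all)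

lemma xe_lact:
 assumes [simp]: "a : vob A" "b : vob A" "s : El F$b" "f : EH A a b" "n : El N$a"
 shows "xe F a (ract A F a b s f) n = xe F b s (lact N a b f n)"
 by (rule Ea_ext[OF mc MF F]) (simp_all add: rF eL ract_ract[OF rF(1) A])

lemma cow_theta: "F = M ==> cow A M N J h [] [] (eo A M M) theta"
 unfolding cow_def using nat1_xe1 nat1_xe2 xe_lact by simp

end

lemma cp_xe:
 assumes [simp]: "F : FF" "G : FF" "a : vob A" "s : El F$a" "n : El N$a" "g : El (eo A F G)"
 shows "cp (Fun A FF) M F G g (xe F a s n) = xe G a (Ea A F G a g s) n"
 by (rule Ea_ext[OF mc MF `G : FF`]) (simp_all add: vcmp_Fun(2)[OF mc] Ea_ract[OF mc])

text \<open>\<open>Z1\<close> says that the rank-one endomorphisms of \<open>M\<close> sum to its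
  identity. A sum whose terms are a natural function \<open>P\<close> of them is therefore the value
  of \<open>P\<close> at the identity.\<close>

lemma sig_theta:
 assumes P: "nat1 as bs (eo A M M) X P" and [simp]: "ob X"
  and w: "!!j m n. j : J ==> m : El M$(h j) ==> n : El N$(h j) ==> w j m n = P (theta j m n)"
 shows "sig S as bs X w = P (idg (Fun A FF) M)"
proof -
 note c = cow_theta[OF MF refl]
 note [simp] = nat1_ok[OF P]
 have s: "sig S [] [] (eo A M M) theta : El (eo A M M)" "st (sig S [] [] (eo A M M) theta) = []"
  using sig_El[OF A M N h S c] by simp_all
 have "sig S [] [] (eo A M M) theta = idg (Fun A FF) M"
 proof (rule Ea_ext[OF mc MF MF s(1)])
  fix a m' assume [simp]: "a : vob A" "m' : El M$a"
  then have [simp]: "ok (st m')" using El_ok by blast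
  have "Ea A M M a (sig S [] [] (eo A M M) theta) m' = sig S [] (st m') M$a (%j m n. Ea A M M a (theta j m n) m')"
   by (rule sig_comp[OF A M N h S c _ _ _ _ _ _ nat1_Ea1[OF mc nat1_id], symmetric]) simp_all
  also have "... = sig S [] (st m') M$a (%j m n. ract A M a (h j) m (e a (h j) n m'))"
   by (rule sig_cong[OF A M N h S cow_Z1]) simp_all
  finally show "Ea A M M a (sig S [] [] (eo A M M) theta) m' = Ea A M M a (idg (Fun A FF) M) m'"
   by (simp add: Z1 vid_Fun(2)[OF mc])
 qed (simp_all add: s)
 then show ?thesis
  using sig_comp[OF A M N h S c _ _ _ _ _ _ P] w by simp
qed

context
 fixes X assumes X [simp]: "ob X" and RXF [simp]: "RX X : FF"
begin

text \<open>\<open>Zf\<close> and \<open>fZ\<close> are the transpositions between maps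
  \<open>[M, F] \<rightarrow> X\<close> and transformations from \<open>F\<close> to
  \<open>[N -, X]\<close>: the first restricts to the elements \<open>xe\<close>, the second sums
  over the coend element.\<close>

definition "Zf F u = EL A F (RX X) (st u) (%a s. lamF (st u @ st s) N$a X (%n. ap (eo A M F) X u (xe F a s n)))"

definition "fZ F Z = lamF (st Z) (eo A M F) X (%t. sig S (st Z @ st t) [] X
 (%j m n. ap N$(h j) X (Ea A F (RX X) (h j) Z (Ea A M F (h j) t m)) n))"

context
 fixes F assumes F [simp]: "F : FF"
begin

lemma Zf_l:
 assumes [simp]: "a : vob A" "s : El F$a" "u : El (hom (eo A M F) X)"
 shows "lamF (st u @ st s) N$a X (%n. ap (eo A M F) X u (xe F a s n)) : El (hom N$a X)"
  "n : El N$a ==> ap N$a X (lamF (st u @ st s) N$a X (%n. ap (eo A M F) X u (xe F a s n))) n = ap (eo A M F) X u (xe F a s n)"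
proof -
 have n: "nat1 (st u @ st s) [] N$a X (%n. ap (eo A M F) X u (xe F a s n))"
  by (rule nat1_conv[OF nat1_ap2[OF nat1_xe2[OF F] _ _ _ refl]]) simp_all
 note l = lamF[OF n pr_simps(3)[OF assms(1)]]
 show "lamF (st u @ st s) N$a X (%n. ap (eo A M F) X u (xe F a s n)) : El (hom N$a X)"
  "n : El N$a ==> ap N$a X (lamF (st u @ st s) N$a X (%n. ap (eo A M F) X u (xe F a s n))) n = ap (eo A M F) X u (xe F a s n)"
  using l by blast+
qed

lemma Zf_eqv:
 assumes u [simp]: "u : El (hom (eo A M F) X)"
 shows "eqv A F (RX X) (st u) (%a s. lamF (st u @ st s) N$a X (%n. ap (eo A M F) X u (xe F a s n)))"
 unfolding eqv_def
proof (intro conjI ballI)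
 fix a assume a [simp]: "a : vob A"
 show "nat1 (st u) [] F$a (RX X)$a (%s. lamF (st u @ st s) N$a X (%n. ap (eo A M F) X u (xe F a s n)))"
  unfolding fob_RX
 proof (rule nat1_lamF)
  fix s assume [simp]: "s : El F$a"
  show "nat1 (st u @ st s @ []) [] N$a X (%n. ap (eo A M F) X u (xe F a s n))"
   by (rule nat1_conv[OF nat1_ap2[OF nat1_xe2[OF F] _ _ _ refl]]) simp_all
 next
  fix n assume [simp]: "n : El N$a"
  show "nat1 (st u) ([] @ st n) F$a X (%s. ap (eo A M F) X u (xe F a s n))"
   by (rule nat1_conv[OF nat1_ap2[OF nat1_xe1[OF F] _ _ _ refl]]) simp_all
 qed simp_all
next
 fix a b s f assume * [simp]: "a : vob A" "b : vob A" "s : El F$b" "f : EH A a b"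
 let ?t = "%a s. lamF (st u @ st s) N$a X (%n. ap (eo A M F) X u (xe F a s n))"
 show "?t a (ract A F a b s f) = ract A (RX X) a b (?t b s) f"
 proof (rule ap_ext)
  show "?t a (ract A F a b s f) : El (hom N$a X)"
   by (rule Zf_l) (simp_all add: rF[OF F])
  have b: "?t b s : El (RX X)$b" using Zf_l(1) by simp
  show "ract A (RX X) a b (?t b s) f : El (hom N$a X)"
   using ract_El[OF RX(1)[OF X] *(1,2) b] by simp
  fix n assume [simp]: "n : El N$a"
  show "ap N$a X (?t a (ract A F a b s f)) n = ap N$a X (ract A (RX X) a b (?t b s) f) n"
   using Zf_l(1) Zf_l(2) Zf_l(2)[of a "ract A F a b s f" u n] RX(2) by (simp add: xe_lact[OF F])
 qed simp_all
qed

lemma Zf: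
 assumes u [simp]: "u : El (hom (eo A M F) X)"
 shows "Zf F u : El (eo A F (RX X))" "st (Zf F u) = st u"
  "a : vob A ==> s : El F$a ==> n : El N$a ==>
   ap N$a X (Ea A F (RX X) a (Zf F u) s) n = ap (eo A M F) X u (xe F a s n)"
proof -
 note E = EL[OF mc F RXF Zf_eqv[OF u] El_ok[OF u]]
 show "Zf F u : El (eo A F (RX X))" "st (Zf F u) = st u" unfolding Zf_def by (rule E)+
 assume "a : vob A" "s : El F$a" "n : El N$a"
 then show "ap N$a X (Ea A F (RX X) a (Zf F u) s) n = ap (eo A M F) X u (xe F a s n)"
  unfolding Zf_def using E(3) Zf_l(2) by simp
qed

lemma fZ_cow:
 assumes [simp]: "Z : El (eo A F (RX X))" "t : El (eo A M F)"
 shows "cow A M N J h (st Z @ st t) [] X (%j m n. ap N$(h j) X (Ea A F (RX X) (h j) Z (Ea A M F (h j) t m)) n)"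
proof -
 have E: "Ea A F (RX X) a Z s : El (hom N$a X)" if "a : vob A" "s : El F$a" for a s
  using Ea_El[OF mc F RXF that(1) assms(1) that(2)] by simp
 have n: "nat1 (st Z @ st t) [] M$a (hom N$a X) (%m. Ea A F (RX X) a Z (Ea A M F a t m))" if "a : vob A" for a
  using nat1_conv[OF nat1_Ea2[OF mc nat1_Ea2[OF mc nat1_id MF F that assms(2)] F RXF that assms(1)]] by simp
 show ?thesis unfolding cow_def
 proof (intro conjI ballI)
  fix j n assume [simp]: "j : J" "n : El N$(h j)"
  show "nat1 (st Z @ st t) (st n @ []) M$(h j) X (%m. ap N$(h j) X (Ea A F (RX X) (h j) Z (Ea A M F (h j) t m)) n)"
   by (rule nat1_conv[OF nat1_ap1[OF n _ _ _ refl]]) simp_all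
 next
  fix j m assume [simp]: "j : J" "m : El M$(h j)"
  show "nat1 ((st Z @ st t) @ st m) [] N$(h j) X (ap N$(h j) X (Ea A F (RX X) (h j) Z (Ea A M F (h j) t m)))"
   by (rule nat1_conv[OF nat1_ap2[OF nat1_id _ _ _ refl]]) (simp_all add: E)
 qed (simp add: Ea_ract[OF mc] RX(2) E)
qed

lemma fZ:
 assumes Z [simp]: "Z : El (eo A F (RX X))"
 shows "fZ F Z : El (hom (eo A M F) X)" "st (fZ F Z) = st Z"
  "t : El (eo A M F) ==> ap (eo A M F) X (fZ F Z) t = sig S (st Z @ st t) [] X
   (%j m n. ap N$(h j) X (Ea A F (RX X) (h j) Z (Ea A M F (h j) t m)) n)"
proof -
 note [simp] = El_ok[OF Z]
 have n: "nat1 (st Z) [] (eo A M F) X (%t. sig S (st Z @ st t) [] X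
 (%j m n. ap N$(h j) X (Ea A F (RX X) (h j) Z (Ea A M F (h j) t m)) n))"
 proof (rule nat1_sig_left[OF A M N h S, where ?p2.0="[]"])
  fix t assume "t : El (eo A M F)"
  from fZ_cow[OF Z this] show "cow A M N J h (st Z @ st t @ []) [] X (%j m n. ap N$(h j) X (Ea A F (RX X) (h j) Z (Ea A M F (h j) t m)) n)"
   by simp
 next
  fix j m n assume [simp]: "j : J" "m : El M$(h j)" "n : El N$(h j)"
  have "nat1 (st Z) (st m) (eo A M F) (hom N$(h j) X) (%t. Ea A F (RX X) (h j) Z (Ea A M F (h j) t m))"
   using nat1_Ea2[OF mc nat1_Ea1[OF mc nat1_id] F RXF] by simp
  from nat1_ap1[OF this _ _ `n : _` refl] show "nat1 (st Z) ([] @ st m @ st n @ []) (eo A M F) X (%t. ap N$(h j) X (Ea A F (RX X) (h j) Z (Ea A M F (h j) t m)) n)"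
   by simp
 qed simp_all
 show "fZ F Z : El (hom (eo A M F) X)" "st (fZ F Z) = st Z"
  "t : El (eo A M F) ==> ap (eo A M F) X (fZ F Z) t = sig S (st Z @ st t) [] X
   (%j m n. ap N$(h j) X (Ea A F (RX X) (h j) Z (Ea A M F (h j) t m)) n)"
  unfolding fZ_def using lamF[OF n] by simp_all
qed

text \<open>The terms of the sum are \<open>u\<close> applied to \<open>t\<close> after a rank-one
  endomorphism of \<open>M\<close>, so by \<open>sig_theta\<close> the sum is \<open>u\<close>
  applied to \<open>t\<close> after the identity.\<close>

lemma fZ_Zf:
 assumes u [simp]: "u : El (hom (eo A M F) X)"
 shows "fZ F (Zf F u) = u"
proof (rule ap_ext)
 fix t assume t [simp]: "t : El (eo A M F)"
 have "ap (eo A M F) X (fZ F (Zf F u)) t = sig S (st (Zf F u) @ st t) [] X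
   (%j m n. ap N$(h j) X (Ea A F (RX X) (h j) (Zf F u) (Ea A M F (h j) t m)) n)"
  by (rule fZ(3)[OF Zf(1)]) simp_all
 also have "... = ap (eo A M F) X u (cp (Fun A FF) M M F t (idg (Fun A FF) M))"
 proof (rule sig_theta)
  have "nat1 (st t @ []) [] (vhom (Fun A FF) M M) (vhom (Fun A FF) M F) (cp (Fun A FF) M M F t)"
   by (rule nat1_cp2[OF nat1_id vcategory_Fun[OF mc]]) simp_all
  then have n: "nat1 (st t) [] (eo A M M) (eo A M F) (cp (Fun A FF) M M F t)" by simp
  show "nat1 (st (Zf F u) @ st t) [] (eo A M M) X (%x. ap (eo A M F) X u (cp (Fun A FF) M M F t x))"
   by (rule nat1_conv[OF nat1_ap2[OF n _ _ _ refl]]) (simp_all add: Zf)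
 qed (simp_all add: Zf cp_xe)
 finally show "ap (eo A M F) X (fZ F (Zf F u)) t = ap (eo A M F) X u t"
  using cp_idg(2)[OF vcategory_Fun[OF mc]] by simp
qed (simp_all add: fZ Zf)

end

lemma Zf_natural:
 assumes [simp]: "F : FF" "G : FF" "g : El (eo A F G)" "u : El (hom (eo A M G) X)" "v : El (hom (eo A M F) X)"
  and v: "st v = st u @ st g" "!!t. t : El (eo A M F) ==> ap (eo A M F) X v t = ap (eo A M G) X u (cp (Fun A FF) M F G g t)"
 shows "Zf F v = cp (Fun A FF) F G (RX X) (Zf G u) g"
proof (rule Ea_ext[OF mc `F : FF` RXF])
 fix a s assume [simp]: "a : vob A" "s : El F$a"
 have E: "Ea A F (RX X) a Z s : El (hom N$a X)" if "Z : El (eo A F (RX X))" for Z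
  using Ea_El[OF mc `F : FF` RXF _ that] by simp
 show "Ea A F (RX X) a (Zf F v) s = Ea A F (RX X) a (cp (Fun A FF) F G (RX X) (Zf G u) g) s"
  by (rule ap_ext[OF E E]) (simp_all add: Zf v vcmp_Fun(2)[OF mc] cp_xe)
qed (simp_all add: Zf v)

lemma fZ_natural:
 assumes [simp]: "F : FF" "G : FF" "g : El (eo A F G)" "Z : El (eo A G (RX X))" "t : El (eo A M F)"
 shows "ap (eo A M G) X (fZ G Z) (cp (Fun A FF) M F G g t) = ap (eo A M F) X (fZ F (cp (Fun A FF) F G (RX X) Z g)) t"
proof -
 have "sig S (st Z @ st g @ st t) [] X (%j m n. ap N$(h j) X (Ea A G (RX X) (h j) Z (Ea A M G (h j) (cp (Fun A FF) M F G g t) m)) n) =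
  sig S (st Z @ st g @ st t) [] X (%j m n. ap N$(h j) X (Ea A F (RX X) (h j) (cp (Fun A FF) F G (RX X) Z g) (Ea A M F (h j) t m)) n)"
 proof (rule sig_cong[OF A M N h S])
  show "cow A M N J h (st Z @ st g @ st t) [] X (%j m n. ap N$(h j) X (Ea A F (RX X) (h j) (cp (Fun A FF) F G (RX X) Z g) (Ea A M F (h j) t m)) n)"
   using fZ_cow[OF `F : FF`, of "cp (Fun A FF) F G (RX X) Z g" t] by simp
 qed (use El_ok[OF assms(3)] El_ok[OF assms(4)] El_ok[OF assms(5)] in "simp_all add: vcmp_Fun(2)[OF mc]")
 then show ?thesis by (simp add: fZ)
qed

end

end

end

context dual_pair
begin

lemma nat1_Zf:
 assumes mc: "mcat A FF" and MF [simp]: "M : FF" and X [simp]: "ob X" and RXF [simp]: "RX X : FF" and F [simp]: "F : FF"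
 shows "nat1 [] [] (hom (eo A M F) X) (eo A F (RX X)) (Zf X F)"
proof (rule nat1_cong[OF nat1_EL[OF mc F RXF] Zf_def[OF mc MF X RXF]])
 note [simp] = eo_obj[OF mc] xe[OF mc MF F] mc_obj[OF mc]
 show "hom (eo A M F) X : obj V" by simp
 fix u assume "u : El (hom (eo A M F) X)"
 then show "eqv A F (RX X) ([] @ st u @ []) (%a s. lamF (st u @ st s) N$a X (%n. ap (eo A M F) X u (xe F a s n)))"
  using Zf_eqv[OF mc MF X RXF] by simp
next
 note [simp] = eo_obj[OF mc] xe[OF mc MF F] mc_obj[OF mc]
 fix a s assume [simp]: "a : vob A" "s : El F$a"
 show "nat1 [] ([] @ st s) (hom (eo A M F) X) (RX X)$a (%u. lamF (st u @ st s) N$a X (%n. ap (eo A M F) X u (xe F a s n)))"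
  unfolding fob_RX
 proof (rule nat1_lamF)
  fix u assume [simp]: "u : El (hom (eo A M F) X)"
  show "nat1 ([] @ st u @ [] @ st s) [] N$a X (%n. ap (eo A M F) X u (xe F a s n))"
   by (rule nat1_conv[OF nat1_ap2[OF nat1_xe2[OF mc MF F] _ _ _ refl]]) simp_all
 next
  fix n assume [simp]: "n : El N$a"
  show "nat1 [] (([] @ st s) @ st n) (hom (eo A M F) X) X (%u. ap (eo A M F) X u (xe F a s n))"
   by (rule nat1_conv[OF nat1_ap1[OF nat1_id _ _ _ refl]]) simp_all
 qed simp_all
qed simp_all

text \<open>As for every left adjoint: a cocone on \<open>[M, S' -]\<close> with vertex
  \<open>X\<close> transposes to one on \<open>S'\<close> with vertex \<open>[N -, X]\<close>,
  factors through the colimit \<open>c\<close>, and transposes back. For this the presheaves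
  \<open>[N -, X]\<close> have to lie in \<open>FF\<close>.\<close>

lemma dual_preserves:
 fixes K :: "('k, 'o, 'm) vcat"
 assumes mc: "mcat A FF" and MF [simp]: "M : FF" and RXF [simp]: "!!X. ob X ==> RX X : FF"
  and K [simp]: "cat K" and fi: "rmod K fi" and S': "func K (Fun A FF) S'"
 shows "preserves_wcolim V (Fun A FF) VV (homf (Fun A FF) M) K fi S'"
proof -
 let ?P = "Fun A FF"
 let ?F = "homf ?P M"
 note P [simp] = vcategory_Fun[OF mc]
 have F: "func ?P VV ?F" by (rule vhom_fun(1)) simp_all
 note FS = vfunctor_vfcomp[OF K P vcategory_self F S']
 have [simp]: "S'$k : FF" if "k : vob K" for k using vfunctorD(1)[OF S' that] by simp
 note [simp] = eo_obj[OF mc] cp_Fun_El[OF mc] rmod_obj[OF fi]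
 have f [simp]: "fm S' k l f : El (eo A S'$k S'$l)" if "k : vob K" "l : vob K" "f : EH K k l" for k l f
  using fm_El[OF S' that] by simp
 have Fm [simp]: "fm ?F G H g : El (hom (eo A M G) (eo A M H))" if "G : FF" "H : FF" "g : El (eo A G H)" for G H g
  using fm_El[OF F] that by simp
 have Fa [simp]: "ap (eo A M G) (eo A M H) (fm ?F G H g) t = cp ?P M G H g t"
  if "G : FF" "H : FF" "g : El (eo A G H)" "t : El (eo A M G)" for G H g t
  using vhom_fun(2)[OF P] that by (simp add: lact_def)
 show ?thesis unfolding preserves_wcolim_iff[OF P vcategory_self F K fi S']
 proof (intro allI impI)
  fix c io assume E: "ecolim ?P K fi S' c io"
  note D = ecolimD[OF E]
  have c [simp]: "c : FF" using D(1) by simp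
  have io [simp]: "io k p : El (eo A S'$k c)" "st (io k p) = st p" if "k : vob K" "p : El fi$k" for k p
   using D(4,5)[OF that] by simp_all
  have ioR: "io k (ract K fi k l p f) = cp ?P S'$k S'$l c (io l p) (fm S' k l f)"
   if "k : vob K" "l : vob K" "p : El fi$l" "f : EH K k l" for k l p f
   using D(2) that homS(2)[OF P K S', of c k l "io l p" f] unfolding eqv_def by simp
  have hs: "ract K (homS VV (fc ?F S') X) k l g f = cp VV (eo A M S'$k) (eo A M S'$l) X g (fm ?F S'$k S'$l (fm S' k l f))"
   if "ob X" "k : vob K" "l : vob K" "g : El (hom (eo A M S'$l) X)" "f : EH K k l" for X k l g f
   using homS(2)[OF vcategory_self K FS(1)] FS(2) that by simp
  show "ecolim VV K fi (fc ?F S') ?F$c (%k p. fm ?F S'$k c (io k p))"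
   unfolding ecolim_def
  proof (intro conjI ballI allI impI)
   show "?F$c : vob VV" by simp
   show "eqv K fi (homS VV (fc ?F S') ?F$c) [] (%k p. fm ?F S'$k c (io k p))"
    unfolding eqv_def
   proof (intro conjI ballI)
    fix k assume [simp]: "k : vob K"
    show "nat1 [] [] fi$k (homS VV (fc ?F S') ?F$c)$k (%p. fm ?F S'$k c (io k p))"
     using nat1_fm[OF D(3) F] by simp
   qed (simp add: hs ioR fm_cp[OF P vcategory_self F])
  next
   fix X ws t assume "X : vob VV" and ws [simp]: "ok ws" and t: "eqv K fi (homS VV (fc ?F S') X) ws t"
   then have X [simp]: "ob X" by simp
   have t1: "nat1 ws [] fi$k (hom (eo A M S'$k) X) (t k)" if "k : vob K" for k
    using t that unfolding eqv_def by simp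
   note tE [simp] = nat1D(1,2)[OF t1]
   have tR: "t k (ract K fi k l p f) = cp VV (eo A M S'$k) (eo A M S'$l) X (t l p) (fm ?F S'$k S'$l (fm S' k l f))"
    if "k : vob K" "l : vob K" "p : El fi$l" "f : EH K k l" for k l p f
    using t that hs[OF X, of k l "t l p" f] unfolding eqv_def by simp
   have rE [simp]: "ract K fi k l p f : El fi$k" if "k : vob K" "l : vob K" "p : El fi$l" "f : EH K k l" for k l p f
    by (rule ract_El[OF fi that])
   note zf = Zf[OF mc MF X RXF[OF X]]
   have Y: "eqv K fi (homS ?P S' (RX X)) ws (%k p. Zf X S'$k (t k p))"
    unfolding eqv_def
   proof (intro conjI ballI)
    fix k assume k [simp]: "k : vob K"
    have "nat1 [] [] (hom (eo A M S'$k) X) (eo A S'$k (RX X)) (Zf X S'$k)"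
     by (rule nat1_Zf[OF mc MF X RXF[OF X]]) simp
    from nat1_comp[OF t1[OF k] this]
    show "nat1 ws [] fi$k (homS ?P S' (RX X))$k (%p. Zf X S'$k (t k p))"
     by simp
   next
    fix k l p f assume * [simp]: "k : vob K" "l : vob K" "p : El fi$l" "f : EH K k l"
    show "Zf X S'$k (t k (ract K fi k l p f)) = ract K (homS ?P S' (RX X)) k l (Zf X S'$l (t l p)) f"
     using homS(2)[OF P K S', of "RX X" k l "Zf X S'$l (t l p)" f] zf(1)[of "S'$l" "t l p"]
     by (simp, intro Zf_natural[OF mc MF X RXF[OF X]]) (simp_all add: tR vcmp_self)
   qed
   obtain Z where Z [simp]: "Z : El (eo A c (RX X))" "st Z = ws"
    and Zi: "!!k p. k : vob K ==> p : El fi$k ==> cp ?P S'$k c (RX X) Z (io k p) = Zf X S'$k (t k p)"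
    using D(6)[OF _ ws Y] by auto
   note z = fZ[OF mc MF X RXF[OF X] c Z(1)]
   have "cp VV (eo A M S'$k) (eo A M c) X (fZ X c Z) (fm ?F S'$k c (io k p)) = t k p"
    if [simp]: "k : vob K" "p : El fi$k" for k p
   proof (rule ap_ext)
    fix s assume [simp]: "s : El (eo A M S'$k)"
    show "ap (eo A M S'$k) X (cp VV (eo A M S'$k) (eo A M c) X (fZ X c Z) (fm ?F S'$k c (io k p))) s
     = ap (eo A M S'$k) X (t k p) s"
     using fZ_natural[OF mc MF X] fZ_Zf[OF mc MF X] by (simp add: vcmp_self z(1) Zi)
   qed (simp_all add: z(1,2))
   then show "EX u:EH VV ?F$c X. st u = ws & (ALL k:vob K. ALL p:El fi$k.
     cp VV (fc ?F S')$k ?F$c X u (fm ?F S'$k c (io k p)) = t k p)"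
    using z(1,2) by (intro bexI[of _ "fZ X c Z"]) simp_all
  next
   fix X u v assume "X : vob VV" "u : EH VV ?F$c X" "v : EH VV ?F$c X" and s: "st u = st v" and
    q: "ALL k:vob K. ALL p:El fi$k. cp VV (fc ?F S')$k ?F$c X u (fm ?F S'$k c (io k p)) =
       cp VV (fc ?F S')$k ?F$c X v (fm ?F S'$k c (io k p))"
   then have [simp]: "ob X" "u : El (hom (eo A M c) X)" "v : El (hom (eo A M c) X)" by simp_all
   have X: "ob X" by simp
   note z = Zf[OF mc MF X RXF[OF X] c]
   have n: "cp ?P S'$k c (RX X) (Zf X c u) (io k p) = Zf X S'$k (cp VV (eo A M S'$k) (eo A M c) X u (fm ?F S'$k c (io k p)))"
    if "k : vob K" "p : El fi$k" "u : El (hom (eo A M c) X)" for k p u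
    by (rule Zf_natural[OF mc MF X RXF[OF X], symmetric]) (use that in "simp_all add: vcmp_self")
   have "Zf X c u = Zf X c v"
   proof (rule D(7)[of "RX X"])
    fix k p assume kp: "k : vob K" "p : El fi$k"
    show "cp ?P S'$k c (RX X) (Zf X c u) (io k p) = cp ?P S'$k c (RX X) (Zf X c v) (io k p)"
     unfolding n[OF kp `u : El (hom (eo A M c) X)`] n[OF kp `v : El (hom (eo A M c) X)`]
     using bspec[OF bspec[OF q kp(1)] kp(2)] by simp
   qed (use s in "simp_all add: z")
   then show "u = v"
    by (subst fZ_Zf[OF mc MF X RXF[OF X] c `u : El (hom (eo A M c) X)`, symmetric],
      subst fZ_Zf[OF mc MF X RXF[OF X] c `v : El (hom (eo A M c) X)`, symmetric]) (erule arg_cong)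
  qed
 qed
qed

end

context symmetric_monoidal_closed
begin

section \<open>Dual pairs over small index sets and closed classes\<close>

lemma viso_trans:
 assumes A [simp]: "cat A" and [simp]: "a : vob A" "b : vob A" "c : vob A" and "viso V A a b" "viso V A b c"
 shows "viso V A a c"
proof -
 obtain f f' where [simp]: "f : EH A a b" "f' : EH A b a" "st f = []" "st f' = []"
  and f: "cp A a b a f' f = idg A a" "cp A b a b f f' = idg A b"
  using assms(5) unfolding viso_arr_elem[OF A `a : _` `b : _`] by blast
 obtain g g' where [simp]: "g : EH A b c" "g' : EH A c b" "st g = []" "st g' = []"
  and g: "cp A b c b g' g = idg A b" "cp A c b c g g' = idg A c"
  using assms(6) unfolding viso_arr_elem[OF A `b : _` `c : _`] by blast
 have "cp A a c a (cp A c b a f' g') (cp A a b c g f) = cp A a b a f' (cp A a b b (cp A b c b g' g) f)"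
  by (simp add: cp_assoc)
 moreover have "cp A c a c (cp A a b c g f) (cp A c b a f' g') = cp A c b c g (cp A c b b (cp A b a b f f') g')"
  by (simp add: cp_assoc)
 ultimately show ?thesis
  unfolding viso_arr_elem[OF A `a : _` `c : _`]
  by (intro bexI[of _ "cp A a b c g f"] bexI[of _ "cp A c b a f' g'"]) (simp_all add: f g cp_idg[OF A])
qed

lemma viso_functor:
 assumes K: "cat K" and A: "cat A" and H: "func K A H" and [simp]: "k : vob K" "l : vob K" and v: "viso V K k l"
 shows "viso V A H$k H$l"
proof -
 note [simp] = vfunctorD(1)[OF H] fm_El[OF H]
 obtain f f' where [simp]: "f : EH K k l" "f' : EH K l k" "st f = []" "st f' = []"
  and f: "cp K k l k f' f = idg K k" "cp K l k l f f' = idg K l"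
  using v unfolding viso_arr_elem[OF K `k : _` `l : _`] by blast
 show ?thesis unfolding viso_arr_elem[OF A vfunctorD(1)[OF H `k : _`] vfunctorD(1)[OF H `l : _`]]
  by (intro bexI[of _ "fm H k l f"] bexI[of _ "fm H l k f'"])
   (simp_all add: fm_cp[OF K A H, symmetric] f fm_idg[OF H])
qed

text \<open>\<open>H\<close> preserves isomorphisms, so each isomorphism class of \<open>K\<close>
  lies in a single class of the full subcategory, and all classes of the latter arise in this
  way.\<close>

lemma small_vcat_vpull:
 assumes K: "cat K" and A: "cat A" and H: "func K A H" and s: "small_vcat ka V K"
 shows "small_vcat ka V (vpull A (vob K) (fob H))"
proof -
 let ?K = "vpull A (vob K) (fob H)"
 have K': "cat ?K" by (rule vpull(1)[OF A]) (use vfunctorD(1)[OF H] in auto)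
 let ?r = "{(k, l). k : vob K & l : vob K & viso V K k l}"
 let ?s = "{(k, l). k : vob K & l : vob K & viso V ?K k l}"
 have i: "viso V ?K k l" if "k : vob K" "l : vob K" "viso V K k l" for k l
  using viso_functor[OF K A H] that vfunctorD(1)[OF H] by (simp add: viso_arr_elem[OF K'] viso_arr_elem[OF A])
 have e: "?s `` (?r `` {k}) = ?s `` {k}" if "k : vob K" for k
 proof (intro equalityI subsetI)
  fix y assume "y : ?s `` (?r `` {k})"
  then obtain l where *: "l : vob K" "viso V K k l" "y : vob K" "viso V ?K l y" by blast
  have "viso V ?K k y" by (rule viso_trans[OF K', of k l y]) (use that * i in simp_all)
  then show "y : ?s `` {k}" using that * by blast
 next
  fix y assume "y : ?s `` {k}"
  moreover have "k : ?r `` {k}" using that viso_refl[OF K] by blast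
  ultimately show "y : ?s `` (?r `` {k})" by blast
 qed
 have "vob K // ?s <= (%X. ?s `` X) ` (vob K // ?r)"
 proof
  fix Y assume "Y : vob K // ?s"
  then obtain k where k: "k : vob K" "Y = ?s `` {k}" by (rule quotientE)
  show "Y : (%X. ?s `` X) ` (vob K // ?r)"
   unfolding k(2) e[OF k(1), symmetric] by (rule imageI) (rule quotientI[OF k(1)])
 qed
 with small_set_subset[OF small_set_image[OF s[unfolded small_vcat_def], of "%X. ?s `` X"]] show ?thesis
  unfolding small_vcat_def by simp
qed

lemma opp_viso:
 assumes AB: "opp A B" and A: "cat A" and [simp]: "a : vob A" "b : vob A" and v: "viso V A a b"
 shows "viso V B a b"
proof -
 note o [simp] = oppD[OF AB]
 note B = opp_vcategory[OF AB A]
 have [simp]: "a : vob B" "b : vob B" by simp_all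
 obtain f g where fg [simp]: "f : EH A a b" "g : EH A b a" "st f = []" "st g = []"
  and f: "cp A a b a g f = idg A a" "cp A b a b f g = idg A b"
  using v unfolding viso_arr_elem[OF A `a : vob A` `b : vob A`] by blast
 have "cp B a b a f g = idg B a" "cp B b a b g f = idg B b"
  using opp_cp[OF AB A] opp_cp by (simp_all add: f sw_Nil_left[OF idg_El[OF A]])
 then show ?thesis unfolding viso_arr_elem[OF B `a : vob B` `b : vob B`]
  by (intro bexI[of _ g] bexI[of _ f]) simp_all
qed

lemma opp_small_vcat:
 assumes AB: "opp A B" and A: "cat A" and s: "small_vcat ka V A"
 shows "small_vcat ka V B"
proof -
 have "{(a, b). a : vob B & b : vob B & viso V B a b} = {(a, b). a : vob A & b : vob A & viso V A a b}"
  using opp_viso[OF AB A] opp_viso[OF opp_sym[OF A AB] opp_vcategory[OF AB A]] oppD(1)[OF AB] by auto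
 then show ?thesis using s oppD(1)[OF AB] unfolding small_vcat_def by simp
qed

text \<open>By \<open>dual_eacc\<close>, \<open>M\<close> is the colimit of the representables at
  the objects \<open>h j\<close> weighted by its own restriction to \<open>J\<close>. That
  restriction is again half of a dual pair, hence a small projective weight, and a closed class must
  contain \<open>M\<close>.\<close>

lemma dual_closed:
 fixes ka :: "'u rel" and J :: "'u set"
 assumes D: "dual_pair V A M N e J h S" and u: "Cinfinite ka" "complete_cat ka V" and sm: "small_vcat ka V (vpull A J h)"
 shows "accessible ka V A M"
  "(vpull A J h, pull M (vincl A h)) : small_projectives ka V"
  "Phi_closed ka V (small_projectives ka V) A X ==> M : X"
proof -
 let ?K = "vpull A J h" and ?H = "vincl A h"
 let ?M = "pull M ?H" and ?P = "{F. accessible ka V A F}"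
 note P = dual_pair.axioms(1)[OF D]
 note A = pairing.A[OF P] and M = pairing.M[OF P]
 note K = vpull(1)[OF A pairing.h[OF P]] and H = vpull(2)[OF A pairing.h[OF P]]
 note M' = pull(1)[OF A K H M] and E = dual_pair.dual_eacc[OF D]
 have w: "weight ka V ?K ?M" unfolding weight_def using K sm M' by blast
 show acc: "accessible ka V A M" unfolding accessible_iff[OF A] using M w H E by blast
 note mK = mcat_presheaves[OF u K sm]
 note DK = dual_pair.dual_restrict[OF D]
 have PK: "presheaves V ?K = Fun ?K {F. rmod ?K F}" unfolding presheaves_def ..
 have "preserves_wcolim V (presheaves V ?K) VV (homf (presheaves V ?K) ?M) L \<psi> T'"
  if "weight ka V L \<psi>" "func L (presheaves V ?K) T'" for L :: "('u, 'o, 'm) vcat" and \<psi> T'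
  unfolding PK
 proof (rule dual_pair.dual_preserves[OF DK mK])
  \<comment> \<open>The right adjoint takes values in all presheaves on \<open>?K\<close>, and these
    form a category with ends because \<open>?K\<close> is small.\<close>
  show "dual_pair.RX V (fc N ?H) X : {F. rmod ?K F}" if "ob X" for X
   using dual_pair.RX(1)[OF DK that] by simp
 qed (use that M' in "unfold PK weight_def, blast+")
 then show sp: "(?K, ?M) : small_projectives ka V"
  unfolding small_projectives_def preserves_small_wcolims_def using w by blast
 assume X: "Phi_closed ka V (small_projectives ka V) A X"
 note mc = mcat_PP[OF u A]
 have PP: "PP ka V A = Fun A ?P" unfolding PP_def ..
 have XP: "X <= ?P" and r: "!!a. a : vob A ==> yo A a : X" using X unfolding Phi_closed_def PP by auto
 have r': "!!a. a : vob A ==> yo A a : ?P" using XP r by blast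
 note Y = Yf(1)[OF mc r']
 have S': "func ?K (Fun A ?P) (fc (Yf A) ?H)"
  by (rule vfunctor_vfcomp(1)[OF K A vcategory_Fun[OF mc] Y H])
 have "ecolim (Fun A ?P) ?K ?M (fc (Yf A) ?H) M (%k p. yon A M ?H$k p)"
  by (rule eacc_Fun_ecolim[OF A K M' H M E mc _ r']) (use acc in simp_all)
 note wc = ecolim_wcolim(1)[OF vcategory_Fun[OF mc] K M' S' this, folded PP]
 have "ALL k : vob ?K. (fc (Yf A) ?H)$k : X"
  using r pairing.h[OF P] fob_Yf[OF mc] by auto
 with X sp wc S'[folded PP] show "M : X" unfolding Phi_closed_def by blast
qed

section \<open>Atomic modules\<close>


definition "LM A FF M = fc (homf (Fun A FF) M) (Yf A)"

abbreviation "evM A M == %a b. Ea A M (yo A b) a"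

text \<open>A rank-one endomorphism of \<open>M\<close>: \<open>m\<close>, read by Yoneda as a map
  from \<open>A(-, h j)\<close> to \<open>M\<close>, after the map \<open>n\<close> from
  \<open>M\<close> to \<open>A(-, h j)\<close>.\<close>

definition "thM A FF M h j m n = cp (Fun A FF) M (yo A (h j)) M (yon A M (h j) m) n"

text \<open>The canonical normal form, with all objects as indices and the canonical dual. By
  \<open>dual_atomic\<close> every dual pair leads to it, and \<open>atomic_small_dual\<close>
  returns to small index sets.\<close>

definition "atomic A FF M = (EX S. dual_pair V A M (LM A FF M) (evM A M) (vob A) (%a. a) S)"

context
 fixes A :: "('a, 'o, 'm) vcat" and FF
 assumes mc: "mcat A FF" and rp [simp]: "!!a. a : vob A ==> yo A a : FF"
begin

lemmas at_simps [simp] = mc_A[OF mc] mc_rmod[OF mc] mc_obj[OF mc] eo_obj[OF mc] Ea_El[OF mc] cp_Fun_El[OF mc] idg_Fun_El[OF mc]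
 vcategory_Fun[OF mc] yon(1,2)[OF mc] fob_Yf[OF mc]

lemma LM:
 assumes M [simp]: "M : FF"
 shows "smod A (LM A FF M)" "(LM A FF M)$b = eo A M (yo A b)"
  "b : vob A ==> c : vob A ==> f : EH A b c ==> n : El (eo A M (yo A b)) ==>
   lact (LM A FF M) b c f n = cp (Fun A FF) M (yo A b) (yo A c) (fm (Yf A) b c f) n"
  "a : vob A ==> b : vob A ==> c : vob A ==> f : EH A b c ==> n : El (eo A M (yo A b)) ==> m : El M$a ==>
   Ea A M (yo A c) a (lact (LM A FF M) b c f n) m = cp A a b c f (Ea A M (yo A b) a n m)"
proof -
 note Y = Yf[OF mc rp]
 have h: "smod (Fun A FF) (homf (Fun A FF) M)" by (rule vhom_fun(1)) simp_all
 have Y1: "func A (Fun A FF) (Yf A)" by (rule Y(1))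
 note v = vfunctor_vfcomp[OF at_simps(1) at_simps(8) vcategory_self h Y1]
 show "smod A (LM A FF M)" unfolding LM_def by (rule v(1))
 show f: "(LM A FF M)$b = eo A M (yo A b)" for b unfolding LM_def by simp
 have y: "fm (Yf A) b c f : El (eo A (yo A b) (yo A c))" if "b : vob A" "c : vob A" "f : EH A b c" for b c f
  using fm_El[OF Y1 that] by simp
 show l: "lact (LM A FF M) b c f n = cp (Fun A FF) M (yo A b) (yo A c) (fm (Yf A) b c f) n"
  if "b : vob A" "c : vob A" "f : EH A b c" "n : El (eo A M (yo A b))" for b c f n
  using vhom_fun(2)[OF at_simps(8)] y that v(2) by (simp add: lact_def LM_def)
 show "Ea A M (yo A c) a (lact (LM A FF M) b c f n) m = cp A a b c f (Ea A M (yo A b) a n m)"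
  if "a : vob A" "b : vob A" "c : vob A" "f : EH A b c" "n : El (eo A M (yo A b))" "m : El M$a"
  using Y(3) Ea_El[OF mc M rp[OF that(2)]] y that by (simp add: l vcmp_Fun(2)[OF mc])
qed

lemma LM_pairing:
 assumes M [simp]: "M : FF" and h: "h ` J <= vob A" and S: "Sfun A M (LM A FF M) J h S"
 shows "pairing V A M (LM A FF M) (evM A M) J h S"
proof (rule pairing.intro[OF symmetric_monoidal_closed_axioms pairing_axioms.intro[OF at_simps(1) _ LM(1)[OF M] h S]])
 note [simp] = LM(2)[OF M]
 fix a b n assume [simp]: "a : vob A" "b : vob A" "n : El (LM A FF M)$b"
 show "nat1 (st n) [] M$a (vhom A a b) (Ea A M (yo A b) a n)"
  using nat1_Ea2[OF mc nat1_id M rp] `n : _` by simp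
next
 note [simp] = LM(2)[OF M]
 fix a b m assume [simp]: "a : vob A" "b : vob A" "m : El M$a"
 show "nat1 [] (st m) (LM A FF M)$b (vhom A a b) (%n. Ea A M (yo A b) a n m)"
  using nat1_Ea1[OF mc nat1_id M rp] by simp
qed (simp_all add: LM(2,4)[OF M] Ea_ract[OF mc] vrep(2) Ea_El[OF mc M rp, simplified])

lemma thM:
 assumes [simp]: "M : FF" "h j : vob A" "m : El M$(h j)" "n : El (eo A M (yo A (h j)))"
 shows "thM A FF M h j m n : El (eo A M M)" "st (thM A FF M h j m n) = st m @ st n"
  "a : vob A ==> m' : El M$a ==> Ea A M M a (thM A FF M h j m n) m' = ract A M a (h j) m (Ea A M (yo A (h j)) a n m')"
 unfolding thM_def using yon(3)[OF mc `M : FF` `h j : _` rp] Ea_El[OF mc `M : FF` rp[OF `h j : _`] _] by (simp_all add: vcmp_Fun(2)[OF mc])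

lemma cow_thM:
 assumes M [simp]: "M : FF" and h: "h ` J <= vob A"
 shows "cow A M (LM A FF M) J h [] [] (eo A M M) (thM A FF M h)"
 unfolding cow_def
proof (intro conjI ballI)
 have [simp]: "h j : vob A" if "j : J" for j using that h by auto
 note [simp] = LM(2)[OF M]
 {
  fix j n assume [simp]: "j : J" "n : El (LM A FF M)$(h j)"
  then have n: "n : El (eo A M (yo A (h j)))" by simp
  have "nat1 [] ([] @ st n) M$(h j) (vhom (Fun A FF) M M) (%m. thM A FF M h j m n)"
   unfolding thM_def by (rule nat1_cp1) (use n nat1_yon[OF mc M] in simp_all)
  then show "nat1 [] (st n @ []) M$(h j) (eo A M M) (%m. thM A FF M h j m n)" by simp
 next
  fix j m assume [simp]: "j : J" "m : El M$(h j)"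
  have "nat1 (st (yon A M (h j) m) @ []) [] (LM A FF M)$(h j) (vhom (Fun A FF) M M) (thM A FF M h j m)"
   unfolding thM_def by (rule nat1_cp2) (simp_all add: nat1_id)
  then show "nat1 ([] @ st m) [] (LM A FF M)$(h j) (eo A M M) (thM A FF M h j m)" by simp
 next
  fix i j m f n assume [simp]: "i : J" "j : J" "m : El M$(h j)" "f : EH A (h i) (h j)" "n : El (LM A FF M)$(h i)"
  then have n [simp]: "n : El (eo A M (yo A (h i)))" by simp
  have r [simp]: "ract A M (h i) (h j) m f : El M$(h i)" by (rule ract_El) simp_all
  have l [simp]: "lact (LM A FF M) (h i) (h j) f n : El (eo A M (yo A (h j)))"
   using lact_El[OF LM(1)[OF M]] by simp
  show "thM A FF M h i (ract A M (h i) (h j) m f) n = thM A FF M h j m (lact (LM A FF M) (h i) (h j) f n)"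
  proof (rule Ea_ext[OF mc M M])
   fix a m' assume [simp]: "a : vob A" "m' : El M$a"
   show "Ea A M M a (thM A FF M h i (ract A M (h i) (h j) m f) n) m' = Ea A M M a (thM A FF M h j m (lact (LM A FF M) (h i) (h j) f n)) m'"
    using Ea_El[OF mc M rp _] by (simp add: thM LM(4) ract_ract)
  qed (simp_all add: thM)
 }
qed

text \<open>One equation yields both triangle identities. Evaluated at \<open>m'\<close> it is
  \<open>Z1\<close>; and \<open>Z2\<close> follows, since a transformation from \<open>M\<close> to
  a representable is determined by its values, which \<open>eval_inverse\<close> computes from
  \<open>Z1\<close>.\<close>

lemma atomicI:
 assumes M [simp]: "M : FF" and h: "h ` J <= vob A" and S: "Sfun A M (LM A FF M) J h S"
  and th: "S (eo A M M) (thM A FF M h) = idg (Fun A FF) M"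
 shows "dual_pair V A M (LM A FF M) (evM A M) J h S"
proof -
 note P = LM_pairing[OF M h S] and L = LM(1)[OF M]
 note [simp] = LM(2)[OF M] pairing.pr_simps(1)[OF P]
 have r: "rmod A M" by simp
 have Z: "sig S [] (st m') M$a (%j m n. ract A M a (h j) m (Ea A M (yo A (h j)) a n m')) = m'"
  if [simp]: "a : vob A" "m' : El M$a" for a m'
 proof -
  have "sig S [] (st m') M$a (%j m n. ract A M a (h j) m (Ea A M (yo A (h j)) a n m')) = Ea A M M a (S (eo A M M) (thM A FF M h)) m'"
  proof (rule sig_master[OF at_simps(1) r L h S cow_thM[OF M h]])
   show "nat1 [] (st m') (eo A M M) M$a (%x. Ea A M M a x m')"
    using nat1_Ea1[OF mc nat1_id M] by simp
  qed (use El_ok[OF that(2)] in "simp_all add: thM")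
  then show ?thesis unfolding th by (simp add: vid_Fun(2)[OF mc])
 qed
 show ?thesis
 proof (rule dual_pair.intro[OF P dual_pair_axioms.intro[OF Z]])
  fix b n' assume b [simp]: "b : vob A" and n: "n' : El (LM A FF M)$b"
  then have n' [simp]: "n' : El (eo A M (yo A b))" by simp
  note q = pairing.eqv_e[OF P b n] and o = El_ok[OF n']
  note c = pairing.cow_eqv[OF P b q]
  show "sig S (st n') [] (LM A FF M)$b (%j m n. lact (LM A FF M) (h j) b (Ea A M (yo A b) (h j) n' m) n) = n'"
  proof (simp, rule Ea_ext[OF mc M rp])
   show "sig S (st n') [] (eo A M (yo A b)) (%j m n. lact (LM A FF M) (h j) b (Ea A M (yo A b) (h j) n' m) n) : El (eo A M (yo A b))"
    "st (sig S (st n') [] (eo A M (yo A b)) (%j m n. lact (LM A FF M) (h j) b (Ea A M (yo A b) (h j) n' m) n)) = st n'"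
    using sig_El[OF at_simps(1) r L h S c] o by simp_all
   fix a m assume [simp]: "a : vob A" "m : El M$a"
   show "Ea A M (yo A b) a (sig S (st n') [] (eo A M (yo A b)) (%j m n. lact (LM A FF M) (h j) b (Ea A M (yo A b) (h j) n' m) n)) m
    = Ea A M (yo A b) a n' m"
    using pairing.eval_inverse[OF P b o q] Z by simp
  qed simp_all
 qed simp_all
qed

end

end

context dual_pair
begin

lemma S_sig:
 assumes "cow A M N J h [] [] X w" "ob X"
 shows "sig S [] [] X w = S X w"
 by (rule sig_master[OF A M N h S assms(1) nat1_id]) (simp_all add: assms(2))

text \<open>The coend element is carried along \<open>f\<close> in the module and along
  precomposition with \<open>g\<close> in the dual. The rank-one endomorphisms of \<open>G\<close>
  then sum to \<open>f\<close> after \<open>g\<close>, which is the identity.\<close>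

lemma retract_atomic:
 assumes mc: "mcat A FF" and rp [simp]: "!!a. a : vob A ==> yo A a : FF" and G [simp]: "G : FF"
  and f: "eqv A M G [] f" and g: "eqv A G M [] g"
  and fg: "!!a x. a : vob A ==> x : El G$a ==> f a (g a x) = x"
 shows "atomic A FF G"
proof -
 note [simp] = mc_rmod[OF mc] mc_obj[OF mc] eo_obj[OF mc] LM(2)[OF mc rp G]
 have f1: "nat1 [] [] M$a G$a (f a)" and g1: "nat1 [] [] G$a M$a (g a)" if "a : vob A" for a
  using f g that unfolding eqv_def by blast+
 have [simp]: "f a m : El G$a" "st (f a m) = st m" if "a : vob A" "m : El M$a" for a m
  using nat1D(1,2)[OF f1[OF that(1)] that(2)] by simp_all
 have [simp]: "g a x : El M$a" "st (g a x) = st x" if "a : vob A" "x : El G$a" for a x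
  using nat1D(1,2)[OF g1[OF that(1)] that(2)] by simp_all
 have fr: "f a (ract A M a b m k) = ract A G a b (f b m) k" if "a : vob A" "b : vob A" "m : El M$b" "k : EH A a b" for a b m k
  using f that unfolding eqv_def by simp
 have gr: "g a (ract A G a b m k) = ract A M a b (g b m) k" if "a : vob A" "b : vob A" "m : El G$b" "k : EH A a b" for a b m k
  using g that unfolding eqv_def by simp
 define \<rho> where "\<rho> b n = EL A G (yo A b) (st n) (%a x. e a b n (g a x))" for b n
 have E: "eqv A G (yo A b) (st n) (%a x. e a b n (g a x))" if [simp]: "b : vob A" "n : El N$b" for b n
  unfolding eqv_def using nat1_comp[OF g1 e1] by (simp add: gr eR vrep(2))
 have \<rho> [simp]: "\<rho> b n : El (eo A G (yo A b))" "st (\<rho> b n) = st n"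
  and \<rho>E: "!!a x. a : vob A ==> x : El G$a ==> Ea A G (yo A b) a (\<rho> b n) x = e a b n (g a x)"
  if "b : vob A" "n : El N$b" for b n
  unfolding \<rho>_def using EL[OF mc G rp[OF that(1)] E[OF that] El_ok[OF that(2)]] by simp_all
 have \<rho>n: "nat1 [] [] N$b (eo A G (yo A b)) (\<rho> b)" if [simp]: "b : vob A" for b
  unfolding \<rho>_def
 proof (rule nat1_EL[OF mc G rp])
  fix a x assume [simp]: "a : vob A" "x : El G$a"
  show "nat1 [] ([] @ st x) N$b (yo A b)$a (%n. e a b n (g a x))"
   using e2[of a b "g a x"] by simp
 qed (use E in simp_all)
 have \<rho>l: "\<rho> c (lact N b c k n) = lact (LM A FF G) b c k (\<rho> b n)"
  if [simp]: "b : vob A" "c : vob A" "k : EH A b c" "n : El N$b" for b c k n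
 proof (rule Ea_ext[OF mc G rp])
  show "lact (LM A FF G) b c k (\<rho> b n) : El (eo A G (yo A c))"
   using lact_El[OF LM(1)[OF mc rp G]] by simp
 qed (simp_all add: \<rho>E LM(4)[OF mc rp G] eL)
 let ?L = "LM A FF G"
 have c: "cow A M N J h [] [] X (%j m n. w (h j) (f (h j) m) (\<rho> (h j) n))" if w: "cow A G ?L (vob A) (%a. a) [] [] X w" for X w
  unfolding cow_def
 proof (intro conjI ballI)
  note d = cowD[OF w]
  {
   fix j n assume [simp]: "j : J" "n : El N$(h j)"
   show "nat1 [] (st n @ []) M$(h j) X (%m. w (h j) (f (h j) m) (\<rho> (h j) n))"
    by (rule nat1_comp[OF f1 d(1)]) simp_all
  next
   fix j m assume [simp]: "j : J" "m : El M$(h j)"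
   show "nat1 ([] @ st m) [] N$(h j) X (%n. w (h j) (f (h j) m) (\<rho> (h j) n))"
    using nat1_comp[OF \<rho>n] d(2)[of "h j" "f (h j) m"] by simp
  next
   fix i j m k n assume "i : J" "j : J" "m : El M$(h j)" "k : EH A (h i) (h j)" "n : El N$(h i)"
   then show "w (h i) (f (h i) (ract A M (h i) (h j) m k)) (\<rho> (h i) n) = w (h j) (f (h j) m) (\<rho> (h j) (lact N (h i) (h j) k n))"
    using d(3) by (simp add: \<rho>l fr)
  }
 qed
 define S' where "S' X w = S X (%j m n. w (h j) (f (h j) m) (\<rho> (h j) n))" for X w
 have S': "Sfun A G ?L (vob A) (%a. a) S'"
  unfolding Sfun_def S'_def using SfunD[OF A M N h S c] SfunN[OF A M N h S c c] by simp
 have c0: "cow A M N J h [] [] (eo A G G) (%j m n. thM A FF G (%a. a) (h j) (f (h j) m) (\<rho> (h j) n))"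
  by (rule c[OF cow_thM[OF mc rp G]]) simp_all
 have "S' (eo A G G) (thM A FF G (%a. a)) = idg (Fun A FF) G"
  unfolding S'_def
 proof (rule Ea_ext[OF mc G G])
  fix a x assume [simp]: "a : vob A" "x : El G$a"
  then have o: "ok (st x)" using El_ok by blast
  let ?z = "%j m n. ract A M a (h j) m (e a (h j) n (g a x))"
  have "sig S [] (st x) G$a (%j m n. f a (?z j m n)) = Ea A G G a (S (eo A G G) (%j m n. thM A FF G (%a. a) (h j) (f (h j) m) (\<rho> (h j) n))) x"
  proof (rule sig_master[OF A M N h S c0])
   show "nat1 [] (st x) (eo A G G) G$a (%y. Ea A G G a y x)"
    using nat1_Ea1[OF mc nat1_id G] by simp
  qed (simp_all add: thM[OF mc rp G] \<rho>E fr o)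
  moreover have "sig S [] (st x) G$a (%j m n. f a (?z j m n)) = f a (sig S [] (st (g a x)) M$a ?z)"
   by (rule sig_comp[OF A M N h S cow_Z1 _ _ _ _ _ _ f1]) (simp_all add: o)
  ultimately show "Ea A G G a (S (eo A G G) (%j m n. thM A FF G (%a. a) (h j) (f (h j) m) (\<rho> (h j) n))) x = Ea A G G a (idg (Fun A FF) G) x"
   using Z1[of a "g a x"] by (simp add: fg vid_Fun(2)[OF mc])
 qed (use SfunD[OF A M N h S c0] in "simp_all add: idg_Fun_El[OF mc]")
 from atomicI[OF mc rp G _ S' this] show ?thesis unfolding atomic_def by auto
qed

end

context symmetric_monoidal_closed
begin

lemma dual_atomic:
 assumes D: "dual_pair V A M N e J h S" and mc: "mcat A FF" and rp: "!!a. a : vob A ==> yo A a : FF" and M: "M : FF"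
 shows "atomic A FF M"
 by (rule dual_pair.retract_atomic[OF D mc rp M, where f = "%a m. m" and g = "%a m. m"]) (simp_all add: eqv_def nat1_id)

text \<open>The coend element is the pair of identities at \<open>a\<close>, so a one-point index
  set is enough; \<open>i\<close> is an arbitrary index.\<close>

lemma dual_pair_rep:
 assumes A [simp]: "cat A" and a [simp]: "a : vob A"
 shows "dual_pair V A (yo A a) (homf A a) (%c b n m. cp A c a b n m) {i} (%_. a) (%X w. w i (idg A a) (idg A a))"
proof -
 let ?M = "yo A a" and ?N = "homf A a" and ?S = "%X w. w i (idg A a) (idg A a)"
 note r [simp] = vrep(2)[OF A a] and l [simp] = vhom_fun(2)[OF A a]
 note M = vrep(1)[OF A a] and N = vhom_fun(1)[OF A a]
 have S: "Sfun A ?M ?N {i} (%_. a) ?S"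
  unfolding Sfun_def by (auto dest: cowD(4,5)[of A ?M ?N "{i}" "%_. a" "[]" "[]" _ _ i "idg A a" "idg A a"])
 have P: "pairing V A ?M ?N (%c b n m. cp A c a b n m) {i} (%_. a) ?S"
 proof (rule pairing.intro[OF symmetric_monoidal_closed_axioms pairing_axioms.intro[OF A M N _ S]])
  fix c b n assume [simp]: "c : vob A" "b : vob A" "n : El ?N$b"
  then show "nat1 (st n) [] ?M$c (vhom A c b) (cp A c a b n)"
   using nat1_cp2[OF nat1_id A] by simp
 next
  fix c b m assume [simp]: "c : vob A" "b : vob A" "m : El ?M$c"
  then show "nat1 [] (st m) ?N$b (vhom A c b) (%n. cp A c a b n m)"
   using nat1_cp1[OF nat1_id A] by simp
 qed (simp_all add: cp_assoc)
 have i: "{i} = {i}" "(%_. a) ` {i} <= vob A" by simp_all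
 have s: "sig ?S ps rs X w = w i (idg A a) (idg A a)" if "cow A ?M ?N {i} (%_. a) ps rs X w" "ok ps" "ok rs" "ob X" for ps rs X w
  unfolding sig_Ph[OF A M N i(2) S that] by (rule cow_wt(2)[OF A M N i(2) S that]) simp_all
 show ?thesis
 proof (rule dual_pair.intro[OF P dual_pair_axioms.intro])
  fix c m assume [simp]: "c : vob A" "m : El ?M$c"
  then have "ok (st m)" using El_ok by blast
  from s[OF pairing.cow_Z1[OF P `c : _` `m : _`] _ this]
  show "sig ?S [] (st m) ?M$c (%j k n. ract A ?M c a k (cp A c a a n m)) = m"
   using `m : _` by (simp add: cp_idg)
 next
  fix b n assume [simp]: "b : vob A" "n : El ?N$b"
  then have "ok (st n)" using El_ok by blast
  from s[OF pairing.cow_eqv[OF P `b : _` pairing.eqv_e[OF P `b : _` `n : _`]] this]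
  show "sig ?S (st n) [] ?N$b (%j m k. lact ?N a b (cp A a a b n m) k) = n"
   using `n : _` by (simp add: cp_idg)
 qed
qed

end

context dual_pair
begin

lemma sig_thM:
 assumes mc: "mcat A FF" and rp [simp]: "!!a. a : vob A ==> yo A a : FF" and M' [simp]: "M : FF"
  and N: "N = LM A FF M" and e: "e = evM A M" and P: "nat1 as bs (eo A M M) X P" and X: "ob X"
  and w: "!!j m n. j : J ==> m : El M$(h j) ==> n : El N$(h j) ==> w j m n = P (thM A FF M h j m n)"
 shows "sig S as bs X w = P (idg (Fun A FF) M)"
proof (rule sig_theta[OF mc M' P X])
 fix j m n assume [simp]: "j : J" "m : El M$(h j)" and n [simp]: "n : El N$(h j)"
 then have n': "n : El (eo A M (yo A (h j)))" unfolding N by (simp add: LM(2)[OF mc rp])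
 note t = thM[where h = h, OF mc rp M' _ _ n']
 have "thM A FF M h j m n = xe M (h j) m n"
 proof (rule Ea_ext[OF mc M' M'])
  fix a m' assume "a : vob A" "m' : El M$a"
  then show "Ea A M M a (thM A FF M h j m n) m' = Ea A M M a (xe M (h j) m n) m'"
   by (simp add: t xe[OF mc M'], simp add: e)
 qed (simp_all add: t xe[OF mc M' M'])
 then show "w j m n = P (xe M (h j) m n)" by (simp add: w)
qed

end

context symmetric_monoidal_closed
begin

text \<open>\<open>fi\<close> is a colimit of representables weighted by itself. As
  \<open>[fi, -]\<close> preserves it, \<open>[fi, fi]\<close> is the coend of
  \<open>fi k \<otimes> [fi, K(-, k)]\<close>, and the identity of \<open>fi\<close> is the required
  element of this coend.\<close>

lemma small_projective_atomic:
 fixes ka :: "'u rel"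
 assumes u: "Cinfinite ka" "complete_cat ka V" and sp: "(K, fi) : small_projectives ka V"
 shows "atomic K {F. rmod K F} fi"
proof -
 let ?G = "{F. rmod K F}"
 let ?P = "Fun K ?G" and ?L = "LM K ?G fi"
 have w: "weight ka V K fi" using sp unfolding small_projectives_def by blast
 then have K [simp]: "cat K" and sm: "small_vcat ka V K" and fi: "rmod K fi" unfolding weight_def by auto
 note mc = mcat_presheaves[OF u K sm]
 have rp [simp]: "yo K a : ?G" if "a : vob K" for a using vrep(1)[OF K that] by simp
 note [simp] = fi vrep(1)[OF K]
 have fiG [simp]: "fi : ?G" by simp
 note P = vcategory_Fun[OF mc]
 note [simp] = eo_obj[OF mc] cp_Fun_El[OF mc] fob_Yf[OF mc] yon(1,2)[OF mc] idg_Fun_El[OF mc] rmod_obj[OF fi] LM(2)[OF mc rp fiG]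
 note Y = Yf(1)[OF mc rp]
 have Y: "func K ?P (Yf K)" by (rule Y)
 let ?S = "fc (Yf K) (vfid V K)"
 note i = eacc_id[OF K fi]
 note YS = vfunctor_vfcomp[OF K K P Y i(1)]
 let ?F = "homf ?P fi"
 have F: "smod ?P ?F" by (rule vhom_fun(1)[OF P]) simp
 note FS = vfunctor_vfcomp[OF K P vcategory_self F YS(1)]
 have id: "(vfid V K)$k = k" "f : EH K k l ==> fm (vfid V K) k l f = f" for k l f
  by (simp_all add: vfid_def fm_def)
 note [simp] = id(1)
 let ?io = "%k p. yon K fi (vfid V K)$k p"
 have "ecolim ?P K fi ?S fi ?io"
  by (rule eacc_Fun_ecolim[OF K K fi i(1) fi i(2) mc fiG rp])
 moreover have "preserves_wcolim V ?P VV ?F K fi ?S"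
  using sp w YS(1) unfolding small_projectives_def preserves_small_wcolims_def presheaves_def by blast
 ultimately have "ecolim VV K fi (fc ?F ?S) ?F$fi (%k p. fm ?F ?S$k fi (?io k p))"
  unfolding preserves_wcolim_iff[OF P vcategory_self F K fi YS(1)] by blast
 note D = ecolimD[OF this]
 have Fm [simp]: "fm ?F G H g : El (hom (eo K fi G) (eo K fi H))" if "G : ?G" "H : ?G" "g : El (eo K G H)" for G H g
  using fm_El[OF F] that by simp
 have Fa [simp]: "ap (eo K fi G) (eo K fi H) (fm ?F G H g) t = cp ?P fi G H g t"
  if "G : ?G" "H : ?G" "g : El (eo K G H)" "t : El (eo K fi G)" for G H g t
  using vhom_fun(2)[OF P] that by (simp add: lact_def)
 let ?t = "thM K ?G fi (%a. a)"
 note th [simp] = thM(1,2)[where h = "%a. a", OF mc rp fiG]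
 have yE [simp]: "fm (Yf K) k l f : El (eo K (yo K k) (yo K l))" if "k : vob K" "l : vob K" "f : EH K k l" for k l f
  using fm_El[OF Y that] by simp
 have ev: "ap (eo K fi (yo K k)) X (cp VV (eo K fi (yo K k)) (eo K fi fi) X u (fm ?F (yo K k) fi (yon K fi k p))) n
   = ap (eo K fi fi) X u (?t k p n)"
  if "ob X" "k : vob K" "u : El (hom (eo K fi fi) X)" "p : El fi$k" "n : El (eo K fi (yo K k))" for X u k p n
  using that by (simp add: vcmp_self thM_def)
 \<comment> \<open>A dinatural family, curried in \<open>n\<close>, is a cocone under the preserved
   colimit and therefore extends to an arrow out of \<open>[fi, fi]\<close>.\<close>
 have ex: "EX u : El (hom (eo K fi fi) X). st u = [] & (ALL k : vob K. ALL p : El fi$k. ALL n : El (eo K fi (yo K k)).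
   ap (eo K fi fi) X u (?t k p n) = w k p n)"
  if X [simp]: "ob X" and w: "cow K fi ?L (vob K) (%a. a) [] [] X w" for X w
 proof -
  let ?w = "%k p. lamF (st p) (eo K fi (yo K k)) X (w k p)"
  note d = cowD[OF w, simplified]
  have l [simp]: "?w k p : El (hom (eo K fi (yo K k)) X)"
   and l2 [simp]: "!!n. n : El (eo K fi (yo K k)) ==> ap (eo K fi (yo K k)) X (?w k p) n = w k p n"
   if "k : vob K" "p : El fi$k" for k p
   using lamF[OF d(2)[OF that]] that by simp_all
  have "eqv K fi (homS VV (fc ?F ?S) X) [] ?w"
   unfolding eqv_def
  proof (intro conjI ballI)
   fix k assume [simp]: "k : vob K"
   show "nat1 [] [] fi$k (homS VV (fc ?F ?S) X)$k (?w k)"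
    unfolding fob_homS self_simps fob_vfcomp id fob_Yf[OF mc] vhom_fun_simps Fun_simps by (rule nat1_lamF) (use d(1,2) in simp_all)
  next
   fix k l p f assume [simp]: "k : vob K" "l : vob K" "p : El fi$l" "f : EH K k l"
   have r [simp]: "ract K fi k l p f : El fi$k" by (rule ract_El[OF fi]) simp_all
   have "?w k (ract K fi k l p f) = cp VV (eo K fi (yo K k)) (eo K fi (yo K l)) X (?w l p) (fm ?F (yo K k) (yo K l) (fm (Yf K) k l f))"
    by (rule ap_ext[where X = "eo K fi (yo K k)" and Y = X])
     (use l[of k "ract K fi k l p f"] l2[of k "ract K fi k l p f"] in "simp_all add: vcmp_self d(3) LM(3)[OF mc rp fiG]")
   then show "?w k (ract K fi k l p f) = ract K (homS VV (fc ?F ?S) X) k l (?w l p) f"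
    using homS(2)[OF vcategory_self K FS(1)] by (simp add: FS(2) YS(2) id(2))
  qed
  from D(6)[OF _ _ this] obtain u where u [simp]: "u : El (hom (eo K fi fi) X)" "st u = []" and
   e: "!!k p. k : vob K ==> p : El fi$k ==> cp VV (eo K fi (yo K k)) (eo K fi fi) X u (fm ?F (yo K k) fi (yon K fi k p)) = ?w k p"
   by auto
  show ?thesis
  proof (intro bexI[of _ u] conjI ballI)
   fix k p n assume *: "k : vob K" "p : El fi$k" "n : El (eo K fi (yo K k))"
   show "ap (eo K fi fi) X u (?t k p n) = w k p n"
    using ev[OF X *(1) u(1) *(2,3)] unfolding e[OF *(1,2)] l2[OF *] ..
  qed simp_all
 qed
 have uq: "u = v" if X [simp]: "ob X" and [simp]: "u : El (hom (eo K fi fi) X)" "v : El (hom (eo K fi fi) X)" "st u = st v"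
  and e: "!!k p n. k : vob K ==> p : El fi$k ==> n : El (eo K fi (yo K k)) ==>
   ap (eo K fi fi) X u (?t k p n) = ap (eo K fi fi) X v (?t k p n)" for X u v
 proof (rule D(7)[of X])
  fix k p assume [simp]: "k : vob K" "p : El fi$k"
  have "cp VV (eo K fi (yo K k)) (eo K fi fi) X u (fm ?F (yo K k) fi (yon K fi k p)) =
   cp VV (eo K fi (yo K k)) (eo K fi fi) X v (fm ?F (yo K k) fi (yon K fi k p))"
   by (rule ap_ext[where X = "eo K fi (yo K k)" and Y = X]) (simp_all add: ev e)
  then show "cp VV (fc ?F ?S)$k ?F$fi X u (fm ?F ?S$k fi (?io k p)) =
   cp VV (fc ?F ?S)$k ?F$fi X v (fm ?F ?S$k fi (?io k p))" by simp
 qed simp_all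
 define U where "U X w = (SOME u. u : El (hom (eo K fi fi) X) & st u = [] & (ALL k : vob K. ALL p : El fi$k. ALL n : El (eo K fi (yo K k)).
   ap (eo K fi fi) X u (?t k p n) = w k p n))" for X w
 have U [simp]: "U X w : El (hom (eo K fi fi) X)" "st (U X w) = []" and
  Uw: "!!k p n. k : vob K ==> p : El fi$k ==> n : El (eo K fi (yo K k)) ==> ap (eo K fi fi) X (U X w) (?t k p n) = w k p n"
  if "ob X" "cow K fi ?L (vob K) (%a. a) [] [] X w" for X w
  using someI_ex[OF ex[OF that, unfolded Bex_def]] unfolding U_def by blast+
 \<comment> \<open>The functional evaluates the extension of the given family at the identity of
   \<open>fi\<close>.\<close>
 define S where "S X w = ap (eo K fi fi) X (U X w) (idg ?P fi)" for X w
 have S: "Sfun K fi ?L (vob K) (%a. a) S"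
  unfolding Sfun_def
 proof (intro conjI ballI allI impI)
  fix X Y g w w' assume X [simp]: "ob X" "ob Y" and g: "g : homs V X Y"
   and w: "cow K fi ?L (vob K) (%a. a) [] [] X w" and w': "cow K fi ?L (vob K) (%a. a) [] [] Y w'"
   and e: "ALL j:vob K. ALL m:El fi$j. ALL n:El ?L$j. w' j m n = lin g (w j m n)"
  have n: "nat1 [] [] (eo K fi fi) Y (%x. lin g (ap (eo K fi fi) X (U X w) x))"
   by (rule nat1_lin[OF nat1_conv[OF nat1_ap2[OF nat1_id _ _ _ refl]] g]) (simp_all add: U[OF X(1) w])
  note l = lamF[OF n]
  have "U Y w' = lamF [] (eo K fi fi) Y (%x. lin g (ap (eo K fi fi) X (U X w) x))"
  proof (rule uq)
   fix k p n assume *: "k : vob K" "p : El fi$k" "n : El (eo K fi (yo K k))"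
   then have "?t k p n : El (eo K fi fi)" by simp
   from l(2)[OF _ this] show "ap (eo K fi fi) Y (U Y w') (?t k p n) = ap (eo K fi fi) Y (lamF [] (eo K fi fi) Y (%x. lin g (ap (eo K fi fi) X (U X w) x))) (?t k p n)"
    unfolding Uw[OF X(2) w' *] using e * by (simp add: Uw[OF X(1) w])
  qed (use l in "simp_all add: U[OF X(2) w']")
  then show "S Y w' = lin g (S X w)" unfolding S_def using l by simp
 qed (simp_all add: S_def)
 have c: "cow K fi ?L (vob K) (%a. a) [] [] (eo K fi fi) ?t" by (rule cow_thM[OF mc rp fiG]) simp_all
 have E: "eo K fi fi : obj V" by simp
 \<comment> \<open>The rank-one endomorphisms form the tautological family, whose extension is the
   identity arrow of \<open>[fi, fi]\<close>.\<close>
 have "U (eo K fi fi) ?t = idg VV (eo K fi fi)"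
  by (rule uq[OF E]) (simp_all add: U[OF E c] Uw[OF E c] vid_self)
 then have "S (eo K fi fi) ?t = idg ?P fi" unfolding S_def by (simp add: vid_self)
 from atomicI[OF mc rp fiG _ S this] show ?thesis unfolding atomic_def by auto
qed

text \<open>The two coend elements correspond along \<open>g\<close>: pushing the first forward in
  the module equals pulling the second back in the dual. The identity of \<open>M'\<close> is
  expanded by its own coend element, and \<open>Z2\<close> for \<open>M\<close> contracts the
  result.\<close>

lemma dinatural:
 assumes mc: "mcat A FF" and rp [simp]: "!!a. a : vob A ==> yo A a : FF" and M [simp]: "M : FF" "M' : FF"
  and D: "dual_pair V A M (LM A FF M) (evM A M) (vob A) (%a. a) S" and D': "dual_pair V A M' (LM A FF M') (evM A M') (vob A) (%a. a) S'"
  and g [simp]: "g : El (eo A M M')" and w: "cow A M' (LM A FF M) (vob A) (%a. a) ps rs X w" and o [simp]: "ok ps" "ok rs" and X [simp]: "ob X"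
 shows "sig S (ps @ st g) rs X (%a m n. w a (Ea A M M' a g m) n) =
  sig S' ps (st g @ rs) X (%a m n. w a m (cp (Fun A FF) M M' (yo A a) n g))"
proof -
 note [simp] = at_simps[OF mc rp]
 note L [simp] = LM(1,2)[OF mc rp M(1)] LM(2)[OF mc rp M(2)]
 note d = cowD[OF w, simplified] and T = pairing.A[OF dual_pair.axioms(1)[OF D]] pairing.M[OF dual_pair.axioms(1)[OF D]]
  pairing.N[OF dual_pair.axioms(1)[OF D]] pairing.h[OF dual_pair.axioms(1)[OF D]] pairing.S[OF dual_pair.axioms(1)[OF D]]
 note og [simp] = El_ok[OF g]
 have c: "cow A M (LM A FF M) (vob A) (%a. a) (ps @ st x @ st g) rs X (%a m n. w a (Ea A M' M' a x (Ea A M M' a g m)) n)"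
  if x [simp]: "x : El (eo A M' M')" for x
  unfolding cow_def
 proof (intro conjI ballI)
  fix a n assume [simp]: "a : vob A" and "n : El (LM A FF M)$a"
  then have [simp]: "n : El (eo A M (yo A a))" by simp
  show "nat1 (ps @ st x @ st g) (st n @ rs) M$a X (%m. w a (Ea A M' M' a x (Ea A M M' a g m)) n)"
   by (rule nat1_comp[OF nat1_Ea2[OF mc nat1_Ea2[OF mc nat1_id M(1,2)] M(2,2)] d(1)]) simp_all
 next
  fix a m assume [simp]: "a : vob A" "m : El M$a"
  show "nat1 ((ps @ st x @ st g) @ st m) rs (LM A FF M)$a X (w a (Ea A M' M' a x (Ea A M M' a g m)))"
   using nat1_conv[OF d(2)[of a "Ea A M' M' a x (Ea A M M' a g m)"]] by simp
 qed (simp add: Ea_ract[OF mc] d(3))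
 \<comment> \<open>The left-hand side with an endomorphism \<open>x\<close> of \<open>M'\<close>
   inserted after \<open>g\<close>. Its value at the identity of \<open>M'\<close> is computed in
   two ways.\<close>
 let ?P = "%x. sig S (ps @ st x @ st g) rs X (%a m n. w a (Ea A M' M' a x (Ea A M M' a g m)) n)"
 have P: "nat1 ps (st g @ rs) (eo A M' M') X ?P"
 proof (rule nat1_sig_left[OF T c])
  fix a m n assume [simp]: "a : vob A" "m : El M$a" and "n : El (LM A FF M)$a"
  then have [simp]: "n : El (eo A M (yo A a))" by simp
  show "nat1 ps (st g @ st m @ st n @ rs) (eo A M' M') X (%x. w a (Ea A M' M' a x (Ea A M M' a g m)) n)"
   by (rule nat1_comp[OF nat1_Ea1[OF mc nat1_id M(2,2)] d(1)]) simp_all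
 qed simp_all
 have "sig S' ps (st g @ rs) X (%a m n. w a m (cp (Fun A FF) M M' (yo A a) n g)) = ?P (idg (Fun A FF) M')"
 proof (rule dual_pair.sig_thM[OF D' mc rp M(2) refl refl P X])
  fix a m n' assume [simp]: "a : vob A" and m [simp]: "m : El M'$a" and "n' : El (LM A FF M')$a"
  then have n [simp]: "n' : El (eo A M' (yo A a))" by simp
  let ?n = "cp (Fun A FF) M M' (yo A a) n' g"
  have ng [simp]: "?n : El (eo A M (yo A a))" by simp
  then have ng': "?n : El (LM A FF M)$a" by simp
  note [simp] = El_ok[OF m] El_ok[OF n]
  note t = thM[where h = "%a. a", OF mc rp M(2)]
  have ev [simp]: "Ea A M (yo A a) b ?n m' = Ea A M' (yo A a) b n' (Ea A M M' b g m')" if "b : vob A" "m' : El M$b" for b m'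
   using that by (simp add: vcmp_Fun(2)[OF mc])
  have evE: "Ea A M' (yo A a) b n' (Ea A M M' b g m') : EH A b a" if "b : vob A" "m' : El M$b" for b m'
   using Ea_El[OF mc M(2) rp[OF `a : _`] that(1) n Ea_El[OF mc M that(1) g that(2)]] by simp
  note cz = pairing.cow_eqv[OF dual_pair.axioms(1)[OF D] `a : vob A` pairing.eqv_e[OF dual_pair.axioms(1)[OF D] `a : vob A` ng']]
  have "w a m (sig S (st ?n) [] (LM A FF M)$a (%b m' n. lact (LM A FF M) b a (Ea A M (yo A a) b ?n m') n)) = ?P (thM A FF M' (%a. a) a m n')"
   by (rule sig_comp[OF T cz _ _ _ _ _ _ cowD(2)[OF w], symmetric]) (simp_all add: t evE d(3))
  then show "w a m ?n = ?P (thM A FF M' (%a. a) a m n')"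
   using dual_pair.Z2[OF D `a : _` ng'] by simp
 qed
 also have "... = sig S (ps @ st g) rs X (%a m n. w a (Ea A M M' a g m) n)"
  using sig_cong[OF T c[of "idg (Fun A FF) M'"], of "%a m n. w a (Ea A M M' a g m) n"] by (simp add: vid_Fun(2)[OF mc])
 finally show ?thesis by simp
qed

section \<open>Colimits of atomic modules with an atomic weight\<close>

context
 fixes A :: "('a, 'o, 'm) vcat" and K :: "('k, 'o, 'm) vcat" and FF GG fi S c io
 assumes mc: "mcat A FF" and rp [simp]: "!!a. a : vob A ==> yo A a : FF"
  and mcK: "mcat K GG" and rpK [simp]: "!!k. k : vob K ==> yo K k : GG" and fi [simp]: "fi : GG"
  and S: "func K (Fun A FF) S" and E: "ecolim (Fun A FF) K fi S c io"
begin

lemmas D = ecolimD[OF E] and [simp] = at_simps[OF mc rp] mc_A[OF mcK] mc_rmod[OF mcK] mc_obj[OF mcK] eo_obj[OF mcK] Ea_El[OF mcK] cp_Fun_El[OF mcK] idg_Fun_El[OF mcK]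

abbreviation "Q == cp (Fun A FF)"
abbreviation "R k' k q p == Ea K fi (yo K k) k' q p"

lemma co [simp]: "c : FF" "k : vob K ==> S$k : FF"
 "k : vob K ==> p : El fi$k ==> io k p : El (eo A S$k c)" "k : vob K ==> p : El fi$k ==> st (io k p) = st p"
 "k : vob K ==> l : vob K ==> f : EH K k l ==> fm S k l f : El (eo A S$k S$l)"
 "k : vob K ==> l : vob K ==> f : EH K k l ==> p : El fi$l ==> ract K fi k l p f : El fi$k"
 "k' : vob K ==> k : vob K ==> q : El (eo K fi (yo K k)) ==> p : El fi$k' ==> R k' k q p : EH K k' k"
 using D(1) vfunctorD(1)[OF S] D(4,5) fm_El[OF S] Ea_El[OF mcK fi rpK] by simp_all

lemma S_cp [simp]:
 "k : vob K ==> l : vob K ==> i : vob K ==> g : EH K l i ==> f : EH K k l ==>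
 fm S k i (cp K k l i g f) = Q S$k S$l S$i (fm S l i g) (fm S k l f)"
 by (rule fm_cp[OF mc_A[OF mcK] at_simps(8)[OF mc rp] S])

lemma io_ract:
 "k : vob K ==> l : vob K ==> f : EH K k l ==> p : El fi$l ==>
 io k (ract K fi k l p f) = Q S$k S$l c (io l p) (fm S k l f)"
 using D(2) homS(2)[OF at_simps(8)[OF mc rp] mc_A[OF mcK] S, of c k l "io l p" f] unfolding eqv_def by simp

lemma R_ract:
 "k' : vob K ==> k'' : vob K ==> k : vob K ==> q : El (eo K fi (yo K k)) ==> p : El fi$k' ==> f : EH K k'' k' ==>
 R k'' k q (ract K fi k'' k' p f) = cp K k'' k' k (R k' k q p) f"
 by (simp add: Ea_ract[OF mcK] vrep(2))

lemma homS_S [simp]: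
 assumes "d : FF" "k : vob K" "l : vob K" "g : El (eo A S$l d)" "f : EH K k l"
 shows "ract K (homS (Fun A FF) S d) k l g f = Q S$k S$l d g (fm S k l f)"
 using homS(2)[OF at_simps(8)[OF mc rp] mc_A[OF mcK] S] assms by simp

text \<open>Abstraction for maps out of the colimit \<open>c\<close>, in the manner of
  \<open>lamF\<close> and \<open>EL\<close>.\<close>

definition "CX d ws t = (SOME u. u : El (eo A c d) & st u = ws & (ALL k : vob K. ALL p : El fi$k. Q S$k c d u (io k p) = t k p))"

lemma CX:
 assumes d: "d : FF" and ws: "ok ws" and t: "eqv K fi (homS (Fun A FF) S d) ws t"
 shows "CX d ws t : El (eo A c d)" "st (CX d ws t) = ws"
  "k : vob K ==> p : El fi$k ==> Q S$k c d (CX d ws t) (io k p) = t k p"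
proof -
 have "EX u. u : El (eo A c d) & st u = ws & (ALL k : vob K. ALL p : El fi$k. Q S$k c d u (io k p) = t k p)"
  using D(6)[OF _ ws t] d unfolding Bex_def Fun_simps by blast
 from someI_ex[OF this] show "CX d ws t : El (eo A c d)" "st (CX d ws t) = ws"
  "k : vob K ==> p : El fi$k ==> Q S$k c d (CX d ws t) (io k p) = t k p"
  unfolding CX_def by blast+
qed

lemma CX_ext:
 assumes "d : FF" "u : El (eo A c d)" "v : El (eo A c d)" "st u = st v"
  "!!k p. k : vob K ==> p : El fi$k ==> Q S$k c d u (io k p) = Q S$k c d v (io k p)"
 shows "u = v"
 using D(7) assms by simp

lemma nat1_CX:
 assumes d [simp]: "d : FF" and Y: "ob Y" and t: "!!y. y : El Y ==> eqv K fi (homS (Fun A FF) S d) (ps @ st y @ rs) (t y)"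
  and n: "!!k p. k : vob K ==> p : El fi$k ==> nat1 ps (rs @ st p) Y (eo A S$k d) (%y. t y k p)"
  and P: "!!y. P y = ps @ st y @ rs" and o: "ok ps" "ok rs"
 shows "nat1 ps rs Y (eo A c d) (%y. CX d (P y) (t y))"
proof (rule nat1I)
 have e: "eqv K fi (homS (Fun A FF) S d) (P y) (t y)" "ok (P y)" if "y : El Y" for y
  using that t P o by simp_all
 fix y assume y: "y : El Y"
 note C = CX[OF d e(2,1)]
 show "CX d (P y) (t y) : El (eo A c d)" "st (CX d (P y) (t y)) = ps @ st y @ rs"
  using C[OF y y] P by auto
 fix vs s assume s: "lhom vs (st y) s" and ry: "re vs s y : El Y"
 have r: "rmid ps (st y) vs rs s (CX d (P y) (t y)) : El (eo A c d)"
  using C[OF y y] P s by (intro rmid_El) auto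
 show "CX d (P (re vs s y)) (t (re vs s y)) = rmid ps (st y) vs rs s (CX d (P y) (t y))"
 proof (rule CX_ext[OF d C(1)[OF ry ry] r])
  fix k p assume kp: "k : vob K" "p : El fi$k"
  have "Q S$k c d (rmid ps (st y) vs rs s (CX d (P y) (t y))) (io k p) = rmid ps (st y) vs (rs @ st p) s (t y k p)"
   using bil_rmid_left[OF _ C(1)[OF y y] co(3)[OF kp], of "vcmp (Fun A FF) S$k c d" "eo A S$k d" ps "st y" rs vs s]
    vcategoryD(3)[OF at_simps(8)[OF mc rp], of "S$k" c d] C(2,3)[OF y y] kp P s
   unfolding cp_def by simp
  then show "Q S$k c d (CX d (P (re vs s y)) (t (re vs s y))) (io k p) = Q S$k c d (rmid ps (st y) vs rs s (CX d (P y) (t y))) (io k p)"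
   using C(3)[OF ry ry kp] nat1D(3)[OF n[OF kp] y s] by simp
 qed (use C(2)[OF ry ry] P in simp)
qed

text \<open>A map \<open>q\<close> from \<open>fi\<close> to \<open>K(-, k)\<close> and a map
  \<open>y\<close> from \<open>S k\<close> to \<open>d\<close> induce a map from \<open>c\<close> to
  \<open>d\<close>, given on the component of \<open>p'\<close> by \<open>y\<close> after the image
  under \<open>S\<close> of the value of \<open>q\<close> at \<open>p'\<close>. For representable
  \<open>d\<close> this produces elements of the dual of \<open>c\<close>.\<close>

definition "star d k y q = CX d (st y @ st q) (%k' p'. Q S$k' S$k d y (fm S k' k (R k' k q p')))"

lemma star_eqv:
 assumes [simp]: "d : FF" "k : vob K" "y : El (eo A S$k d)" "q : El (eo K fi (yo K k))"
 shows "eqv K fi (homS (Fun A FF) S d) (st y @ st q) (%k' p'. Q S$k' S$k d y (fm S k' k (R k' k q p')))"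
 unfolding eqv_def
proof (intro conjI ballI)
 fix l assume [simp]: "l : vob K"
 have n: "nat1 (st q) [] fi$l (vhom K l k) (R l k q)"
  using nat1_Ea2[OF mcK nat1_id fi rpK] by simp
 have "nat1 (st y @ st q) [] fi$l (vhom (Fun A FF) S$l d) (%p'. Q S$l S$k d y (fm S l k (R l k q p')))"
  by (rule nat1_cp2[OF nat1_fm[OF n S] at_simps(8)[OF mc rp]]) simp_all
 then show "nat1 (st y @ st q) [] fi$l (homS (Fun A FF) S d)$l (%p'. Q S$l S$k d y (fm S l k (R l k q p')))"
  by simp
qed (simp add: R_ract cp_assoc[OF at_simps(8)[OF mc rp]])

lemma star [simp]:
 assumes "d : FF" "k : vob K" "y : El (eo A S$k d)" "q : El (eo K fi (yo K k))"
 shows "star d k y q : El (eo A c d)" "st (star d k y q) = st y @ st q"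
  "k' : vob K ==> p' : El fi$k' ==> Q S$k' c d (star d k y q) (io k' p') = Q S$k' S$k d y (fm S k' k (R k' k q p'))"
proof -
 have "ok (st y @ st q)" using El_ok[OF assms(3)] El_ok[OF assms(4)] by simp
 note C = CX[OF assms(1) this star_eqv[OF assms]]
 show "star d k y q : El (eo A c d)" "st (star d k y q) = st y @ st q"
  "k' : vob K ==> p' : El fi$k' ==> Q S$k' c d (star d k y q) (io k' p') = Q S$k' S$k d y (fm S k' k (R k' k q p'))"
  unfolding star_def using C by blast+
qed

lemma nat1_star1:
 assumes [simp]: "d : FF" "k : vob K" "q : El (eo K fi (yo K k))"
 shows "nat1 [] (st q) (eo A S$k d) (eo A c d) (%y. star d k y q)"
 unfolding star_def
proof (rule nat1_CX)
 fix l p assume [simp]: "l : vob K" "p : El fi$l"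
 have "nat1 [] ([] @ st (fm S l k (R l k q p))) (vhom (Fun A FF) S$k d) (vhom (Fun A FF) S$l d) (%y. Q S$l S$k d y (fm S l k (R l k q p)))"
  by (rule nat1_cp1[OF nat1_id at_simps(8)[OF mc rp]]) simp_all
 then show "nat1 [] (st q @ st p) (eo A S$k d) (eo A S$l d) (%y. Q S$l S$k d y (fm S l k (R l k q p)))"
  by simp
qed (use star_eqv El_ok[OF assms(3)] in simp_all)

lemma nat1_star2:
 assumes [simp]: "d : FF" "k : vob K" "y : El (eo A S$k d)"
 shows "nat1 (st y) [] (eo K fi (yo K k)) (eo A c d) (star d k y)"
 unfolding star_def
proof (rule nat1_CX)
 fix l p assume [simp]: "l : vob K" "p : El fi$l"
 have n: "nat1 [] (st p) (eo K fi (yo K k)) (vhom K l k) (%q. R l k q p)"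
  using nat1_Ea1[OF mcK nat1_id fi rpK] by simp
 have "nat1 (st y @ []) (st p) (eo K fi (yo K k)) (vhom (Fun A FF) S$l d) (%q. Q S$l S$k d y (fm S l k (R l k q p)))"
  by (rule nat1_cp2[OF nat1_fm[OF n S] at_simps(8)[OF mc rp]]) simp_all
 then show "nat1 (st y) ([] @ st p) (eo K fi (yo K k)) (eo A S$l d) (%q. Q S$l S$k d y (fm S l k (R l k q p)))"
  by simp
qed (use star_eqv El_ok[OF assms(3)] in simp_all)

text \<open>The action of endomorphisms of the weight on the colimit, by functoriality in the
  weight.\<close>

definition "TT x = CX c (st x) (%k p. io k (Ea K fi fi k x p))"

lemma TT_eqv:
 assumes [simp]: "x : El (eo K fi fi)"
 shows "eqv K fi (homS (Fun A FF) S c) (st x) (%k p. io k (Ea K fi fi k x p))"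
 unfolding eqv_def
proof (intro conjI ballI)
 fix k assume [simp]: "k : vob K"
 show "nat1 (st x) [] fi$k (homS (Fun A FF) S c)$k (%p. io k (Ea K fi fi k x p))"
  using nat1_comp[OF nat1_Ea2[OF mcK nat1_id fi fi _ assms] D(3)] by simp
qed (simp add: Ea_ract[OF mcK] io_ract)

lemma TT:
 assumes "x : El (eo K fi fi)"
 shows "TT x : El (eo A c c)" "st (TT x) = st x"
  "k : vob K ==> p : El fi$k ==> Q S$k c c (TT x) (io k p) = io k (Ea K fi fi k x p)"
 using CX[OF co(1) El_ok[OF assms] TT_eqv[OF assms]] unfolding TT_def by blast+

lemma nat1_TT: "nat1 [] [] (eo K fi fi) (eo A c c) TT"
 unfolding TT_def
proof (rule nat1_CX)
 fix k p assume [simp]: "k : vob K" "p : El fi$k"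
 show "nat1 [] ([] @ st p) (eo K fi fi) (eo A S$k c) (%x. io k (Ea K fi fi k x p))"
  using nat1_comp[OF nat1_Ea1[OF mcK nat1_id fi fi] D(3)] by simp
qed (use TT_eqv in simp_all)

lemma star_lact:
 assumes [simp]: "a : vob A" "b : vob A" "f : EH A a b" "k : vob K" "n : El (eo A S$k (yo A a))" "q : El (eo K fi (yo K k))"
 shows "star (yo A b) k (lact (LM A FF S$k) a b f n) q = lact (LM A FF c) a b f (star (yo A a) k n q)"
proof -
 have Y: "func A (Fun A FF) (Yf A)" by (rule Yf(1)[OF mc rp])
 have [simp]: "fm (Yf A) a b f : El (eo A (yo A a) (yo A b))"
  using fm_El[OF Y] by simp
 have e: "lact (LM A FF S$k) a b f n = Q S$k (yo A a) (yo A b) (fm (Yf A) a b f) n"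
  "lact (LM A FF c) a b f (star (yo A a) k n q) = Q c (yo A a) (yo A b) (fm (Yf A) a b f) (star (yo A a) k n q)"
  by (rule LM(3)[OF mc rp]; simp)+
 show ?thesis unfolding e
  by (rule CX_ext[OF rp[OF `b : _`]]) (simp_all add: cp_assoc[OF at_simps(8)[OF mc rp]])
qed

lemma star_dinatural:
 assumes [simp]: "k : vob K" "l : vob K" "f : EH K k l" "d : FF" "y : El (eo A S$l d)" and q [simp]: "q : El (eo K fi (yo K k))"
 shows "star d k (Q S$k S$l d y (fm S k l f)) q = star d l y (lact (LM K GG fi) k l f q)"
proof -
 have [simp]: "lact (LM K GG fi) k l f q : El (eo K fi (yo K l))"
  using lact_El[OF LM(1)[OF mcK rpK fi]] by (simp add: LM(2)[OF mcK rpK])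
 show ?thesis
  by (rule CX_ext[OF `d : FF`]) (simp_all add: LM(4)[OF mcK rpK fi] cp_assoc[OF at_simps(8)[OF mc rp]])
qed

text \<open>The summand of a double coend, over \<open>k\<close> and over \<open>a\<close>, that
  evaluates \<open>w\<close> on \<open>c\<close> and its dual. The indices \<open>k\<close> and
  \<open>l\<close> are kept apart so that an arrow from \<open>k\<close> to \<open>l\<close> can act
  between them.\<close>

definition "inn w l k p q a m n = w a (Ea A S$l c a (io l p) m) (star (yo A a) k n q)"

context
 fixes Sfi Tk
 assumes Dfi: "dual_pair V K fi (LM K GG fi) (evM K fi) (vob K) (%a. a) Sfi"
  and Dk: "!!k. k : vob K ==> dual_pair V A S$k (LM A FF S$k) (evM A S$k) (vob A) (%a. a) (Tk k)"
begin

lemma inn_cow: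
 assumes w: "cow A c (LM A FF c) (vob A) (%a. a) [] [] X w" and [simp]: "k : vob K" "l : vob K" "p : El fi$l" "q : El (eo K fi (yo K k))"
 shows "cow A S$l (LM A FF S$k) (vob A) (%a. a) (st p) (st q) X (inn w l k p q)"
 unfolding cow_def inn_def
proof (intro conjI ballI)
 note L [simp] = LM(2)[OF mc rp co(1)] LM(2)[OF mc rp co(2)[OF `k : _`]]
 note d = cowD[OF w, simplified]
 {
  fix a n assume [simp]: "a : vob A" and "n : El (LM A FF S$k)$a"
  then have [simp]: "n : El (eo A S$k (yo A a))" by simp
  show "nat1 (st p) (st n @ st q) (S$l)$a X (%m. w a (Ea A S$l c a (io l p) m) (star (yo A a) k n q))"
   by (rule nat1_comp[OF nat1_Ea2[OF mc nat1_id co(2) co(1)] d(1)]) simp_all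
 next
  fix a m assume [simp]: "a : vob A" "m : El (S$l)$a"
  have "nat1 (st p @ st m) (st q) (eo A S$k (yo A a)) X (%n. w a (Ea A S$l c a (io l p) m) (star (yo A a) k n q))"
   by (rule nat1_comp[OF nat1_star1 d(2)]) simp_all
  then show "nat1 (st p @ st m) (st q) (LM A FF S$k)$a X (%n. w a (Ea A S$l c a (io l p) m) (star (yo A a) k n q))"
   by simp
 next
  fix a b m f n assume [simp]: "a : vob A" "b : vob A" "m : El (S$l)$b" "f : EH A a b" and "n : El (LM A FF S$k)$a"
  then have [simp]: "n : El (eo A S$k (yo A a))" by simp
  show "w a (Ea A S$l c a (io l p) (ract A S$l a b m f)) (star (yo A a) k n q) =
   w b (Ea A S$l c b (io l p) m) (star (yo A b) k (lact (LM A FF S$k) a b f n) q)"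
   by (simp add: Ea_ract[OF mc] d(3) star_lact)
 }
qed

text \<open>The inner sum, over the coend element of \<open>S k\<close>; the stages of
  \<open>p\<close> and \<open>q\<close> are its parameters on the left and on the right.\<close>

definition "WW X w k p q = sig (Tk k) (st p) (st q) X (inn w k k p q)"

lemma pk: "k : vob K ==> cat A & rmod A S$k & smod A (LM A FF S$k) & (%a. a) ` vob A <= vob A &
  Sfun A S$k (LM A FF S$k) (vob A) (%a. a) (Tk k)"
 using pairing.N[OF dual_pair.axioms(1)[OF Dk]] pairing.S[OF dual_pair.axioms(1)[OF Dk]] by simp

lemmas pk' = pk[THEN conjunct1] pk[THEN conjunct2, THEN conjunct1] pk[THEN conjunct2, THEN conjunct2, THEN conjunct1]
 pk[THEN conjunct2, THEN conjunct2, THEN conjunct2, THEN conjunct1] pk[THEN conjunct2, THEN conjunct2, THEN conjunct2, THEN conjunct2]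

text \<open>Dinaturality in \<open>k\<close> is the compatibility of the coend elements of
  \<open>S k\<close> and \<open>S l\<close> along \<open>fm S k l f\<close>, that is
  \<open>dinatural\<close>. The laws of \<open>io\<close> and of \<open>star\<close> for
  \<open>f\<close> bring the sums into the form to which it applies.\<close>

lemma WW_cow:
 assumes w: "cow A c (LM A FF c) (vob A) (%a. a) [] [] X w" and X [simp]: "ob X"
 shows "cow K fi (LM K GG fi) (vob K) (%a. a) [] [] X (WW X w)"
 unfolding cow_def WW_def
proof (intro conjI ballI)
 note L [simp] = LM(2)[OF mcK rpK fi] LM(2)[OF mc rp co(1)]
 note d = cowD[OF w, simplified]
 {
  fix k q assume k [simp]: "k : vob K" and "q : El (LM K GG fi)$k"
  then have q [simp]: "q : El (eo K fi (yo K k))" by simp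
  show "nat1 [] (st q @ []) fi$k X (%p. sig (Tk k) (st p) (st q) X (inn w k k p q))"
  proof (rule nat1_sig_left[OF pk'[OF k], where ?p2.0="[]"])
   fix a m n assume [simp]: "a : vob A" "m : El (S$k)$a" and "n : El (LM A FF S$k)$a"
   then have [simp]: "n : El (eo A S$k (yo A a))" by (simp add: LM(2)[OF mc])
   show "nat1 [] ([] @ st m @ st n @ st q) fi$k X (%p. inn w k k p q a m n)"
    unfolding inn_def by (rule nat1_comp[OF nat1_Ea1[OF mc D(3)[OF k, simplified] co(2,1)] d(1)]) simp_all
  qed (use inn_cow[OF w k k _ q] El_ok[OF q] in simp_all)
 next
  fix k p assume k [simp]: "k : vob K" and p [simp]: "p : El fi$k"
  have "nat1 (st p) [] (eo K fi (yo K k)) X (%q. sig (Tk k) (st p) (st q) X (inn w k k p q))"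
  proof (rule nat1_sig_right[OF pk'[OF k], where ?r1.0="[]"])
   fix a m n assume [simp]: "a : vob A" "m : El (S$k)$a" and "n : El (LM A FF S$k)$a"
   then have [simp]: "n : El (eo A S$k (yo A a))" by (simp add: LM(2)[OF mc])
   show "nat1 (st p @ st m @ st n @ []) [] (eo K fi (yo K k)) X (%q. inn w k k p q a m n)"
    unfolding inn_def by (rule nat1_comp[OF nat1_star2 d(2)]) simp_all
  qed (use inn_cow[OF w k k p] El_ok[OF p] in simp_all)
  then show "nat1 ([] @ st p) [] (LM K GG fi)$k X (%q. sig (Tk k) (st p) (st q) X (inn w k k p q))"
   by simp
 next
  fix k l p f q assume kl [simp]: "k : vob K" "l : vob K" and p [simp]: "p : El fi$l" and f [simp]: "f : EH K k l" and "q : El (LM K GG fi)$k"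
  then have q [simp]: "q : El (eo K fi (yo K k))" by simp
  have fq [simp]: "lact (LM K GG fi) k l f q : El (eo K fi (yo K l))"
   using lact_El[OF LM(1)[OF mcK rpK fi]] by simp
  have pf [simp]: "ract K fi k l p f : El fi$k" by simp
  note [simp] = El_ok[OF p] El_ok[OF q] El_ok[OF f]
  have "sig (Tk k) (st p @ st f) (st q) X (inn w k k (ract K fi k l p f) q) =
   sig (Tk k) (st p @ st f) (st q) X (%a m n. inn w l k p q a (Ea A S$k S$l a (fm S k l f) m) n)"
   by (rule sig_cong[OF pk'[OF kl(1)], symmetric])
    (use inn_cow[OF w kl(1) kl(1) pf q] in "simp_all add: inn_def io_ract vcmp_Fun(2)[OF mc]")
  also have "... = sig (Tk l) (st p) (st f @ st q) X (%a m n. inn w l k p q a m (Q S$k S$l (yo A a) n (fm S k l f)))"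
   using dinatural[OF mc rp co(2)[OF kl(1)] co(2)[OF kl(2)] Dk[OF kl(1)] Dk[OF kl(2)] co(5)[OF kl f] inn_cow[OF w kl p q]] by simp
  also have "... = sig (Tk l) (st p) (st f @ st q) X (inn w l l p (lact (LM K GG fi) k l f q))"
   by (rule sig_cong[OF pk'[OF kl(2)]])
    (use inn_cow[OF w kl(2) kl(2) p fq] in "simp_all add: inn_def star_dinatural LM(2)[OF mc rp]")
  finally show "sig (Tk k) (st (ract K fi k l p f)) (st q) X (inn w k k (ract K fi k l p f) q) =
   sig (Tk l) (st p) (st (lact (LM K GG fi) k l f q)) X (inn w l l p (lact (LM K GG fi) k l f q))" by simp
 }
qed

text \<open>The coend element of \<open>c\<close> combines that of the weight with those of all
  \<open>S k\<close>. On the rank-one endomorphisms of \<open>c\<close> the inner sum collapses to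
  the identity of \<open>S k\<close>, and the outer one to the identity of
  \<open>fi\<close>.\<close>

lemma colimit_atomic_aux: "atomic A FF c"
proof -
 note Pfi = dual_pair.axioms(1)[OF Dfi]
 note T = pairing.A[OF Pfi] pairing.M[OF Pfi] pairing.N[OF Pfi] pairing.h[OF Pfi] pairing.S[OF Pfi]
 note [simp] = LM(2)[OF mcK rpK fi] LM(2)[OF mc rp]
 define S' where "S' X w = Sfi X (WW X w)" for X w
 have S': "Sfun A c (LM A FF c) (vob A) (%a. a) S'"
  unfolding Sfun_def
 proof (intro conjI ballI allI impI)
  fix X w assume "ob X" "cow A c (LM A FF c) (vob A) (%a. a) [] [] X w"
  then show "S' X w : El X" "st (S' X w) = []" unfolding S'_def using SfunD[OF T WW_cow] by simp_all
 next
  fix X Y g w w' assume X: "ob X" "ob Y" and g: "g : homs V X Y"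
   and w: "cow A c (LM A FF c) (vob A) (%a. a) [] [] X w" and w': "cow A c (LM A FF c) (vob A) (%a. a) [] [] Y w'"
   and e: "ALL j:vob A. ALL m:El c$j. ALL n:El (LM A FF c)$j. w' j m n = lin g (w j m n)"
  show "S' Y w' = lin g (S' X w)" unfolding S'_def
  proof (rule SfunN[OF T WW_cow[OF w X(1)] WW_cow[OF w' X(2)] X g])
   fix k p q assume k: "k : vob K" and p: "p : El fi$k" and "q : El (LM K GG fi)$k"
   then have q: "q : El (eo K fi (yo K k))" by simp
   show "WW Y w' k p q = lin g (WW X w k p q)" unfolding WW_def
    by (rule sig_comp[OF pk'[OF k] inn_cow[OF w k k p q] _ _ _ _ _ _ nat1_lin[OF nat1_id g]])
     (use k p q X e El_ok[OF p] El_ok[OF q] in "simp_all add: inn_def")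
  qed
 qed
 have t: "cow A c (LM A FF c) (vob A) (%a. a) [] [] (eo A c c) (thM A FF c (%a. a))"
  by (rule cow_thM[OF mc rp co(1)]) simp_all
 let ?th = "thM K GG fi (%a. a)"
 have W: "WW (eo A c c) (thM A FF c (%a. a)) k p q = TT (?th k p q)"
  if k [simp]: "k : vob K" and p [simp]: "p : El fi$k" and q [simp]: "q : El (eo K fi (yo K k))" for k p q
 proof -
  note [simp] = El_ok[OF p] El_ok[OF q] and th = thM[where h = "%a. a"]
  have "nat1 (st p @ []) [] (vhom (Fun A FF) S$k S$k) (vhom (Fun A FF) S$k c) (%x. Q S$k S$k c (io k p) x)"
   using nat1_cp2[OF nat1_id at_simps(8)[OF mc rp], of "S$k" "S$k" c "io k p"] by simp
  then have n: "nat1 (st p) [] (eo A S$k S$k) (eo A S$k c) (%x. Q S$k S$k c (io k p) x)" by simp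
  have n': "nat1 (st p) (st q) (eo A S$k S$k) (eo A c c) (%x. star c k (Q S$k S$k c (io k p) x) q)"
   by (rule nat1_comp[OF n nat1_star1]) simp_all
  \<comment> \<open>The inner terms are a natural function of the rank-one endomorphisms of
    \<open>S k\<close>, so their sum is the value of this function at the identity of
    \<open>S k\<close>.\<close>
  have "WW (eo A c c) (thM A FF c (%a. a)) k p q = star c k (Q S$k S$k c (io k p) (idg (Fun A FF) S$k)) q"
   unfolding WW_def
  proof (rule dual_pair.sig_thM[OF Dk[OF k] mc rp co(2)[OF k] refl refl n'])
   fix a m n assume [simp]: "a : vob A" "m : El (S$k)$a" and "n : El (LM A FF S$k)$a"
   then have n [simp]: "n : El (eo A S$k (yo A a))" by simp
   note t1 [simp] = th[OF mc rp co(2)[OF k] `a : _` `m : _` n]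
   note t2 [simp] = th[OF mc rp co(1) `a : _` Ea_El[OF mc co(2)[OF k] co(1) `a : _` co(3)[OF k p] `m : _`] star(1)[OF rp[OF `a : _`] k n q]]
   show "inn (thM A FF c (%a. a)) k k p q a m n = star c k (Q S$k S$k c (io k p) (thM A FF S$k (%a. a) a m n)) q"
    unfolding inn_def
   proof (rule CX_ext[OF co(1)])
    fix l p' assume [simp]: "l : vob K" "p' : El fi$l"
    show "Q S$l c c (thM A FF c (%a. a) a (Ea A S$k c a (io k p) m) (star (yo A a) k n q)) (io l p') =
     Q S$l c c (star c k (Q S$k S$k c (io k p) (thM A FF S$k (%a. a) a m n)) q) (io l p')"
    proof (rule Ea_ext[OF mc co(2)[OF `l : _`] co(1)])
     fix b x assume b [simp]: "b : vob A" and x [simp]: "x : El (S$l)$b"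
     have s: "Ea A c (yo A a) b (star (yo A a) k n q) (Ea A S$l c b (io l p') x) =
      Ea A S$k (yo A a) b n (Ea A S$l S$k b (fm S l k (R l k q p')) x)"
      using vcmp_Fun(2)[OF mc co(2)[OF `l : _`] co(1) rp[OF `a : _`] b star(1)[OF rp[OF `a : _`] k n q] co(3)[OF `l : _` `p' : _`]] by (simp add: vcmp_Fun(2)[OF mc])
     have [simp]: "Ea A S$k (yo A a) b n (Ea A S$l S$k b (fm S l k (R l k q p')) x) : EH A b a"
      using Ea_El[OF mc co(2)[OF k] rp[OF `a : _`] b] by simp
     show "Ea A S$l c b (Q S$l c c (thM A FF c (%a. a) a (Ea A S$k c a (io k p) m) (star (yo A a) k n q)) (io l p')) x =
      Ea A S$l c b (Q S$l c c (star c k (Q S$k S$k c (io k p) (thM A FF S$k (%a. a) a m n)) q) (io l p')) x"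
      by (simp add: vcmp_Fun(2)[OF mc] s Ea_ract[OF mc])
    qed simp_all
   qed simp_all
  qed simp_all
  also have "... = star c k (io k p) q" using cp_idg(2)[OF at_simps(8)[OF mc rp]] by simp
  \<comment> \<open>What remains depends on \<open>p\<close> and \<open>q\<close> only through the
    rank-one endomorphism of \<open>fi\<close> that they form, acting on \<open>c\<close> by
    \<open>TT\<close>.\<close>
  also have "... = TT (?th k p q)"
  proof (rule CX_ext[OF co(1)])
   note t1 [simp] = th[OF mcK rpK fi k p q]
   fix l p' assume [simp]: "l : vob K" "p' : El fi$l"
   show "Q S$l c c (star c k (io k p) q) (io l p') = Q S$l c c (TT (?th k p q)) (io l p')"
    by (simp add: TT io_ract)
  qed (simp_all add: TT th[OF mcK rpK fi k p q])
  finally show ?thesis .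
 qed
 have "S' (eo A c c) (thM A FF c (%a. a)) = sig Sfi [] [] (eo A c c) (WW (eo A c c) (thM A FF c (%a. a)))"
  unfolding S'_def by (rule dual_pair.S_sig[OF Dfi WW_cow[OF t], symmetric]) simp_all
 also have "... = TT (idg (Fun K GG) fi)"
  by (rule dual_pair.sig_thM[OF Dfi mcK rpK fi refl refl nat1_TT]) (simp_all add: W)
 also have "... = idg (Fun A FF) c"
  by (rule CX_ext[OF co(1)]) (simp_all add: TT vid_Fun(2)[OF mcK] cp_idg(1)[OF at_simps(8)[OF mc rp]])
 finally have "S' (eo A c c) (thM A FF c (%a. a)) = idg (Fun A FF) c" .
 from atomicI[OF mc rp co(1) _ S' this] show ?thesis unfolding atomic_def by auto
qed

end

lemma colimit_atomic:
 assumes "atomic K GG fi" "!!k. k : vob K ==> atomic A FF S$k"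
 shows "atomic A FF c"
proof -
 obtain Sfi where 1: "dual_pair V K fi (LM K GG fi) (evM K fi) (vob K) (%a. a) Sfi"
  using assms(1) unfolding atomic_def by blast
 define Tk where "Tk k = (SOME T. dual_pair V A S$k (LM A FF S$k) (evM A S$k) (vob A) (%a. a) T)" for k
 have "dual_pair V A S$k (LM A FF S$k) (evM A S$k) (vob A) (%a. a) (Tk k)" if "k : vob K" for k
  using assms(2)[OF that] unfolding atomic_def Tk_def by (rule someI_ex)
 from colimit_atomic_aux[OF 1 this] show ?thesis .
qed

end

text \<open>By the Kan extension property of \<open>M\<close>, a dinatural family over the objects
  \<open>H k\<close> extends uniquely to all objects of \<open>A\<close>, where the given functional
  evaluates it. The coend element is thus indexed by the objects of \<open>K\<close>, which makes
  the index set small for accessible \<open>M\<close>.\<close>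

lemma atomic_small_dual:
 assumes mc: "mcat A FF" and rp [simp]: "!!a. a : vob A ==> yo A a : FF" and MF [simp]: "M : FF" and at: "atomic A FF M"
  and K [simp]: "cat K" and fi: "rmod K fi" and H: "func K A H" and E: "eacc A M K fi H u"
 shows "EX S. dual_pair V A M (LM A FF M) (evM A M) (vob K) (fob H) S"
proof -
 let ?L = "LM A FF M"
 note A = mc_A[OF mc] and M = mc_rmod[OF mc MF]
 note [simp] = ea_simps[OF A K fi H M E] mc_obj[OF mc] eo_obj[OF mc]
 have Lo [simp]: "?L$b = eo A M (yo A b)" for b by (rule LM(2)[OF mc rp MF])
 obtain S where D: "dual_pair V A M ?L (evM A M) (vob A) (%a. a) S" using at unfolding atomic_def by blast
 note P = dual_pair.axioms(1)[OF D]
 note N = pairing.N[OF P]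
 note T = A M N pairing.h[OF P] pairing.S[OF P]
 note RX = dual_pair.RX[OF D]
 let ?R = "dual_pair.RX V ?L"
 have Ro [simp]: "(?R X)$a = hom (eo A M (yo A a)) X" for X a using dual_pair.fob_RX[OF D] by simp
 \<comment> \<open>Dinatural families agree as soon as they agree on the elements
   \<open>u k p\<close>: an arrow \<open>g\<close> that restricts such an element can be moved to
   the other argument.\<close>
 have uq: "w a m n = w' a m n"
  if w: "cow A M ?L (vob A) (%a. a) [] [] X w" and w': "cow A M ?L (vob A) (%a. a) [] [] X w'" and X: "ob X"
   and e: "!!k p n. k : vob K ==> p : El fi$k ==> n : El (eo A M (yo A H$k)) ==> w H$k (u k p) n = w' H$k (u k p) n"
   and a: "a : vob A" and m: "m : El M$a" and n: "n : El (eo A M (yo A a))" for X w w' a m n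
 proof (rule eacc_ext[OF A K fi H M E a X cowD(1)[OF w a] cowD(1)[OF w' a] _ m])
  fix k p g assume *: "k : vob K" "p : El fi$k" "g : EH A a H$k"
  then have "lact ?L a H$k g n : El (eo A M (yo A H$k))"
   using lact_El[OF N a _] n by simp
  then show "w a (ract A M a H$k (u k p) g) n = w' a (ract A M a H$k (u k p) g) n"
   using * n a by (simp add: cowD(3)[OF w] cowD(3)[OF w'] e)
 qed (use n in simp_all)
 have ex: "EX w'. cow A M ?L (vob A) (%a. a) [] [] X w' &
   (ALL k : vob K. ALL p : El fi$k. ALL n : El (eo A M (yo A H$k)). w' H$k (u k p) n = w k (u k p) n)"
  if w: "cow A M ?L (vob K) (fob H) [] [] X w" and X [simp]: "ob X" for X w
 proof -
  note d = cowD[OF w, simplified]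
  let ?t = "%k p. lamF (st p) (eo A M (yo A H$k)) X (w k (u k p))"
  have n1: "nat1 [] (st n) fi$k X (%p. w k (u k p) n)" if "k : vob K" "n : El (eo A M (yo A H$k))" for k n
   by (rule nat1_comp[OF eaccD(1)[OF E] d(1)]) (use that in simp_all)
  have n2: "nat1 (st p) [] (eo A M (yo A H$k)) X (w k (u k p))" if "k : vob K" "p : El fi$k" for k p
   using d(2)[of k "u k p"] that by simp
  have l [simp]: "?t k p : El (hom (eo A M (yo A H$k)) X)" and
   l2 [simp]: "!!n. n : El (eo A M (yo A H$k)) ==> ap (eo A M (yo A H$k)) X (?t k p) n = w k (u k p) n"
   if "k : vob K" "p : El fi$k" for k p
   using lamF[OF n2[OF that]] that by simp_all
  note R = RX(1)[OF X]
  \<comment> \<open>The family is curried into the presheaf \<open>?R X\<close>, that is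
    \<open>[L M -, X]\<close>, so that the extension property of \<open>M\<close> applies to
    it.\<close>
  have "eqv K fi (pull (?R X) H) [] ?t"
   unfolding eqv_def
  proof (intro conjI ballI)
   fix k assume [simp]: "k : vob K"
   have "nat1 [] [] fi$k (hom (eo A M (yo A H$k)) X) (?t k)"
    by (rule nat1_lamF) (use n1 n2 in simp_all)
   then show "nat1 [] [] fi$k (pull (?R X) H)$k (?t k)" by simp
  next
   fix k l p f assume [simp]: "k : vob K" "l : vob K" "p : El fi$l" and f [simp]: "f : EH K k l"
   have r [simp]: "ract K fi k l p f : El fi$k" by (rule ract_El[OF fi]) simp_all
   have "ract K (pull (?R X) H) k l (?t l p) f = ract A (?R X) H$k H$l (?t l p) (fm H k l f)"
    by (rule pull(2)[OF A K H R]) simp_all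
   also have "... = ?t k (ract K fi k l p f)"
   proof (rule ap_ext)
    show "ract A (?R X) H$k H$l (?t l p) (fm H k l f) : El (hom (eo A M (yo A H$k)) X)"
     using ract_El[OF R] by simp
    show "?t k (ract K fi k l p f) : El (hom (eo A M (yo A H$k)) X)" by (rule l) simp_all
    fix n assume [simp]: "n : El (eo A M (yo A H$k))"
    have "lact ?L H$k H$l (fm H k l f) n : El (eo A M (yo A H$l))"
     using lact_El[OF N] by simp
    then show "ap (eo A M (yo A H$k)) X (ract A (?R X) H$k H$l (?t l p) (fm H k l f)) n =
     ap (eo A M (yo A H$k)) X (?t k (ract K fi k l p f)) n"
     using RX(2) l2[of k "ract K fi k l p f" n] by (simp add: d(3)[symmetric] eaccD(2)[OF E])
   qed simp_all
   finally show "?t k (ract K fi k l p f) = ract K (pull (?R X) H) k l (?t l p) f" by simp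
  qed
  from eacc_extend[OF A K fi H M E R _ this] obtain r where r: "eqv A M (?R X) [] r"
   and rt: "!!k p. k : vob K ==> p : El fi$k ==> r H$k (u k p) = ?t k p" by auto
  have rn: "nat1 [] [] M$a (hom (eo A M (yo A a)) X) (r a)" if "a : vob A" for a
   using r that unfolding eqv_def by simp
  note [simp] = nat1D(1,2)[OF rn]
  have rr: "r a (ract A M a b m f) = ract A (?R X) a b (r b m) f" if "a : vob A" "b : vob A" "m : El M$b" "f : EH A a b" for a b m f
   using r that unfolding eqv_def by simp
  have "cow A M ?L (vob A) (%a. a) [] [] X (%a m n. ap (eo A M (yo A a)) X (r a m) n)"
   unfolding cow_def
  proof (intro conjI ballI)
   fix a n assume "a : vob A" "n : El ?L$a"
   then show "nat1 [] (st n @ []) M$a X (%m. ap (eo A M (yo A a)) X (r a m) n)"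
    using nat1_ap1[OF rn _ X _] by simp
  next
   fix a m assume [simp]: "a : vob A" "m : El M$a"
   show "nat1 ([] @ st m) [] ?L$a X (ap (eo A M (yo A a)) X (r a m))"
    using nat1_ap2[OF nat1_id _ X nat1D(1)[OF rn]] by simp
  qed (use RX(2)[OF X] in "simp add: rr")
  moreover have "ap (eo A M (yo A H$k)) X (r H$k (u k p)) n = w k (u k p) n"
   if "k : vob K" "p : El fi$k" "n : El (eo A M (yo A H$k))" for k p n
   unfolding rt[OF that(1,2)] by (rule l2[OF that])
  ultimately show ?thesis by blast
 qed
 define W where "W X w = (SOME w'. cow A M ?L (vob A) (%a. a) [] [] X w' &
   (ALL k : vob K. ALL p : El fi$k. ALL n : El (eo A M (yo A H$k)). w' H$k (u k p) n = w k (u k p) n))" for X w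
 have W: "cow A M ?L (vob A) (%a. a) [] [] X (W X w)"
  and Wu: "!!k p n. k : vob K ==> p : El fi$k ==> n : El (eo A M (yo A H$k)) ==> W X w H$k (u k p) n = w k (u k p) n"
  if "cow A M ?L (vob K) (fob H) [] [] X w" "ob X" for X w
  using someI_ex[OF ex[OF that]] unfolding W_def by blast+
 define S' where "S' X w = S X (W X w)" for X w
 have S': "Sfun A M ?L (vob K) (fob H) S'"
  unfolding Sfun_def S'_def
 proof (intro conjI ballI allI impI)
  fix X Y g w w' assume X: "ob X" "ob Y" and g: "g : homs V X Y"
   and w: "cow A M ?L (vob K) (fob H) [] [] X w" and w': "cow A M ?L (vob K) (fob H) [] [] Y w'"
   and e: "ALL j:vob K. ALL m:El M$(H$j). ALL n:El ?L$(H$j). w' j m n = lin g (w j m n)"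
  have c: "cow A M ?L (vob A) (%a. a) [] [] Y (%a m n. lin g (W X w a m n))"
   by (rule cow_comp[OF T W[OF w X(1)] nat1_lin[OF nat1_id g]]) simp_all
  show "S Y (W Y w') = lin g (S X (W X w))"
  proof (rule SfunN[OF T W[OF w X(1)] W[OF w' X(2)] X g])
   fix a m n assume "a : vob A" "m : El M$a" "n : El ?L$a"
   then have amn: "a : vob A" "m : El M$a" "n : El (eo A M (yo A a))" by simp_all
   have "W Y w' H$k (u k p) n = lin g (W X w H$k (u k p) n)"
    if "k : vob K" "p : El fi$k" "n : El (eo A M (yo A H$k))" for k p n
    unfolding Wu[OF w X(1) that] Wu[OF w' X(2) that] using e that by simp
   from uq[OF W[OF w' X(2)] c X(2) this amn] show "W Y w' a m n = lin g (W X w a m n)" .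
  qed
 qed (use SfunD[OF T W] in simp_all)
 have t: "cow A M ?L (vob K) (fob H) [] [] (eo A M M) (thM A FF M (fob H))"
  by (rule cow_thM[OF mc rp MF]) auto
 have t': "cow A M ?L (vob A) (%a. a) [] [] (eo A M M) (thM A FF M (%a. a))"
  by (rule cow_thM[OF mc rp MF]) auto
 have o: "eo A M M : obj V" by simp
 have "S' (eo A M M) (thM A FF M (fob H)) = sig S [] [] (eo A M M) (W (eo A M M) (thM A FF M (fob H)))"
  unfolding S'_def by (rule dual_pair.S_sig[OF D W[OF t o] o, symmetric])
 also have "... = idg (Fun A FF) M"
 proof (rule dual_pair.sig_thM[OF D mc rp MF refl refl nat1_id o])
  fix a m n assume "a : vob A" "m : El M$a" "n : El ?L$a"
  then have amn: "a : vob A" "m : El M$a" "n : El (eo A M (yo A a))" by simp_all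
  have "W (eo A M M) (thM A FF M (fob H)) H$k (u k p) n = thM A FF M (%a. a) H$k (u k p) n"
   if "k : vob K" "p : El fi$k" "n : El (eo A M (yo A H$k))" for k p n
   unfolding Wu[OF t o that] thM_def ..
  from uq[OF W[OF t o] t' o this amn] show "W (eo A M M) (thM A FF M (fob H)) a m n = thM A FF M (%a. a) a m n" .
 qed
 finally have "S' (eo A M M) (thM A FF M (fob H)) = idg (Fun A FF) M" .
 moreover have "fob H ` vob K <= vob A" by auto
 ultimately show ?thesis using atomicI[OF mc rp MF _ S'] by blast
qed

section \<open>The Cauchy completion and its dual\<close>


abbreviation "\<P> ka A == {F. accessible ka V A F}"

definition "QO ka A = \<Inter>{X. Phi_closed ka V (small_projectives ka V) A X}"

lemma opp_vpull: "opp A B ==> h ` J <= vob A ==> opp (vpull A J h) (vpull B J h)"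
 unfolding opp_def vpull_def by (simp add: image_subset_iff)

context
 fixes ka :: "'u rel"
 assumes u: "Cinfinite ka" "complete_cat ka V"
begin

context
 fixes A :: "('a, 'o, 'm) vcat"
 assumes A [simp]: "cat A"
begin

lemmas mcP = mcat_PP[OF u A]

lemma PP_Fun: "PP ka V A = Fun A (\<P> ka A)"
 unfolding PP_def ..

lemma rep_accessible: "a : vob A ==> yo A a : \<P> ka A"
proof -
 assume a: "a : vob A"
 \<comment> \<open>An arbitrary element of \<open>'u\<close> serves as the index of the one-point
   family.\<close>
 fix i :: 'u
 have "small_vcat ka V (vpull A {i} (%_. a))"
  unfolding small_vcat_def by (rule small_set_finite[OF u(1)]) (simp add: quotient_def)
 from dual_closed(1)[OF dual_pair_rep[OF A a] u this] show ?thesis by simp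
qed

text \<open>Representables carry explicit duals, an isomorphic copy is a retract, and a small
  projective weight is atomic, so that \<open>colimit_atomic\<close> applies. Minimality then places
  \<open>QO ka A\<close> inside this class.\<close>

lemma atomic_closed: "Phi_closed ka V (small_projectives ka V) A {M. accessible ka V A M & atomic A (\<P> ka A) M}"
 unfolding Phi_closed_def PP_Fun
proof (intro conjI ballI allI impI)
 note rp = rep_accessible
 show "{M. accessible ka V A M & atomic A (\<P> ka A) M} <= vob (Fun A (\<P> ka A))" by auto
 show "yo A a : {M. accessible ka V A M & atomic A (\<P> ka A) M}" if "a : vob A" for a
  using dual_atomic[OF dual_pair_rep[OF A that] mcP rp] rp[OF that] by simp
next
 fix F G assume F: "F : {M. accessible ka V A M & atomic A (\<P> ka A) M}" and "G : vob (Fun A (\<P> ka A))" and v: "viso V (Fun A (\<P> ka A)) F G"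
 then have G: "G : \<P> ka A" and F': "F : \<P> ka A" by simp_all
 note P = vcategory_Fun[OF mcP] and rp = rep_accessible
 obtain f g where f: "f : El (eo A F G)" "st f = []" and g: "g : El (eo A G F)" "st g = []"
  and fg: "cp (Fun A (\<P> ka A)) G F G f g = idg (Fun A (\<P> ka A)) G"
  using v F' G unfolding viso_arr_elem[OF P, of F G, unfolded Fun_simps, OF F' G] Fun_simps by blast
 obtain S where D: "dual_pair V A F (LM A (\<P> ka A) F) (evM A F) (vob A) (%a. a) S"
  using F unfolding atomic_def by blast
 have e: "eqv A M N [] (%a. Ea A M N a t)" if "M : \<P> ka A" "N : \<P> ka A" "t : El (eo A M N)" "st t = []" for M N t
  unfolding eqv_def using nat1_Ea2[OF mcP nat1_id that(1,2) _ that(3)] that(4) Ea_ract[OF mcP that(1,2) _ _ that(3)] by simp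
 have "Ea A F G a f (Ea A G F a g x) = x" if "a : vob A" "x : El G$a" for a x
  using vcmp_Fun(2)[OF mcP G F' G that(1) f(1) g(1) that(2)] vid_Fun(2)[OF mcP G that] unfolding fg by simp
 from dual_pair.retract_atomic[OF D mcP rp G e[OF F' G f] e[OF G F' g] this]
 show "G : {M. accessible ka V A M & atomic A (\<P> ka A) M}" using G by simp
next
 note rp = rep_accessible and P = vcategory_Fun[OF mcP]
 have "c : {M. accessible ka V A M & atomic A (\<P> ka A) M}"
  if sp: "(K, fi) : small_projectives ka V" and S: "func K (Fun A (\<P> ka A)) S"
   and X: "ALL k : vob K. S$k : {M. accessible ka V A M & atomic A (\<P> ka A) M}"
   and w: "wcolim V (Fun A (\<P> ka A)) K fi S c omg" for K :: "('u, 'o, 'm) vcat" and fi S c omg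
 proof -
  have K: "cat K" and sm: "small_vcat ka V K" and fi: "rmod K fi" using sp unfolding small_projectives_def weight_def by auto
  note mcK = mcat_presheaves[OF u K sm]
  have rK: "yo K k : {F. rmod K F}" if "k : vob K" for k using vrep(1)[OF K that] by simp
  note E = wcolim_ecolim(1)[OF P K fi S w]
  have "atomic A (\<P> ka A) c"
   by (rule colimit_atomic[OF mcP rp mcK rK _ S E small_projective_atomic[OF u sp]]) (use fi X in simp_all)
  then show ?thesis using ecolimD(1)[OF E] by simp
 qed
 then show "case x of (K, fi) => ALL S c omg. func K (Fun A (\<P> ka A)) S &
    (ALL k:vob K. S$k : {M. accessible ka V A M & atomic A (\<P> ka A) M}) &
    wcolim V (Fun A (\<P> ka A)) K fi S c omg --> c : {M. accessible ka V A M & atomic A (\<P> ka A) M}"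
  if "x : small_projectives ka V" for x
  using that by (cases x) blast
qed

lemma QO_D: "M : QO ka A ==> M : \<P> ka A" "M : QO ka A ==> atomic A (\<P> ka A) M"
 using atomic_closed unfolding QO_def by blast+

text \<open>The dual pair of \<open>M\<close> is reindexed by a small set and then swapped. The
  swapped pair makes the dual of \<open>M\<close> a member of every closed class over
  \<open>B\<close>.\<close>

lemma QO_dual:
 assumes AB: "opp A B" and M: "M : QO ka A"
 shows "LM A (\<P> ka A) M : QO ka B"
  "EX (J :: 'u set) h S. dual_pair V B (LM A (\<P> ka A) M) M (esw (evM A M)) J h S"
proof -
 obtain K :: "('u, 'o, 'm) vcat" and fi H u' where w: "weight ka V K fi" and H: "func K A H" and E: "eacc A M K fi H u'"
  using QO_D(1)[OF M] unfolding mem_Collect_eq accessible_iff[OF A] by blast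
 have K: "cat K" and sm: "small_vcat ka V K" and fi: "rmod K fi" using w unfolding weight_def by auto
 obtain S where "dual_pair V A M (LM A (\<P> ka A) M) (evM A M) (vob K) (fob H) S"
  using atomic_small_dual[OF mcP rep_accessible QO_D[OF M] K fi H E] by blast
 note D = dual_pair_swap[OF this AB]
 have i: "fob H ` vob K <= vob A" using vfunctorD(1)[OF H] by auto
 have "small_vcat ka V (vpull B (vob K) (fob H))"
  by (rule opp_small_vcat[OF opp_vpull[OF AB i] vpull(1)[OF A i] small_vcat_vpull[OF K A H sm]])
 from dual_closed(3)[OF D u this] show "LM A (\<P> ka A) M : QO ka B" unfolding QO_def by blast
 show "EX (J :: 'u set) h S. dual_pair V B (LM A (\<P> ka A) M) M (esw (evM A M)) J h S" using D by blast
qed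

lemma QQ_simps [simp]: "vob (QQ ka V A) = QO ka A" "vhom (QQ ka V A) = eo A" "cp (QQ ka V A) = cp (Fun A (\<P> ka A))"
  "idg (QQ ka V A) = idg (Fun A (\<P> ka A))"
 by (simp_all add: QQ_def Phi_completion_def full_sub_def QO_def PP_Fun cp_def idg_def fun_eq_iff)

lemma vcategory_QQ [simp]: "cat (QQ ka V A)"
proof -
 have s: "QO ka A <= vob (Fun A (\<P> ka A))" using QO_D(1) by auto
 have "cat (full_sub (Fun A (\<P> ka A)) (QO ka A))"
  using vcategory_Fun[OF mcP] s unfolding vcategory_def full_sub_def by (simp add: subset_iff)
 then show ?thesis by (simp add: QQ_def Phi_completion_def QO_def PP_Fun)
qed

end

end

end

section \<open>Uniqueness of duals and the duality functor\<close>

context dual_pair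
begin

text \<open>Any dual \<open>N\<close> of \<open>M\<close> is the canonical one: a transformation
  from \<open>M\<close> to a representable is represented by an element of \<open>N\<close> through
  \<open>eval_inverse\<close>, and \<open>Z2\<close> recovers that element from its
  evaluations.\<close>

lemma rho:
 assumes mc: "mcat A FF" and MF: "M : FF" and b: "b : vob A" "yo A b : FF"
 defines "\<rho> == %n. EL A M (yo A b) (st n) (%a m. e a b n m)"
 shows "nat1 [] [] N$b (eo A M (yo A b)) \<rho>"
  "n : El N$b ==> a : vob A ==> m : El M$a ==> Ea A M (yo A b) a (\<rho> n) m = e a b n m"
  "x : El (eo A M (yo A b)) ==> EX n : El N$b. \<rho> n = x"
  "n : El N$b ==> n' : El N$b ==> \<rho> n = \<rho> n' ==> n = n'"
proof -
 note [simp] = b(1)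
 show n1: "nat1 [] [] N$b (eo A M (yo A b)) \<rho>" unfolding \<rho>_def
  by (rule nat1_EL[OF mc MF b(2)]) (use eqv_e[OF b(1)] e2 in simp_all)
 show Er: "Ea A M (yo A b) a (\<rho> n) m = e a b n m" if "n : El N$b" "a : vob A" "m : El M$a" for n a m
  unfolding \<rho>_def by (rule EL(3)[OF mc MF b(2) eqv_e[OF b(1) that(1)] El_ok[OF that(1)] that(2,3)])
 note rE = nat1D(1,2)[OF n1]
 show "EX n : El N$b. \<rho> n = x" if x: "x : El (eo A M (yo A b))" for x
 proof -
  have s: "eqv A M (yo A b) (st x) (%a. Ea A M (yo A b) a x)"
   unfolding eqv_def using nat1_Ea2[OF mc nat1_id MF b(2) _ x] Ea_ract[OF mc MF b(2) _ _ x] by simp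
  let ?n = "sig S (st x) [] N$b (%j m n. lact N (h j) b (Ea A M (yo A b) (h j) x m) n)"
  have n: "?n : El N$b" "st ?n = st x"
   using sig_El[OF A M N h S cow_eqv[OF b(1) s]] El_ok[OF x] by simp_all
  have "\<rho> ?n = x"
  proof (rule Ea_ext[OF mc MF b(2) rE(1)[OF n(1)] x])
   show "st (\<rho> ?n) = st x" using rE(2)[OF n(1)] n(2) by simp
   fix a m assume am: "a : vob A" "m : El M$a"
   show "Ea A M (yo A b) a (\<rho> ?n) m = Ea A M (yo A b) a x m"
    unfolding Er[OF n(1) am] by (rule eval_inverse[OF b(1) El_ok[OF x] s am Z1[OF am]])
  qed
  with n(1) show ?thesis by blast
 qed
 assume n: "n : El N$b" and n': "n' : El N$b" and eq: "\<rho> n = \<rho> n'"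
 have s: "st n = st n'" using rE(2)[OF n] rE(2)[OF n'] eq by simp
 have "sig S (st n) [] N$b (%j m k. lact N (h j) b (e (h j) b n m) k) = sig S (st n) [] N$b (%j m k. lact N (h j) b (e (h j) b n' m) k)"
  by (rule sig_cong[OF A M N h S, of "st n", symmetric])
   (use cow_eqv[OF b(1) eqv_e[OF b(1) n]] Er[OF n] Er[OF n'] eq El_ok[OF n] in simp_all)
 from this[unfolded Z2[OF b(1) n], unfolded s Z2[OF b(1) n']] show "n = n'" .
qed

end

context symmetric_monoidal_closed
begin

text \<open>The pointwise inverse inherits naturality and linearity from \<open>t\<close>.
  Surjectivity and injectivity concern elements at all stages, so the inverse is again represented
  by an element of the end.\<close>

lemma eqv_iso:
 assumes mc: "mcat A FF" and F: "F : FF" and G: "G : FF" and t: "eqv A F G [] t"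
  and sj: "!!a x. a : vob A ==> x : El G$a ==> EX m : El F$a. t a m = x"
  and ij: "!!a m m'. a : vob A ==> m : El F$a ==> m' : El F$a ==> t a m = t a m' ==> m = m'"
 shows "EX g : El (eo A G F). st g = [] & cp (Fun A FF) G F G (EL A F G [] t) g = idg (Fun A FF) G &
  cp (Fun A FF) F G F g (EL A F G [] t) = idg (Fun A FF) F"
proof -
 note E = EL[OF mc F G t, simplified]
 have t1: "nat1 [] [] F$a G$a (t a)" if "a : vob A" for a using t that unfolding eqv_def by simp
 have tr: "t a (ract A F a b m f) = ract A G a b (t b m) f" if "a : vob A" "b : vob A" "m : El F$b" "f : EH A a b" for a b m f
  using t that unfolding eqv_def by simp
 define s where "s a x = (SOME m. m : El F$a & t a m = x)" for a x
 have s: "s a x : El F$a" "t a (s a x) = x" if "a : vob A" "x : El G$a" for a x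
  using someI_ex[OF sj[OF that, unfolded Bex_def]] unfolding s_def by blast+
 have st: "st (s a x) = st x" if "a : vob A" "x : El G$a" for a x
  using nat1D(2)[OF t1 s(1), OF that(1) that] s(2)[OF that] by simp
 have sI: "s a x = m" if "a : vob A" "x : El G$a" "m : El F$a" "t a m = x" for a x m
  by (rule ij[OF that(1) s(1)[OF that(1,2)] that(3)]) (use s(2) that in simp)
 have e: "eqv A G F [] s" unfolding eqv_def
 proof (intro conjI ballI)
  fix a assume a: "a : vob A"
  show "nat1 [] [] G$a F$a (s a)"
  proof (rule nat1I)
   fix x vs r assume x: "x : El G$a" and r: "lhom vs (st x) r" and rx: "re vs r x : El G$a"
   have r': "lhom vs (st (s a x)) r" using r st[OF a x] by simp
   have "s a (re vs r x) = re vs r (s a x)"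
   proof (rule sI[OF a rx re_El[OF s(1)[OF a x] r']])
    show "t a (re vs r (s a x)) = re vs r x"
     using nat1D(3)[OF t1[OF a] s(1)[OF a x] r'] rmid_Nil[OF x refl r] by (simp add: s(2)[OF a x] st[OF a x])
   qed
   then show "s a (re vs r x) = rmid [] (st x) vs [] r (s a x)"
    using rmid_Nil[OF s(1)[OF a x] refl r'] st[OF a x] by simp
  qed (use s(1) st a in simp_all)
 next
  fix a b x f assume *: "a : vob A" "b : vob A" "x : El G$b" "f : EH A a b"
  show "s a (ract A G a b x f) = ract A F a b (s b x) f"
   by (rule sI[OF *(1) ract_El[OF mcatD(2)[OF mc G] *] ract_El[OF mcatD(2)[OF mc F] *(1,2) s(1)[OF *(2,3)] *(4)]])
    (use * s in "simp add: tr")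
 qed
 note E' = EL[OF mc G F e, simplified]
 let ?t = "EL A F G [] t" and ?s = "EL A G F [] s"
 have 1: "cp (Fun A FF) G F G ?t ?s = idg (Fun A FF) G"
 proof (rule Ea_ext[OF mc G G])
  fix a x assume "a : vob A" "x : El G$a"
  then show "Ea A G G a (cp (Fun A FF) G F G ?t ?s) x = Ea A G G a (idg (Fun A FF) G) x"
   using E E' s by (simp add: vcmp_Fun(2)[OF mc G F G] vid_Fun(2)[OF mc G])
 qed (use E(1,2) E'(1,2) in "simp_all add: cp_Fun_El[OF mc G F G] idg_Fun_El[OF mc G]")
 have 2: "cp (Fun A FF) F G F ?s ?t = idg (Fun A FF) F"
 proof (rule Ea_ext[OF mc F F])
  fix a x assume *: "a : vob A" "x : El F$a"
  note tx = nat1D(1)[OF t1[OF *(1)] *(2)]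
  show "Ea A F F a (cp (Fun A FF) F G F ?s ?t) x = Ea A F F a (idg (Fun A FF) F) x"
   using E E' * tx sI[OF *(1) tx *(2) refl] by (simp add: vcmp_Fun(2)[OF mc F G F] vid_Fun(2)[OF mc F])
 qed (use E(1,2) E'(1,2) in "simp_all add: cp_Fun_El[OF mc F G F] idg_Fun_El[OF mc F]")
 show ?thesis using E'(1,2) 1 2 by blast
qed

text \<open>The action of \<open>L\<close> on maps, by precomposition. As a parameter
  \<open>t\<close> precedes the argument \<open>n\<close>, while in the composite it follows it;
  hence the permutation.\<close>

definition "Lt ka A B M M' t = EL B (LM A (\<P> ka A) M) (LM A (\<P> ka A) M') (st t)
 (%b n. sw [] (st n) (st t) [] (cp (Fun A (\<P> ka A)) M' M (yo A b) n t))"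

definition "Lf ka A B = \<lparr>fob = LM A (\<P> ka A), fmap = %M M'. arr1 (eo A M' M) (Lt ka A B M M')\<rparr>"

context
 fixes ka :: "'u rel"
 assumes u: "Cinfinite ka" "complete_cat ka V"
begin

context
 fixes A B :: "('a, 'o, 'm) vcat"
 assumes A [simp]: "cat A" and AB: "opp A B"
begin

abbreviation "PA == Fun A (\<P> ka A)"
abbreviation "PB == Fun B (\<P> ka B)"
abbreviation "LA == LM A (\<P> ka A)"

lemma B [simp]: "cat B" "vob B = vob A" "a : vob A ==> b : vob A ==> vhom B a b = vhom A b a"
 using opp_vcategory[OF AB] oppD[OF AB] by simp_all

lemmas mA = mcat_PP[OF u A] and mB = mcat_PP[OF u B(1)]
lemmas rA = rep_accessible[OF u A]
lemmas rA' [simp] = rA[unfolded mem_Collect_eq]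

lemma QM [simp]:
 assumes "M : QO ka A"
 shows "accessible ka V A M" "LA M : QO ka B" "accessible ka V B (LA M)" "smod A (LA M)" "rmod B (LA M)" "(LA M)$b = eo A M (yo A b)"
  "b : vob A ==> eo A M (yo A b) : obj V"
proof -
 show M: "accessible ka V A M" using QO_D(1)[OF u A assms] by simp
 show L: "LA M : QO ka B" by (rule QO_dual(1)[OF u A AB assms])
 show "accessible ka V B (LA M)" using QO_D(1)[OF u B(1) L] by simp
 have M: "M : \<P> ka A" using M by simp
 show s: "smod A (LA M)" by (rule LM(1)[OF mA rA M])
 show "rmod B (LA M)" by (rule iffD2[OF opp_smod[OF AB A] s])
 show "(LA M)$b = eo A M (yo A b)" by (rule LM(2)[OF mA rA M])
 show "b : vob A ==> eo A M (yo A b) : obj V" using eo_obj[OF mA M rA] .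
qed

lemma Lt:
 assumes M [simp]: "M : QO ka A" "M' : QO ka A"
 shows "t : El (eo A M' M) ==> Lt ka A B M M' t : El (eo B (LA M) (LA M'))" "t : El (eo A M' M) ==> st (Lt ka A B M M' t) = st t"
  "t : El (eo A M' M) ==> b : vob A ==> n : El (eo A M (yo A b)) ==>
   Ea B (LA M) (LA M') b (Lt ka A B M M' t) n = sw [] (st n) (st t) [] (cp PA M' M (yo A b) n t)"
  "nat1 [] [] (eo A M' M) (eo B (LA M) (LA M')) (Lt ka A B M M')"
proof -
 have MA [simp]: "M : \<P> ka A" "M' : \<P> ka A" and LB: "LA M : \<P> ka B" "LA M' : \<P> ka B" by simp_all
 note P = vcategory_Fun[OF mA]
 have c [simp]: "cp PA M' M (yo A b) n t : El (eo A M' (yo A b))"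
  if "t : El (eo A M' M)" "b : vob A" "n : El (eo A M (yo A b))" for t b n
  by (rule cp_Fun_El[OF mA MA(2,1) rA[OF that(2)] that(3,1)])
 have Y: "func A PA (Yf A)" by (rule Yf(1)[OF mA rA])
 have y [simp]: "fm (Yf A) a b f : El (eo A (yo A a) (yo A b))" if "a : vob A" "b : vob A" "f : EH A a b" for a b f
  using fm_El[OF Y that] fob_Yf[OF mA] by simp
 have lE [simp]: "lact (LA M) a b f n : El (eo A M (yo A b))" if "M : QO ka A" "a : vob A" "b : vob A" "f : EH A a b" "n : El (eo A M (yo A a))" for M a b f n
  using lact_El[OF QM(4)[OF that(1)]] that by simp
 have l: "lact (LA M) a b f n = cp PA M (yo A a) (yo A b) (fm (Yf A) a b f) n"
  if "M : QO ka A" "a : vob A" "b : vob A" "f : EH A a b" "n : El (eo A M (yo A a))" for M a b f n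
  using LM(3)[OF mA rA _ that(2-5)] QM(1)[OF that(1)] by simp
 have rl: "ract B (LA M) a b n f = sw [] (st f) (st n) [] (lact (LA M) b a f n)"
  if "M : QO ka A" "a : vob A" "b : vob A" "f : EH A b a" "n : El (eo A M (yo A b))" for M a b n f
  using ract_lact[OF QM(5)[OF that(1)]] that by simp
 let ?t = "%t b n. sw [] (st n) (st t) [] (cp PA M' M (yo A b) n t)"
 have sE [simp]: "?t t b n : El (eo A M' (yo A b))" if "t : El (eo A M' M)" "b : vob A" "n : El (eo A M (yo A b))" for t b n
  using c[OF that] by (intro sw_El) simp_all
 have e: "eqv B (LA M) (LA M') (st t) (?t t)" if t [simp]: "t : El (eo A M' M)" for t
  unfolding eqv_def
 proof (intro conjI ballI)
  fix b assume "b : vob B"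
  then have [simp]: "b : vob A" by simp
  have "nat1 [] ([] @ st t) (vhom PA M (yo A b)) (vhom PA M' (yo A b)) (%n. cp PA M' M (yo A b) n t)"
   by (rule nat1_cp1[OF nat1_id P]) simp_all
  then have n: "nat1 [] (st t) (eo A M (yo A b)) (eo A M' (yo A b)) (%n. cp PA M' M (yo A b) n t)" by simp
  have "nat1 (st t) [] (eo A M (yo A b)) (eo A M' (yo A b)) (?t t b)"
   by (rule nat1_sw_left[where ?w1.0="[]" and ?w2.0="[]", OF n]) simp_all
  then show "nat1 (st t) [] (LA M)$b (LA M')$b (?t t b)" by simp
 next
  fix a b n f assume "a : vob B" "b : vob B" "n : El (LA M)$b" "f : EH B a b"
  then have * [simp]: "a : vob A" "b : vob A" "n : El (eo A M (yo A b))" "f : EH A b a" by simp_all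
  define z where "z = cp PA M' M (yo A a) (lact (LA M) b a f n) t"
  have z: "z : El (eo A M' (yo A a))" "st z = [] @ st f @ st n @ st t @ []" by (simp_all add: z_def)
  have "cp PA M' M (yo A a) (sw [] (st f) (st n) [] (lact (LA M) b a f n)) t = sw [] (st f) (st n) (st t) z"
   unfolding z_def by (subst cp_sw_left[OF P]) simp_all
  moreover have "lact (LA M') b a f (?t t b n) = sw (st f) (st n) (st t) [] z"
  proof (subst lact_sw_right[OF QM(4)[OF M(2)]])
   have "lact (LA M') b a f (cp PA M' M (yo A b) n t) = z"
    unfolding z_def l[OF M(1) *(2,1,4,3)] l[OF M(2) *(2,1,4) c[OF t *(2,3)]]
    by (rule cp_assoc[OF P, symmetric]) simp_all
   then show "sw (st f @ []) (st n) (st t) [] (lact (LA M') b a f (cp PA M' M (yo A b) n t)) = sw (st f) (st n) (st t) [] z" by simp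
  qed simp_all
  ultimately show "?t t a (ract B (LA M) a b n f) = ract B (LA M') a b (?t t b n) f"
   using sw_rev3'[OF z] unfolding rl[OF M(1) *(1,2,4,3)] rl[OF M(2) *(1,2,4) sE[OF t *(2,3)]] by simp
 qed
 show "Lt ka A B M M' t : El (eo B (LA M) (LA M'))" "st (Lt ka A B M M' t) = st t" if "t : El (eo A M' M)"
  unfolding Lt_def by (rule EL[OF mB LB e[OF that] El_ok[OF that]])+
 show "Ea B (LA M) (LA M') b (Lt ka A B M M' t) n = ?t t b n"
  if "t : El (eo A M' M)" "b : vob A" "n : El (eo A M (yo A b))" for t b n
  unfolding Lt_def by (rule EL(3)[OF mB LB e[OF that(1)] El_ok[OF that(1)]]) (use that in simp_all)
 show "nat1 [] [] (eo A M' M) (eo B (LA M) (LA M')) (Lt ka A B M M')"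
  unfolding Lt_def
 proof (rule nat1_EL[OF mB LB])
  show "eo A M' M : obj V" by (rule eo_obj[OF mA MA(2,1)])
  fix b n assume "b : vob B" "n : El (LA M)$b"
  then have [simp]: "b : vob A" "n : El (eo A M (yo A b))" by simp_all
  have "nat1 (st n @ []) [] (vhom PA M' M) (vhom PA M' (yo A b)) (cp PA M' M (yo A b) n)"
   by (rule nat1_cp2[OF nat1_id P]) simp_all
  then have n: "nat1 (st n) [] (eo A M' M) (eo A M' (yo A b)) (cp PA M' M (yo A b) n)" by simp
  have "nat1 [] (st n) (eo A M' M) (eo A M' (yo A b)) (%t. ?t t b n)"
   by (rule nat1_sw_right[where ?w1.0="[]" and ?w2.0="[]", OF n]) (simp_all add: eo_obj[OF mA MA(2,1)])
  then show "nat1 [] ([] @ st n) (eo A M' M) (LA M')$b (%t. ?t t b n)" by simp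
 qed (use e in simp_all)
qed

text \<open>Contravariance reverses the composition of \<open>g\<close> and \<open>f'\<close>. After
  evaluation at \<open>n\<close> this is a reversal of three blocks, again settled by
  \<open>sw_rev3'\<close>.\<close>

lemma Lf:
 "func (Op (QQ ka V A)) (QQ ka V B) (Lf ka A B)"
 "M : QO ka A ==> M' : QO ka A ==> t : El (eo A M' M) ==> fm (Lf ka A B) M M' t = Lt ka A B M M' t"
 "fob (Lf ka A B) = LA"
proof -
 note [simp] = QQ_simps[OF u A] QQ_simps[OF u B(1)] vcategory_QQ[OF u A] vcategory_QQ[OF u B(1)]
 note P = vcategory_Fun[OF mA] and PB' = vcategory_Fun[OF mB]
 have MA: "M : \<P> ka A" "LA M : \<P> ka B" if "M : QO ka A" for M using that by simp_all
 have o [simp]: "eo A M' M : obj V" if "M : QO ka A" "M' : QO ka A" for M M' using eo_obj[OF mA MA(1)[OF that(2)] MA(1)[OF that(1)]] .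
 show f: "fob (Lf ka A B) = LA" by (simp add: Lf_def)
 show m: "fm (Lf ka A B) M M' t = Lt ka A B M M' t" if "M : QO ka A" "M' : QO ka A" "t : El (eo A M' M)" for M M' t
  using arr1(2)[OF Lt(4)[OF that(1,2)] _] that by (simp add: fm_def Lf_def)
 show "func (Op (QQ ka V A)) (QQ ka V B) (Lf ka A B)"
 proof (rule vfunctorI)
  fix M assume "M : vob (Op (QQ ka V A))"
  then have M [simp]: "M : QO ka A" by simp
  note i = idg_Fun_El[OF mA MA(1)[OF M]]
  have "Lt ka A B M M (idg PA M) = idg PB (LA M)"
  proof (rule Ea_ext[OF mB MA(2)[OF M] MA(2)[OF M]])
   fix b n assume "b : vob B" "n : El (LA M)$b"
   then have * [simp]: "b : vob A" "n : El (eo A M (yo A b))" by simp_all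
   show "Ea B (LA M) (LA M) b (Lt ka A B M M (idg PA M)) n = Ea B (LA M) (LA M) b (idg PB (LA M)) n"
    using cp_idg(2)[OF P] vid_Fun(2)[OF mB] sw_Nil_right[OF *(2)] by (simp add: Lt(3)[OF M M i])
  qed (use Lt(1,2)[OF M M i] idg_Fun_El[OF mB MA(2)[OF M]] in simp_all)
  then show "fm (Lf ka A B) M M (idg (Op (QQ ka V A)) M) = idg (QQ ka V B) (Lf ka A B)$M"
   using i by (simp add: m f)
 next
  fix M1 M2 M3 g f' assume "M1 : vob (Op (QQ ka V A))" "M2 : vob (Op (QQ ka V A))" "M3 : vob (Op (QQ ka V A))"
   "g : EH (Op (QQ ka V A)) M2 M3" "f' : EH (Op (QQ ka V A)) M1 M2"
  then have M [simp]: "M1 : QO ka A" "M2 : QO ka A" "M3 : QO ka A" and g [simp]: "g : El (eo A M3 M2)" and f' [simp]: "f' : El (eo A M2 M1)"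
   by simp_all
  let ?c = "cp PA M3 M2 M1 f' g"
  have c [simp]: "?c : El (eo A M3 M1)" by (rule cp_Fun_El[OF mA]) simp_all
  have sc [simp]: "sw [] (st f') (st g) [] ?c : El (eo A M3 M1)" by (rule sw_El[OF c]) simp
  note l1 = Lt[OF M(1,2)] and l2 = Lt[OF M(2,3)] and l3 = Lt[OF M(1,3)]
  have "Lt ka A B M1 M3 (sw [] (st f') (st g) [] ?c) = cp PB (LA M1) (LA M2) (LA M3) (Lt ka A B M2 M3 g) (Lt ka A B M1 M2 f')"
  proof (rule Ea_ext[OF mB MA(2)[OF M(1)] MA(2)[OF M(3)]])
   fix b n assume "b : vob B" "n : El (LA M1)$b"
   then have b [simp]: "b : vob A" and n [simp]: "n : El (eo A M1 (yo A b))" by simp_all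
   note rb = rA[OF b]
   define y where "y = cp PA M3 M1 (yo A b) n ?c"
   have y: "y : El (eo A M3 (yo A b))" "st y = [] @ st n @ st f' @ st g @ []"
    unfolding y_def using cp_Fun_El[OF mA MA(1)[OF M(3)] MA(1)[OF M(1)] rb n] by simp_all
   have nf [simp]: "cp PA M2 M1 (yo A b) n f' : El (eo A M2 (yo A b))"
    by (rule cp_Fun_El[OF mA MA(1)[OF M(2)] MA(1)[OF M(1)] rb n f'])
   have snf [simp]: "sw [] (st n) (st f') [] (cp PA M2 M1 (yo A b) n f') : El (eo A M2 (yo A b))"
    by (rule sw_El[OF nf]) simp
   have 1: "cp PA M3 M1 (yo A b) n (sw [] (st f') (st g) [] ?c) = sw (st n) (st f') (st g) [] y"
    unfolding y_def using cp_sw_right[OF P] by simp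
   have 2: "cp PA M3 M2 (yo A b) (sw [] (st n) (st f') [] (cp PA M2 M1 (yo A b) n f')) g = sw [] (st n) (st f') (st g) y"
    unfolding y_def using cp_sw_left[OF P] cp_assoc[OF P] by simp
   show "Ea B (LA M1) (LA M3) b (Lt ka A B M1 M3 (sw [] (st f') (st g) [] ?c)) n =
    Ea B (LA M1) (LA M3) b (cp PB (LA M1) (LA M2) (LA M3) (Lt ka A B M2 M3 g) (Lt ka A B M1 M2 f')) n"
    using vcmp_Fun(2)[OF mB MA(2)[OF M(1)] MA(2)[OF M(2)]] l1(1) l2(1) by (simp add: l3(3) l1(3) l2(3) 1 2 sw_rev3'[OF y, simplified])
  qed (use l1(1,2)[OF f'] l2(1,2)[OF g] l3(1,2)[OF sc] cp_Fun_El[OF mB MA(2)[OF M(1)] MA(2)[OF M(2)] MA(2)[OF M(3)]] in simp_all)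
  then show "fm (Lf ka A B) M1 M3 (cp (Op (QQ ka V A)) M1 M2 M3 g f') =
   cp (QQ ka V B) (Lf ka A B)$M1 (Lf ka A B)$M2 (Lf ka A B)$M3 (fm (Lf ka A B) M2 M3 g) (fm (Lf ka A B) M1 M2 f')"
   using vcmp_vop(2)[OF vcategory_QQ[OF u A]] by (simp add: m f)
 next
  fix M M' assume "M : vob (Op (QQ ka V A))" "M' : vob (Op (QQ ka V A))"
  then show "fmap (Lf ka A B) M M' : homs V (vhom (Op (QQ ka V A)) M M') (vhom (QQ ka V B) (Lf ka A B)$M (Lf ka A B)$M')"
   using arr1(1)[OF Lt(4)] by (simp, simp add: Lf_def)
 qed (use f in simp_all)
qed

end

end

text \<open>The comparison of \<open>rho\<close> for the swapped pair: over \<open>B\<close>, the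
  module \<open>M\<close> is itself a dual of \<open>L\<close>.\<close>

definition "rh A B L M a m = EL B L (yo B a) (st m) (%b. esw (evM A M) b a m)"

text \<open>The map from \<open>M\<close> to its double dual, which sends \<open>m\<close> to
  evaluation at \<open>m\<close>.\<close>

definition "eta ka A B M = EL A M (LM B (\<P> ka B) (LM A (\<P> ka A) M)) [] (rh A B (LM A (\<P> ka A) M) M)"

context
 fixes ka :: "'u rel"
 assumes u: "Cinfinite ka" "complete_cat ka V"
begin

context
 fixes A B :: "('a, 'o, 'm) vcat"
 assumes A [simp]: "cat A" and AB: "opp A B"
begin

abbreviation "FA == Fun A (\<P> ka A)"
abbreviation "FB == Fun B (\<P> ka B)"
abbreviation "La == LM A (\<P> ka A)"
abbreviation "Lb == LM B (\<P> ka B)"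

text \<open>By the swapped pair \<open>M\<close> is a dual of \<open>La M\<close>, and
  \<open>rho\<close> compares it with the canonical dual \<open>Lb (La M)\<close>. Bijectivity of
  this comparison makes \<open>eta\<close> invertible.\<close>

lemma eta:
 assumes M: "M : QO ka A"
 shows "eta ka A B M : El (eo A M (Lb (La M)))" "st (eta ka A B M) = []"
  "!!a m b n. a : vob A ==> m : El M$a ==> b : vob A ==> n : El (eo A M (yo A b)) ==>
   Ea B (La M) (yo B a) b (Ea A M (Lb (La M)) a (eta ka A B M) m) n = sw [] (st n) (st m) [] (Ea A M (yo A b) a n m)"
  "EX g : El (eo A (Lb (La M)) M). st g = [] &
   cp FA (Lb (La M)) M (Lb (La M)) (eta ka A B M) g = idg FA (Lb (La M)) &
   cp FA M (Lb (La M)) M g (eta ka A B M) = idg FA M"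
proof -
 note B = opp_vcategory[OF AB A] and BA = opp_sym[OF A AB]
 note [simp] = oppD[OF AB]
 note Q = QM[OF u A AB M] and Q' = QM[OF u B BA QM(2)[OF u A AB M]]
 note mA = mcat_PP[OF u A] and mB = mcat_PP[OF u B]
 have MA: "M : \<P> ka A" "Lb (La M) : \<P> ka A" "La M : \<P> ka B" using Q(1,3) Q'(3) by simp_all
 have rB: "yo B b : \<P> ka B" if "b : vob B" for b by (rule rep_accessible[OF u B that])
 obtain J :: "'u set" and h S where D: "dual_pair V B (La M) M (esw (evM A M)) J h S"
  using QO_dual(2)[OF u A AB M] by blast
 note P = dual_pair.axioms(1)[OF D]
 note r = dual_pair.rho[OF D mB MA(3) _ rB, folded rh_def]
 have e: "eqv A M (Lb (La M)) [] (rh A B (La M) M)"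
  unfolding eqv_def
 proof (intro conjI ballI)
  fix a assume "a : vob A"
  then show "nat1 [] [] M$a (Lb (La M))$a (rh A B (La M) M a)"
   using r(1) Q'(6) by simp
 next
  fix a b m f assume *: "a : vob A" "b : vob A" "m : El M$b" "f : EH A a b"
  then have b: "a : vob B" "b : vob B" "f : EH B b a" by simp_all
  note n = r(1)[OF b(1) b(1)] r(1)[OF b(2) b(2)]
  have sM: "smod B M" by (rule pairing.N[OF P])
  have l: "lact M b a f m : El M$a" by (rule lact_El[OF sM b(2,1,3) *(3)])
  have x: "rh A B (La M) M b m : El (Lb (La M))$b" using nat1D(1)[OF n(2) *(3)] Q'(6) by simp
  have "rh A B (La M) M a (lact M b a f m) = lact (Lb (La M)) b a f (rh A B (La M) M b m)"
  proof (rule Ea_ext[OF mB MA(3) rB[OF b(1)]])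
   show "rh A B (La M) M a (lact M b a f m) : El (eo B (La M) (yo B a))" by (rule nat1D(1)[OF n(1) l])
   show "lact (Lb (La M)) b a f (rh A B (La M) M b m) : El (eo B (La M) (yo B a))"
    using lact_El[OF Q'(4) b(2,1,3) x] Q'(6) by simp
   show "st (rh A B (La M) M a (lact M b a f m)) = st (lact (Lb (La M)) b a f (rh A B (La M) M b m))"
    using nat1D(2)[OF n(1) l] nat1D(2)[OF n(2) *(3)] by simp
   fix c k assume c: "c : vob B" "k : El (La M)$c"
   show "Ea B (La M) (yo B a) c (rh A B (La M) M a (lact M b a f m)) k = Ea B (La M) (yo B a) c (lact (Lb (La M)) b a f (rh A B (La M) M b m)) k"
    using LM(4)[OF mB rB MA(3) c(1) b(2,1,3) nat1D(1)[OF n(2) *(3)] c(2)] r(2)[OF b(1) b(1) l c] r(2)[OF b(2) b(2) *(3) c]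
     pairing.eL[OF P c(1) b(2,1,3) *(3) c(2)] by simp
  qed
  moreover have "rh A B (La M) M a (sw [] (st f) (st m) [] (lact M b a f m)) = sw [] (st f) (st m) [] (rh A B (La M) M a (lact M b a f m))"
   using nat1_sw[OF n(1) l] by simp
  ultimately show "rh A B (La M) M a (ract A M a b m f) = ract A (Lb (La M)) a b (rh A B (La M) M b m) f"
   using ract_lact[OF mcatD(2)[OF mA MA(1)] *] ract_lact[OF mcatD(2)[OF mA MA(2)] *(1,2) x *(4)] nat1D(2)[OF n(2) *(3)] by simp
 qed
 note E = EL[OF mA MA(1,2) e, folded eta_def, simplified]
 show "eta ka A B M : El (eo A M (Lb (La M)))" "st (eta ka A B M) = []" by (rule E)+
 show "Ea B (La M) (yo B a) b (Ea A M (Lb (La M)) a (eta ka A B M) m) n = sw [] (st n) (st m) [] (Ea A M (yo A b) a n m)"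
  if "a : vob A" "m : El M$a" "b : vob A" "n : El (eo A M (yo A b))" for a m b n
  using r(2) that Q(6) by (simp add: E(3) esw_def)
 have s: "EX m : El M$a. rh A B (La M) M a m = x" if "a : vob A" "x : El (Lb (La M))$a" for a x
  using r(3) that Q'(6) by simp
 have i: "m = m'" if "a : vob A" "m : El M$a" "m' : El M$a" "rh A B (La M) M a m = rh A B (La M) M a m'" for a m m'
  using r(4) that by simp
 from eqv_iso[OF mA MA(1,2) e s i, folded eta_def]
 show "EX g : El (eo A (Lb (La M)) M). st g = [] &
   cp FA (Lb (La M)) M (Lb (La M)) (eta ka A B M) g = idg FA (Lb (La M)) &
   cp FA M (Lb (La M)) M g (eta ka A B M) = idg FA M" .
qed

text \<open>Evaluated at \<open>m\<close> and \<open>n\<close>, both sides are \<open>n\<close>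
  applied to the image of \<open>m\<close> under \<open>t\<close>. What has to be checked is that
  the permutations of the blocks of \<open>n\<close>, \<open>t\<close> and \<open>m\<close>
  coincide.\<close>

lemma eta_natural:
 assumes M: "M : QO ka A" and M': "M' : QO ka A" and t: "t : El (eo A M M')"
 shows "cp FA M M' (Lb (La M')) (eta ka A B M') t =
  cp FA M (Lb (La M)) (Lb (La M')) (Lt ka B A (La M) (La M') (Lt ka A B M' M t)) (eta ka A B M)"
proof -
 note B = opp_vcategory[OF AB A] and BA = opp_sym[OF A AB]
 note [simp] = oppD[OF AB]
 note Q = QM[OF u A AB] and Q' = QM[OF u B BA QM(2)[OF u A AB]]
 note mA = mcat_PP[OF u A] and mB = mcat_PP[OF u B]
 have PM: "M : \<P> ka A" "Lb (La M) : \<P> ka A" "La M : \<P> ka B" if "M : QO ka A" for M using Q(1,3)[OF that] Q'(3)[OF that] by simp_all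
 note Pm = PM[OF M] and Pm' = PM[OF M'] and e = eta[OF M] and e' = eta[OF M']
 let ?s = "Lt ka A B M' M t" and ?x = "%a m. Ea A M (Lb (La M)) a (eta ka A B M) m"
 note s = Lt[OF u A AB M' M] and s' = Lt[OF u B BA QM(2)[OF u A AB M] QM(2)[OF u A AB M']]
 note sE = s(1)[OF t] and s'E = s'(1)[OF s(1)[OF t]]
 have rA: "yo A b : \<P> ka A" if "b : vob A" for b by (rule rep_accessible[OF u A that])
 have rB: "yo B b : \<P> ka B" if "b : vob A" for b using rep_accessible[OF u B] that by simp
 show ?thesis
 proof (rule Ea_ext[OF mA Pm(1) Pm'(2)])
  show "cp FA M M' (Lb (La M')) (eta ka A B M') t : El (eo A M (Lb (La M')))"
   by (rule cp_Fun_El[OF mA Pm(1) Pm'(1,2) e'(1) t])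
  show "cp FA M (Lb (La M)) (Lb (La M')) (Lt ka B A (La M) (La M') ?s) (eta ka A B M) : El (eo A M (Lb (La M')))"
   by (rule cp_Fun_El[OF mA Pm(1,2) Pm'(2) s'E e(1)])
  show "st (cp FA M M' (Lb (La M')) (eta ka A B M') t) =
   st (cp FA M (Lb (La M)) (Lb (La M')) (Lt ka B A (La M) (La M') ?s) (eta ka A B M))"
   by (simp add: e(2) e'(2) s(2)[OF t] s'(2)[OF sE])
  fix a m assume a: "a : vob A" and m: "m : El M$a"
  have tm: "Ea A M M' a t m : El M'$a" by (rule Ea_El[OF mA Pm(1) Pm'(1) a t m])
  have x: "?x a m : El (eo B (La M) (yo B a))" and x': "?x a m : El (Lb (La M))$a"
   using Ea_El[OF mA Pm(1,2) a e(1) m] Q'(6)[OF M] by simp_all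
  have a': "a : vob B" using a by simp
  have xc: "cp FB (La M') (La M) (yo B a) (?x a m) ?s : El (eo B (La M') (yo B a))"
   by (rule cp_Fun_El[OF mB Pm'(3) Pm(3) rB[OF a] x sE])
  have R: "Ea A (Lb (La M)) (Lb (La M')) a (Lt ka B A (La M) (La M') ?s) (?x a m) =
   sw [] (st m) (st t) [] (cp FB (La M') (La M) (yo B a) (?x a m) ?s)"
   using s'(3)[OF sE a' x] by (simp add: s(2)[OF t] e(2))
  have L: "Ea A M' (Lb (La M')) a (eta ka A B M') (Ea A M M' a t m) = Ea A (Lb (La M)) (Lb (La M')) a (Lt ka B A (La M) (La M') ?s) (?x a m)"
   unfolding R
  proof (rule Ea_ext[OF mB Pm'(3) rB[OF a]])
   show "Ea A M' (Lb (La M')) a (eta ka A B M') (Ea A M M' a t m) : El (eo B (La M') (yo B a))"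
    using Ea_El[OF mA Pm'(1,2) a e'(1) tm] Q'(6)[OF M'] by simp
   show "sw [] (st m) (st t) [] (cp FB (La M') (La M) (yo B a) (?x a m) ?s) : El (eo B (La M') (yo B a))"
    by (rule sw_El[OF xc]) (simp add: e(2) s(2)[OF t])
   show "st (Ea A M' (Lb (La M')) a (eta ka A B M') (Ea A M M' a t m)) = st (sw [] (st m) (st t) [] (cp FB (La M') (La M) (yo B a) (?x a m) ?s))"
    by (simp add: e'(2))
   fix b n assume "b : vob B" "n : El (La M')$b"
   then have b: "b : vob A" "b : vob B" and n: "n : El (eo A M' (yo A b))" and n': "n : El (La M')$b" using Q(6)[OF M'] by simp_all
   define y where "y = Ea A M' (yo A b) a n (Ea A M M' a t m)"
   have y: "y : EH A a b" "st y = [] @ st n @ st t @ st m @ []"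
    unfolding y_def using Ea_El[OF mA Pm'(1) rA[OF b(1)] a n tm] by simp_all
   have nt: "cp FA M M' (yo A b) n t : El (eo A M (yo A b))"
    by (rule cp_Fun_El[OF mA Pm(1) Pm'(1) rA[OF b(1)] n t])
   have nt': "cp FA M M' (yo A b) n t : El (La M)$b" using nt Q(6)[OF M] by simp
   have ex: "Ea B (La M) (yo B a) b (?x a m) (cp FA M M' (yo A b) n t) = sw [] (st n @ st t) (st m) [] y"
    using e(3)[OF a m b(1) nt] vcmp_Fun(2)[OF mA Pm(1) Pm'(1) rA[OF b(1)] a n t m] by (simp add: y_def)
   have "Ea B (La M') (yo B a) b (cp FB (La M') (La M) (yo B a) (?x a m) ?s) n =
     Ea B (La M) (yo B a) b (?x a m) (sw [] (st n) (st t) [] (cp FA M M' (yo A b) n t))"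
    using vcmp_Fun(2)[OF mB Pm'(3) Pm(3) rB[OF a] b(2) x sE n'] s(3)[OF t b(1) n] by simp
   also have "... = sw (st m) (st n) (st t) [] (sw [] (st n @ st t) (st m) [] y)"
    using Ea_sw_right[OF mB Pm(3) rB[OF a] b(2) x nt'] by (simp add: ex e(2))
   also have "... = sw [] (st n) (st m @ st t) [] (sw (st n) (st t) (st m) [] y)"
    using sw_append_left[OF y(1)] y(2) sw_append_right[OF sw_El[OF y(1)]] by simp
   also have "... = sw [] (st t) (st m) (st n) (sw [] (st n) (st t @ st m) [] y)"
    using sw_rev3'[OF y] sw_append_right[OF y(1)] y(2) sw_append_left[OF sw_El[OF y(1)]] by simp
   finally have q: "Ea B (La M') (yo B a) b (cp FB (La M') (La M) (yo B a) (?x a m) ?s) n =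
    sw [] (st t) (st m) (st n) (sw [] (st n) (st t @ st m) [] y)" .
   have "Ea B (La M') (yo B a) b (sw [] (st m) (st t) [] (cp FB (La M') (La M) (yo B a) (?x a m) ?s)) n =
    sw [] (st m) (st t) (st n) (sw [] (st t) (st m) (st n) (sw [] (st n) (st t @ st m) [] y))"
    using Ea_sw[OF mB Pm'(3) rB[OF a] b(2) xc n'] by (simp add: q e(2) s(2)[OF t])
   also have "... = sw [] (st n) (st t @ st m) [] y"
    using sw_sw[OF sw_El[OF y(1)]] y(2) by simp
   finally show "Ea B (La M') (yo B a) b (Ea A M' (Lb (La M')) a (eta ka A B M') (Ea A M M' a t m)) n =
    Ea B (La M') (yo B a) b (sw [] (st m) (st t) [] (cp FB (La M') (La M) (yo B a) (?x a m) ?s)) n"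
    using e'(3)[OF a tm b(1) n] by (simp add: y_def)
  qed
  show "Ea A M (Lb (La M')) a (cp FA M M' (Lb (La M')) (eta ka A B M') t) m =
   Ea A M (Lb (La M')) a (cp FA M (Lb (La M)) (Lb (La M')) (Lt ka B A (La M) (La M') ?s) (eta ka A B M)) m"
   unfolding vcmp_Fun(2)[OF mA Pm(1) Pm'(1,2) a e'(1) t m] vcmp_Fun(2)[OF mA Pm(1,2) Pm'(2) a s'E e(1) m] by (rule L)
 qed
qed

end

end

definition "eps ka A B M = (SOME g. g : El (eo A (LM B (\<P> ka B) (LM A (\<P> ka A) M)) M) & st g = [] &
   cp (Fun A (\<P> ka A)) (LM B (\<P> ka B) (LM A (\<P> ka A) M)) M (LM B (\<P> ka B) (LM A (\<P> ka A) M)) (eta ka A B M) g =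
    idg (Fun A (\<P> ka A)) (LM B (\<P> ka B) (LM A (\<P> ka A) M)) &
   cp (Fun A (\<P> ka A)) M (LM B (\<P> ka B) (LM A (\<P> ka A) M)) M g (eta ka A B M) = idg (Fun A (\<P> ka A)) M)"

section \<open>The equivalence: unit and counit isomorphisms\<close>

context
 fixes ka :: "'u rel"
 assumes u: "Cinfinite ka" "complete_cat ka V"
begin

context
 fixes A B :: "('a, 'o, 'm) vcat"
 assumes A [simp]: "cat A" and AB: "opp A B"
begin

abbreviation "QA == QQ ka V A"
abbreviation "Lm == LM A (\<P> ka A)"
abbreviation "LL == %M. LM B (\<P> ka B) (Lm M)"
abbreviation "et == eta ka A B"
abbreviation "es == eps ka A B"

lemma eps:
 assumes M: "M : QO ka A"
 shows "es M : El (eo A (LL M) M)" "st (es M) = []"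
  "cp QA (LL M) M (LL M) (et M) (es M) = idg QA (LL M)" "cp QA M (LL M) M (es M) (et M) = idg QA M"
 using someI_ex[OF eta(4)[OF u A AB M, unfolded Bex_def]] unfolding eps_def[symmetric] QQ_simps[OF u A] by blast+

lemma glb_eps:
 assumes "M : QO ka A"
 shows "glb (snd (es M)) = es M" "glb (snd (et M)) = et M"
  "snd (es M) : homs V I (eo A (LL M) M)" "snd (et M) : homs V I (eo A M (LL M))"
 using El_Nil[OF eps(1,2)[OF assms]] El_Nil[OF eta(1,2)[OF u A AB assms]] by simp_all

lemma unit_facts:
 shows "M : QO ka A ==> LL M : QO ka A"
  "func QA (Op (QQ ka V B)) (vfop (Lf ka A B))" "func (Op (QQ ka V B)) QA (Lf ka B A)"
  "M : QO ka A ==> M' : QO ka A ==> t : El (eo A M M') ==> Lt ka B A (Lm M) (Lm M') (Lt ka A B M' M t) : El (eo A (LL M) (LL M'))"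
  "M : QO ka A ==> M' : QO ka A ==> t : El (eo A M M') ==>
   fm (Lf ka B A) (Lm M) (Lm M') (fm (Lf ka A B) M' M t) =
   Lt ka B A (Lm M) (Lm M') (Lt ka A B M' M t)"
proof -
 note B = opp_vcategory[OF AB A] and BA = opp_sym[OF A AB]
 note F = Lf[OF u A AB] and G = Lf[OF u B BA] and q = QM(2)[OF u A AB]
 show "LL M : QO ka A" if "M : QO ka A" for M by (rule QM(2)[OF u B BA q[OF that]])
 show "func (Op (QQ ka V B)) QA (Lf ka B A)" by (rule G(1))
 have "func (Op (Op QA)) (Op (QQ ka V B)) (vfop (Lf ka A B))"
  by (rule vfunctor_vfop[OF vcategory_vop[OF vcategory_QQ[OF u A]] vcategory_QQ[OF u B] F(1)])
 then show "func QA (Op (QQ ka V B)) (vfop (Lf ka A B))"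
  unfolding opp_vfunctor[OF opp_vop vcategory_QQ[OF u A]] .
 assume *: "M : QO ka A" "M' : QO ka A" "t : El (eo A M M')"
 note l = Lt(1)[OF u A AB *(2,1,3)]
 show "Lt ka B A (Lm M) (Lm M') (Lt ka A B M' M t) : El (eo A (LL M) (LL M'))"
  by (rule Lt(1)[OF u B BA q[OF *(1)] q[OF *(2)] l])
 show "fm (Lf ka B A) (Lm M) (Lm M') (fm (Lf ka A B) M' M t) =
   Lt ka B A (Lm M) (Lm M') (Lt ka A B M' M t)"
  unfolding F(2)[OF *(2,1,3)] by (rule G(2)[OF q[OF *(1)] q[OF *(2)] l])
qed

lemma vfid_simps: "(vfid V C)$a = a" "t : EH C a b ==> fm (vfid V C) a b t = t"
 by (simp_all add: vfid_def fm_def)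

lemma vfunctor_vfid: "cat C ==> func C C (vfid V C)"
 by (rule vfunctorI) (simp_all add: vfid_simps, simp add: vfid_def idt_homs)

text \<open>The components are the inverses \<open>es\<close>. Their naturality is that of
  \<open>et\<close>, composed on both sides with inverses.\<close>

lemma unit_iso: "vnat_iso V QA QA (fc (Lf ka B A) (vfop (Lf ka A B))) (vfid V QA)"
proof -
 note B = opp_vcategory[OF AB A]
 note C [simp] = vcategory_QQ[OF u A] and s = QQ_simps[OF u A]
 note F = vfunctor_vfcomp[OF C vcategory_vop[OF vcategory_QQ[OF u B]] C unit_facts(3,2)]
 have fo: "(fc (Lf ka B A) (vfop (Lf ka A B)))$M = LL M" for M
  using Lf(3)[OF u A AB] Lf(3)[OF u B opp_sym[OF A AB]] by simp
 have "cp QA (LL M) (LL M') M' (es M') (Lt ka B A (Lm M) (Lm M') (Lt ka A B M' M t)) = cp QA (LL M) M M' t (es M)"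
  (is "cp QA _ _ _ _ ?l = _")
  if M: "M : QO ka A" and M': "M' : QO ka A" and t: "t : El (eo A M M')" for M M' t
 proof -
  note l = unit_facts(4)[OF M M' t] and n = eta_natural[OF u A AB M M' t] and e = eps[OF M] and e' = eps[OF M']
  note o [simp] = M M' t unit_facts(1)[OF M] unit_facts(1)[OF M'] l e(1) e'(1) eta(1)[OF u A AB M] eta(1)[OF u A AB M'] s(1,2)
  note as = cp_assoc[OF C]
  have c [simp]: "cp QA a b c g f : El (eo A a c)"
   if "a : QO ka A" "b : QO ka A" "c : QO ka A" "g : El (eo A b c)" "f : El (eo A a b)" for a b c g f
   using cp_El[OF C] that by simp
  have "cp QA (LL M) (LL M') M' (es M') ?l = cp QA (LL M) (LL M') M' (es M') (cp QA (LL M) (LL M) (LL M') ?l (cp QA (LL M) M (LL M) (et M) (es M)))"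
   unfolding e(3) using cp_idg(2)[OF C] by simp
  also have "cp QA (LL M) (LL M) (LL M') ?l (cp QA (LL M) M (LL M) (et M) (es M)) = cp QA (LL M) M (LL M') (cp QA M (LL M) (LL M') ?l (et M)) (es M)"
   by (rule as[symmetric]) simp_all
  also have "cp QA M (LL M) (LL M') ?l (et M) = cp QA M M' (LL M') (et M') t"
   using n by (simp add: s(3))
  also have "cp QA (LL M) (LL M') M' (es M') (cp QA (LL M) M (LL M') (cp QA M M' (LL M') (et M') t) (es M))
   = cp QA (LL M) M M' (cp QA M (LL M') M' (es M') (cp QA M M' (LL M') (et M') t)) (es M)"
   by (rule as[symmetric]) simp_all
  also have "cp QA M (LL M') M' (es M') (cp QA M M' (LL M') (et M') t) = cp QA M M' M' (cp QA M' (LL M') M' (es M') (et M')) t"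
   by (rule as[symmetric]) simp_all
  also have "... = t" unfolding e'(4) using cp_idg(1)[OF C] by simp
  finally show ?thesis .
 qed
 then have "vnat V QA QA (fc (Lf ka B A) (vfop (Lf ka A B))) (vfid V QA) (%M. snd (es M))"
  unfolding vnat_iff[OF C C F(1) vfunctor_vfid[OF C]] fo using glb_eps unit_facts(5)
  by (simp add: s(1,2) vfid_simps F(2) Lf(3)[OF u A AB])
 moreover have "viso_arr V QA (LL M) M (snd (es M))" if M: "M : QO ka A" for M
  by (subst viso_arr_iff[OF C], simp_all add: s(1,2) M unit_facts(1))
   (use glb_eps[OF M] eps(3,4)[OF M] M in \<open>auto intro!: bexI[of _ "snd (et M)"]\<close>)
 ultimately show ?thesis unfolding vnat_iso_def fo vfid_simps(1) vop_simps(1) s(1) by blast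
qed

text \<open>Directions reverse in the opposite category, so the components are now the maps
  \<open>et\<close> themselves and \<open>eta_natural\<close> applies directly. Their stages are
  empty, which makes the permutations from \<open>Op\<close> trivial.\<close>

lemma counit_iso: "vnat_iso V (Op QA) (Op QA) (fc (vfop (Lf ka B A)) (Lf ka A B)) (vfid V (Op QA))"
proof -
 note B = opp_vcategory[OF AB A] and BA = opp_sym[OF A AB]
 note C [simp] = vcategory_QQ[OF u A] and s = QQ_simps[OF u A] and O = vcategory_vop[OF vcategory_QQ[OF u A]]
 have G: "func (QQ ka V B) (Op QA) (vfop (Lf ka B A))"
 proof -
  have "func (Op (Op (QQ ka V B))) (Op QA) (vfop (Lf ka B A))"
   by (rule vfunctor_vfop[OF vcategory_vop[OF vcategory_QQ[OF u B]] C Lf(1)[OF u B BA]])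
  then show ?thesis unfolding opp_vfunctor[OF opp_vop vcategory_QQ[OF u B]] .
 qed
 note F = vfunctor_vfcomp[OF O vcategory_QQ[OF u B] O G Lf(1)[OF u A AB]]
 have fo: "(fc (vfop (Lf ka B A)) (Lf ka A B))$M = LL M" for M
  using Lf(3)[OF u A AB] Lf(3)[OF u B BA] by simp
 have op: "cp (Op QA) a b c g f = sw [] (st f) (st g) [] (cp QA c b a f g)"
   "cp QA c b a f g : El (eo A c a)"
  if "a : QO ka A" "b : QO ka A" "c : QO ka A" "g : El (eo A c b)" "f : El (eo A b a)" for a b c g f
  using vcmp_vop(2)[OF C] cp_El[OF C] that by (simp_all add: s(1,2))
 have "cp (Op QA) (LL M) (LL M') M' (et M') (Lt ka B A (Lm M') (Lm M) (Lt ka A B M M' t)) = cp (Op QA) (LL M) M M' t (et M)"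
  (is "cp _ _ _ _ _ ?l = _")
  if M: "M : QO ka A" and M': "M' : QO ka A" and t: "t : El (eo A M' M)" for M M' t
 proof -
  note l = unit_facts(4)[OF M' M t] and n = eta_natural[OF u A AB M' M t] and e = eta(1,2)[OF u A AB M] and e' = eta(1,2)[OF u A AB M']
  note i = unit_facts(1)[OF M] unit_facts(1)[OF M']
  have 1: "sw [] (st ?l) [] [] (cp QA M' (LL M') (LL M) ?l (et M')) = cp QA M' (LL M') (LL M) ?l (et M')"
   by (rule sw_Nil_right[OF op(2)[OF i M' e'(1) l]]) (simp add: e'(2))
  have 2: "sw [] [] (st t) [] (cp QA M' M (LL M) (et M) t) = cp QA M' M (LL M) (et M) t"
   by (rule sw_Nil_left[OF op(2)[OF i(1) M M' t e(1)]]) (simp add: e(2))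
  show ?thesis
   unfolding op(1)[OF i M' e'(1) l] op(1)[OF i(1) M M' t e(1)] e(2) e'(2) 1 2 using n by (simp add: s(3))
 qed
 then have "vnat V (Op QA) (Op QA) (fc (vfop (Lf ka B A)) (Lf ka A B)) (vfid V (Op QA)) (%M. snd (et M))"
  unfolding vnat_iff[OF O O F(1) vfunctor_vfid[OF O]] fo using glb_eps unit_facts(5)
  by (simp add: s(1,2) vfid_simps F(2) Lf(3)[OF u A AB])
 moreover have "viso_arr V (Op QA) (LL M) M (snd (et M))" if M: "M : QO ka A" for M
 proof -
  note i = unit_facts(1)[OF M] and e = eta(1,2)[OF u A AB M] and e' = eps[OF M]
  have j: "LL M : vob (Op QA)" "M : vob (Op QA)" using i M by (simp_all add: s(1))
  have "cp (Op QA) (LL M) M (LL M) (es M) (et M) = idg QA (LL M)"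
   unfolding op(1)[OF i M i e'(1) e(1)] using sw_Nil_left[OF op(2)[OF i M i e'(1) e(1)]] e(2) e'(2,3) by simp
  moreover have "cp (Op QA) M (LL M) M (et M) (es M) = idg QA M"
   unfolding op(1)[OF M i M e(1) e'(1)] using sw_Nil_left[OF op(2)[OF M i M e(1) e'(1)]] e(2) e'(2,4) by simp
  ultimately show ?thesis unfolding viso_arr_iff[OF O j] using glb_eps[OF M] M
   by (intro conjI bexI[of _ "snd (es M)"]) (simp_all add: s(2))
 qed
 ultimately show ?thesis unfolding vnat_iso_def fo vfid_simps(1) vop_simps(1) s(1) by blast
qed

end

end

end

theorem proposition7p4:
  fixes \<kappa> :: "'u rel" and V :: "('o, 'm) smcat" and A :: "('a, 'o, 'm) vcat"
  assumes "universe \<kappa>"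
    and "cosmos \<kappa> V"
    and "vcategory V A"
  shows "vequivalent V (vop V (QQ \<kappa> V (vop V A))) (QQ \<kappa> V A)"
proof -
  interpret symmetric_monoidal_closed V using assms(2) unfolding cosmos_def by blast
  have u: "Cinfinite \<kappa>" "complete_cat \<kappa> V" using assms(1,2) unfolding universe_def cosmos_def by blast+
  note A = assms(3)
  note B = vcategory_vop[OF A] and AB = opp_vop[of A]
  note BA = opp_sym[OF A AB]
  \<comment> \<open>The counit is taken with \<open>A\<close> and its opposite exchanged, so that
    both isomorphisms concern the same pair of functors: \<open>Lf\<close> from the opposite side to
    \<open>A\<close>, and \<open>vfop\<close> of the \<open>Lf\<close> in the other
    direction.\<close>
  show ?thesis unfolding vequivalent_def
    using unit_facts(2,3)[OF u A AB] unit_iso[OF u A AB] counit_iso[OF u B BA] by blast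
qed

end
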